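(* Let $\Bbbk$ be a field with $\operatorname{char}\Bbbk=p$, let $L$ be a finite simplicial complex on vertex set $\mathsf V$, let $\chi\colon G_L\twoheadrightarrow\mathbb Z$ be an epimorphism, and let $r\ge1$ be an integer. The $\Bbbk\mathbb Z$-module $H_{\le r}(T_L,\Bbbk\mathbb Z_\chi):=\bigoplus_{i=0}^rH_i(T_L,\Bbbk\mathbb Z_\chi)$ has trivial $\mathbb Z$-action if and only if $(\dagger)_r$ $\beta_i(\Bbbk\langle L\rangle,\mathsf V_p(\chi))=0$, for all $i\le r$; and $(\ddagger)_r$ $\beta_i(\Bbbk\langle L\rangle,\mathsf V_q(\chi))=0$, for all $q\in\mathcal P(\chi)$ with $q\ne p$, and for all $i\le r$.
   Context: Simplices are identified with their vertex sets; every $v\in\mathsf V$ is a vertex of $L$. Give $S^1$ the CW-structure with one $0$-cell $*$ and one $1$-cell. The toric complex is the subcomplex $T_L=\bigcup_{\sigma\in L}\{x: x_v=*\text{ for }v\notin\sigma\}$ of $(S^1)^{\mathsf V}$, with fundamental group the right-angled Artin group $G_L=\langle v\in\mathsf V\mid uv=vu\text{ if }\{u,v\}\text{ is an edge of }L\rangle$. $\Bbbk\mathbb Z=\Bbbk[t^{\pm1}]$, and $\Bbbk\mathbb Z_\chi$ is $\Bbbk\mathbb Z$ viewed as a $\Bbbk G_L$-module via the linear extension of $\chi$. Then $H_i(T_L,\Bbbk\mathbb Z_\chi)\cong H_i(T_L^\chi,\Bbbk)$ as $\Bbbk\mathbb Z$-modules, where $T_L^\chi\to T_L$ is the infinite cyclic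 cover with fundamental group $\ker\chi$ and $\mathbb Z$ acts by deck transformations. A $\Bbbk\mathbb Z$-module $M$ has trivial $\mathbb Z$-action if $t\cdot m=m$ for all $m\in M$. Write $m_v=\chi(v)\in\mathbb Z$. For $q=0$ or $q$ a prime, $\mathsf V_q(\chi)=\{v\in\mathsf V\mid m_v\not\equiv0\pmod q\}$ (for $q=0$ this means $m_v\ne0$). $\mathcal P(\chi)=\{q\text{ prime}\mid\mathsf V_q(\chi)\subsetneq\mathsf V_0(\chi)\}$. Let $V$ be the $\Bbbk$-vector space with basis $\mathsf V$ and $V^*$ its dual with dual basis $\{v^*\}$. $\Bbbk\langle L\rangle=\bigwedge V^*/J_L$, where $J_L$ is generated by the monomials $v_{i_1}^*\cdots v_{i_k}^*$ with $\{v_{i_1},\dots,v_{i_k}\}\notin L$. For $\mathsf W\subset\mathsf V$, put $z_{\mathsf W}=\sum_{v\in\mathsf W}v^*$; $\beta_i(\Bbbk\langle L\rangle,\mathsf W)$ is the dimension over $\Bbbk$ of the $i$-th cohomology of the cochain complex $\Bbbk\langle L\rangle^0\to\Bbbk\langle L\rangle^1\to\cdots$ whose differential is right multiplication by $z_{\mathsf W}$. *)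

theory Defs
  imports
    "HOL-Analysis.Analysis"
    "HOL-Homology.Homology"
    "HOL-Number_Theory.Cong"
    "HOL-Algebra.Module"
    "HOL-Library.Poly_Mapping"
begin

section \<open>Simplicial complexes and right-angled Artin groups\<close>

text \<open>The vertex set \<open>\<V>\<close> is the whole (finite) type \<^typ>\<open>'v\<close>; the empty simplex belongs to
  every complex.\<close>

definition abstract_simplicial_complex :: "'v::finite set set \<Rightarrow> bool" where
  "abstract_simplicial_complex L \<longleftrightarrow>
     {} \<in> L \<and> (\<forall>v. {v} \<in> L) \<and> (\<forall>\<sigma>\<in>L. \<forall>\<tau>. \<tau> \<subseteq> \<sigma> \<longrightarrow> \<tau> \<in> L)"

text \<open>A word in the generators and their formal inverses: \<open>(v, True)\<close> stands for \<open>v\<close> and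
  \<open>(v, False)\<close> for its inverse.\<close>

type_synonym 'v gword = "('v \<times> bool) list"

inductive raag_eq :: "'v set set \<Rightarrow> 'v gword \<Rightarrow> 'v gword \<Rightarrow> bool" for L where
  refl: "raag_eq L x x"
| sym: "raag_eq L x y \<Longrightarrow> raag_eq L y x"
| trans: "raag_eq L x y \<Longrightarrow> raag_eq L y z \<Longrightarrow> raag_eq L x z"
| app: "raag_eq L x x' \<Longrightarrow> raag_eq L y y' \<Longrightarrow> raag_eq L (x @ y) (x' @ y')"
| cancel: "raag_eq L [(v, b), (v, \<not> b)] []"
| commute: "u \<noteq> v \<Longrightarrow> {u, v} \<in> L \<Longrightarrow> raag_eq L [(u, True), (v, True)] [(v, True), (u, True)]"

definition raag_class :: "'v set set \<Rightarrow> 'v gword \<Rightarrow> 'v gword set" where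
  "raag_class L x = {y. raag_eq L x y}"

definition raag :: "'v set set \<Rightarrow> 'v gword set monoid" where
  "raag L = \<lparr>carrier = range (raag_class L),
             monoid.mult = (\<lambda>X Y. {z. \<exists>x\<in>X. \<exists>y\<in>Y. raag_eq L (x @ y) z}),
             one = raag_class L []\<rparr>"

definition raag_gen :: "'v set set \<Rightarrow> 'v \<Rightarrow> 'v gword set" where
  "raag_gen L v = raag_class L [(v, True)]"

lemma raag_class_eq_iff: "raag_class L x = raag_class L y \<longleftrightarrow> raag_eq L x y"
proof
  assume "raag_class L x = raag_class L y"
  moreover have "y \<in> raag_class L y" by (simp add: raag_class_def raag_eq.refl)
  ultimately have "y \<in> raag_class L x" by simp
  then show "raag_eq L x y" by (simp add: raag_class_def)
next
  assume "raag_eq L x y"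
  then show "raag_class L x = raag_class L y"
    unfolding raag_class_def by (blast intro: raag_eq.trans dest: raag_eq.sym)
qed

lemma raag_mult:
  "raag_class L x \<otimes>\<^bsub>raag L\<^esub> raag_class L y = raag_class L (x @ y)"
proof -
  have "(\<exists>a\<in>raag_class L x. \<exists>b\<in>raag_class L y. raag_eq L (a @ b) z) \<longleftrightarrow> raag_eq L (x @ y) z" for z
  proof
    assume "\<exists>a\<in>raag_class L x. \<exists>b\<in>raag_class L y. raag_eq L (a @ b) z"
    then obtain a b where ab: "raag_eq L x a" "raag_eq L y b" "raag_eq L (a @ b) z"
      by (auto simp: raag_class_def)
    show "raag_eq L (x @ y) z"
      by (rule raag_eq.trans[OF raag_eq.app[OF ab(1,2)] ab(3)])
  next
    assume "raag_eq L (x @ y) z"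
    moreover have "x \<in> raag_class L x" "y \<in> raag_class L y"
      by (simp_all add: raag_class_def raag_eq.refl)
    ultimately show "\<exists>a\<in>raag_class L x. \<exists>b\<in>raag_class L y. raag_eq L (a @ b) z" by blast
  qed
  then show ?thesis by (simp add: raag_def raag_class_def[of L "x @ y"])
qed

lemma raag_inverse: "raag_eq L (map (\<lambda>(v, b). (v, \<not> b)) (rev x) @ x) []"
proof (induction x)
  case (Cons a x)
  obtain v b where a: "a = (v, b)" by (cases a)
  let ?i = "map (\<lambda>(v, b). (v, \<not> b)) (rev x)"
  have "raag_eq L (?i @ [(v, \<not> b), (v, b)] @ x) (?i @ [] @ x)"
    using raag_eq.cancel[of L v "\<not> b"] by (intro raag_eq.app raag_eq.refl) auto
  then have "raag_eq L (?i @ [(v, \<not> b), (v, b)] @ x) []"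
    using Cons.IH by (auto intro: raag_eq.trans)
  then show ?case
    by (simp add: a)
qed (simp add: raag_eq.refl)

lemma group_raag: "group (raag L)"
proof (rule groupI)
  show "\<one>\<^bsub>raag L\<^esub> \<in> carrier (raag L)" by (simp add: raag_def)
  have car: "\<exists>w. x = raag_class L w" if "x \<in> carrier (raag L)" for x
    using that by (auto simp: raag_def)
  have inj: "raag_class L w \<in> carrier (raag L)" for w by (simp add: raag_def)
  have one: "\<one>\<^bsub>raag L\<^esub> = raag_class L []" by (simp add: raag_def)
  fix x assume "x \<in> carrier (raag L)"
  then obtain w where x: "x = raag_class L w" using car by blast
  show "\<one>\<^bsub>raag L\<^esub> \<otimes>\<^bsub>raag L\<^esub> x = x" by (simp add: x one raag_mult)
  show "\<exists>y\<in>carrier (raag L). y \<otimes>\<^bsub>raag L\<^esub> x = \<one>\<^bsub>raag L\<^esub>"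
    by (intro bexI[of _ "raag_class L (map (\<lambda>(v, b). (v, \<not> b)) (rev w))"] inj)
      (simp add: x one raag_mult raag_class_eq_iff raag_inverse)
  fix y assume "y \<in> carrier (raag L)"
  then obtain w' where y: "y = raag_class L w'" using car by blast
  show "x \<otimes>\<^bsub>raag L\<^esub> y \<in> carrier (raag L)" by (simp add: x y raag_mult inj)
  fix z assume "z \<in> carrier (raag L)"
  then obtain w'' where z: "z = raag_class L w''" using car by blast
  show "x \<otimes>\<^bsub>raag L\<^esub> y \<otimes>\<^bsub>raag L\<^esub> z = x \<otimes>\<^bsub>raag L\<^esub> (y \<otimes>\<^bsub>raag L\<^esub> z)"
    by (simp add: x y z raag_mult)
qed

definition weight :: "'v set set \<Rightarrow> ('v gword set \<Rightarrow> int) \<Rightarrow> 'v \<Rightarrow> int" where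
  "weight L chi v = chi (raag_gen L v)"

text \<open>For \<open>q = 0\<close> congruence modulo \<open>q\<close> is equality.\<close>

definition Vq :: "'v set set \<Rightarrow> ('v gword set \<Rightarrow> int) \<Rightarrow> nat \<Rightarrow> 'v set" where
  "Vq L chi q = {v. \<not> [weight L chi v = 0] (mod int q)}"

definition bad_primes :: "'v set set \<Rightarrow> ('v gword set \<Rightarrow> int) \<Rightarrow> nat set" where
  "bad_primes L chi = {q. prime q \<and> Vq L chi q \<subset> Vq L chi 0}"


section \<open>The toric complex and its infinite cyclic cover\<close>

text \<open>The circle is the unit circle in \<open>\<complex>\<close>, with 0-cell \<open>1\<close>.\<close>

definition toric_complex :: "'v::finite set set \<Rightarrow> (complex ^ 'v) set" where
  "toric_complex L = (\<Union>\<sigma>\<in>L. {x. (\<forall>v. x $ v \<in> sphere 0 1) \<and> (\<forall>v. v \<notin> \<sigma> \<longrightarrow> x $ v = 1)})"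

text \<open>The map \<open>x \<mapsto> \<Prod>\<^sub>v x\<^sub>v\<^bsup>m\<^sub>v\<^esup>\<close> from the toric complex to the circle sends the loop of
  the \<open>v\<close>-th coordinate circle to \<open>m\<^sub>v = chi v\<close> times a generator, hence it induces \<open>chi\<close> on
  fundamental groups. The cover with fundamental group \<open>ker chi\<close> is the pullback along this map of
  the universal cover \<open>s \<mapsto> exp (2 \<pi> \<i> s)\<close> of the circle; \<open>t\<^sup>j\<close> acts by \<open>s \<mapsto> s + j\<close>.\<close>

definition char_map :: "'v::finite set set \<Rightarrow> ('v gword set \<Rightarrow> int) \<Rightarrow> complex ^ 'v \<Rightarrow> complex" where
  "char_map L chi x = (\<Prod>v\<in>UNIV. x $ v powi weight L chi v)"

definition cyclic_cover ::
  "'v::finite set set \<Rightarrow> ('v gword set \<Rightarrow> int) \<Rightarrow> ((complex ^ 'v) \<times> real) set" where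
  "cyclic_cover L chi = {(x, s). x \<in> toric_complex L \<and> char_map L chi x = cis (2 * pi * s)}"

definition deck :: "int \<Rightarrow> 'a \<times> real \<Rightarrow> 'a \<times> real" where
  "deck j = (\<lambda>(x, s). (x, s + of_int j))"

text \<open>The next facts confirm that this is the connected regular cover on which the loop of the
  vertex \<open>v\<close> lifts to a path from a point to its translate by \<open>t\<^bsup>m\<^esup>\<close>, \<open>m = chi v\<close>.\<close>

lemma deck_fibre:
  "(x, s) \<in> cyclic_cover L chi \<Longrightarrow>
     (x, s') \<in> cyclic_cover L chi \<longleftrightarrow> (\<exists>j. (x, s') = deck j (x, s))"
proof -
  assume "(x, s) \<in> cyclic_cover L chi"
  then have "(x, s') \<in> cyclic_cover L chi \<longleftrightarrow> cis (2 * pi * s') = cis (2 * pi * s)"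
    by (auto simp: cyclic_cover_def)
  also have "\<dots> \<longleftrightarrow> (\<exists>j::int. 2 * pi * s' = 2 * pi * s + 2 * pi * j)"
    unfolding cis_conv_exp exp_eq by (simp add: complex_eq_iff algebra_simps)
  also have "\<dots> \<longleftrightarrow> (\<exists>j::int. s' = s + j)"
    unfolding distrib_left[symmetric] by simp
  finally show ?thesis by (simp add: deck_def)
qed

lemma char_map_circle: "x \<in> toric_complex L \<Longrightarrow> norm (char_map L chi x) = 1"
  by (auto simp: char_map_def toric_complex_def norm_power_int simp flip: prod_norm)

lemma continuous_char_map: "continuous_on (toric_complex L) (char_map L chi)"
  unfolding char_map_def
proof (intro continuous_on_prod continuous_on_power_int disjI2 ballI)
  show "continuous_on (toric_complex L) (\<lambda>x. x $ v)" for v by (intro continuous_intros)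
  fix v x assume "x \<in> toric_complex L"
  then have "norm (x $ v) = 1" by (auto simp: toric_complex_def)
  then show "x $ v \<noteq> 0" by auto
qed

lemma loop_lift:
  assumes "abstract_simplicial_complex L"
  defines "\<gamma> \<equiv> \<lambda>v t. (\<chi> u. if u = v then cis (2 * pi * t) else 1) :: complex ^ 'v::finite"
  shows "(\<gamma> v t, of_int s + t * of_int (weight L chi v)) \<in> cyclic_cover L chi"
    and "(\<gamma> v 1, of_int s + 1 * of_int (weight L chi v)) =
           deck (weight L chi v) (\<gamma> v 0, of_int s)"
proof -
  have "char_map L chi (\<gamma> v t) = cis (2 * pi * t) powi weight L chi v"
  proof -
    have "char_map L chi (\<gamma> v t) =
       (\<Prod>u\<in>UNIV. if u = v then cis (2 * pi * t) powi weight L chi v else 1)"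
      unfolding char_map_def \<gamma>_def by (intro prod.cong) auto
    then show ?thesis by simp
  qed
  also have "\<dots> = cis (2 * pi * (of_int s + t * of_int (weight L chi v)))"
  proof -
    have "cis (2 * pi * s) = 1" by simp
    then show ?thesis
      by (simp add: cis_power_int distrib_left flip: cis_mult) (simp add: mult_ac)
  qed
  finally show "(\<gamma> v t, of_int s + t * of_int (weight L chi v)) \<in> cyclic_cover L chi"
    using assms(1) by (auto simp: cyclic_cover_def toric_complex_def abstract_simplicial_complex_def \<gamma>_def
        intro!: bexI[of _ "{v}"])
  show "(\<gamma> v 1, of_int s + 1 * of_int (weight L chi v)) = deck (weight L chi v) (\<gamma> v 0, of_int s)"
    by (simp add: deck_def \<gamma>_def vec_eq_iff)
qed

lemma covering_space_cyclic_cover: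
  "covering_space (cyclic_cover L chi) fst (toric_complex L)"
proof
  let ?C = "cyclic_cover L chi" and ?T = "toric_complex L" and ?f = "char_map L chi"
  have lift: "\<exists>s. ?f x = cis (2 * pi * s)" if "x \<in> ?T" for x
  proof -
    have "?f x = cis (2 * pi * (Arg (?f x) / (2 * pi)))"
      using char_map_circle[OF that] rcis_cmod_Arg[of "?f x"]
      by (simp add: rcis_def)
    then show ?thesis by blast
  qed
  show "continuous_on ?C fst" by (intro continuous_intros)
  show "fst ` ?C = ?T"
    using lift by (force simp: cyclic_cover_def image_iff)
  fix x0 assume x0: "x0 \<in> ?T"
  then obtain s0 where s0: "?f x0 = cis (2 * pi * s0)" using lift by blast
  define h where "h x = ?f x * cis (- (2 * pi * s0))" for x
  define \<theta> where "\<theta> x = Im (Ln (h x)) / (2 * pi)" for x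
  define U where "U = {x \<in> ?T. 0 < Re (h x)}"
  define A where "A j = {(x, s). x \<in> U \<and> s = s0 + \<theta> x + of_int j}" for j :: int
  have conth: "continuous_on ?T h"
    unfolding h_def by (intro continuous_intros continuous_char_map)
  have opU: "openin (top_of_set ?T) U"
  proof -
    have "U = ?T \<inter> (\<lambda>x. Re (h x)) -` {0<..}" by (auto simp: U_def)
    moreover have "continuous_on ?T (\<lambda>x. Re (h x))" by (intro continuous_intros conth)
    ultimately show ?thesis
      using continuous_openin_preimage_gen open_greaterThan by metis
  qed
  have cont\<theta>: "continuous_on U \<theta>"
    unfolding \<theta>_def
    by (intro continuous_intros continuous_on_subset[OF conth])
      (auto simp: U_def complex_nonpos_Reals_iff)
  have \<theta>: "h x = cis (2 * pi * \<theta> x)" "\<bar>\<theta> x\<bar> < 1 / 4" if "x \<in> U" for x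
  proof -
    from that have re: "0 < Re (h x)" and "x \<in> ?T" by (auto simp: U_def)
    then have n: "norm (h x) = 1" by (simp add: h_def norm_mult char_map_circle)
    with re have nz: "h x \<noteq> 0" by auto
    have "Ln (h x) = \<i> * Im (Ln (h x))"
      using Re_Ln[OF nz] n by (simp add: complex_eq_iff)
    with exp_Ln[OF nz] show "h x = cis (2 * pi * \<theta> x)"
      by (simp add: \<theta>_def cis_conv_exp)
    show "\<bar>\<theta> x\<bar> < 1 / 4"
      using Re_Ln_pos_lt_imp[OF re] by (simp add: \<theta>_def field_simps abs_divide)
  qed
  have memC: "(x, s) \<in> ?C \<longleftrightarrow> (\<exists>j::int. s = s0 + \<theta> x + j)" if "x \<in> U" for x s
  proof -
    have "?f x = h x * cis (2 * pi * s0)" by (simp add: h_def mult.assoc cis_mult)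
    also have "\<dots> = cis (2 * pi * (s0 + \<theta> x))"
      unfolding \<theta>(1)[OF that] by (simp add: cis_mult algebra_simps)
    finally have fx: "?f x = cis (2 * pi * (s0 + \<theta> x))" .
    with that have "(x, s0 + \<theta> x) \<in> ?C" by (simp add: cyclic_cover_def U_def)
    from deck_fibre[OF this] show ?thesis by (simp add: deck_def)
  qed
  show "\<exists>T. x0 \<in> T \<and> openin (top_of_set ?T) T \<and>
           (\<exists>v. \<Union>v = ?C \<inter> fst -` T \<and> (\<forall>u\<in>v. openin (top_of_set ?C) u) \<and>
                pairwise disjnt v \<and> (\<forall>u\<in>v. \<exists>q. homeomorphism u T fst q))"
  proof (intro exI[of _ U] exI[of _ "range A"] conjI ballI opU)
    show "x0 \<in> U" using x0 by (simp add: U_def h_def s0 cis_mult)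
    show "\<Union>(range A) = ?C \<inter> fst -` U" using memC by (auto simp: A_def)
    show "pairwise disjnt (range A)" by (auto simp: pairwise_def disjnt_def A_def)
  next
    fix u assume "u \<in> range A"
    then obtain j where u: "u = A j" by blast
    have "A j = (?C \<inter> fst -` U) \<inter> (?C \<inter> snd -` ball (s0 + j) (1 / 2))"
    proof (rule equalityI; rule subsetI)
      fix z assume "z \<in> A j"
      then show "z \<in> (?C \<inter> fst -` U) \<inter> (?C \<inter> snd -` ball (s0 + j) (1 / 2))"
        using memC \<theta>(2) by (fastforce simp: A_def dist_real_def)
    next
      fix z assume z: "z \<in> (?C \<inter> fst -` U) \<inter> (?C \<inter> snd -` ball (s0 + j) (1 / 2))"
      obtain x s where xs: "z = (x, s)" by (cases z)
      with z have x: "x \<in> U" and "(x, s) \<in> ?C" and d: "\<bar>s0 + j - s\<bar> < 1 / 2"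
        by (auto simp: dist_real_def)
      then obtain i :: int where i: "s = s0 + \<theta> x + i" using memC by blast
      with d \<theta>(2)[OF x] have "\<bar>real_of_int j - real_of_int i\<bar> < 1" by linarith
      then have "i = j" by linarith
      with i x xs show "z \<in> A j" by (simp add: A_def)
    qed
    moreover have "openin (top_of_set ?C) (?C \<inter> fst -` U)"
      by (rule continuous_openin_preimage[OF _ _ opU])
         (auto intro: continuous_intros simp: cyclic_cover_def)
    moreover have "openin (top_of_set ?C) (?C \<inter> snd -` ball (s0 + j) (1 / 2))"
      by (intro continuous_openin_preimage_gen continuous_intros open_ball)
    ultimately show "openin (top_of_set ?C) u" unfolding u by (metis openin_Int)
    have "homeomorphism (A j) U fst (\<lambda>x. (x, s0 + \<theta> x + j))"
      by (rule homeomorphismI) (auto intro!: continuous_intros cont\<theta> simp: A_def)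
    then show "\<exists>q. homeomorphism u U fst q" unfolding u by blast
  qed
qed


lemma path_connected_cyclic_cover:
  fixes L :: "'v::finite set set"
  assumes L: "abstract_simplicial_complex L" and chi: "chi \<in> epi (raag L) integer_group"
  shows "path_connected (cyclic_cover L chi)"
proof -
  let ?C = "cyclic_cover L chi" and ?e = "(\<chi> v. 1) :: complex ^ 'v"
  let ?P = "path_component ?C"
  have e: "(?e, of_int n) \<in> ?C" for n :: int
    using L by (auto simp: cyclic_cover_def toric_complex_def abstract_simplicial_complex_def char_map_def)
  define D where "D = {d. \<forall>n. ?P (?e, of_int n) (?e, of_int (n + d))}"
  have D0: "0 \<in> D" using e by (simp add: D_def path_component_refl)
  have Dadd: "a + b \<in> D" if "a \<in> D" "b \<in> D" for a b
    unfolding D_def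
  proof safe
    fix n
    have 1: "?P (?e, of_int n) (?e, of_int (n + a))"
      using that unfolding D_def by blast
    have 2: "?P (?e, of_int (n + a)) (?e, of_int (n + a + b))"
      using that unfolding D_def by blast
    show "?P (?e, of_int n) (?e, of_int (n + (a + b)))"
      using path_component_trans[OF 1 2] by (simp add: add.assoc)
  qed
  have Dneg: "- a \<in> D" if "a \<in> D" for a
    unfolding D_def
  proof safe
    fix n
    have "?P (?e, of_int (n - a)) (?e, of_int (n - a + a))" using that unfolding D_def by blast
    then show "?P (?e, of_int n) (?e, of_int (n + - a))"
      by (simp add: path_component_sym)
  qed
  have Dgen: "weight L chi v \<in> D" for v
    unfolding D_def
  proof safe
    fix n
    let ?g = "\<lambda>t. ((\<chi> u. if u = v then cis (2 * pi * t) else 1) :: complex ^ 'v,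
                     of_int n + t * of_int (weight L chi v))"
    have "continuous_on {0..1} ?g"
    proof (intro continuous_on_Pair continuous_on_vec_lambda)
      show "continuous_on {0..1} (\<lambda>t. if u = v then cis (2 * pi * t) else 1)" for u
        by (cases "u = v") (auto intro!: continuous_intros)
    qed (intro continuous_intros)
    then have "path ?g" by (simp add: path_def)
    moreover have "path_image ?g \<subseteq> ?C" unfolding path_image_def using loop_lift(1)[OF L] by blast
    moreover have "pathstart ?g = (?e, of_int n)" "pathfinish ?g = (?e, of_int (n + weight L chi v))"
      by (auto simp: pathstart_def pathfinish_def vec_eq_iff)
    ultimately show "?P (?e, of_int n) (?e, of_int (n + weight L chi v))"
      unfolding path_component_def by blast
  qed
  have hom: "chi (raag_class L (x @ y)) = chi (raag_class L x) + chi (raag_class L y)" for x y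
  proof -
    have "chi (raag_class L x \<otimes>\<^bsub>raag L\<^esub> raag_class L y) = chi (raag_class L x) + chi (raag_class L y)"
      using chi by (auto simp: epi_def hom_def raag_def)
    then show ?thesis by (simp add: raag_mult)
  qed
  have nil: "chi (raag_class L []) = 0" using hom[of "[]" "[]"] by simp
  have Dletter: "chi (raag_class L [(v, b)]) \<in> D" for v b
  proof (cases b)
    case True
    then show ?thesis using Dgen by (simp add: weight_def raag_gen_def)
  next
    case False
    have "raag_class L ([(v, True)] @ [(v, False)]) = raag_class L []"
      using raag_eq.cancel[of L v True] by (simp add: raag_class_eq_iff)
    then have "chi (raag_class L [(v, True)]) + chi (raag_class L [(v, False)]) = 0"
      using hom nil by metis
    then have "chi (raag_class L [(v, False)]) = - weight L chi v"
      by (simp add: weight_def raag_gen_def)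
    with False Dgen Dneg show ?thesis by simp
  qed
  have "chi (raag_class L w) \<in> D" for w
  proof (induction w)
    case (Cons a w)
    then show ?case
      using Dadd[OF Dletter[of "fst a" "snd a"]] hom[of "[a]" w] by simp
  qed (simp add: nil D0)
  moreover have "\<exists>w. d = chi (raag_class L w)" for d
  proof -
    have "d \<in> chi ` carrier (raag L)" using chi by (simp add: epi_def)
    then show ?thesis by (auto simp: raag_def)
  qed
  ultimately have D: "d \<in> D" for d by metis
  have base: "\<exists>n. ?P z (?e, of_int n)" if "z \<in> ?C" for z
  proof -
    obtain x s where z: "z = (x, s)" by (cases z)
    with that obtain \<sigma> where \<sigma>: "\<sigma> \<in> L" "\<And>v. v \<notin> \<sigma> \<Longrightarrow> x $ v = 1" "\<And>v. norm (x $ v) = 1"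
      and f: "char_map L chi x = cis (2 * pi * s)"
      by (auto simp: cyclic_cover_def toric_complex_def)
    define a where "a v = Arg (x $ v)" for v
    have a: "x $ v = cis (a v)" for v
      using rcis_cmod_Arg[of "x $ v"] \<sigma>(3) by (simp add: a_def rcis_def)
    have a0: "a v = 0" if "v \<notin> \<sigma>" for v using \<sigma>(2)[OF that] by (simp add: a_def)
    define c where "c = (\<Sum>v\<in>UNIV. a v * weight L chi v) / (2 * pi)"
    have prodcis: "(\<Prod>v\<in>A. cis (h v)) = cis (\<Sum>v\<in>A. h v)" if "finite A" for A :: "'v set" and h
      using that by (induction A rule: finite_induct) (auto simp: cis_mult)
    have f': "char_map L chi (\<chi> v. cis (t * a v)) = cis (2 * pi * (t * c))" for t
    proof -
      have "char_map L chi (\<chi> v. cis (t * a v)) = cis (\<Sum>v\<in>UNIV. t * (a v * weight L chi v))"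
        by (simp add: char_map_def cis_power_int prodcis mult_ac)
      also have "\<dots> = cis (2 * pi * (t * c))"
        by (simp add: c_def flip: sum_distrib_left)
      finally show ?thesis .
    qed
    have fx: "cis (2 * pi * c) = cis (2 * pi * s)"
    proof -
      have "x = (\<chi> v. cis (1 * a v))" by (simp add: vec_eq_iff a)
      then show ?thesis using f f'[of 1] by simp
    qed
    let ?g = "\<lambda>t. ((\<chi> v. cis ((1 - t) * a v)) :: complex ^ 'v, s - t * c)"
    have inC: "?g t \<in> ?C" for t
    proof -
      have "cis (2 * pi * ((1 - t) * c)) = cis (2 * pi * c) * cis (- (2 * pi * (t * c)))"
        by (simp add: cis_mult algebra_simps)
      also have "\<dots> = cis (2 * pi * (s - t * c))"
        unfolding fx by (simp add: cis_mult algebra_simps)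
      finally show ?thesis
        using \<sigma>(1) a0 by (auto simp: cyclic_cover_def f' toric_complex_def intro!: bexI[of _ \<sigma>])
    qed
    have "continuous_on {0..1} ?g"
      by (intro continuous_on_Pair continuous_on_vec_lambda continuous_intros)
    then have "path ?g" by (simp add: path_def)
    moreover have "path_image ?g \<subseteq> ?C" unfolding path_image_def using inC by blast
    moreover have "pathstart ?g = z" by (simp add: pathstart_def z vec_eq_iff a)
    ultimately have P: "?P z (pathfinish ?g)" unfolding path_component_def by blast
    have fin: "pathfinish ?g = (?e, s - c)" by (simp add: pathfinish_def)
    have "(?e, of_int 0) \<in> ?C" "(?e, s - c) \<in> ?C"
      using e[of 0] inC[of 1] by (simp_all del: of_int_0)
    then obtain j where "(?e, s - c) = deck j (?e, of_int 0)"
      using deck_fibre by blast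
    then have "s - c = of_int j" by (simp add: deck_def)
    with P fin show ?thesis by auto
  qed
  show ?thesis
    unfolding path_connected_component
  proof safe
    fix x s y t assume "(x, s) \<in> ?C" "(y, t) \<in> ?C"
    then obtain m n where mn: "?P (x, s) (?e, of_int m)" "?P (y, t) (?e, of_int n)"
      using base by metis
    have "?P (?e, of_int m) (?e, of_int (m + (n - m)))" using D unfolding D_def by blast
    then have 1: "?P (?e, of_int m) (?e, of_int n)" by simp
    show "?P (x, s) (y, t)"
      by (rule path_component_trans[OF mn(1) path_component_trans[OF 1 path_component_sym[OF mn(2)]]])
  qed
qed


section \<open>Singular homology with field coefficients, and the action of the group algebra\<close>

type_synonym ('a, 'k) sing_chain = "((nat \<Rightarrow> real) \<Rightarrow> 'a) \<Rightarrow>\<^sub>0 'k"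

definition pm_scale :: "'k::field \<Rightarrow> ('b \<Rightarrow>\<^sub>0 'k) \<Rightarrow> ('b \<Rightarrow>\<^sub>0 'k)" where
  "pm_scale a c = Poly_Mapping.map ((*) a) c"

lemma lookup_pm_scale: "Poly_Mapping.lookup (pm_scale a c) x = a * Poly_Mapping.lookup c x"
  by (simp add: pm_scale_def Poly_Mapping.map.rep_eq when_def)

lemma vector_space_pm_scale: "vector_space (pm_scale :: 'k::field \<Rightarrow> ('b \<Rightarrow>\<^sub>0 'k) \<Rightarrow> _)"
  by unfold_locales
    (auto intro!: poly_mapping_eqI simp: lookup_pm_scale lookup_add algebra_simps)

interpretation pm: vector_space "pm_scale :: 'k::field \<Rightarrow> ('b \<Rightarrow>\<^sub>0 'k) \<Rightarrow> _"
  by (rule vector_space_pm_scale)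

definition sing_chains :: "nat \<Rightarrow> 'a topology \<Rightarrow> ('a, 'k::field) sing_chain set" where
  "sing_chains n X = {c. \<forall>f\<in>Poly_Mapping.keys c. singular_simplex n X f}"

definition sing_bd :: "nat \<Rightarrow> ('a, 'k::field) sing_chain \<Rightarrow> ('a, 'k) sing_chain" where
  "sing_bd n c = (if n = 0 then 0
     else \<Sum>f\<in>Poly_Mapping.keys c. \<Sum>k\<le>n. Poly_Mapping.single (singular_face n k f) ((- 1) ^ k * Poly_Mapping.lookup c f))"

definition sing_push ::
  "nat \<Rightarrow> ('a \<Rightarrow> 'b) \<Rightarrow> ('a, 'k::field) sing_chain \<Rightarrow> ('b, 'k) sing_chain" where
  "sing_push n g c = (\<Sum>f\<in>Poly_Mapping.keys c. Poly_Mapping.single (simplex_map n g f) (Poly_Mapping.lookup c f))"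

definition sing_cycles :: "nat \<Rightarrow> 'a topology \<Rightarrow> ('a, 'k::field) sing_chain set" where
  "sing_cycles n X = {c \<in> sing_chains n X. sing_bd n c = 0}"

definition sing_boundaries :: "nat \<Rightarrow> 'a topology \<Rightarrow> ('a, 'k::field) sing_chain set" where
  "sing_boundaries n X = sing_bd (Suc n) ` sing_chains (Suc n) X"

definition sing_class ::
  "nat \<Rightarrow> 'a topology \<Rightarrow> ('a, 'k::field) sing_chain \<Rightarrow> ('a, 'k) sing_chain set" where
  "sing_class n X c = {c + b | b. b \<in> sing_boundaries n X}"

text \<open>The group algebra \<open>\<k>\<int> = \<k>[t\<^sup>\<plusminus>\<^sup>1]\<close> is the type \<^typ>\<open>int \<Rightarrow>\<^sub>0 'k\<close> with its convolution
  product; \<open>t\<^sup>j\<close> is \<open>Poly_Mapping.single j 1\<close>.\<close>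

definition kZ_ring :: "(int \<Rightarrow>\<^sub>0 'k::field) ring" where
  "kZ_ring = \<lparr>carrier = UNIV, monoid.mult = (*), one = 1, zero = 0, add = (+)\<rparr>"

definition kZ_t :: "int \<Rightarrow>\<^sub>0 'k::field" where
  "kZ_t = Poly_Mapping.single 1 1"

definition kZ_act :: "nat \<Rightarrow> (int \<Rightarrow> 'a \<Rightarrow> 'a) \<Rightarrow> (int \<Rightarrow>\<^sub>0 'k::field) \<Rightarrow>
    ('a, 'k) sing_chain \<Rightarrow> ('a, 'k) sing_chain" where
  "kZ_act n \<tau> p c = (\<Sum>j\<in>Poly_Mapping.keys p. pm_scale (Poly_Mapping.lookup p j) (sing_push n (\<tau> j) c))"

text \<open>\<open>H\<^sub>n(X, \<k>)\<close> for a space with \<open>\<int>\<close>-action \<open>\<tau>\<close>. The \<open>module\<close> record extends \<open>ring\<close>; its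
  multiplicative fields play no role for modules.\<close>

definition homology_module :: "nat \<Rightarrow> 'a topology \<Rightarrow> (int \<Rightarrow> 'a \<Rightarrow> 'a) \<Rightarrow>
    (int \<Rightarrow>\<^sub>0 'k::field, ('a, 'k) sing_chain set) module" where
  "homology_module n X \<tau> =
     \<lparr>carrier = sing_class n X ` sing_cycles n X,
      monoid.mult = undefined, one = undefined,
      zero = sing_class n X 0,
      add = (\<lambda>M N. {x + y | x y. x \<in> M \<and> y \<in> N}),
      smult = (\<lambda>p M. {kZ_act n \<tau> p c + b | c b. c \<in> M \<and> b \<in> sing_boundaries n X})\<rparr>"

definition direct_sum_module ::
  "'i set \<Rightarrow> ('i \<Rightarrow> ('r, 'm) module) \<Rightarrow> ('r, 'i \<Rightarrow> 'm) module" where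
  "direct_sum_module I M =
     \<lparr>carrier = (\<Pi>\<^sub>E i\<in>I. carrier (M i)),
      monoid.mult = undefined, one = undefined,
      zero = (\<lambda>i\<in>I. \<zero>\<^bsub>M i\<^esub>),
      add = (\<lambda>x y. \<lambda>i\<in>I. x i \<oplus>\<^bsub>M i\<^esub> y i),
      smult = (\<lambda>p x. \<lambda>i\<in>I. p \<odot>\<^bsub>M i\<^esub> x i)\<rparr>"

text \<open>\<open>H\<^sub>i(T\<^sub>L, \<k>\<int>\<^sub>\<chi>)\<close>, as the homology of the infinite cyclic cover with \<open>\<int>\<close> acting by deck
  transformations.\<close>

definition twisted_homology ::
  "'k::field itself \<Rightarrow> 'v::finite set set \<Rightarrow> ('v gword set \<Rightarrow> int) \<Rightarrow> nat \<Rightarrow>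
     (int \<Rightarrow>\<^sub>0 'k, ((complex ^ 'v) \<times> real, 'k) sing_chain set) module" where
  "twisted_homology K L chi i = homology_module i (top_of_set (cyclic_cover L chi)) deck"

definition twisted_homology_le ::
  "'k::field itself \<Rightarrow> 'v::finite set set \<Rightarrow> ('v gword set \<Rightarrow> int) \<Rightarrow> nat \<Rightarrow>
     (int \<Rightarrow>\<^sub>0 'k, nat \<Rightarrow> ((complex ^ 'v) \<times> real, 'k) sing_chain set) module" where
  "twisted_homology_le K L chi r = direct_sum_module {0..r} (twisted_homology K L chi)"

definition trivial_Z_action :: "(int \<Rightarrow>\<^sub>0 'k::field, 'm) module \<Rightarrow> bool" where
  "trivial_Z_action M \<longleftrightarrow> (\<forall>m\<in>carrier M. kZ_t \<odot>\<^bsub>M\<^esub> m = m)"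


subsection \<open>The module axioms\<close>

definition pm_ext :: "('b \<Rightarrow> 'c \<Rightarrow>\<^sub>0 'k::field) \<Rightarrow> ('b \<Rightarrow>\<^sub>0 'k) \<Rightarrow> ('c \<Rightarrow>\<^sub>0 'k)" where
  "pm_ext h c = (\<Sum>f\<in>Poly_Mapping.keys c. pm_scale (Poly_Mapping.lookup c f) (h f))"

lemma pm_ext_superset:
  assumes "finite A" "Poly_Mapping.keys c \<subseteq> A"
  shows "pm_ext h c = (\<Sum>f\<in>A. pm_scale (Poly_Mapping.lookup c f) (h f))"
  unfolding pm_ext_def using assms
  by (intro sum.mono_neutral_left) (auto simp: in_keys_iff)

lemma pm_ext_add: "pm_ext h (c + d) = pm_ext h c + pm_ext h d"
proof -
  let ?A = "Poly_Mapping.keys c \<union> Poly_Mapping.keys d"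
  have "Poly_Mapping.keys (c + d) \<subseteq> ?A" by (rule Poly_Mapping.keys_add)
  then show ?thesis
    by (simp add: pm_ext_superset[of ?A] lookup_add pm.scale_left_distrib sum.distrib)
qed

lemma pm_ext_scale: "pm_ext h (pm_scale a c) = pm_scale a (pm_ext h c)"
proof -
  have "Poly_Mapping.keys (pm_scale a c) \<subseteq> Poly_Mapping.keys c"
    by (auto simp: in_keys_iff lookup_pm_scale)
  then show ?thesis
    by (simp add: pm_ext_superset[of "Poly_Mapping.keys c"] lookup_pm_scale pm.scale_sum_right)
qed

lemma pm_ext_0 [simp]: "pm_ext h 0 = 0" by (simp add: pm_ext_def)

lemma pm_ext_sum: "pm_ext h (sum g A) = (\<Sum>i\<in>A. pm_ext h (g i))"
  by (induction A rule: infinite_finite_induct) (auto simp: pm_ext_add)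

lemma pm_ext_single [simp]: "pm_ext h (Poly_Mapping.single f a) = pm_scale a (h f)"
  by (simp add: pm_ext_superset[of "{f}"])

lemma pm_scale_single: "pm_scale a (Poly_Mapping.single f b) = Poly_Mapping.single f (a * b)"
  by (auto intro!: poly_mapping_eqI simp: lookup_pm_scale lookup_single when_def)

lemma sing_push_ext: "sing_push n g = pm_ext (\<lambda>f. Poly_Mapping.single (simplex_map n g f) 1)"
  by (rule ext) (simp add: sing_push_def pm_ext_def pm_scale_single)

lemma sing_bd_ext:
  "n \<noteq> 0 \<Longrightarrow> sing_bd n = pm_ext (\<lambda>f. \<Sum>k\<le>n. Poly_Mapping.single (singular_face n k f) ((- 1) ^ k))"
  by (rule ext)
    (simp add: sing_bd_def pm_ext_def pm_scale_single pm.scale_sum_right mult.commute)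

lemma sing_bd_add: "sing_bd n (c + d) = sing_bd n c + sing_bd n d"
  by (cases "n = 0") (simp_all add: sing_bd_def[of 0] sing_bd_ext pm_ext_add)
lemma sing_bd_0 [simp]: "sing_bd n 0 = 0" by (simp add: sing_bd_def)
lemma sing_bd_scale: "sing_bd n (pm_scale a c) = pm_scale a (sing_bd n c)"
  by (cases "n = 0") (simp_all add: sing_bd_def[of 0] sing_bd_ext pm_ext_scale)
lemma sing_bd_sum: "sing_bd n (sum g A) = (\<Sum>i\<in>A. sing_bd n (g i))"
  by (cases "n = 0") (simp_all add: sing_bd_def[of 0] sing_bd_ext pm_ext_sum)

lemma sum_single_lookup:
  "(\<Sum>f\<in>Poly_Mapping.keys c. Poly_Mapping.single f (Poly_Mapping.lookup c f)) = (c :: 'b \<Rightarrow>\<^sub>0 'k::field)"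
proof (rule poly_mapping_eqI)
  fix x
  have "Poly_Mapping.lookup (\<Sum>f\<in>Poly_Mapping.keys c. Poly_Mapping.single f (Poly_Mapping.lookup c f)) x
      = (\<Sum>f\<in>Poly_Mapping.keys c. if f = x then Poly_Mapping.lookup c x else 0)"
    unfolding lookup_sum by (intro sum.cong) (auto simp: lookup_single when_def)
  then show "Poly_Mapping.lookup (\<Sum>f\<in>Poly_Mapping.keys c. Poly_Mapping.single f (Poly_Mapping.lookup c f)) x
      = Poly_Mapping.lookup c x"
    by (simp add: in_keys_iff)
qed

lemma pm_induct:
  fixes c :: "'b \<Rightarrow>\<^sub>0 'k::field"
  assumes "P 0" "\<And>a b. P a \<Longrightarrow> P b \<Longrightarrow> P (a + b)" "\<And>f a. f \<in> Poly_Mapping.keys c \<Longrightarrow> P (Poly_Mapping.single f a)"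
  shows "P c"
proof -
  have "P (\<Sum>f\<in>A. Poly_Mapping.single f (Poly_Mapping.lookup c f))"
    if "finite A" "A \<subseteq> Poly_Mapping.keys c" for A
    using that by (induction A rule: finite_induct) (auto intro: assms)
  from this[of "Poly_Mapping.keys c"] show ?thesis
    by (simp add: sum_single_lookup)
qed

lemma sing_chains_subspace: "pm.subspace (sing_chains n X :: ('a,'k::field) sing_chain set)"
  by (rule pm.subspaceI)
    (auto simp: sing_chains_def in_keys_iff lookup_add lookup_pm_scale)

lemma subspace_image_bd:
  assumes "pm.subspace S"
  shows "pm.subspace (sing_bd n ` (S :: ('a,'k::field) sing_chain set))"
proof (rule pm.subspaceI)
  show "0 \<in> sing_bd n ` S"
    using imageI[OF pm.subspace_0[OF assms], of "sing_bd n"] by simp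
next
  fix x y assume "x \<in> sing_bd n ` S" "y \<in> sing_bd n ` S"
  then obtain c d where "c \<in> S" "x = sing_bd n c" "d \<in> S" "y = sing_bd n d" by blast
  then show "x + y \<in> sing_bd n ` S"
    using pm.subspace_add[OF assms, of c d] by (metis sing_bd_add imageI)
next
  fix a x assume "x \<in> sing_bd n ` S"
  then obtain c where "c \<in> S" "x = sing_bd n c" by blast
  then show "pm_scale a x \<in> sing_bd n ` S"
    using pm.subspace_scale[OF assms, of c a] by (metis sing_bd_scale imageI)
qed

lemma sing_boundaries_subspace: "pm.subspace (sing_boundaries n X :: ('a,'k::field) sing_chain set)"
  unfolding sing_boundaries_def by (intro subspace_image_bd sing_chains_subspace)

lemma sing_cycles_subspace: "pm.subspace (sing_cycles n X :: ('a,'k::field) sing_chain set)"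
  using sing_chains_subspace[of n X]
  unfolding pm.subspace_def sing_cycles_def
  by (auto simp: sing_bd_add sing_bd_scale)

lemma sing_push_add: "sing_push n g (c + d) = sing_push n g c + sing_push n g d"
  by (simp add: sing_push_ext pm_ext_add)
lemma sing_push_scale: "sing_push n g (pm_scale a c) = pm_scale a (sing_push n g c)"
  by (simp add: sing_push_ext pm_ext_scale)
lemma sing_push_sum: "sing_push n g (sum h A) = (\<Sum>i\<in>A. sing_push n g (h i))"
  by (simp add: sing_push_ext pm_ext_sum)

lemma sing_push_chains:
  assumes "c \<in> sing_chains n X" "continuous_map X Y g"
  shows "sing_push n g c \<in> sing_chains n Y"
  unfolding sing_push_def
  using assms
  by (intro pm.subspace_sum[OF sing_chains_subspace])
    (auto simp: sing_chains_def intro: singular_simplex_simplex_map)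

lemma sing_push_bd:
  assumes "c \<in> sing_chains (Suc n) X"
  shows "sing_bd (Suc n) (sing_push (Suc n) g c) = sing_push n g (sing_bd (Suc n) c)"
proof (induction rule: pm_induct[of _ c])
  case (3 f a)
  then have f: "singular_simplex (Suc n) X f" using assms by (auto simp: sing_chains_def)
  have "singular_face (Suc n) k (simplex_map (Suc n) g f) = simplex_map n g (singular_face (Suc n) k f)"
    if "k \<le> Suc n" for k
    using simplical_face_in_standard_simplex[of "Suc n" k] that
    by (auto simp: singular_face_def simplex_map_def fun_eq_iff restrict_def)
  then show ?case
    by (simp add: sing_push_ext sing_bd_ext pm_ext_sum pm_ext_scale pm_scale_single pm_ext_add)
qed (simp_all add: sing_push_add sing_bd_add, simp_all add: sing_push_ext sing_bd_def)

lemma sing_push_comp: "sing_push n g (sing_push n h c) = sing_push n (g \<circ> h) c"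
proof (induction rule: pm_induct[of _ c])
  case (3 f a)
  have "simplex_map n g (simplex_map n h f) = simplex_map n (g \<circ> h) f"
    by (simp add: simplex_map_def fun_eq_iff restrict_def)
  then show ?case by (simp add: sing_push_ext pm_scale_single del: comp_apply o_apply)
qed (simp_all add: sing_push_add, simp add: sing_push_def)

lemma sing_push_id: "c \<in> sing_chains n X \<Longrightarrow> sing_push n id c = c"
proof -
  assume c: "c \<in> sing_chains n X"
  show ?thesis
proof (rule pm_induct[of _ c])
  fix f a
  assume "f \<in> Poly_Mapping.keys c"
  with c have "simplex_map n id f = f"
    by (auto simp: sing_chains_def simplex_map_def singular_simplex_def extensional_restrict)
  then show "sing_push n id (Poly_Mapping.single f a) = Poly_Mapping.single f a"
    by (simp add: sing_push_ext pm_scale_single)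
qed (simp_all add: sing_push_add, simp add: sing_push_def)
qed

lemma kZ_act_add: "kZ_act n \<tau> p (c + d) = kZ_act n \<tau> p c + kZ_act n \<tau> p d"
  by (simp add: kZ_act_def sing_push_add pm.scale_right_distrib sum.distrib)

lemma kZ_act_superset:
  assumes "finite A" "Poly_Mapping.keys p \<subseteq> A"
  shows "kZ_act n \<tau> p c = (\<Sum>j\<in>A. pm_scale (Poly_Mapping.lookup p j) (sing_push n (\<tau> j) c))"
  unfolding kZ_act_def using assms
  by (intro sum.mono_neutral_left) (auto simp: in_keys_iff)

lemma kZ_act_plus: "kZ_act n \<tau> (p + q) c = kZ_act n \<tau> p c + kZ_act n \<tau> q c"
proof -
  let ?A = "Poly_Mapping.keys p \<union> Poly_Mapping.keys q"
  have "Poly_Mapping.keys (p + q) \<subseteq> ?A" by (rule Poly_Mapping.keys_add)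
  then show ?thesis
    by (simp add: kZ_act_superset[of ?A] lookup_add pm.scale_left_distrib sum.distrib)
qed

lemma kZ_act_single: "kZ_act n \<tau> (Poly_Mapping.single j a) c = pm_scale a (sing_push n (\<tau> j) c)"
  by (simp add: kZ_act_superset[of "{j}"])

lemma kZ_act_mult:
  assumes "\<And>i j. \<tau> (i + j) = \<tau> i \<circ> \<tau> j"
  shows "kZ_act n \<tau> (p * q) c = kZ_act n \<tau> p (kZ_act n \<tau> q c)"
proof (induction rule: pm_induct[of _ p])
  case (3 i a)
  show ?case
  proof (induction rule: pm_induct[of _ q])
    case (3 j b)
    show ?case
      by (simp add: mult_single kZ_act_single sing_push_scale sing_push_comp assms)
  qed (simp_all add: distrib_left kZ_act_plus kZ_act_add, simp add: kZ_act_def sing_push_def)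
qed (simp_all add: distrib_right kZ_act_plus, simp add: kZ_act_def)

lemma cring_kZ_ring: "cring (kZ_ring :: (int \<Rightarrow>\<^sub>0 'k::field) ring)"
proof (rule cringI)
  show "abelian_group (kZ_ring :: (int \<Rightarrow>\<^sub>0 'k) ring)"
  proof (rule abelian_groupI)
    fix x :: "int \<Rightarrow>\<^sub>0 'k"
    show "\<exists>y\<in>carrier kZ_ring. y \<oplus>\<^bsub>kZ_ring\<^esub> x = \<zero>\<^bsub>kZ_ring\<^esub>"
      by (rule bexI[of _ "- x"]) (simp_all add: kZ_ring_def)
  qed (simp_all add: kZ_ring_def add.assoc add.commute)
  show "comm_monoid (kZ_ring :: (int \<Rightarrow>\<^sub>0 'k) ring)"
    by (rule comm_monoidI) (simp_all add: kZ_ring_def mult.assoc mult.commute)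
qed (simp add: kZ_ring_def distrib_right)

locale Z_space =
  fixes X :: "'a topology" and \<tau> :: "int \<Rightarrow> 'a \<Rightarrow> 'a"
  assumes cont: "continuous_map X X (\<tau> j)"
    and act0: "\<tau> 0 = id" and act_add: "\<tau> (i + j) = \<tau> i \<circ> \<tau> j"
begin

lemma push_boundaries:
  assumes "b \<in> sing_boundaries n X" shows "sing_push n (\<tau> j) b \<in> sing_boundaries n X"
proof -
  obtain c where c: "c \<in> sing_chains (Suc n) X" "b = sing_bd (Suc n) c"
    using assms by (auto simp: sing_boundaries_def)
  show ?thesis
    unfolding c(2) sing_push_bd[OF c(1), symmetric] sing_boundaries_def
    by (rule imageI) (rule sing_push_chains[OF c(1) cont])
qed

lemma push_cycles:
  assumes "c \<in> sing_cycles n X" shows "sing_push n (\<tau> j) c \<in> sing_cycles n X"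
proof -
  have c: "c \<in> sing_chains n X" "sing_bd n c = 0" using assms by (simp_all add: sing_cycles_def)
  have "sing_bd n (sing_push n (\<tau> j) c) = 0"
  proof (cases n)
    case 0
    then show ?thesis by (simp add: sing_bd_def)
  next
    case (Suc m)
    with c show ?thesis
      using sing_push_bd[of c m X "\<tau> j"] by (simp add: sing_push_def[of _ _ 0])
  qed
  with sing_push_chains[OF c(1) cont] show ?thesis by (simp add: sing_cycles_def)
qed

lemma act_boundaries: "b \<in> sing_boundaries n X \<Longrightarrow> kZ_act n \<tau> p b \<in> sing_boundaries n X"
  unfolding kZ_act_def
  by (intro pm.subspace_sum pm.subspace_scale sing_boundaries_subspace push_boundaries)

lemma act_cycles: "b \<in> sing_cycles n X \<Longrightarrow> kZ_act n \<tau> p b \<in> sing_cycles n X"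
  unfolding kZ_act_def
  by (intro pm.subspace_sum pm.subspace_scale sing_cycles_subspace push_cycles)

lemma class_add:
  "{x + y | x y. x \<in> sing_class n X c \<and> y \<in> sing_class n X d} = sing_class n X (c + d)" (is "?l = ?r")
proof
  note S = sing_boundaries_subspace[of n X]
  show "?l \<subseteq> ?r"
  proof
    fix z assume "z \<in> ?l"
    then obtain b b' where "b \<in> sing_boundaries n X" "b' \<in> sing_boundaries n X" "z = (c + b) + (d + b')"
      by (auto simp: sing_class_def)
    then show "z \<in> ?r" using pm.subspace_add[OF S, of b b']
      by (auto simp: sing_class_def intro!: exI[of _ "b + b'"])
  qed
  show "?r \<subseteq> ?l"
  proof
    fix z assume "z \<in> ?r"
    then obtain b where "b \<in> sing_boundaries n X" "z = c + d + b" by (auto simp: sing_class_def)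
    moreover from this have "c \<in> sing_class n X c" "d + b \<in> sing_class n X d"
      using pm.subspace_0[OF S] by (auto simp: sing_class_def intro: exI[of _ 0])
    ultimately show "z \<in> ?l" by (auto simp: add.assoc)
  qed
qed

lemma class_act:
  "{kZ_act n \<tau> p x + y | x y. x \<in> sing_class n X c \<and> y \<in> sing_boundaries n X}
     = sing_class n X (kZ_act n \<tau> p c)" (is "?l = ?r")
proof
  note S = sing_boundaries_subspace[of n X]
  show "?l \<subseteq> ?r"
  proof
    fix z assume "z \<in> ?l"
    then obtain b b' where "b \<in> sing_boundaries n X" "b' \<in> sing_boundaries n X"
       "z = kZ_act n \<tau> p (c + b) + b'"
      by (auto simp: sing_class_def)
    then show "z \<in> ?r" using pm.subspace_add[OF S act_boundaries, of b b' p]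
      by (auto simp: sing_class_def kZ_act_add add.assoc)
  qed
  show "?r \<subseteq> ?l"
  proof
    fix z assume "z \<in> ?r"
    then obtain b where "b \<in> sing_boundaries n X" "z = kZ_act n \<tau> p c + b" by (auto simp: sing_class_def)
    moreover have "c \<in> sing_class n X c"
      using pm.subspace_0[OF S] by (auto simp: sing_class_def intro: exI[of _ 0])
    ultimately show "z \<in> ?l" by auto
  qed
qed

lemma module_homology: "Module.module kZ_ring (homology_module n X \<tau> :: (int \<Rightarrow>\<^sub>0 'k::field, ('a,'k) sing_chain set) module)"
proof (rule moduleI)
  let ?M = "homology_module n X \<tau> :: (int \<Rightarrow>\<^sub>0 'k::field, ('a,'k) sing_chain set) module"
  have car: "carrier ?M = sing_class n X ` sing_cycles n X"
    and zero: "\<zero>\<^bsub>?M\<^esub> = sing_class n X 0"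
    and add: "\<And>c d. sing_class n X c \<oplus>\<^bsub>?M\<^esub> sing_class n X d = sing_class n X (c + d)"
    and smult: "\<And>p c. p \<odot>\<^bsub>?M\<^esub> sing_class n X c = sing_class n X (kZ_act n \<tau> p c)"
    by (simp_all only: homology_module_def class_add class_act partial_object.simps monoid.simps ring.simps module.simps)
  note simps = car zero add smult
  note S = sing_cycles_subspace[of n X]
  show "cring kZ_ring" by (rule cring_kZ_ring)
  have cycle0: "(0 :: ('a,'k) sing_chain) \<in> sing_cycles n X" using pm.subspace_0[OF S] .
  show "abelian_group ?M"
  proof (rule abelian_groupI)
    fix x assume "x \<in> carrier ?M"
    then obtain c where c: "c \<in> sing_cycles n X" "x = sing_class n X c"
      by (auto simp: car)
    show "\<exists>y\<in>carrier ?M. y \<oplus>\<^bsub>?M\<^esub> x = \<zero>\<^bsub>?M\<^esub>"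
    proof (rule bexI)
      show "sing_class n X (- c) \<oplus>\<^bsub>?M\<^esub> x = \<zero>\<^bsub>?M\<^esub>" by (simp add: c simps)
      show "sing_class n X (- c) \<in> carrier ?M" using pm.subspace_neg[OF S c(1)] by (simp add: car)
    qed
    show "\<zero>\<^bsub>?M\<^esub> \<oplus>\<^bsub>?M\<^esub> x = x" by (simp add: c simps)
    fix y assume "y \<in> carrier ?M"
    then obtain d where d: "d \<in> sing_cycles n X" "y = sing_class n X d"
      by (auto simp: car)
    show "x \<oplus>\<^bsub>?M\<^esub> y \<in> carrier ?M"
      using pm.subspace_add[OF S c(1) d(1)] by (simp add: c d simps)
    show "x \<oplus>\<^bsub>?M\<^esub> y = y \<oplus>\<^bsub>?M\<^esub> x" by (simp add: c d simps add.commute)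
    fix z assume "z \<in> carrier ?M"
    then obtain e where e: "z = sing_class n X e" by (auto simp: car)
    show "x \<oplus>\<^bsub>?M\<^esub> y \<oplus>\<^bsub>?M\<^esub> z = x \<oplus>\<^bsub>?M\<^esub> (y \<oplus>\<^bsub>?M\<^esub> z)"
      by (simp add: c d e simps add.assoc)
  next
    show "\<zero>\<^bsub>?M\<^esub> \<in> carrier ?M" using cycle0 by (simp add: car zero)
  qed
  have "kZ_act n \<tau> 1 c = c" if "c \<in> sing_cycles n X" for c :: "('a,'k) sing_chain"
    unfolding single_one[symmetric] kZ_act_single act0
    using that sing_push_id by (auto simp: sing_cycles_def)
  then show "\<And>x. x \<in> carrier ?M \<Longrightarrow> \<one>\<^bsub>kZ_ring\<^esub> \<odot>\<^bsub>?M\<^esub> x = x"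
    by (auto simp: simps kZ_ring_def)
  fix a b x y assume "x \<in> carrier ?M" "y \<in> carrier ?M"
  then obtain c d where c: "c \<in> sing_cycles n X" "x = sing_class n X c"
      and d: "d \<in> sing_cycles n X" "y = sing_class n X d"
    by (auto simp: car)
  show "a \<odot>\<^bsub>?M\<^esub> (x \<oplus>\<^bsub>?M\<^esub> y) = a \<odot>\<^bsub>?M\<^esub> x \<oplus>\<^bsub>?M\<^esub> a \<odot>\<^bsub>?M\<^esub> y"
    by (simp add: c d add smult kZ_act_add)
  show "a \<odot>\<^bsub>?M\<^esub> x \<in> carrier ?M"
    by (simp add: c smult car act_cycles)
  show "(a \<oplus>\<^bsub>kZ_ring\<^esub> b) \<odot>\<^bsub>?M\<^esub> x = a \<odot>\<^bsub>?M\<^esub> x \<oplus>\<^bsub>?M\<^esub> b \<odot>\<^bsub>?M\<^esub> x"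
    by (simp add: c add smult kZ_act_plus kZ_ring_def)
  show "(a \<otimes>\<^bsub>kZ_ring\<^esub> b) \<odot>\<^bsub>?M\<^esub> x = a \<odot>\<^bsub>?M\<^esub> (b \<odot>\<^bsub>?M\<^esub> x)"
    by (simp add: c add smult kZ_act_mult act_add kZ_ring_def)
qed

end

lemma deck_closed:
  assumes "z \<in> cyclic_cover L chi" shows "deck j z \<in> cyclic_cover L chi"
proof -
  obtain x s where z: "z = (x, s)" by (cases z)
  have "(x, s + of_int j) \<in> cyclic_cover L chi"
    unfolding deck_fibre[OF assms[unfolded z]] by (rule exI[of _ j]) (simp add: deck_def)
  then show ?thesis by (simp add: z deck_def)
qed

lemma Z_space_cyclic_cover: "Z_space (top_of_set (cyclic_cover L chi)) deck"
proof (rule Z_space.intro)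
  fix i j :: int
  have "continuous_on (cyclic_cover L chi) (deck j)"
    unfolding deck_def case_prod_unfold by (intro continuous_intros)
  then show "continuous_map (top_of_set (cyclic_cover L chi)) (top_of_set (cyclic_cover L chi)) (deck j)"
    by (auto intro: deck_closed)
  show "deck 0 = (id :: 'b \<times> real \<Rightarrow> _)" by (rule ext) (simp add: deck_def case_prod_unfold)
  show "deck (i + j) = (deck i \<circ> deck j :: 'b \<times> real \<Rightarrow> _)"
    by (rule ext) (simp add: deck_def case_prod_unfold)
qed

lemma module_twisted_homology: "Module.module kZ_ring (twisted_homology K L chi i)"
  unfolding twisted_homology_def by (rule Z_space.module_homology[OF Z_space_cyclic_cover])

lemma module_direct_sum:
  assumes R: "cring R" and M: "\<And>i. i \<in> I \<Longrightarrow> Module.module R (M i)"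
  shows "Module.module R (direct_sum_module I M)"
proof (rule moduleI[OF R])
  let ?S = "direct_sum_module I M"
  have ab: "abelian_group (M i)" if "i \<in> I" for i
    using M[OF that] by (simp add: Module.module_def)
  have mem: "x i \<in> carrier (M i)" if "x \<in> carrier ?S" "i \<in> I" for x i
    using that by (auto simp: direct_sum_module_def PiE_mem)
  have ext: "x = y" if "x \<in> carrier ?S" "y \<in> carrier ?S" "\<And>i. i \<in> I \<Longrightarrow> x i = y i" for x y
    using that by (auto simp: direct_sum_module_def intro: PiE_ext)
  have add: "(x \<oplus>\<^bsub>?S\<^esub> y) i = x i \<oplus>\<^bsub>M i\<^esub> y i" if "i \<in> I" for x y i
    using that by (simp add: direct_sum_module_def)
  have smult: "(a \<odot>\<^bsub>?S\<^esub> y) i = a \<odot>\<^bsub>M i\<^esub> y i" if "i \<in> I" for a y i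
    using that by (simp add: direct_sum_module_def)
  have zero: "\<zero>\<^bsub>?S\<^esub> i = \<zero>\<^bsub>M i\<^esub>" if "i \<in> I" for i
    using that by (simp add: direct_sum_module_def)
  have closed_add: "x \<oplus>\<^bsub>?S\<^esub> y \<in> carrier ?S" if "x \<in> carrier ?S" "y \<in> carrier ?S" for x y
    using abelian_groupE(1)[OF ab] mem that by (simp add: direct_sum_module_def)
  have closed_zero: "\<zero>\<^bsub>?S\<^esub> \<in> carrier ?S"
    using abelian_groupE(2)[OF ab] by (simp add: direct_sum_module_def)
  have closed_smult: "a \<odot>\<^bsub>?S\<^esub> x \<in> carrier ?S" if "a \<in> carrier R" "x \<in> carrier ?S" for a x
    using Module.module.smult_closed[OF M] mem that by (simp add: direct_sum_module_def)
  show "abelian_group ?S"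
  proof (rule abelian_groupI)
    fix x assume x: "x \<in> carrier ?S"
    show "\<zero>\<^bsub>?S\<^esub> \<oplus>\<^bsub>?S\<^esub> x = x"
      by (rule ext) (simp_all add: add zero x closed_add closed_zero mem abelian_groupE(5)[OF ab])
    let ?y = "\<lambda>i\<in>I. \<ominus>\<^bsub>M i\<^esub> x i"
    have y: "?y \<in> carrier ?S"
      using abelian_group.a_inv_closed[OF ab] mem[OF x] by (simp add: direct_sum_module_def)
    have "?y \<oplus>\<^bsub>?S\<^esub> x = \<zero>\<^bsub>?S\<^esub>"
      by (rule ext) (simp_all add: add zero x y closed_add closed_zero mem abelian_group.l_neg[OF ab])
    with y show "\<exists>y\<in>carrier ?S. y \<oplus>\<^bsub>?S\<^esub> x = \<zero>\<^bsub>?S\<^esub>" by blast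
    fix y assume y: "y \<in> carrier ?S"
    show "x \<oplus>\<^bsub>?S\<^esub> y = y \<oplus>\<^bsub>?S\<^esub> x"
      by (rule ext) (simp_all add: add x y closed_add mem abelian_groupE(4)[OF ab])
    fix z assume z: "z \<in> carrier ?S"
    show "x \<oplus>\<^bsub>?S\<^esub> y \<oplus>\<^bsub>?S\<^esub> z = x \<oplus>\<^bsub>?S\<^esub> (y \<oplus>\<^bsub>?S\<^esub> z)"
      by (rule ext) (simp_all add: add x y z closed_add mem abelian_groupE(3)[OF ab])
  qed (use closed_add closed_zero in blast)+
  interpret R: cring R by (rule R)
  fix x assume x: "x \<in> carrier ?S"
  show "\<one>\<^bsub>R\<^esub> \<odot>\<^bsub>?S\<^esub> x = x"
    by (rule ext) (simp_all add: smult x closed_smult mem Module.module.smult_one[OF M])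
  fix a assume a: "a \<in> carrier R"
  show "a \<odot>\<^bsub>?S\<^esub> x \<in> carrier ?S" by (rule closed_smult[OF a x])
  show "a \<odot>\<^bsub>?S\<^esub> (x \<oplus>\<^bsub>?S\<^esub> y) = a \<odot>\<^bsub>?S\<^esub> x \<oplus>\<^bsub>?S\<^esub> a \<odot>\<^bsub>?S\<^esub> y" if y: "y \<in> carrier ?S" for y
    by (rule ext) (simp_all add: add smult x y a closed_add closed_smult mem Module.module.smult_r_distr[OF M])
  fix b assume b: "b \<in> carrier R"
  show "(a \<oplus>\<^bsub>R\<^esub> b) \<odot>\<^bsub>?S\<^esub> x = a \<odot>\<^bsub>?S\<^esub> x \<oplus>\<^bsub>?S\<^esub> b \<odot>\<^bsub>?S\<^esub> x"
    by (rule ext) (simp_all add: add smult x a b closed_add closed_smult mem Module.module.smult_l_distr[OF M])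
  show "(a \<otimes>\<^bsub>R\<^esub> b) \<odot>\<^bsub>?S\<^esub> x = a \<odot>\<^bsub>?S\<^esub> (b \<odot>\<^bsub>?S\<^esub> x)"
    by (rule ext) (simp_all add: smult x a b closed_smult mem Module.module.smult_assoc1[OF M])
qed

lemma module_twisted_homology_le: "Module.module kZ_ring (twisted_homology_le K L chi r)"
  unfolding twisted_homology_le_def
  by (rule module_direct_sum[OF Module.module.axioms(1)[OF module_twisted_homology] module_twisted_homology])


section \<open>The exterior face ring\<close>

text \<open>Words \<open>v\<^sub>1\<dots>v\<^sub>n\<close> are the noncommutative monomials in the dual basis; the type \<open>'v dword \<Rightarrow>\<^sub>0 'k\<close>
  with its convolution product is the tensor algebra of \<open>V\<^sup>*\<close>, graded by word length.\<close>

datatype 'v dword = DWord (letters: "'v list")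

instantiation dword :: (type) monoid_add
begin
definition "0 = DWord []"
definition "x + y = DWord (letters x @ letters y)"
instance by standard (simp_all add: zero_dword_def plus_dword_def)
end

definition dual_vec :: "'v \<Rightarrow> 'v dword \<Rightarrow>\<^sub>0 'k::field" where
  "dual_vec v = Poly_Mapping.single (DWord [v]) 1"

definition tensor_grade :: "nat \<Rightarrow> ('v dword \<Rightarrow>\<^sub>0 'k::field) set" where
  "tensor_grade i = {x. \<forall>w\<in>Poly_Mapping.keys x. length (letters w) = i}"

text \<open>\<open>\<k>\<langle>L\<rangle>\<close> is the quotient of the tensor algebra by the two-sided ideal \<open>face_ideal L\<close> generated by
  the squares of elements of \<open>V\<^sup>*\<close> (giving \<open>\<And>V\<^sup>*\<close>) and by the monomials not supported on a
  simplex (the generators of \<open>J\<^sub>L\<close>).\<close>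

definition face_ideal_gens :: "'v set set \<Rightarrow> ('v dword \<Rightarrow>\<^sub>0 'k::field) set" where
  "face_ideal_gens L = {x * x | x. x \<in> tensor_grade 1}
     \<union> {Poly_Mapping.single w 1 | w. set (letters w) \<notin> L}"

definition face_ideal :: "'v set set \<Rightarrow> ('v dword \<Rightarrow>\<^sub>0 'k::field) set" where
  "face_ideal L = pm.span {a * g * b | a g b. g \<in> face_ideal_gens L}"

definition z_elt :: "'v set \<Rightarrow> 'v dword \<Rightarrow>\<^sub>0 'k::field" where
  "z_elt W = (\<Sum>v\<in>W. dual_vec v)"

text \<open>The cocycles and coboundaries of degree \<open>i\<close> of \<open>(\<k>\<langle>L\<rangle>, \<cdot> z\<^sub>W)\<close> are the images in \<open>\<k>\<langle>L\<rangle>\<close> of the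
  following subspaces of the \<open>i\<close>-th tensor power. Both contain the degree \<open>i\<close> part of the ideal, and
  everything is finite-dimensional, so the difference of their dimensions is the dimension of the
  cohomology.\<close>

definition face_cocycles :: "'v::finite set set \<Rightarrow> 'v set \<Rightarrow> nat \<Rightarrow> ('v dword \<Rightarrow>\<^sub>0 'k::field) set" where
  "face_cocycles L W i = {x \<in> tensor_grade i. x * z_elt W \<in> face_ideal L}"

definition face_coboundaries :: "'v::finite set set \<Rightarrow> 'v set \<Rightarrow> nat \<Rightarrow> ('v dword \<Rightarrow>\<^sub>0 'k::field) set" where
  "face_coboundaries L W i =
     {y * z_elt W + u | y u. (case i of 0 \<Rightarrow> y = 0 | Suc j \<Rightarrow> y \<in> tensor_grade j)
        \<and> u \<in> face_ideal L \<inter> tensor_grade i}"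

lemma pm_scale_mult: "pm_scale a x = Poly_Mapping.single 0 a * (x :: 'm::monoid_add \<Rightarrow>\<^sub>0 'k::field)"
  by (rule pm_induct[of _ x]) (simp_all add: pm.scale_right_distrib distrib_left mult_single pm_scale_single)

lemma pm_const_central:
  fixes x :: "'m::monoid_add \<Rightarrow>\<^sub>0 'k::field"
  shows "Poly_Mapping.single 0 a * x = x * Poly_Mapping.single 0 a"
  by (rule pm_induct[of _ x]) (simp_all add: distrib_left distrib_right mult_single mult.commute[of a])

lemma face_ideal_closed:
  assumes "x \<in> face_ideal L" shows "p * x * q \<in> face_ideal L"
proof -
  let ?G = "{a * g * b | a g b. g \<in> face_ideal_gens L}"
  have "p * x * q \<in> pm.span ?G"
    using assms unfolding face_ideal_def
  proof (induction rule: pm.span_induct_alt)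
    case base
    then show ?case by (simp add: pm.span_zero)
  next
    case (step c x y)
    obtain a g b where g: "x = a * g * b" "g \<in> face_ideal_gens L" using step(1) by blast
    have "p * x * q = (p * a) * g * (b * q)" by (simp add: g mult.assoc)
    then have "p * x * q \<in> ?G" using g(2) by blast
    then have "p * x * q \<in> pm.span ?G" by (rule pm.span_base)
    moreover have "p * pm_scale c x * q = pm_scale c (p * x * q)"
      by (metis (no_types) pm_scale_mult pm_const_central mult.assoc)
    ultimately show ?case
      using step(2) by (simp add: distrib_left distrib_right pm.span_add pm.span_scale)
  qed
  then show ?thesis by (simp add: face_ideal_def)
qed

lemma tensor_grade_subspace: "pm.subspace (tensor_grade i :: ('v dword \<Rightarrow>\<^sub>0 'k::field) set)"
  by (rule pm.subspaceI) (auto simp: tensor_grade_def in_keys_iff lookup_add lookup_pm_scale)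

lemma tensor_grade_mult:
  assumes "x \<in> tensor_grade i" "y \<in> tensor_grade j"
  shows "x * y \<in> tensor_grade (i + j)"
  unfolding tensor_grade_def
proof safe
  fix w assume "w \<in> Poly_Mapping.keys (x * y)"
  with keys_mult[of x y] obtain u v where "w = u + v" "u \<in> Poly_Mapping.keys x" "v \<in> Poly_Mapping.keys y"
    by blast
  with assms show "length (letters w) = i + j" by (simp add: tensor_grade_def plus_dword_def)
qed

lemma z_elt_grade: "z_elt W \<in> tensor_grade 1"
  unfolding z_elt_def
  by (intro pm.subspace_sum[OF tensor_grade_subspace]) (simp add: tensor_grade_def dual_vec_def)

lemma face_coboundaries_subset: "face_coboundaries L W i \<subseteq> face_cocycles L W i"
proof
  fix x :: "'a dword \<Rightarrow>\<^sub>0 'b" assume "x \<in> face_coboundaries L W i"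
  then obtain y u where x: "x = y * z_elt W + u"
    and y: "case i of 0 \<Rightarrow> y = 0 | Suc j \<Rightarrow> y \<in> tensor_grade j"
    and u: "u \<in> face_ideal L" "u \<in> tensor_grade i"
    by (auto simp: face_coboundaries_def)
  have "y * z_elt W \<in> tensor_grade i"
  proof (cases i)
    case 0
    with y show ?thesis by (simp add: pm.subspace_0[OF tensor_grade_subspace])
  next
    case (Suc j)
    with y tensor_grade_mult[OF _ z_elt_grade[of W], of y j] show ?thesis by simp
  qed
  with u have "x \<in> tensor_grade i" unfolding x by (intro pm.subspace_add[OF tensor_grade_subspace])
  moreover have "y * (z_elt W * z_elt W) * 1 \<in> face_ideal L"
  proof -
    have "z_elt W * z_elt W \<in> face_ideal_gens L"
      unfolding face_ideal_gens_def using z_elt_grade[of W] by auto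
    then have "y * (z_elt W * z_elt W) * 1 \<in> {a * g * b | a g b. g \<in> face_ideal_gens L}" by blast
    then show ?thesis unfolding face_ideal_def by (rule pm.span_base)
  qed
  moreover have "1 * u * z_elt W \<in> face_ideal L" by (rule face_ideal_closed[OF u(1)])
  ultimately show "x \<in> face_cocycles L W i"
    by (auto simp: face_cocycles_def x distrib_right mult.assoc face_ideal_def intro: pm.span_add)
qed

definition betti :: "'k::field itself \<Rightarrow> 'v::finite set set \<Rightarrow> 'v set \<Rightarrow> nat \<Rightarrow> nat" where
  "betti K L W i =
     pm.dim (face_cocycles L W i :: ('v dword \<Rightarrow>\<^sub>0 'k) set)
     - pm.dim (face_coboundaries L W i :: ('v dword \<Rightarrow>\<^sub>0 'k) set)"

end

theory Submission
  imports Defs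
begin

text \<open>Give the cyclic cover its equivariant cell structure: its cellular complex is
  \<open>\<k>\<int> \<otimes> \<k>[L]\<close> with differential weighted by \<open>t\<^bsup>m\<^esup> - 1\<close>, \<open>m = m\<^sub>v\<close>. Adding the
  vertices one at a time, the cover of \<open>L\<close> arises from the cover of the deletion of \<open>v\<close> by gluing in a
  cylinder over the cover of the link of \<open>v\<close>; excision and the homology of a cylinder show inductively
  that the map from cellular to singular chains has acyclic cone.

  Write \<open>t\<^bsup>m\<^esup> - 1 = (t - 1) [m]\<close>. As \<open>t - 1\<close> is a nonzerodivisor, it kills the homology in degree \<open>i\<close>
  of the complex with weights \<open>t\<^bsup>m\<^esup> - 1\<close> iff the complex with weights \<open>[m\<^sub>v]\<close> is exact in degree \<open>i\<close>.
  Reducing the latter modulo \<open>t - 1\<close>, or modulo \<open>[q]\<close> for a prime \<open>q\<close>, turns the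
  weights into units on \<open>V\<^sub>p\<close> or \<open>V\<^sub>q\<close> and zero elsewhere, and rescaling makes the units \<open>1\<close>. Conversely, exactness
  for the weights \<open>1\<close> on \<open>V\<^sub>q\<close> implies that a cycle of degree at most \<open>r\<close> becomes a boundary after
  multiplication by a power of \<open>\<Prod>[m\<^sub>v]\<close>, \<open>v \<in> V\<^sub>q\<close>, and no prime ideal contains these products for all
  relevant \<open>q\<close>. Over a field the complex with weights \<open>1\<close> on \<open>V\<^sub>q\<close> is dual to
  \<open>(\<k>\<langle>L\<rangle>, \<cdot> z\<^bsub>V\<^sub>q\<^esub>)\<close>.\<close>

section \<open>From integral to field coefficients\<close>

text \<open>The degrees up to \<open>r\<close> cannot be separated: reducing the quantum weights
  modulo an element \<open>f\<close> meets a Bockstein obstruction one degree lower, so exactness in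
  degree \<open>i\<close> downstairs uses degrees \<open>i - 1\<close> and \<open>i\<close>
  upstairs. The quotient by [q] need be neither a field nor map to the coefficient field, but the
  reduced weights are 0 and 1, so a linear splitting of the scalars is enough and no roots of unity
  are adjoined. In characteristic p > 0 one has \<open>[p] = (t - 1)^(p - 1)\<close>, so
  \<open>q = p\<close> leads back to the reduction modulo t - 1. On the topological side, the two
  ends of the cylinder over the cover of a link are attached by maps that differ by a deck
  transformation, which is where the weight \<open>t^m - 1\<close> comes from. The weights on a link
  may fail to generate the integers, and its cover may be disconnected; the induction therefore runs
  over arbitrary weights and over complexes that omit vertices. Cone acyclicity asks for no
  equivariant homotopies and turns the gluing step into one chase with chains, without connecting
  homomorphisms.\<close>

definition zk :: "('b \<Rightarrow>\<^sub>0 int) \<Rightarrow> ('b \<Rightarrow>\<^sub>0 'k::field)" where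
  "zk c = Poly_Mapping.map of_int c"

lemma lookup_zk: "Poly_Mapping.lookup (zk c) x = of_int (Poly_Mapping.lookup c x)"
  by (simp add: zk_def Poly_Mapping.map.rep_eq when_def)

lemma zk_0 [simp]: "zk 0 = 0"
  by (rule poly_mapping_eqI) (simp add: lookup_zk)

lemma zk_add: "zk (a + b) = zk a + zk b"
  by (rule poly_mapping_eqI) (simp add: lookup_zk lookup_add)

lemma zk_diff: "zk (a - b) = zk a - zk b"
  by (rule poly_mapping_eqI) (simp add: lookup_zk lookup_minus)

lemma zk_of [simp]: "zk (frag_of f) = Poly_Mapping.single f 1"
  by (rule poly_mapping_eqI) (simp add: lookup_zk lookup_single when_def)

lemma zk_cmul: "zk (frag_cmul a c) = pm_scale (of_int a) (zk c)"
  by (rule poly_mapping_eqI) (simp add: lookup_zk lookup_pm_scale)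

lemma zk_sum: "zk (sum g A) = (\<Sum>i\<in>A. zk (g i))"
  by (induction A rule: infinite_finite_induct) (auto simp: zk_add)

lemma pm_ext_diff: "pm_ext h (a - b) = pm_ext h a - pm_ext h b"
  using pm_ext_add[of h "a - b" b] by simp

lemma zk_extend: "zk (frag_extend g c) = pm_ext (\<lambda>f. zk (g f)) (zk c)"
  using subset_UNIV[of "Poly_Mapping.keys c"]
  by (induction c rule: frag_induction) (auto simp: frag_extend_diff zk_diff pm_ext_diff)

lemma keys_zk: "Poly_Mapping.keys (zk c) \<subseteq> Poly_Mapping.keys c"
  by (auto simp: in_keys_iff lookup_zk)

lemma zk_chains: "singular_chain n X c \<Longrightarrow> zk c \<in> sing_chains n X"
  using keys_zk[of c] by (auto simp: sing_chains_def singular_chain_def)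

lemma zk_boundary: "zk (chain_boundary n c) = sing_bd n (zk c)"
proof (cases "n = 0")
  case False
  then show ?thesis
    by (simp add: chain_boundary_def zk_extend sing_bd_ext zk_sum zk_cmul pm_scale_single)
qed (simp add: chain_boundary_def sing_bd_def)

lemma zk_chain_map: "zk (chain_map n g c) = sing_push n g (zk c)"
  by (simp add: chain_map_def zk_extend sing_push_ext)

lemma sing_bd_single: "sing_bd n (Poly_Mapping.single f 1) = zk (chain_boundary n (frag_of f))"
  by (simp add: zk_boundary)

lemma sing_chains_single: "f \<in> Poly_Mapping.keys c \<Longrightarrow> c \<in> sing_chains n X \<Longrightarrow> singular_simplex n X f"
  by (simp add: sing_chains_def)

lemma linear_eq_on_chains:
  assumes c: "c \<in> sing_chains n X"
    and F: "F 0 = 0" "\<And>a b. F (a + b) = F a + F b" "\<And>a b. F (pm_scale a b) = pm_scale a (F b)"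
    and G: "G 0 = 0" "\<And>a b. G (a + b) = G a + G b" "\<And>a b. G (pm_scale a b) = pm_scale a (G b)"
    and eq: "\<And>f. singular_simplex n X f \<Longrightarrow> F (Poly_Mapping.single f 1) = G (Poly_Mapping.single f 1)"
  shows "F c = G c"
proof (rule pm_induct[of "\<lambda>c. F c = G c" c])
  fix f a assume "f \<in> Poly_Mapping.keys c"
  then have "singular_simplex n X f" using c by (rule sing_chains_single)
  then have "F (pm_scale a (Poly_Mapping.single f 1)) = G (pm_scale a (Poly_Mapping.single f 1))"
    by (simp only: F G eq)
  then show "F (Poly_Mapping.single f a) = G (Poly_Mapping.single f a)"
    by (simp add: pm_scale_single)
qed (simp_all add: F G)

lemma sing_bd_chains:
  assumes "c \<in> sing_chains (Suc n) X" shows "sing_bd (Suc n) c \<in> sing_chains n X"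
proof -
  have gen: "sing_bd (Suc n) (Poly_Mapping.single f a) \<in> sing_chains n X"
    if "f \<in> Poly_Mapping.keys c" for f a
  proof -
    have "singular_chain (Suc n) X (frag_of f)"
      using sing_chains_single[OF that assms] by (simp add: singular_chain_of)
    then have "pm_scale a (sing_bd (Suc n) (Poly_Mapping.single f 1)) \<in> sing_chains n X"
      using zk_chains[OF singular_chain_boundary_alt]
      by (auto simp: sing_bd_single intro: pm.subspace_scale[OF sing_chains_subspace])
    then show ?thesis
      by (simp add: pm_scale_single flip: sing_bd_scale)
  qed
  show ?thesis
    by (rule pm_induct[of "\<lambda>c. sing_bd (Suc n) c \<in> sing_chains n X"])
      (auto simp: sing_bd_add pm.subspace_0[OF sing_chains_subspace] intro: gen
        pm.subspace_add[OF sing_chains_subspace])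
qed

lemma sing_bd_bd:
  assumes "c \<in> sing_chains (Suc (Suc n)) X" shows "sing_bd (Suc n) (sing_bd (Suc (Suc n)) c) = 0"
proof -
  have "sing_bd (Suc n) (sing_bd (Suc (Suc n)) c) = (\<lambda>c. 0) c"
  proof (rule linear_eq_on_chains[OF assms])
    fix f assume "singular_simplex (Suc (Suc n)) X f"
    then show "sing_bd (Suc n) (sing_bd (Suc (Suc n)) (Poly_Mapping.single f 1)) = 0"
      using chain_boundary_boundary[of "Suc (Suc n)" X "frag_of f"]
      by (simp add: sing_bd_single singular_chain_of flip: zk_boundary)
  qed (simp_all add: sing_bd_add sing_bd_scale)
  then show ?thesis by simp
qed

lemma sing_bd_diff: "sing_bd n (a - b) = sing_bd n a - sing_bd n b"
  using sing_bd_add[of n "a - b" b] by simp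
lemma sing_bd_uminus: "sing_bd n (- a) = - sing_bd n a"
  using sing_bd_diff[of n 0 a] by simp
lemma sing_push_0 [simp]: "sing_push n g 0 = 0"
  by (simp add: sing_push_def)
lemma sing_push_diff: "sing_push n g (a - b) = sing_push n g a - sing_push n g b"
  using sing_push_add[of n g "a - b" b] by simp
lemma sing_push_uminus: "sing_push n g (- a) = - sing_push n g a"
  using sing_push_diff[of n g 0 a] by simp

lemma sing_push_cong:
  assumes "c \<in> sing_chains n X" "\<And>x. x \<in> topspace X \<Longrightarrow> g x = h x"
  shows "sing_push n g c = sing_push n h c"
proof (rule linear_eq_on_chains[OF assms(1)])
  fix f assume "singular_simplex n X f"
  then show "sing_push n g (Poly_Mapping.single f 1) = sing_push n h (Poly_Mapping.single f 1)"
    using simplex_map_eq[of n X f g h] assms(2) by (simp add: sing_push_ext)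
qed (simp_all add: sing_push_add sing_push_scale)

lemma sing_push_ident:
  assumes "c \<in> sing_chains n X" "\<And>x. x \<in> topspace X \<Longrightarrow> g x = x"
  shows "sing_push n g c = c"
  using sing_push_cong[OF assms(1), of g id] sing_push_id[OF assms(1)] assms(2) by simp

lemma sing_push_bd':
  assumes "c \<in> sing_chains n X"
  shows "sing_bd n (sing_push n g c) = sing_push (n - 1) g (sing_bd n c)"
  using sing_push_bd[of c "n - 1" X g] assms by (cases n) (auto simp: sing_bd_def)

section \<open>Acyclic models\<close>

text \<open>The identity is homotopic to a constant map, so the cycle is homologous to one carried
  by a single point, where cycles of positive degree bound.\<close>

lemma contractible_cycle_boundary:
  assumes X: "contractible_space X" and n: "0 < n"
    and c: "singular_chain n X c" "chain_boundary n c = 0"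
  shows "\<exists>d. singular_chain (Suc n) X d \<and> chain_boundary (Suc n) d = c"
proof (cases "topspace X = {}")
  \<comment> \<open>The empty space is contractible by definition but offers no base point.\<close>
  case True
  then show ?thesis using c by (intro exI[of _ 0]) (simp add: singular_chain_empty)
next
  case False
  obtain a where hom: "homotopic_with (\<lambda>x. True) X X id (\<lambda>x. a)"
    using X by (auto simp: contractible_space_def)
  from homotopic_with_imp_continuous_maps[OF hom] False have a: "a \<in> topspace X"
    by (auto simp: continuous_map_def)
  have hom': "homotopic_with (\<lambda>h. h \<in> {} \<rightarrow> {}) X X id (\<lambda>x. a)"
    using hom by (rule homotopic_with_mono) auto
  have cyc: "singular_relcycle n X {} c" using c by (simp add: singular_cycle)
  have 1: "singular_relboundary n X {} (c - chain_map n (\<lambda>x. a) c)"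
    using homotopic_imp_homologous_rel_chain_maps[OF hom' cyc] chain_map_ident[OF c(1)]
    by (simp add: homologous_rel_def)
  have "continuous_map X (subtopology X {a}) (\<lambda>x. a)"
    using a by (auto simp: continuous_map_in_subtopology)
  then have "singular_relcycle n (subtopology X {a}) {} (chain_map n (\<lambda>x. a) c)"
    by (intro singular_relcycle_chain_map[OF cyc]) auto
  then have "singular_relboundary n (subtopology X {a}) {} (chain_map n (\<lambda>x. a) c)"
    using singular_boundary_eq_cycle_singleton[of "subtopology X {a}" a n] a n by auto
  then have 2: "singular_relboundary n X {} (chain_map n (\<lambda>x. a) c)"
    by (metis singular_boundary_mono subtopology_topspace a empty_subsetI insert_subset)
  from singular_relboundary_add[OF 1 2] show ?thesis by (simp add: singular_boundary)
qed

text \<open>The fundamental simplex; restricted because singular simplices are extensional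
  functions.\<close>

definition idsimp :: "nat \<Rightarrow> (nat \<Rightarrow> real) \<Rightarrow> (nat \<Rightarrow> real)" where
  "idsimp n = restrict id (standard_simplex n)"

text \<open>The models are \<open>\<Delta>\<^sup>n \<times> [0, 1]\<close>. A chain on a model is an operator on singular chains natural in
  homotopies, and an identity between such operators needs to be checked on the models only.\<close>

definition model :: "nat \<Rightarrow> ((nat \<Rightarrow> real) \<times> real) topology" where
  "model n = prod_topology (subtopology (powertop_real UNIV) (standard_simplex n)) (top_of_set {0..1})"

lemma topspace_model: "topspace (model n) = standard_simplex n \<times> {0..1}"
  by (simp add: model_def)

text \<open>Convexity: straight lines contract the simplex to the vertex \<open>?e\<close>.\<close>

lemma contractible_standard_simplex:
  "contractible_space (subtopology (powertop_real UNIV) (standard_simplex n))" (is "contractible_space ?X")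
proof -
  let ?e = "\<lambda>j::nat. if j = 0 then 1 else 0 :: real"
  define h where "h = (\<lambda>(u, x) i. (1 - u) * x i + u * ?e i)"
  have e: "?e \<in> standard_simplex n" by simp
  have "continuous_map (prod_topology (top_of_set {0..1}) ?X) ?X h"
  proof -
    have f: "continuous_map (prod_topology (top_of_set {0..1}) ?X) euclideanreal fst"
      using continuous_map_fst continuous_map_into_fulltopology by blast
    have g: "continuous_map (prod_topology (top_of_set {0..1}) ?X) euclideanreal (\<lambda>z. snd z i)" for i
      using continuous_map_compose[OF continuous_map_snd continuous_map_from_subtopology[OF continuous_map_product_projection[of i UNIV "\<lambda>_. euclideanreal"]]]
      by (auto simp: o_def)
    have "continuous_map (prod_topology (top_of_set {0..1}) ?X) (powertop_real UNIV) h"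
      unfolding continuous_map_componentwise h_def case_prod_unfold
      by (auto intro!: continuous_intros f g)
    moreover have "h \<in> topspace (prod_topology (top_of_set {0..1}) ?X) \<rightarrow> standard_simplex n"
      using convex_standard_simplex[OF _ e] by (auto simp: h_def)
    ultimately show ?thesis by (simp add: continuous_map_in_subtopology)
  qed
  then have "homotopic_with (\<lambda>x. True) ?X ?X id (\<lambda>x. ?e)"
    unfolding homotopic_with_def by (intro exI[of _ h]) (auto simp: h_def)
  then show ?thesis unfolding contractible_space_def by blast
qed

lemma contractible_model: "contractible_space (model n)"
  unfolding model_def contractible_space_prod_topology
  using contractible_standard_simplex convex_imp_contractible[of "{0..1::real}"] by auto

text \<open>The natural operator represented, in the sense of Yoneda, by the chain \<open>w\<close>
  on a model; its values live in the cylinder over the space.\<close>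

definition zop :: "nat \<Rightarrow> (((nat \<Rightarrow> real) \<times> real) chain) \<Rightarrow> 'a chain \<Rightarrow> ('a \<times> real) chain" where
  "zop d w c = frag_extend (\<lambda>f. chain_map d (map_prod f id) w) c"

lemma zop_0 [simp]: "zop d w 0 = 0" "zop d 0 c = 0"
  by (simp_all add: zop_def frag_extend_eq_0)

lemma zop_diff: "zop d w (a - b) = zop d w a - zop d w b"
  by (simp add: zop_def frag_extend_diff)

lemma zop_of [simp]: "zop d w (frag_of f) = chain_map d (map_prod f id) w"
  by (simp add: zop_def)

lemma zop_diff_left: "zop d (w - w') c = zop d w c - zop d w' c"
  using subset_UNIV[of "Poly_Mapping.keys c"]
  by (induction c rule: frag_induction) (auto simp: zop_diff chain_map_diff)

lemma continuous_map_cyl: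
  assumes "singular_simplex n X f"
  shows "continuous_map (model n) (prod_topology X (top_of_set {0..1})) (map_prod f id)"
proof -
  have "continuous_map (model n) (prod_topology X (top_of_set {0..1})) (\<lambda>(x, y). (f x, id y))"
    unfolding model_def continuous_map_prod_top using assms by (simp add: singular_simplex_def)
  then show ?thesis by (simp add: map_prod_def)
qed

lemma zop_chain:
  assumes "singular_chain d (model n) w" "singular_chain n X c"
  shows "singular_chain d (prod_topology X (top_of_set {0..1})) (zop d w c)"
  unfolding zop_def using assms
  by (intro singular_chain_extend singular_chain_chain_map[OF assms(1)] continuous_map_cyl)
    (auto simp: singular_chain_def)

lemma zop_boundary:
  assumes "singular_chain d X w"
  shows "chain_boundary d (zop d w c) = zop (d - 1) (chain_boundary d w) c"
  using subset_UNIV[of "Poly_Mapping.keys c"]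
  by (induction c rule: frag_induction)
    (auto simp: zop_diff chain_boundary_diff chain_boundary_chain_map[OF assms])

lemma zop_natural:
  assumes w: "singular_chain d (model n) w" and b: "singular_chain n X b"
  shows "chain_map d (map_prod g id) (zop d w b) = zop d w (chain_map n g b)"
  using b unfolding singular_chain_def
proof (induction b rule: frag_induction)
  case (one f)
  have "chain_map d (map_prod g id) (chain_map d (map_prod f id) w) = chain_map d (map_prod g id \<circ> map_prod f id) w"
    by (simp add: chain_map_compose)
  also have "\<dots> = chain_map d (map_prod (simplex_map n g f) id) w"
    by (rule chain_map_eq[OF w]) (auto simp: topspace_model simplex_map_def)
  finally show ?case by (simp only: zop_of chain_map_of)
qed (auto simp: chain_map_diff zop_diff)

lemma chain_map_idsimp:
  assumes "singular_simplex n X f" shows "chain_map n f (frag_of (idsimp n)) = frag_of f"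
  unfolding idsimp_def by (rule singular_simplex_chain_map_id[OF assms])

lemma singular_idsimp: "singular_simplex n (subtopology (powertop_real UNIV) (standard_simplex n)) (idsimp n)"
  unfolding singular_simplex_def idsimp_def by (auto simp: id_def)

text \<open>By naturality an operator is known once it is known on \<open>idsimp\<close>: the value
  on the boundary of the fundamental simplex represents the operator precomposed with the
  boundary.\<close>

lemma zop_zop:
  assumes w: "singular_chain d (model n) w" and b: "singular_chain (Suc n) X b"
  shows "zop d (zop d w (chain_boundary (Suc n) (frag_of (idsimp (Suc n))))) b = zop d w (chain_boundary (Suc n) b)"
  using b unfolding singular_chain_def
proof (induction b rule: frag_induction)
  case (one f)
  let ?i = "frag_of (idsimp (Suc n))"
  have i: "singular_chain (Suc n) (subtopology (powertop_real UNIV) (standard_simplex (Suc n))) ?i"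
    using singular_idsimp by (simp add: singular_chain_of)
  have "chain_map d (map_prod f id) (zop d w (chain_boundary (Suc n) ?i))
      = zop d w (chain_map n f (chain_boundary (Suc n) ?i))"
    by (rule zop_natural[OF w singular_chain_boundary_alt[OF i]])
  also have "\<dots> = zop d w (chain_boundary (Suc n) (frag_of f))"
    using chain_boundary_chain_map[OF i, of f] chain_map_idsimp[of "Suc n" X f] one by simp
  finally show ?case by simp
qed (auto simp: zop_diff chain_boundary_diff)

text \<open>\<open>u\<close> is a natural chain map given by its values on fundamental simplices,
  and \<open>p\<close> is a null-homotopy. It is built degree by degree: \<open>u\<close> minus the
  homotopy already built, applied to the boundary, is a cycle on a contractible model. Degree 0 is
  prescribed because there a cycle need not bound. At \<open>n = 0\<close> the index
  \<open>n - 1\<close> is harmless, as the boundary of a 0-chain is 0.\<close>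

lemma acyclic_models:
  assumes u: "\<And>n. singular_chain n (model n) (u n)"
    and ub: "\<And>n. chain_boundary (Suc n) (u (Suc n)) = zop n (u n) (chain_boundary (Suc n) (frag_of (idsimp (Suc n))))"
    and p0: "singular_chain 1 (model 0) p0" "chain_boundary 1 p0 = u 0"
  shows "\<exists>p. \<forall>n. singular_chain (Suc n) (model n) (p n) \<and>
     chain_boundary (Suc n) (p n) = u n - zop n (p (n - 1)) (chain_boundary n (frag_of (idsimp n)))"
proof -
  let ?i = "\<lambda>n. frag_of (idsimp n)"
  \<comment> \<open>The middle conjunct says that the right-hand side in the next degree will be a
    cycle; this is what lets the choice continue.\<close>
  define P where "P n p \<longleftrightarrow> singular_chain (Suc n) (model n) p \<and>
      zop n (u n - chain_boundary (Suc n) p) (chain_boundary (Suc n) (?i (Suc n))) = 0 \<and>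
      (n = 0 \<longrightarrow> chain_boundary (Suc n) p = u n)" for n p
  define Q where "Q n p q \<longleftrightarrow>
      chain_boundary (Suc (Suc n)) q = u (Suc n) - zop (Suc n) p (chain_boundary (Suc n) (?i (Suc n)))" for n p q
  have "\<exists>f. \<forall>n. P n (f n) \<and> Q n (f n) (f (Suc n))"
  proof (rule dependent_nat_choice)
    show "\<exists>p. P 0 p" using p0 by (intro exI[of _ p0]) (simp add: P_def)
  next
    fix n p assume P: "P n p"
    let ?X = "\<lambda>n. subtopology (powertop_real UNIV) (standard_simplex n)"
    let ?r = "u (Suc n) - zop (Suc n) p (chain_boundary (Suc n) (?i (Suc n)))"
    have i: "singular_chain n (?X n) (?i n)" for n
      using singular_idsimp by (simp add: singular_chain_of)
    have pc: "singular_chain (Suc n) (model n) p" using P by (simp add: P_def)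
    have "singular_chain (Suc n) (model (Suc n)) (zop (Suc n) p (chain_boundary (Suc n) (?i (Suc n))))"
      using zop_chain[OF pc singular_chain_boundary_alt, OF i] by (simp add: model_def)
    then have r: "singular_chain (Suc n) (model (Suc n)) ?r"
      by (intro singular_chain_diff u)
    have "chain_boundary (Suc n) ?r = zop n (u n) (chain_boundary (Suc n) (?i (Suc n)))
        - zop n (chain_boundary (Suc n) p) (chain_boundary (Suc n) (?i (Suc n)))"
      using zop_boundary[OF pc] by (simp add: chain_boundary_diff ub)
    also have "\<dots> = 0" using P by (simp add: P_def zop_diff_left)
    finally obtain q where q: "singular_chain (Suc (Suc n)) (model (Suc n)) q" "chain_boundary (Suc (Suc n)) q = ?r"
      using contractible_cycle_boundary[OF contractible_model _ r] by auto
    \<comment> \<open>The invariant for the next degree: what is left after \<open>q\<close> is the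
      operator of \<open>p\<close> on a boundary, and the boundary of a boundary is 0.\<close>
    have "zop (Suc n) (u (Suc n) - ?r) (chain_boundary (Suc (Suc n)) (?i (Suc (Suc n))))
       = zop (Suc n) p (chain_boundary (Suc n) (chain_boundary (Suc (Suc n)) (?i (Suc (Suc n)))))"
      using zop_zop[OF pc singular_chain_boundary_alt, OF i] by simp
    also have "\<dots> = 0"
      using chain_boundary_boundary_alt[OF i] by simp
    finally have "P (Suc n) q" using q by (simp add: P_def)
    with q(2) show "\<exists>q. P (Suc n) q \<and> Q n p q" by (auto simp: Q_def)
  qed
  then obtain p where p: "\<And>n. P n (p n)" "\<And>n. Q n (p n) (p (Suc n))" by blast
  have "chain_boundary (Suc n) (p n) = u n - zop n (p (n - 1)) (chain_boundary n (?i n))" for n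
    using p(1)[of 0] p(2)[of "n - 1"] by (cases n) (simp_all add: P_def Q_def chain_boundary_def[of 0])
  with p(1) show ?thesis by (intro exI[of _ p]) (simp add: P_def)
qed

section \<open>Natural operators on singular chains\<close>

text \<open>The operator of a chain on a model followed by a map \<open>H\<close> out of the
  cylinder. With \<open>H\<close> as an argument one definition serves both prisms and, with
  \<open>fst\<close>, subdivision.\<close>

definition kop :: "nat \<Rightarrow> ((nat \<Rightarrow> real) \<times> real, 'k::field) sing_chain \<Rightarrow> ('a \<times> real \<Rightarrow> 'b)
    \<Rightarrow> ('a, 'k) sing_chain \<Rightarrow> ('b, 'k) sing_chain" where
  "kop d w H c = pm_ext (\<lambda>f. sing_push d (\<lambda>(x, s). H (f x, s)) w) c"

lemma kop_0 [simp]: "kop d w H 0 = 0"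
  by (simp add: kop_def)
lemma kop_add: "kop d w H (a + b) = kop d w H a + kop d w H b"
  by (simp add: kop_def pm_ext_add)
lemma kop_diff: "kop d w H (a - b) = kop d w H a - kop d w H b"
  by (simp add: kop_def pm_ext_diff)
lemma kop_scale: "kop d w H (pm_scale a b) = pm_scale a (kop d w H b)"
  by (simp add: kop_def pm_ext_scale)
lemma kop_sum: "kop d w H (sum g A) = (\<Sum>i\<in>A. kop d w H (g i))"
  by (simp add: kop_def pm_ext_sum)
lemma kop_single: "kop d w H (Poly_Mapping.single f 1) = sing_push d (\<lambda>(x, s). H (f x, s)) w"
  by (simp add: kop_def)
lemma kop_diff_left: "kop d (w - w') H c = kop d w H c - kop d w' H c"
  by (simp add: kop_def sing_push_diff pm_ext_def pm.scale_right_diff_distrib sum_subtractf)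

lemma kop_chains:
  assumes w: "w \<in> sing_chains d (model n)" and c: "c \<in> sing_chains n X"
    and H: "continuous_map (prod_topology X (top_of_set {0..1})) Y H"
  shows "kop d w H c \<in> sing_chains d Y"
  unfolding kop_def pm_ext_def
proof (intro pm.subspace_sum pm.subspace_scale sing_chains_subspace sing_push_chains[OF w])
  fix f assume "f \<in> Poly_Mapping.keys c"
  then have "singular_simplex n X f" using c by (rule sing_chains_single)
  from continuous_map_compose[OF continuous_map_cyl[OF this] H]
  show "continuous_map (model n) Y (\<lambda>(x, s). H (f x, s))"
    by (simp add: o_def map_prod_def case_prod_unfold)
qed

lemma sing_push_kop: "sing_push d g (kop d w H c) = kop d w (g \<circ> H) c"
  by (simp add: kop_def pm_ext_def sing_push_sum sing_push_scale sing_push_comp o_def case_prod_unfold)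

lemma kop_push:
  assumes w: "w \<in> sing_chains d (model n)"
  shows "kop d w H (sing_push n g c) = kop d w (\<lambda>(x, s). H (g x, s)) c"
proof (induction rule: pm_induct[of _ c])
  case (3 f a)
  have "sing_push d (\<lambda>(x, s). H (simplex_map n g f x, s)) w = sing_push d (\<lambda>(x, s). H (g (f x), s)) w"
    by (rule sing_push_cong[OF w]) (auto simp: topspace_model simplex_map_def)
  then show ?case by (simp add: sing_push_ext[of n] pm_scale_single) (simp add: kop_def case_prod_unfold)
qed (simp_all add: kop_add sing_push_add)

lemma zk_zop: "zk (zop d w b) = kop d (zk w) id (zk b)"
  by (simp add: zop_def zk_extend kop_def zk_chain_map map_prod_def)

lemma kop_idsimp:
  assumes "singular_simplex n X f"
  shows "sing_push n f (Poly_Mapping.single (idsimp n) 1) = Poly_Mapping.single f 1"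
  using arg_cong[OF chain_map_idsimp[OF assms], of zk] by (simp only: zk_chain_map zk_of)

text \<open>A boundary formula on the fundamental simplex spreads to every singular simplex by
  naturality and to chains by linearity.\<close>

lemma kop_boundary:
  assumes w: "w \<in> sing_chains (Suc d) (model n)" and v: "v \<in> sing_chains d (model n)"
    and w': "w' \<in> sing_chains d (model (n - 1))"
    and bd: "sing_bd (Suc d) w = v - kop d w' id (sing_bd n (Poly_Mapping.single (idsimp n) 1))"
    and c: "c \<in> sing_chains n X"
  shows "sing_bd (Suc d) (kop (Suc d) w H c) = kop d v H c - kop d w' H (sing_bd n c)"
proof (rule linear_eq_on_chains[OF c])
  fix f assume f: "singular_simplex n X f"
  let ?i = "Poly_Mapping.single (idsimp n) 1"
  let ?h = "\<lambda>(x, s). H (f x, s)"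
  have i: "?i \<in> sing_chains n (subtopology (powertop_real UNIV) (standard_simplex n))"
    using singular_idsimp by (simp add: sing_chains_def)
  have "sing_bd (Suc d) (kop (Suc d) w H (Poly_Mapping.single f 1)) = sing_push d ?h (sing_bd (Suc d) w)"
    unfolding kop_single by (rule sing_push_bd[OF w])
  also have "\<dots> = sing_push d ?h v - kop d w' ?h (sing_bd n ?i)"
    by (simp add: bd sing_push_diff sing_push_kop)
  also have "kop d w' ?h (sing_bd n ?i) = kop d w' H (sing_push (n - 1) f (sing_bd n ?i))"
    by (rule kop_push[OF w', symmetric])
  also have "sing_push (n - 1) f (sing_bd n ?i) = sing_bd n (Poly_Mapping.single f 1)"
    using sing_push_bd'[OF i, of f, symmetric] by (simp only: kop_idsimp[OF f])
  finally show "sing_bd (Suc d) (kop (Suc d) w H (Poly_Mapping.single f 1))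
      = kop d v H (Poly_Mapping.single f 1) - kop d w' H (sing_bd n (Poly_Mapping.single f 1))"
    by (simp only: kop_single)
qed (simp_all add: kop_add sing_bd_add kop_scale sing_bd_scale pm.scale_right_diff_distrib)

text \<open>Two families of chains on the model simplices are compared by pushing them to the two ends of
  the cylinder.\<close>

lemma model_homotopy:
  assumes \<tau>: "\<And>n. singular_chain n (subtopology (powertop_real UNIV) (standard_simplex n)) (\<tau> n)"
    and \<tau>b: "\<And>n. chain_boundary (Suc n) (\<tau> (Suc n)) =
       frag_extend (\<lambda>f. chain_map n f (\<tau> n)) (chain_boundary (Suc n) (frag_of (idsimp (Suc n))))"
    and a: "a \<in> {0..1}"
  defines "e \<equiv> \<lambda>n. chain_map n (\<lambda>x. (x, a)) (\<tau> n)"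
  shows "singular_chain n (model n) (e n)"
    and "chain_boundary (Suc n) (e (Suc n)) = zop n (e n) (chain_boundary (Suc n) (frag_of (idsimp (Suc n))))"
    and "kop n (zk (e n)) H c = pm_ext (\<lambda>f. sing_push n (\<lambda>x. H (f x, a)) (zk (\<tau> n))) c"
proof -
  have "continuous_map (subtopology (powertop_real UNIV) (standard_simplex n)) (model n) (\<lambda>x. (x, a))" for n
    using a by (auto simp: model_def continuous_map_pairwise o_def)
  then show "singular_chain n (model n) (e n)"
    unfolding e_def by (rule singular_chain_chain_map[OF \<tau>])
  have *: "chain_map n (\<lambda>x. (x, a)) (frag_extend (\<lambda>f. chain_map n f (\<tau> n)) b) = zop n (e n) b" for b :: "(nat \<Rightarrow> real) chain"
    using subset_UNIV[of "Poly_Mapping.keys b"]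
  proof (induction b rule: frag_induction)
    case (one f)
    have "(\<lambda>x. (x, a)) \<circ> f = map_prod f id \<circ> (\<lambda>x. (x, a))" by auto
    then have "chain_map n (\<lambda>x. (x, a)) (chain_map n f (\<tau> n)) = chain_map n (map_prod f id) (e n)"
      unfolding e_def by (metis chain_map_compose comp_apply)
    then show ?case by (simp only: zop_of frag_extend_of)
  qed (auto simp: zop_diff frag_extend_diff chain_map_diff)
  show "chain_boundary (Suc n) (e (Suc n)) = zop n (e n) (chain_boundary (Suc n) (frag_of (idsimp (Suc n))))"
    using chain_boundary_chain_map[OF \<tau>, of "Suc n" "\<lambda>x. (x, a)"] by (simp add: e_def \<tau>b * del: chain_map_of)
  show "kop n (zk (e n)) H c = pm_ext (\<lambda>f. sing_push n (\<lambda>x. H (f x, a)) (zk (\<tau> n))) c"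
    by (simp add: kop_def e_def zk_chain_map sing_push_comp o_def)
qed

section \<open>Prism and subdivision chains on the models\<close>

definition prism_model :: "nat \<Rightarrow> ((nat \<Rightarrow> real) \<times> real) chain" where
  "prism_model = (SOME p. \<forall>n. singular_chain (Suc n) (model n) (p n) \<and>
     chain_boundary (Suc n) (p n) =
       chain_map n (\<lambda>x. (x, 1)) (frag_of (idsimp n)) - chain_map n (\<lambda>x. (x, 0)) (frag_of (idsimp n))
       - zop n (p (n - 1)) (chain_boundary n (frag_of (idsimp n))))"

definition subd_chain :: "nat \<Rightarrow> nat \<Rightarrow> (nat \<Rightarrow> real) chain" where
  "subd_chain N n = (singular_subdivision n ^^ N) (frag_of (idsimp n))"

text \<open>The interval is a dummy here: both families sit at time 0 and \<open>fst\<close> later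
  removes it, so the homotopy from the identity to subdivision reuses the cylinder models.\<close>

definition subd_model :: "nat \<Rightarrow> nat \<Rightarrow> ((nat \<Rightarrow> real) \<times> real) chain" where
  "subd_model N = (SOME p. \<forall>n. singular_chain (Suc n) (model n) (p n) \<and>
     chain_boundary (Suc n) (p n) =
       chain_map n (\<lambda>x. (x, 0)) (subd_chain N n) - chain_map n (\<lambda>x. (x, 0)) (frag_of (idsimp n))
       - zop n (p (n - 1)) (chain_boundary n (frag_of (idsimp n))))"

lemma idsimp_chain:
  "singular_chain n (subtopology (powertop_real UNIV) (standard_simplex n)) (frag_of (idsimp n))"
  using singular_idsimp by (simp add: singular_chain_of)

lemma idsimp_extend:
  assumes "singular_chain n X b" shows "frag_extend (\<lambda>f. chain_map n f (frag_of (idsimp n))) b = b"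
  using assms unfolding singular_chain_def
proof (induction b rule: frag_induction)
  case (one f)
  then show ?case using chain_map_idsimp[of n X f] by (simp only: frag_extend_of mem_Collect_eq)
qed (auto simp: frag_extend_diff)

lemma subd_iter_chain:
  "singular_chain n X c \<Longrightarrow> singular_chain n X ((singular_subdivision n ^^ N) c)"
  by (induction N) (auto intro: singular_chain_singular_subdivision)

lemma subd_iter_natural:
  "singular_chain n X c \<Longrightarrow> (singular_subdivision n ^^ N) (chain_map n g c) = chain_map n g ((singular_subdivision n ^^ N) c)"
  by (induction N) (auto simp: naturality_singular_subdivision[OF subd_iter_chain])

lemma subd_iter_boundary:
  "singular_chain n X c \<Longrightarrow> chain_boundary n ((singular_subdivision n ^^ N) c) = (singular_subdivision (n - 1) ^^ N) (chain_boundary n c)"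
  by (induction N) (auto simp: chain_boundary_singular_subdivision[OF subd_iter_chain])

lemma subd_chain_of:
  assumes "singular_simplex n X f"
  shows "chain_map n f (subd_chain N n) = (singular_subdivision n ^^ N) (frag_of f)"
  unfolding subd_chain_def
  using subd_iter_natural[OF idsimp_chain, of N n f] chain_map_idsimp[OF assms] by simp

lemma subd_extend:
  assumes "singular_chain n X b"
  shows "frag_extend (\<lambda>f. chain_map n f (subd_chain N n)) b = (singular_subdivision n ^^ N) b"
  using assms unfolding singular_chain_def
proof (induction b rule: frag_induction)
  case (one f)
  then show ?case using subd_chain_of[of n X f N] by (simp only: frag_extend_of mem_Collect_eq)
qed (auto simp: frag_extend_diff singular_subdivision_power_diff)

lemma subd_chain_boundary:
  "chain_boundary (Suc n) (subd_chain N (Suc n)) =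
     frag_extend (\<lambda>f. chain_map n f (subd_chain N n)) (chain_boundary (Suc n) (frag_of (idsimp (Suc n))))"
  using subd_extend[OF singular_chain_boundary_alt[OF idsimp_chain], of n N]
    subd_iter_boundary[OF idsimp_chain, of "Suc n" N] by (simp add: subd_chain_def)

lemma subd_chain_chain:
  "singular_chain n (subtopology (powertop_real UNIV) (standard_simplex n)) (subd_chain N n)"
  unfolding subd_chain_def by (intro subd_iter_chain idsimp_chain)

lemma idsimp_boundary:
  "chain_boundary (Suc n) (frag_of (idsimp (Suc n))) =
     frag_extend (\<lambda>f. chain_map n f (frag_of (idsimp n))) (chain_boundary (Suc n) (frag_of (idsimp (Suc n))))"
  using idsimp_extend[OF singular_chain_boundary_alt[OF idsimp_chain], of n] by simp

text \<open>Contractibility settles the positive degrees. In degree 0 the two families are points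
  over the same vertex, joined by a segment of the cylinder.\<close>

lemma acyclic_models_diff:
  assumes \<tau>: "\<And>n. singular_chain n (subtopology (powertop_real UNIV) (standard_simplex n)) (\<tau> n)"
      "\<And>n. chain_boundary (Suc n) (\<tau> (Suc n)) =
       frag_extend (\<lambda>f. chain_map n f (\<tau> n)) (chain_boundary (Suc n) (frag_of (idsimp (Suc n))))"
      "\<tau> 0 = frag_of (idsimp 0)"
    and a: "a \<in> {0..1}"
  shows "\<exists>p. \<forall>n. singular_chain (Suc n) (model n) (p n) \<and>
     chain_boundary (Suc n) (p n) =
       chain_map n (\<lambda>x. (x, a)) (\<tau> n) - chain_map n (\<lambda>x. (x, 0)) (frag_of (idsimp n))
       - zop n (p (n - 1)) (chain_boundary n (frag_of (idsimp n)))"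
proof -
  have z: "(0::real) \<in> {0..1}" by simp
  note 1 = model_homotopy[OF \<tau>(1,2) a] and 2 = model_homotopy[OF idsimp_chain idsimp_boundary z]
  let ?X = "subtopology (powertop_real UNIV) (standard_simplex 1)"
  \<comment> \<open>The segment from time 0 to time \<open>a\<close> over the 0-simplex,
    parametrised by the barycentric coordinate \<open>x 1\<close>: face 0 of the 1-simplex is its
    end, face 1 its start.\<close>
  define g where "g x = ((\<lambda>j::nat. if j = 0 then 1 else 0 :: real), a * x 1)" for x :: "nat \<Rightarrow> real"
  let ?p0 = "chain_map 1 g (frag_of (idsimp 1))"
  have g: "continuous_map ?X (model 0) g"
  proof -
    have "continuous_map ?X euclideanreal (\<lambda>x. a * x 1)"
      using continuous_map_from_subtopology[OF continuous_map_product_projection[of 1 UNIV "\<lambda>_. euclideanreal"]]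
      by (intro continuous_intros) auto
    moreover have "a * x 1 \<in> {0..1}" if "x \<in> standard_simplex 1" for x
      using a that by (auto simp: standard_simplex_def mult_le_one)
    ultimately show ?thesis
      unfolding g_def model_def continuous_map_pairwise
      by (auto simp: o_def continuous_map_in_subtopology)
  qed
  have p0: "singular_chain 1 (model 0) ?p0"
    by (rule singular_chain_chain_map[OF idsimp_chain g])
  have sim: "simplex_map 0 h f = (\<lambda>x\<in>standard_simplex 0. h (f (\<lambda>j. if j = 0 then 1 else 0)))"
    for h :: "(nat \<Rightarrow> real) \<Rightarrow> (nat \<Rightarrow> real) \<times> real" and f
    unfolding simplex_map_def by (rule restrict_ext) (auto simp: standard_simplex_0)
  have "chain_boundary 1 ?p0 = chain_map 0 (\<lambda>x. (x, a)) (\<tau> 0) - chain_map 0 (\<lambda>x. (x, 0)) (frag_of (idsimp 0))"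
  proof -
    have "chain_boundary 1 ?p0 = frag_of (simplex_map 0 g (singular_face 1 0 (idsimp 1)))
       - frag_of (simplex_map 0 g (singular_face 1 1 (idsimp 1)))"
      using chain_boundary_chain_map[OF idsimp_chain, of 1 g]
      by (simp add: chain_boundary_of chain_map_diff)
    also have "simplex_map 0 g (singular_face 1 0 (idsimp 1)) = simplex_map 0 (\<lambda>x. (x, a)) (idsimp 0)"
      by (simp add: sim g_def singular_face_def idsimp_def simplical_face_in_standard_simplex)
         (simp add: simplical_face_def)
    also have "simplex_map 0 g (singular_face 1 1 (idsimp 1)) = simplex_map 0 (\<lambda>x. (x, 0)) (idsimp 0)"
      by (simp add: sim g_def singular_face_def idsimp_def simplical_face_in_standard_simplex)
         (simp add: simplical_face_def)
    finally show ?thesis unfolding \<tau>(3) chain_map_of .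
  qed
  then show ?thesis
    using acyclic_models[of "\<lambda>n. chain_map n (\<lambda>x. (x, a)) (\<tau> n) - chain_map n (\<lambda>x. (x, 0)) (frag_of (idsimp n))", OF _ _ p0]
      1(1,2) 2(1,2)
    by (simp add: chain_boundary_diff zop_diff_left singular_chain_diff del: chain_map_of)
qed

lemma prism_model:
  "singular_chain (Suc n) (model n) (prism_model n)"
  "chain_boundary (Suc n) (prism_model n) =
       chain_map n (\<lambda>x. (x, 1)) (frag_of (idsimp n)) - chain_map n (\<lambda>x. (x, 0)) (frag_of (idsimp n))
       - zop n (prism_model (n - 1)) (chain_boundary n (frag_of (idsimp n)))"
  using someI_ex[OF acyclic_models_diff[OF idsimp_chain idsimp_boundary HOL.refl, of 1], folded prism_model_def]
  by auto

lemma subd_model: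
  "singular_chain (Suc n) (model n) (subd_model N n)"
  "chain_boundary (Suc n) (subd_model N n) =
       chain_map n (\<lambda>x. (x, 0)) (subd_chain N n) - chain_map n (\<lambda>x. (x, 0)) (frag_of (idsimp n))
       - zop n (subd_model N (n - 1)) (chain_boundary n (frag_of (idsimp n)))"
proof -
  have "(singular_subdivision 0 ^^ N) (frag_of (idsimp 0)) = frag_of (idsimp 0)"
    by (induction N) (auto simp: singular_subdivision_zero[OF idsimp_chain])
  then have 0: "subd_chain N 0 = frag_of (idsimp 0)" by (simp add: subd_chain_def)
  show "singular_chain (Suc n) (model n) (subd_model N n)"
  "chain_boundary (Suc n) (subd_model N n) =
       chain_map n (\<lambda>x. (x, 0)) (subd_chain N n) - chain_map n (\<lambda>x. (x, 0)) (frag_of (idsimp n))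
       - zop n (subd_model N (n - 1)) (chain_boundary n (frag_of (idsimp n)))"
    using someI_ex[OF acyclic_models_diff[OF subd_chain_chain[of _ N] subd_chain_boundary[of _ N] 0, of 0], folded subd_model_def]
    by auto
qed

section \<open>Prism operator and iterated subdivision over a field\<close>

definition prism :: "nat \<Rightarrow> ('a \<times> real \<Rightarrow> 'b) \<Rightarrow> ('a, 'k::field) sing_chain \<Rightarrow> ('b, 'k) sing_chain" where
  "prism n = kop (Suc n) (zk (prism_model n))"

definition subd_htpy :: "nat \<Rightarrow> nat \<Rightarrow> ('a, 'k::field) sing_chain \<Rightarrow> ('a, 'k) sing_chain" where
  "subd_htpy N n = kop (Suc n) (zk (subd_model N n)) fst"

definition subdiv :: "nat \<Rightarrow> nat \<Rightarrow> ('a, 'k::field) sing_chain \<Rightarrow> ('a, 'k) sing_chain" where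
  "subdiv N n = pm_ext (\<lambda>f. zk ((singular_subdivision n ^^ N) (frag_of f)))"

lemma prism_linear:
  "prism n H 0 = 0" "prism n H (a + b) = prism n H a + prism n H b"
  "prism n H (pm_scale r a) = pm_scale r (prism n H a)" "prism n H (a - b) = prism n H a - prism n H b"
  "prism n H (- a) = - prism n H a"
  using kop_diff[of "Suc n" _ H 0 a] by (auto simp: prism_def kop_add kop_scale kop_diff)

lemma prism_model_sing: "zk (prism_model n) \<in> sing_chains (Suc n) (model n)"
  by (intro zk_chains prism_model)

lemma prism_chains_gen:
  assumes "c \<in> sing_chains n X" "continuous_map (prod_topology X (top_of_set {0..1})) Y H"
  shows "prism n H c \<in> sing_chains (Suc n) Y"
  unfolding prism_def by (rule kop_chains[OF prism_model_sing assms])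

lemma prism_chains:
  assumes "c \<in> sing_chains n (top_of_set A)" "continuous_on (A \<times> {0..1}) H" "H ` (A \<times> {0..1}) \<subseteq> B"
  shows "prism n H c \<in> sing_chains (Suc n) (top_of_set B)"
proof (rule prism_chains_gen[OF assms(1)])
  show "continuous_map (prod_topology (top_of_set A) (top_of_set {0..1})) (top_of_set B) H"
    using assms(2,3) by (auto simp: continuous_map_in_subtopology image_subset_iff_funcset simp flip: subtopology_Times)
qed

lemma prism_push: "sing_push (Suc n) g (prism n H c) = prism n (g \<circ> H) c"
  by (simp add: prism_def sing_push_kop)

lemma push_prism: "prism n H (sing_push n g c) = prism n (\<lambda>(x, s). H (g x, s)) c"
  by (simp add: prism_def kop_push[OF prism_model_sing])

lemma kop_end:
  assumes "c \<in> sing_chains n X"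
  shows "kop n (zk (chain_map n (\<lambda>x. (x, a)) (frag_of (idsimp n)))) H c = sing_push n (\<lambda>x. H (x, a)) c"
proof (rule linear_eq_on_chains[OF assms])
  fix f assume f: "singular_simplex n X f"
  have "sing_push n (\<lambda>x. H (f x, a)) (Poly_Mapping.single (idsimp n) 1)
    = sing_push n (\<lambda>x. H (x, a)) (sing_push n f (Poly_Mapping.single (idsimp n) 1))"
    by (simp add: sing_push_comp o_def)
  then show "kop n (zk (chain_map n (\<lambda>x. (x, a)) (frag_of (idsimp n)))) H (Poly_Mapping.single f 1)
      = sing_push n (\<lambda>x. H (x, a)) (Poly_Mapping.single f 1)"
    by (simp only: kop_single zk_chain_map zk_of sing_push_comp kop_idsimp[OF f]) (simp add: o_def)
qed (simp_all add: kop_add kop_scale sing_push_add sing_push_scale)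

text \<open>The minus sign of the last term is the one that \<open>sg\<close> has to match: crossing
  with one more circle negates the old part of the boundary.\<close>

lemma prism_bd:
  assumes c: "c \<in> sing_chains n X"
  shows "sing_bd (Suc n) (prism n H c) =
      sing_push n (\<lambda>x. H (x, 1)) c - sing_push n (\<lambda>x. H (x, 0)) c - prism (n - 1) H (sing_bd n c)"
proof -
  let ?e = "\<lambda>a::real. zk (chain_map n (\<lambda>x. (x, a)) (frag_of (idsimp n))) :: ((nat \<Rightarrow> real) \<times> real, 'b) sing_chain"
  have e: "?e a \<in> sing_chains n (model n)" if "a \<in> {0..1}" for a
    by (intro zk_chains model_homotopy(1)[OF idsimp_chain idsimp_boundary that])
  show ?thesis
  proof (cases n)
    case 0
    have "?e 1 - ?e 0 \<in> sing_chains n (model n)"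
      using e by (intro pm.subspace_diff[OF sing_chains_subspace]) auto
    from kop_boundary[OF prism_model_sing[of n] this pm.subspace_0[OF sing_chains_subspace] _ c, of H]
    show ?thesis
      by (simp add: 0 prism_def kop_diff_left zk_diff sing_bd_def[of 0] prism_model(2) kop_end[OF c[unfolded 0]] chain_boundary_def[of 0]
        del: chain_map_of flip: zk_boundary)
  next
    case (Suc m)
    have "?e 1 - ?e 0 \<in> sing_chains n (model n)"
      using e by (intro pm.subspace_diff[OF sing_chains_subspace]) auto
    moreover have "(zk (prism_model (n - 1)) :: ((nat \<Rightarrow> real) \<times> real, 'b) sing_chain) \<in> sing_chains n (model (n - 1))"
      using prism_model_sing[of m] Suc by simp
    moreover have "sing_bd (Suc n) (zk (prism_model n) :: (_, 'b) sing_chain) = ?e 1 - ?e 0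
       - kop n (zk (prism_model (n - 1))) id (sing_bd n (Poly_Mapping.single (idsimp n) 1))"
      by (simp add: prism_model(2) zk_diff zk_zop del: chain_map_of flip: zk_boundary) (simp add: zk_boundary)
    ultimately show ?thesis
      using kop_boundary[OF prism_model_sing[of n] _ _ _ c, of "?e 1 - ?e 0" "zk (prism_model (n - 1))" H]
      by (simp add: Suc prism_def kop_diff_left kop_end[OF c[unfolded Suc]] del: chain_map_of)
  qed
qed

lemma subd_htpy_linear:
  "subd_htpy N n 0 = 0" "subd_htpy N n (a + b) = subd_htpy N n a + subd_htpy N n b"
  "subd_htpy N n (pm_scale r a) = pm_scale r (subd_htpy N n a)" "subd_htpy N n (a - b) = subd_htpy N n a - subd_htpy N n b"
  by (auto simp: subd_htpy_def kop_add kop_scale kop_diff)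

lemma subd_model_sing: "zk (subd_model N n) \<in> sing_chains (Suc n) (model n)"
  by (intro zk_chains subd_model)

lemma subd_htpy_chains: "c \<in> sing_chains n X \<Longrightarrow> subd_htpy N n c \<in> sing_chains (Suc n) X"
  unfolding subd_htpy_def by (erule kop_chains[OF subd_model_sing]) (rule continuous_map_fst)

lemma subd_htpy_push: "subd_htpy N n (sing_push n g c) = sing_push (Suc n) g (subd_htpy N n c)"
  by (simp add: subd_htpy_def kop_push[OF subd_model_sing] sing_push_kop o_def case_prod_unfold)

lemma subdiv_linear:
  "subdiv N n 0 = 0" "subdiv N n (a + b) = subdiv N n a + subdiv N n b"
  "subdiv N n (pm_scale r a) = pm_scale r (subdiv N n a)" "subdiv N n (a - b) = subdiv N n a - subdiv N n b"
  by (auto simp: subdiv_def pm_ext_add pm_ext_scale pm_ext_diff)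

lemma subdiv_chains: "c \<in> sing_chains n X \<Longrightarrow> subdiv N n c \<in> sing_chains n X"
  unfolding subdiv_def pm_ext_def
  by (intro pm.subspace_sum pm.subspace_scale sing_chains_subspace zk_chains subd_iter_chain)
    (auto simp: singular_chain_of sing_chains_def)

lemma subd_htpy_bd:
  assumes c: "c \<in> sing_chains n X"
  shows "sing_bd (Suc n) (subd_htpy N n c) = subdiv N n c - c - subd_htpy N (n - 1) (sing_bd n c)"
proof -
  have z: "(0::real) \<in> {0..1}" by simp
  let ?e = "zk (chain_map n (\<lambda>x. (x, 0::real)) (frag_of (idsimp n))) :: ((nat \<Rightarrow> real) \<times> real, 'b) sing_chain"
  let ?s = "zk (chain_map n (\<lambda>x. (x, 0::real)) (subd_chain N n)) :: ((nat \<Rightarrow> real) \<times> real, 'b) sing_chain"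
  have "?e \<in> sing_chains n (model n)" "?s \<in> sing_chains n (model n)"
    by (intro zk_chains model_homotopy(1)[OF idsimp_chain idsimp_boundary z]
         model_homotopy(1)[OF subd_chain_chain subd_chain_boundary z])+
  then have es: "?s - ?e \<in> sing_chains n (model n)"
    by (intro pm.subspace_diff[OF sing_chains_subspace])
  have kend: "kop n (?s - ?e) fst c = subdiv N n c - c"
  proof -
    have "kop n ?s fst c = subdiv N n c"
    proof (rule linear_eq_on_chains[OF c])
      fix f assume f: "singular_simplex n X f"
      then show "kop n ?s fst (Poly_Mapping.single f 1) = subdiv N n (Poly_Mapping.single f 1)"
        by (simp add: kop_single zk_chain_map sing_push_comp o_def subdiv_def flip: subd_chain_of)
    qed (simp_all add: kop_add kop_scale subdiv_linear)
    moreover have "kop n ?e fst c = c"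
      using kop_end[OF c, of 0 fst] sing_push_id[OF c] by (simp add: id_def)
    ultimately show ?thesis by (simp only: kop_diff_left)
  qed
  show ?thesis
  proof (cases n)
    case 0
    from kop_boundary[OF subd_model_sing[of N n] es pm.subspace_0[OF sing_chains_subspace] _ c, of fst]
    show ?thesis
      by (simp add: 0 subd_htpy_def kend[unfolded 0] sing_bd_def[of 0] subd_model(2) zk_diff chain_boundary_def[of 0]
        del: chain_map_of flip: zk_boundary)
  next
    case (Suc m)
    have "(zk (subd_model N (n - 1)) :: ((nat \<Rightarrow> real) \<times> real, 'b) sing_chain) \<in> sing_chains n (model (n - 1))"
      using subd_model_sing[of N m] Suc by simp
    moreover have "sing_bd (Suc n) (zk (subd_model N n) :: (_, 'b) sing_chain) = ?s - ?e
       - kop n (zk (subd_model N (n - 1))) id (sing_bd n (Poly_Mapping.single (idsimp n) 1))"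
      by (simp add: subd_model(2) zk_diff zk_zop del: chain_map_of flip: zk_boundary) (simp add: zk_boundary)
    ultimately show ?thesis
      using kop_boundary[OF subd_model_sing[of N n] es _ _ c, of "zk (subd_model N (n - 1))" fst]
      by (simp add: Suc subd_htpy_def kend[unfolded Suc] del: chain_map_of)
  qed
qed

text \<open>Apply the boundary to the homotopy formula for \<open>c\<close> and compare with the
  formula for the boundary of \<open>c\<close>.\<close>

lemma subdiv_bd:
  assumes c: "c \<in> sing_chains (Suc n) X"
  shows "sing_bd (Suc n) (subdiv N (Suc n) c) = subdiv N n (sing_bd (Suc n) c)"
proof -
  have "sing_bd (Suc n) (sing_bd (Suc (Suc n)) (subd_htpy N (Suc n) c)) = 0"
    by (rule sing_bd_bd[OF subd_htpy_chains[OF c]])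
  moreover have "sing_bd n (sing_bd (Suc n) c) = 0"
    using sing_bd_bd[of c "n - 1" X] c by (cases n) (auto simp: sing_bd_def[of 0])
  ultimately show ?thesis
    using subd_htpy_bd[OF c, of N] subd_htpy_bd[OF sing_bd_chains[OF c], of N]
    by (simp add: sing_bd_diff subd_htpy_linear)
qed

lemma subdiv_push:
  assumes c: "c \<in> sing_chains n X"
  shows "subdiv N n (sing_push n g c) = sing_push n g (subdiv N n c)"
proof (rule linear_eq_on_chains[OF c])
  fix f assume f: "singular_simplex n X f"
  have "(singular_subdivision n ^^ N) (frag_of (simplex_map n g f)) = chain_map n g ((singular_subdivision n ^^ N) (frag_of f))"
    using subd_iter_natural[of n X "frag_of f" N g] f by (simp add: singular_chain_of)
  then show "subdiv N n (sing_push n g (Poly_Mapping.single f 1)) = sing_push n g (subdiv N n (Poly_Mapping.single f 1))"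
    by (simp add: subdiv_def zk_chain_map sing_push_ext[of n g])
qed (simp_all add: sing_push_add sing_push_scale subdiv_linear)

text \<open>Holding for all large \<open>N\<close>, the conclusion survives sums, and one
  \<open>N\<close> can serve two chains at once. For a single simplex it is the Lebesgue number
  argument for iterated subdivision.\<close>

lemma subdiv_small:
  fixes c :: "('a::topological_space, 'k::field) sing_chain"
  assumes c: "c \<in> sing_chains n (top_of_set A)"
    and U: "openin (top_of_set A) U" and V: "openin (top_of_set A) V" and UV: "A \<subseteq> U \<union> V"
  shows "\<exists>N0. \<forall>N\<ge>N0. \<exists>u\<in>sing_chains n (top_of_set U). \<exists>v\<in>sing_chains n (top_of_set V). subdiv N n c = u + v"
proof (rule pm_induct[of _ c])
  show "\<exists>N0. \<forall>N\<ge>N0. \<exists>u\<in>sing_chains n (top_of_set U). \<exists>v\<in>sing_chains n (top_of_set V). subdiv N n (0 :: ('a, 'k) sing_chain) = u + v"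
    by (auto simp: subdiv_linear intro!: bexI[of _ 0] pm.subspace_0[OF sing_chains_subspace])
next
  fix a b :: "('a, 'k) sing_chain"
  let ?P = "\<lambda>N (a :: ('a, 'k) sing_chain). \<exists>u\<in>sing_chains n (top_of_set U). \<exists>v\<in>sing_chains n (top_of_set V). subdiv N n a = u + v"
  assume "\<exists>N0. \<forall>N\<ge>N0. ?P N a" "\<exists>N0. \<forall>N\<ge>N0. ?P N b"
  then obtain N1 N2 where N: "\<forall>N\<ge>N1. ?P N a" "\<forall>N\<ge>N2. ?P N b" by blast
  have "?P N (a + b)" if "N \<ge> max N1 N2" for N
  proof -
    from N that obtain u v u' v' where uv: "u \<in> sing_chains n (top_of_set U)" "v \<in> sing_chains n (top_of_set V)"
      "subdiv N n a = u + v" "u' \<in> sing_chains n (top_of_set U)" "v' \<in> sing_chains n (top_of_set V)" "subdiv N n b = u' + v'"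
      by fastforce
    then show ?thesis
      by (intro bexI[of _ "u + u'"] bexI[of _ "v + v'"])
        (simp_all add: subdiv_linear pm.subspace_add[OF sing_chains_subspace])
  qed
  then show "\<exists>N0. \<forall>N\<ge>N0. ?P N (a + b)" by blast
next
  fix f a assume "f \<in> Poly_Mapping.keys c"
  then have f: "singular_simplex n (top_of_set A) f" using c by (rule sing_chains_single)
  let ?sd = "\<lambda>N. (singular_subdivision n ^^ N) (frag_of f)"
  have fc: "singular_chain n (top_of_set A) (frag_of f)" using f by (simp add: singular_chain_of)
  obtain N0 where N0: "\<And>N g. N0 \<le> N \<Longrightarrow> g \<in> Poly_Mapping.keys (?sd N) \<Longrightarrow>
     \<exists>W\<in>{U, V}. g \<in> standard_simplex n \<rightarrow> W"
    using sufficient_iterated_singular_subdivision_exists[of "{U, V}", OF _ _ fc] U V UV by auto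
  have "\<exists>u\<in>sing_chains n (top_of_set U). \<exists>v\<in>sing_chains n (top_of_set V). subdiv N n (Poly_Mapping.single f a) = u + v"
    if N: "N \<ge> N0" for N
  proof -
    have "g \<in> {g. singular_simplex n (top_of_set U) g} \<union> {g. singular_simplex n (top_of_set V) g}"
      if g: "g \<in> Poly_Mapping.keys (?sd N)" for g
    proof -
      have s: "singular_simplex n (top_of_set A) g"
        using subd_iter_chain[OF fc, of N] g by (auto simp: singular_chain_def)
      then have "singular_simplex n euclidean g" by (simp add: singular_simplex_subtopology)
      then show ?thesis using N0[OF N g] by (auto simp: singular_simplex_subtopology)
    qed
    then have "Poly_Mapping.keys (?sd N) \<subseteq> {g. singular_simplex n (top_of_set U) g} \<union> {g. singular_simplex n (top_of_set V) g}"
      by blast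
    from frag_split[OF this] obtain d e where de: "Poly_Mapping.keys d \<subseteq> {g. singular_simplex n (top_of_set U) g}"
       "Poly_Mapping.keys e \<subseteq> {g. singular_simplex n (top_of_set V) g}" "d + e = ?sd N" by metis
    then have "singular_chain n (top_of_set U) d" "singular_chain n (top_of_set V) e"
      by (auto simp: singular_chain_def)
    moreover have "subdiv N n (Poly_Mapping.single f a) = pm_scale a (zk d) + pm_scale a (zk e)"
      by (simp add: subdiv_def zk_add pm.scale_right_distrib flip: de(3))
    ultimately show ?thesis
      by (intro bexI[of _ "pm_scale a (zk d)"] bexI[of _ "pm_scale a (zk e)"])
        (auto intro: pm.subspace_scale[OF sing_chains_subspace] zk_chains)
  qed
  then show "\<exists>N0. \<forall>N\<ge>N0. \<exists>u\<in>sing_chains n (top_of_set U). \<exists>v\<in>sing_chains n (top_of_set V). subdiv N n (Poly_Mapping.single f a) = u + v"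
    by blast
qed

section \<open>Integer degrees\<close>

text \<open>Chains of negative degree are zero, which makes the bottom degrees uniform.\<close>

definition SC :: "int \<Rightarrow> 'a::topological_space set \<Rightarrow> ('a, 'k::field) sing_chain set" where
  "SC k A = (if k < 0 then {0} else sing_chains (nat k) (top_of_set A))"

definition bd :: "int \<Rightarrow> ('a, 'k::field) sing_chain \<Rightarrow> ('a, 'k) sing_chain" where
  "bd k c = (if k \<le> 0 then 0 else sing_bd (nat k) c)"

abbreviation push :: "int \<Rightarrow> ('a \<Rightarrow> 'b) \<Rightarrow> ('a, 'k::field) sing_chain \<Rightarrow> ('b, 'k) sing_chain" where
  "push k \<equiv> sing_push (nat k)"

abbreviation pri :: "int \<Rightarrow> ('a \<times> real \<Rightarrow> 'b) \<Rightarrow> ('a, 'k::field) sing_chain \<Rightarrow> ('b, 'k) sing_chain" where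
  "pri k \<equiv> prism (nat k)"

lemma SC_subspace: "pm.subspace (SC k A)"
  using sing_chains_subspace[of "nat k" "top_of_set A"] by (auto simp: SC_def pm.subspace_def)

lemma SC_0 [simp]: "0 \<in> SC k A" by (rule pm.subspace_0[OF SC_subspace])
lemma SC_add: "a \<in> SC k A \<Longrightarrow> b \<in> SC k A \<Longrightarrow> a + b \<in> SC k A"
  by (rule pm.subspace_add[OF SC_subspace])
lemma SC_diff: "a \<in> SC k A \<Longrightarrow> b \<in> SC k A \<Longrightarrow> a - b \<in> SC k A"
  by (rule pm.subspace_diff[OF SC_subspace])
lemma SC_neg: "a \<in> SC k A \<Longrightarrow> - a \<in> SC k A"
  by (rule pm.subspace_neg[OF SC_subspace])
lemma SC_scale: "a \<in> SC k A \<Longrightarrow> pm_scale r a \<in> SC k A"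
  by (rule pm.subspace_scale[OF SC_subspace])

lemma sing_chains_top_of_set:
  "c \<in> sing_chains n (top_of_set A) \<longleftrightarrow>
    c \<in> sing_chains n euclidean \<and> (\<forall>f\<in>Poly_Mapping.keys c. f ` standard_simplex n \<subseteq> A)"
  by (auto simp: sing_chains_def singular_simplex_subtopology)

lemma SC_mono: "c \<in> SC k A \<Longrightarrow> A \<subseteq> B \<Longrightarrow> c \<in> SC k B"
  by (auto simp: SC_def sing_chains_top_of_set[of _ _ A] sing_chains_top_of_set[of _ _ B] split: if_splits)

text \<open>Lying in a subspace is a condition on each simplex of the support. This is used where
  otherwise a Mayer-Vietoris sequence would appear.\<close>

lemma SC_Int: "c \<in> SC k A \<Longrightarrow> c \<in> SC k B \<Longrightarrow> c \<in> SC k (A \<inter> B)"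
  by (auto simp: SC_def sing_chains_def singular_simplex_subtopology split: if_splits)

lemma SC_empty [simp]: "SC k {} = {0}"
proof -
  have "c = 0" if "c \<in> sing_chains n (top_of_set {})" for c n
    using that singular_simplex_empty[of "top_of_set {}"] unfolding sing_chains_def
    by (auto intro!: poly_mapping_eqI simp flip: keys_eq_empty)
  moreover have "0 \<in> sing_chains n (top_of_set {})" for n
    by (rule pm.subspace_0[OF sing_chains_subspace])
  ultimately show ?thesis by (auto simp: SC_def)
qed

text \<open>A standard simplex is connected, so each simplex lies in one of the two pieces.\<close>

lemma SC_split:
  assumes c: "c \<in> SC k (A \<union> B)"
    and op: "openin (top_of_set (A \<union> B)) A" "openin (top_of_set (A \<union> B)) B" and disj: "A \<inter> B = {}"
  shows "\<exists>a\<in>SC k A. \<exists>b\<in>SC k B. c = a + b"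
proof (cases "k < 0")
  case True
  then show ?thesis using c by (auto simp: SC_def)
next
  case False
  let ?n = "nat k"
  have c: "c \<in> sing_chains ?n (top_of_set (A \<union> B))" using c False by (simp add: SC_def)
  have "\<exists>a\<in>sing_chains ?n (top_of_set A). \<exists>b\<in>sing_chains ?n (top_of_set B). c = a + b"
  proof (rule pm_induct[of _ c])
    show "\<exists>a\<in>sing_chains ?n (top_of_set A). \<exists>b\<in>sing_chains ?n (top_of_set B). 0 = a + b"
      by (intro bexI[of _ 0]) (auto intro: pm.subspace_0[OF sing_chains_subspace])
  next
    fix x y :: "('a, 'b) sing_chain"
    assume "\<exists>a\<in>sing_chains ?n (top_of_set A). \<exists>b\<in>sing_chains ?n (top_of_set B). x = a + b"
      "\<exists>a\<in>sing_chains ?n (top_of_set A). \<exists>b\<in>sing_chains ?n (top_of_set B). y = a + b"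
    then obtain a b a' b' where "a \<in> sing_chains ?n (top_of_set A)" "b \<in> sing_chains ?n (top_of_set B)" "x = a + b"
      "a' \<in> sing_chains ?n (top_of_set A)" "b' \<in> sing_chains ?n (top_of_set B)" "y = a' + b'" by blast
    then show "\<exists>a\<in>sing_chains ?n (top_of_set A). \<exists>b\<in>sing_chains ?n (top_of_set B). x + y = a + b"
      by (intro bexI[of _ "a + a'"] bexI[of _ "b + b'"])
        (simp_all add: pm.subspace_add[OF sing_chains_subspace])
  next
    fix f r assume "f \<in> Poly_Mapping.keys c"
    then have f: "singular_simplex ?n (top_of_set (A \<union> B)) f" using c by (rule sing_chains_single)
    let ?D = "f ` standard_simplex ?n"
    have "connectedin (top_of_set (A \<union> B)) ?D"
      using f connectedin_standard_simplex[of ?n]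
      unfolding singular_simplex_def
      by (metis connectedin_continuous_map_image connectedin_subtopology subset_refl)
    then have "connected ?D" "?D \<subseteq> A \<union> B" by (auto simp: connectedin_subtopology)
    moreover obtain S T where "open S" "A = (A \<union> B) \<inter> S" "open T" "B = (A \<union> B) \<inter> T"
      using op by (auto simp: openin_open)
    ultimately have "?D \<subseteq> A \<or> ?D \<subseteq> B"
      using connectedD[of ?D S T] disj by blast
    moreover have "singular_simplex ?n euclidean f" using f by (simp add: singular_simplex_subtopology)
    ultimately have "Poly_Mapping.single f r \<in> sing_chains ?n (top_of_set A) \<or> Poly_Mapping.single f r \<in> sing_chains ?n (top_of_set B)"
      by (auto simp: sing_chains_def singular_simplex_subtopology)
    then show "\<exists>a\<in>sing_chains ?n (top_of_set A). \<exists>b\<in>sing_chains ?n (top_of_set B). Poly_Mapping.single f r = a + b"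
      using pm.subspace_0[OF sing_chains_subspace] by (metis add_0 add_0_right)
  qed
  then show ?thesis using False by (simp add: SC_def)
qed

lemma bd_linear:
  "bd k 0 = 0" "bd k (a + b) = bd k a + bd k b" "bd k (a - b) = bd k a - bd k b" "bd k (- a) = - bd k a"
  by (auto simp: bd_def sing_bd_add sing_bd_diff sing_bd_uminus)

lemma bd_SC: "c \<in> SC k A \<Longrightarrow> bd k c \<in> SC (k - 1) A"
  using sing_bd_chains[of c "nat (k - 1)" "top_of_set A"]
  by (auto simp: SC_def bd_def pm.subspace_0[OF sing_chains_subspace] Suc_nat_eq_nat_zadd1 split: if_splits)

lemma bd_bd: "c \<in> SC k A \<Longrightarrow> bd (k - 1) (bd k c) = 0"
  using sing_bd_bd[of c "nat (k - 2)" "top_of_set A"]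
  by (auto simp: SC_def bd_def Suc_nat_eq_nat_zadd1 split: if_splits)

lemma push_SC:
  assumes "c \<in> SC k A" "continuous_on A g" "g ` A \<subseteq> B"
  shows "push k g c \<in> SC k B"
proof (cases "k < 0")
  case False
  have "continuous_map (top_of_set A) (top_of_set B) g"
    using assms by (auto simp: continuous_map_in_subtopology)
  with False assms(1) show ?thesis by (auto simp: SC_def intro: sing_push_chains)
qed (use assms in \<open>auto simp: SC_def\<close>)

lemma push_linear:
  "push k g 0 = 0" "push k g (a + b) = push k g a + push k g b" "push k g (a - b) = push k g a - push k g b" "push k g (- a) = - push k g a"
  by (auto simp: sing_push_add sing_push_diff sing_push_uminus)

lemma push_bd: "c \<in> SC k A \<Longrightarrow> bd k (push k g c) = push (k - 1) g (bd k c)"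
  using sing_push_bd[of c "nat (k - 1)" "top_of_set A" g]
  by (auto simp: SC_def bd_def Suc_nat_eq_nat_zadd1 split: if_splits)

lemma push_ident: "c \<in> SC k A \<Longrightarrow> (\<And>x. x \<in> A \<Longrightarrow> g x = x) \<Longrightarrow> push k g c = c"
  by (auto simp: SC_def intro: sing_push_ident split: if_splits)

lemma pri_SC:
  assumes "c \<in> SC k A" "continuous_on (A \<times> {0..1}) H" "H ` (A \<times> {0..1}) \<subseteq> B"
  shows "pri k H c \<in> SC (k + 1) B"
  using assms prism_chains[of c "nat k" A H B]
  by (auto simp: SC_def prism_linear Suc_nat_eq_nat_zadd1 add.commute pm.subspace_0[OF sing_chains_subspace] split: if_splits)

lemma pri_bd:
  assumes "c \<in> SC k A"
  shows "bd (k + 1) (pri k H c) = push k (\<lambda>x. H (x, 1)) c - push k (\<lambda>x. H (x, 0)) c - pri (k - 1) H (bd k c)"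
  using assms prism_bd[of c "nat k" "top_of_set A" H]
  by (auto simp: SC_def bd_def prism_linear Suc_nat_eq_nat_zadd1 add.commute nat_diff_distrib split: if_splits)
    (auto simp: sing_bd_def[of 0] prism_linear)

lemma push_pri:
  assumes "c \<in> SC k A" shows "push (k + 1) g (pri k H c) = pri k (g \<circ> H) c"
  using assms prism_push[of "nat k" g H c]
  by (auto simp: SC_def prism_linear Suc_nat_eq_nat_zadd1 add.commute split: if_splits)

definition sd :: "nat \<Rightarrow> int \<Rightarrow> ('a, 'k::field) sing_chain \<Rightarrow> ('a, 'k) sing_chain" where
  "sd N k = subdiv N (nat k)"
definition th :: "nat \<Rightarrow> int \<Rightarrow> ('a, 'k::field) sing_chain \<Rightarrow> ('a, 'k) sing_chain" where
  "th N k = subd_htpy N (nat k)"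

lemma sd_linear: "sd N k 0 = 0" "sd N k (a + b) = sd N k a + sd N k b" "sd N k (a - b) = sd N k a - sd N k b"
  by (auto simp: sd_def subdiv_linear)
lemma th_linear: "th N k 0 = 0" "th N k (a + b) = th N k a + th N k b" "th N k (a - b) = th N k a - th N k b"
  by (auto simp: th_def subd_htpy_linear)

lemma sd_SC: "c \<in> SC k A \<Longrightarrow> sd N k c \<in> SC k A"
  by (auto simp: sd_def SC_def subdiv_linear intro: subdiv_chains split: if_splits)
lemma th_SC: "c \<in> SC k A \<Longrightarrow> th N k c \<in> SC (k + 1) A"
  using subd_htpy_chains[of c "nat k" "top_of_set A" N]
  by (auto simp: th_def SC_def subd_htpy_linear Suc_nat_eq_nat_zadd1 add.commute pm.subspace_0[OF sing_chains_subspace] split: if_splits)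
lemma th_bd: "c \<in> SC k A \<Longrightarrow> bd (k + 1) (th N k c) = sd N k c - c - th N (k - 1) (bd k c)"
  using subd_htpy_bd[of c "nat k" "top_of_set A" N]
  by (auto simp: SC_def th_def sd_def bd_def subd_htpy_linear subdiv_linear Suc_nat_eq_nat_zadd1 add.commute nat_diff_distrib split: if_splits)
    (auto simp: sing_bd_def[of 0] subd_htpy_linear)
lemma sd_bd: "c \<in> SC k A \<Longrightarrow> bd k (sd N k c) = sd N (k - 1) (bd k c)"
  using subdiv_bd[of c "nat (k - 1)" "top_of_set A" N]
  by (auto simp: SC_def sd_def bd_def subdiv_linear Suc_nat_eq_nat_zadd1 split: if_splits)
lemma sd_push: "c \<in> SC k A \<Longrightarrow> sd N k (push k g c) = push k g (sd N k c)"
  using subdiv_push[of c "nat k" "top_of_set A" N g]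
  by (auto simp: SC_def sd_def subdiv_linear split: if_splits)
lemma th_push: "c \<in> SC k A \<Longrightarrow> th N k (push k g c) = push (k + 1) g (th N k c)"
  using subd_htpy_push[of N "nat k" g c]
  by (auto simp: SC_def th_def subd_htpy_linear Suc_nat_eq_nat_zadd1 add.commute split: if_splits)

lemma sd_small:
  assumes "c \<in> SC k A" "openin (top_of_set A) U" "openin (top_of_set A) V" "A \<subseteq> U \<union> V"
  shows "\<exists>N0. \<forall>N\<ge>N0. \<exists>u\<in>SC k U. \<exists>v\<in>SC k V. sd N k c = u + v"
  using assms subdiv_small[of c "nat k" A U V]
  by (auto simp: SC_def sd_def subdiv_linear split: if_splits)

section \<open>Relative exactness\<close>

text \<open>Excision for \<open>q\<close> from \<open>(E, DE)\<close> to \<open>(X, V)\<close>, as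
  acyclicity of a relative cone. After subdivision both chains split into small pieces; over
  \<open>U\<close> the map \<open>q\<close> has the inverse \<open>r\<close>, through which the
  \<open>U\<close>-piece of \<open>y\<close> lifts to \<open>E\<close>.\<close>

lemma excision_cone:
  fixes E :: "'a::topological_space set" and X :: "'b::topological_space set"
    and x :: "('a, 'k::field) sing_chain"
  assumes E: "openin (top_of_set E) UE" "openin (top_of_set E) DE" "E \<subseteq> UE \<union> DE"
    and X: "openin (top_of_set X) U" "openin (top_of_set X) V" "X \<subseteq> U \<union> V"
    and q: "continuous_on E q" "q ` E \<subseteq> X" "q ` UE \<subseteq> U" "q ` DE \<subseteq> V"
    and r: "continuous_on U r" "r ` U \<subseteq> UE" "r ` (U \<inter> V) \<subseteq> DE"
    and qr: "\<And>u. u \<in> U \<Longrightarrow> q (r u) = u" and rq: "\<And>e. e \<in> UE \<Longrightarrow> r (q e) = e"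
    and x: "x \<in> SC k E" "bd k x \<in> SC (k - 1) DE"
    and y: "y \<in> SC (k + 1) X" "bd (k + 1) y - push k q x \<in> SC k V"
  shows "\<exists>w\<in>SC (k + 1) E. x - bd (k + 1) w \<in> SC k DE \<and>
           (\<exists>u\<in>SC (k + 2) X. y - push (k + 1) q w - bd (k + 2) u \<in> SC (k + 1) V)"
proof -
  have sub: "UE \<subseteq> E" "DE \<subseteq> E" "U \<subseteq> X" "V \<subseteq> X"
    using E X by (auto dest: openin_imp_subset)
  obtain N1 N2 where N1: "\<forall>N\<ge>N1. \<exists>u\<in>SC k UE. \<exists>v\<in>SC k DE. sd N k x = u + v"
    and N2: "\<forall>N\<ge>N2. \<exists>u\<in>SC (k + 1) U. \<exists>v\<in>SC (k + 1) V. sd N (k + 1) y = u + v"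
    using sd_small[OF x(1) E] sd_small[OF y(1) X] by blast
  define N where "N = max N1 N2"
  obtain xu xd where xx: "xu \<in> SC k UE" "xd \<in> SC k DE" "sd N k x = xu + xd"
    using N1[rule_format, of N] by (auto simp: N_def)
  obtain yu yv where yy: "yu \<in> SC (k + 1) U" "yv \<in> SC (k + 1) V" "sd N (k + 1) y = yu + yv"
    using N2[rule_format, of N] by (auto simp: N_def)
  define yt where "yt = push (k + 1) r yu"
  have yt: "yt \<in> SC (k + 1) UE" unfolding yt_def by (rule push_SC[OF yy(1) r(1,2)])
  have qyt: "push (k + 1) q yt = yu"
    unfolding yt_def sing_push_comp by (rule push_ident[OF yy(1)]) (simp add: qr)
  have contq: "continuous_on A q" if "A \<subseteq> E" for A using q(1) that by (rule continuous_on_subset)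
  have dyt: "bd (k + 1) yt \<in> SC k UE" using bd_SC[OF yt] by simp
  \<comment> \<open>The error of the lift. Its image lies in \<open>U\<close> by construction and in
    \<open>V\<close> because all other terms of the subdivided relation do; hence it lies in
    \<open>U \<inter> V\<close>, and \<open>r\<close> carries it back into
    \<open>DE\<close>.\<close>
  define z where "z = bd (k + 1) yt - xu"
  have z: "z \<in> SC k UE" unfolding z_def by (intro SC_diff dyt xx)
  have qz: "push k q z \<in> SC k U" by (rule push_SC[OF z contq[OF sub(1)] q(3)])
  have "push k q z = bd (k + 1) yu - push k q xu"
    using push_bd[OF yt, of q] by (simp add: z_def push_linear qyt)
  also have "\<dots> = (sd N k (bd (k + 1) y - push k q x) + push k q xd) - bd (k + 1) yv"
  proof -
    have "sd N k (push k q x) = push k q xu + push k q xd"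
      using sd_push[OF x(1), of N q] xx(3) by (simp add: push_linear)
    moreover have "sd N k (bd (k + 1) y) = bd (k + 1) yu + bd (k + 1) yv"
      using sd_bd[OF y(1), of N] yy(3) by (simp add: bd_linear)
    ultimately show ?thesis by (simp add: sd_linear)
  qed
  also have "\<dots> \<in> SC k V"
  proof -
    have "bd (k + 1) yv \<in> SC k V" using bd_SC[OF yy(2)] by simp
    then show ?thesis
      by (intro SC_diff SC_add sd_SC[OF y(2)] push_SC[OF xx(2) contq[OF sub(2)] q(4)])
  qed
  finally have "push k q z \<in> SC k (U \<inter> V)" using qz by (intro SC_Int)
  then have "push k r (push k q z) \<in> SC k DE"
    by (rule push_SC) (use r in \<open>auto intro: continuous_on_subset\<close>)
  moreover have "push k r (push k q z) = z"
    unfolding sing_push_comp by (rule push_ident[OF z]) (simp add: rq)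
  ultimately have zD: "z \<in> SC k DE" by simp
  \<comment> \<open>The subdivision homotopy converts the statement about the subdivided chain into
    one about \<open>x\<close>.\<close>
  define w where "w = yt - th N k x"
  have thx: "th N k x \<in> SC (k + 1) E" by (rule th_SC[OF x(1)])
  have w: "w \<in> SC (k + 1) E" unfolding w_def by (intro SC_diff thx SC_mono[OF yt sub(1)])
  have "x - bd (k + 1) w = xd - z - th N (k - 1) (bd k x)"
    using th_bd[OF x(1), of N] xx(3) by (simp add: w_def bd_linear z_def)
  moreover have "th N (k - 1) (bd k x) \<in> SC k DE"
    using th_SC[OF x(2), of N] by simp
  ultimately have 1: "x - bd (k + 1) w \<in> SC k DE"
    using xx zD by (auto intro!: SC_diff)
  define u where "u = - th N (k + 1) y"
  have u: "u \<in> SC (k + 2) X" unfolding u_def using th_SC[OF y(1), of N] by (auto intro: SC_neg simp: add.assoc)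
  have "y - push (k + 1) q w - bd (k + 2) u = yv - th N k (bd (k + 1) y - push k q x)"
    using th_bd[OF y(1), of N] th_push[OF x(1), of N q] yy(3) qyt
    by (simp add: w_def u_def push_linear bd_linear th_linear add.assoc algebra_simps)
  moreover have "th N k (bd (k + 1) y - push k q x) \<in> SC (k + 1) V"
    by (rule th_SC[OF y(2)])
  ultimately have "y - push (k + 1) q w - bd (k + 2) u \<in> SC (k + 1) V"
    using yy(2) by (auto intro!: SC_diff)
  with 1 w u show ?thesis by blast
qed

text \<open>Suspension: relative chains of the cylinder modulo the complement of the middle slice
  are, up to homology, prisms over chains of \<open>Y\<close>. The complement falls into two
  disjoint halves, and the part of the boundary in the upper half reveals the primitive of
  \<open>c\<close>.\<close>

lemma interval_cone:
  fixes Y :: "'a::topological_space set" and c :: "('a, 'k::field) sing_chain"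
  defines "E \<equiv> Y \<times> {0..1::real}" and "D \<equiv> Y \<times> ({0..1} - {1/2})"
  assumes w: "w \<in> SC (k + 1) E" and c: "c \<in> SC (k - 1) Y" "bd (k - 1) c = 0"
    and wc: "bd (k + 1) w - pri (k - 1) id c \<in> SC k D"
  shows "\<exists>g\<in>SC k Y. bd k g = c \<and> (\<exists>u\<in>SC (k + 2) E. w + pri k id g - bd (k + 2) u \<in> SC (k + 1) D)"
proof -
  define D0 where "D0 = Y \<times> {0..<1/2::real}"
  define D1 where "D1 = Y \<times> {1/2<..1::real}"
  have D: "D = D0 \<union> D1" "D0 \<inter> D1 = {}" by (auto simp: D_def D0_def D1_def)
  have sub: "D0 \<subseteq> D" "D1 \<subseteq> D" "D \<subseteq> E" by (auto simp: D_def D0_def D1_def E_def)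
  have op: "openin (top_of_set D) D0" "openin (top_of_set D) D1"
  proof -
    have "D0 = D \<inter> (UNIV \<times> {..<1/2})" "D1 = D \<inter> (UNIV \<times> {1/2<..})"
      by (auto simp: D_def D0_def D1_def)
    then show "openin (top_of_set D) D0" "openin (top_of_set D) D1"
      by (metis open_Times open_UNIV open_lessThan openin_open_Int)
        (metis \<open>D1 = D \<inter> (UNIV \<times> {1/2<..})\<close> open_Times open_UNIV open_greaterThan openin_open_Int)
  qed
  let ?i0 = "\<lambda>y::'a. (y, 0::real)" and ?i1 = "\<lambda>y::'a. (y, 1::real)"
  let ?\<pi> = "fst :: 'a \<times> real \<Rightarrow> 'a"
  have i0: "push j ?i0 a \<in> SC j D0" and i1: "push j ?i1 a \<in> SC j D1" if "a \<in> SC j Y" for a :: "('a, 'k) sing_chain" and j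
    by (rule push_SC[OF that]; auto intro!: continuous_intros simp: D0_def D1_def)+
  have P: "pri j id a \<in> SC (j + 1) E" if "a \<in> SC j Y" for a :: "('a, 'k) sing_chain" and j
    by (rule pri_SC[OF that]) (auto simp: E_def)
  have Pbd: "bd (j + 1) (pri j id a) = push j ?i1 a - push j ?i0 a - pri (j - 1) id (bd j a)"
    if "a \<in> SC j Y" for a :: "('a, 'k) sing_chain" and j
    using pri_bd[OF that, of id] by simp
  obtain e0 e1 where e: "e0 \<in> SC k D0" "e1 \<in> SC k D1" "bd (k + 1) w - pri (k - 1) id c = e0 + e1"
    using SC_split[of _ k D0 D1] wc op D by metis
  have w2: "bd k (bd (k + 1) w) = 0" using bd_bd[OF w] by simp
  have sum0: "- (push (k - 1) ?i1 c - push (k - 1) ?i0 c) = bd k e0 + bd k e1"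
  proof -
    have "bd k (pri (k - 1) id c) = push (k - 1) ?i1 c - push (k - 1) ?i0 c"
      using Pbd[OF c(1)] by (simp add: c(2) prism_linear)
    then show ?thesis using arg_cong[OF e(3), of "bd k"] by (simp add: bd_linear w2)
  qed
  have b: "bd k e0 \<in> SC (k - 1) D0" "bd k e1 \<in> SC (k - 1) D1" using e by (auto intro: bd_SC)
  \<comment> \<open>The two sides are carried by disjoint halves, so both are 0.\<close>
  have "push (k - 1) ?i0 c - bd k e0 = bd k e1 + push (k - 1) ?i1 c"
    using sum0 by (simp add: algebra_simps)
  moreover have "push (k - 1) ?i0 c - bd k e0 \<in> SC (k - 1) D0" by (intro SC_diff i0 c b)
  moreover have "bd k e1 + push (k - 1) ?i1 c \<in> SC (k - 1) D1" by (intro SC_add i1 c b)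
  ultimately have "bd k e1 + push (k - 1) ?i1 c \<in> SC (k - 1) (D0 \<inter> D1)" by (metis SC_Int)
  then have be1: "bd k e1 = - push (k - 1) ?i1 c" by (simp add: D eq_neg_iff_add_eq_0)
  \<comment> \<open>Projecting \<open>e1\<close> to \<open>Y\<close> yields a primitive of
    \<open>c\<close> up to the sign in \<open>be1\<close>.\<close>
  define g where "g = - push k ?\<pi> e1"
  have g: "g \<in> SC k Y" unfolding g_def
    by (intro SC_neg push_SC[OF e(2)]) (auto intro!: continuous_intros simp: D1_def)
  have \<pi>i: "push j ?\<pi> (push j ?i1 a) = a" if "a \<in> SC j Y" for a :: "('a, 'k) sing_chain" and j
    unfolding sing_push_comp by (rule push_ident[OF that]) simp
  have bg: "bd k g = c"
    using push_bd[OF e(2), of ?\<pi>] by (simp add: g_def bd_linear be1 push_linear \<pi>i[OF c(1)])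
  define w' where "w' = w + pri k id g"
  have w': "w' \<in> SC (k + 1) E" unfolding w'_def by (intro SC_add w P g)
  \<comment> \<open>With the prism over \<open>g\<close> added, the upper part \<open>f1\<close> of
    the boundary is a cycle whose projection to \<open>Y\<close> is 0.\<close>
  define f0 f1 where "f0 = e0 - push k ?i0 g" and "f1 = e1 + push k ?i1 g"
  have f: "f0 \<in> SC k D0" "f1 \<in> SC k D1" unfolding f0_def f1_def by (intro SC_diff SC_add e i0 i1 g)+
  have bw': "bd (k + 1) w' = f0 + f1"
    using Pbd[OF g] e(3) by (simp add: w'_def bd_linear f0_def f1_def bg algebra_simps)
  have bf1: "bd k f1 = 0"
    using push_bd[OF g, of ?i1] by (simp add: f1_def bd_linear be1 bg)
  have \<pi>f1: "push k ?\<pi> f1 = 0"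
    using \<pi>i[OF g] by (simp add: f1_def push_linear) (simp add: g_def)
  \<comment> \<open>Slides the upper half to height 1, where \<open>f1\<close> becomes the image of
    its projection, hence 0; so \<open>f1\<close> bounds inside the upper half.\<close>
  let ?H1 = "\<lambda>((y, a), s). (y :: 'a, a + s * (1 - a) :: real)"
  have c1: "continuous_on A ?H1" for A unfolding case_prod_unfold by (intro continuous_intros)
  have h1: "?H1 ` (D1 \<times> {0..1}) \<subseteq> D1"
  proof -
    have "1 / 2 < a + s * (1 - a) \<and> a + s * (1 - a) \<le> 1" if "1/2 < a" "a \<le> 1" "0 \<le> s" "s \<le> 1" for a s :: real
    proof -
      have "0 \<le> s * (1 - a)" "s * (1 - a) \<le> 1 - a"
        using that mult_left_le_one_le[of "1 - a" s] by simp_all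
      with that show ?thesis by linarith
    qed
    then show ?thesis by (auto simp: D1_def)
  qed
  define K where "K = pri k ?H1 f1"
  have K: "K \<in> SC (k + 1) D1" unfolding K_def by (rule pri_SC[OF f(2) c1 h1])
  have bK: "bd (k + 1) K = - f1"
  proof -
    have "push k (\<lambda>x. ?H1 (x, 1)) f1 = push k ?i1 (push k ?\<pi> f1)"
      unfolding sing_push_comp by (rule arg_cong[of _ _ "\<lambda>g. push k g f1"]) auto
    moreover have "push k (\<lambda>x. ?H1 (x, 0)) f1 = f1"
      by (rule push_ident[OF f(2)]) auto
    ultimately show ?thesis unfolding K_def pri_bd[OF f(2)] by (simp add: bf1 \<pi>f1 push_linear prism_linear)
  qed
  \<comment> \<open>Slides the whole cylinder down to height 0 and preserves the lower half, so
    \<open>v\<close> moves into that half and the trace of its boundary \<open>f0\<close> stays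
    there.\<close>
  let ?H0 = "\<lambda>((y, a), s). (y :: 'a, (1 - s) * a :: real)"
  have c0: "continuous_on A ?H0" for A unfolding case_prod_unfold by (intro continuous_intros)
  have h0: "?H0 ` (D0 \<times> {0..1}) \<subseteq> D0"
  proof -
    have "0 \<le> (1 - s) * a \<and> (1 - s) * a < 1/2" if "0 \<le> a" "a < 1/2" "0 \<le> s" "s \<le> 1" for a s :: real
      using that mult_left_le_one_le[of a "1 - s"] by simp
    then show ?thesis by (fastforce simp: D0_def)
  qed
  have hE: "?H0 ` (E \<times> {0..1}) \<subseteq> E"
    by (auto simp: E_def mult_le_one)
  define v where "v = w' + K"
  have v: "v \<in> SC (k + 1) E" unfolding v_def by (intro SC_add w' SC_mono[OF K]) (use sub in auto)
  have bv: "bd (k + 1) v = f0" by (simp add: v_def bd_linear bw' bK)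
  define u where "u = - pri (k + 1) ?H0 v"
  have u: "u \<in> SC (k + 2) E" unfolding u_def using pri_SC[OF v c0 hE] by (simp add: SC_neg add.assoc)
  have "bd (k + 2) u = - (push (k + 1) (\<lambda>x. ?H0 (x, 1)) v - v - pri k ?H0 f0)"
  proof -
    have "push (k + 1) (\<lambda>x. ?H0 (x, 0)) v = v" by (rule push_ident[OF v]) auto
    then show ?thesis
      using pri_bd[OF v, of ?H0] by (simp add: u_def bd_linear bv add.assoc)
  qed
  then have "w' - bd (k + 2) u = push (k + 1) (\<lambda>x. ?H0 (x, 1)) v - pri k ?H0 f0 - K"
    by (simp add: v_def algebra_simps)
  also have "\<dots> \<in> SC (k + 1) D"
  proof -
    have "push (k + 1) (\<lambda>x. ?H0 (x, 1)) v \<in> SC (k + 1) D0"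
      by (rule push_SC[OF v]) (auto simp: E_def D0_def case_prod_unfold intro!: continuous_intros)
    moreover have "pri k ?H0 f0 \<in> SC (k + 1) D0" by (rule pri_SC[OF f(1) c0 h0])
    ultimately show ?thesis using K sub by (blast intro: SC_diff SC_mono)
  qed
  finally show ?thesis using g bg u unfolding w'_def by blast
qed

text \<open>Excision moves the problem from \<open>X\<close> to the cylinder, where
  \<open>interval_cone\<close> solves it; \<open>q\<close> then carries the correction back to
  \<open>X\<close>.\<close>

lemma cylinder_cone:
  fixes Y :: "'a::topological_space set" and X :: "'b::topological_space set"
    and c :: "('a, 'k::field) sing_chain"
  assumes X: "openin (top_of_set X) U" "openin (top_of_set X) V" "X \<subseteq> U \<union> V"
    and q: "continuous_on (Y \<times> {0..1}) q" "q ` (Y \<times> {0..1}) \<subseteq> X" "q ` (Y \<times> {0<..<1}) \<subseteq> U"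
       "q ` (Y \<times> ({0..1} - {1/2})) \<subseteq> V"
    and r: "continuous_on U r" "r ` U \<subseteq> Y \<times> {0<..<1}" "r ` (U \<inter> V) \<subseteq> Y \<times> ({0..1} - {1/2})"
    and qr: "\<And>u. u \<in> U \<Longrightarrow> q (r u) = u" and rq: "\<And>e. e \<in> Y \<times> {0<..<1} \<Longrightarrow> r (q e) = e"
    and c: "c \<in> SC (k - 1) Y" "bd (k - 1) c = 0"
    and y: "y \<in> SC (k + 1) X" "bd (k + 1) y - pri (k - 1) q c \<in> SC k V"
  shows "\<exists>g\<in>SC k Y. bd k g = c \<and> (\<exists>u\<in>SC (k + 2) X. y + pri k q g - bd (k + 2) u \<in> SC (k + 1) V)"
proof -
  let ?E = "Y \<times> {0..1::real}" and ?D = "Y \<times> ({0..1} - {1/2::real})" and ?U = "Y \<times> {0<..<1::real}"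
  have op: "openin (top_of_set ?E) ?U" "openin (top_of_set ?E) ?D"
  proof -
    have "?U = ?E \<inter> (UNIV \<times> {0<..<1})" "?D = ?E \<inter> (UNIV \<times> (- {1/2}))" by auto
    moreover have "open (UNIV \<times> {0<..<1::real} :: ('a \<times> real) set)" "open (UNIV \<times> (- {1/2::real}) :: ('a \<times> real) set)"
      by (auto intro!: open_Times simp: open_Compl)
    ultimately show "openin (top_of_set ?E) ?U" "openin (top_of_set ?E) ?D"
      by (metis openin_open_Int)+
  qed
  have cov: "?E \<subseteq> ?U \<union> ?D" by auto
  let ?x = "pri (k - 1) id c"
  have x: "?x \<in> SC k ?E" using pri_SC[OF c(1), of id ?E] by auto
  have bx: "bd k ?x \<in> SC (k - 1) ?D"
  proof -
    have "bd k ?x = push (k - 1) (\<lambda>y. (y, 1)) c - push (k - 1) (\<lambda>y. (y, 0)) c"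
      using pri_bd[OF c(1), of id] by (simp add: c(2) prism_linear)
    also have "\<dots> \<in> SC (k - 1) ?D"
      by (intro SC_diff push_SC[OF c(1)]) (auto intro!: continuous_intros)
    finally show ?thesis .
  qed
  have qx: "push k q ?x = pri (k - 1) q c" using push_pri[OF c(1), of q id] by simp
  obtain w u where w: "w \<in> SC (k + 1) ?E" "?x - bd (k + 1) w \<in> SC k ?D"
    and u: "u \<in> SC (k + 2) X" "y - push (k + 1) q w - bd (k + 2) u \<in> SC (k + 1) V"
    using excision_cone[OF op cov X q r qr rq x bx y(1)] y(2) qx by metis
  have "bd (k + 1) w - ?x \<in> SC k ?D" using SC_neg[OF w(2)] by simp
  from interval_cone[OF w(1) c this] obtain g u' where g: "g \<in> SC k Y" "bd k g = c"
    and u': "u' \<in> SC (k + 2) ?E" "w + pri k id g - bd (k + 2) u' \<in> SC (k + 1) ?D"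
    by blast
  let ?u = "u + push (k + 2) q u'"
  have qu': "push (k + 2) q u' \<in> SC (k + 2) X" by (rule push_SC[OF u'(1) q(1,2)])
  have bqu': "bd (k + 2) (push (k + 2) q u') = push (k + 1) q (bd (k + 2) u')"
    using push_bd[OF u'(1), of q] by (simp add: add.commute)
  have qg: "push (k + 1) q (pri k id g) = pri k q g" using push_pri[OF g(1), of q id] by simp
  have "y + pri k q g - bd (k + 2) ?u = (y - push (k + 1) q w - bd (k + 2) u)
     + push (k + 1) q (w + pri k id g - bd (k + 2) u')"
    by (simp only: push_linear bd_linear bqu' qg) (simp add: algebra_simps)
  moreover have "\<dots> \<in> SC (k + 1) V"
    by (intro SC_add u(2) push_SC[OF u'(2) _ q(4)] continuous_on_subset[OF q(1)]) auto
  ultimately show ?thesis using g u(1) qu' by (metis SC_add)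
qed

text \<open>The homotopy keeps \<open>Z\<close> inside \<open>Z\<close>, so its trace on the
  boundary of \<open>y\<close> is a chain of \<open>Z\<close> and can be subtracted from the
  retracted chain.\<close>

lemma deformation_cone:
  fixes G :: "'a::topological_space \<times> real \<Rightarrow> 'a" and y :: "('a, 'k::field) sing_chain"
  assumes Z: "Z \<subseteq> V" and G: "continuous_on (V \<times> {0..1}) G" "G ` (V \<times> {0..1}) \<subseteq> V"
    and G0: "\<And>x. x \<in> V \<Longrightarrow> G (x, 0) = x" and G1: "\<And>x. x \<in> V \<Longrightarrow> G (x, 1) \<in> Z"
    and GZ: "\<And>x s. x \<in> Z \<Longrightarrow> s \<in> {0..1} \<Longrightarrow> G (x, s) \<in> Z"
    and y: "y \<in> SC k V" "bd k y \<in> SC (k - 1) Z"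
  shows "\<exists>z\<in>SC k Z. \<exists>u\<in>SC (k + 1) V. y - z = bd (k + 1) u"
proof -
  let ?\<rho> = "\<lambda>x. G (x, 1)"
  have \<rho>: "push k ?\<rho> y \<in> SC k Z"
    by (rule push_SC[OF y(1) continuous_on_compose2[OF G(1)]])
      (auto intro!: continuous_on_Pair continuous_on_id continuous_on_const G1)
  have K: "pri k G y \<in> SC (k + 1) V" by (rule pri_SC[OF y(1) G])
  have K': "pri (k - 1) G (bd k y) \<in> SC k Z"
  proof -
    have "G ` (Z \<times> {0..1}) \<subseteq> Z" using GZ by blast
    moreover have "continuous_on (Z \<times> {0..1}) G" using Z by (intro continuous_on_subset[OF G(1)]) auto
    ultimately show ?thesis using pri_SC[OF y(2)] by fastforce
  qed
  have "push k (\<lambda>x. G (x, 0)) y = y" by (rule push_ident[OF y(1)]) (simp add: G0)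
  then have "y - (push k ?\<rho> y - pri (k - 1) G (bd k y)) = bd (k + 1) (- pri k G y)"
    using pri_bd[OF y(1), of G] by (simp add: bd_linear)
  then show ?thesis using \<rho> K K' by (meson SC_diff SC_neg)
qed

section \<open>The Koszul-type complex of a simplicial complex\<close>

text \<open>An arbitrary total order of the vertices; it fixes the signs and the order of the
  induction.\<close>

definition vnum :: "'v::finite \<Rightarrow> nat" where
  "vnum = (SOME e. bij_betw e UNIV {..<CARD('v)})"

lemma bij_vnum: "bij_betw vnum (UNIV :: 'v::finite set) {..<CARD('v)}"
  unfolding vnum_def
  using someI_ex[of "\<lambda>e. bij_betw e (UNIV :: 'v set) {..<CARD('v)}"]
    ex_bij_betw_finite_nat[of "UNIV :: 'v set"] by (simp add: atLeast0LessThan)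

lemma vnum_eq_iff [simp]: "vnum u = vnum v \<longleftrightarrow> u = v"
  using bij_vnum by (auto simp: bij_betw_def inj_on_def)

lemma vnum_less: "vnum (v::'v::finite) < CARD('v)"
  using bij_vnum by (auto simp: bij_betw_def)

text \<open>Counting the larger vertices is the sign rule for product cells built up by crossing with one
  circle at a time, in increasing order of \<open>vnum\<close>; see \<open>cell\<close> below.\<close>

definition sg :: "'v::finite \<Rightarrow> 'v set \<Rightarrow> 'a::comm_ring_1" where
  "sg v \<rho> = (- 1) ^ card {u \<in> \<rho>. vnum v < vnum u}"

lemma sg_insert:
  assumes "u \<notin> \<rho>"
  shows "sg v (insert u \<rho>) = (if vnum v < vnum u then - sg v \<rho> else sg v \<rho>)"
proof -
  have "{w \<in> insert u \<rho>. vnum v < vnum w} =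
     (if vnum v < vnum u then insert u {w \<in> \<rho>. vnum v < vnum w} else {w \<in> \<rho>. vnum v < vnum w})"
    by auto
  then show ?thesis using assms by (simp add: sg_def)
qed

lemma sg_anti:
  assumes "u \<notin> \<rho>" "v \<notin> \<rho>" "u \<noteq> v"
  shows "sg u \<rho> * sg v (insert u \<rho>) = - (sg v \<rho> * sg u (insert v \<rho>))"
  using assms vnum_eq_iff[of u v] by (auto simp: sg_insert not_less_iff_gr_or_eq simp del: vnum_eq_iff)

text \<open>Contraction in the exterior algebra, in terms of coefficient functions instead of basis
  vectors.\<close>

definition con :: "'v::finite \<Rightarrow> ('v set \<Rightarrow> 'a::comm_ring_1) \<Rightarrow> 'v set \<Rightarrow> 'a" where
  "con v x \<rho> = (if v \<in> \<rho> then 0 else sg v \<rho> * x (insert v \<rho>))"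

lemma con_same: "con v (con v x) \<rho> = 0"
  by (simp add: con_def)

lemma con_anti: "con u (con v x) \<rho> = - con v (con u x) \<rho>"
proof (cases "u \<in> \<rho> \<or> v \<in> \<rho> \<or> u = v")
  case False
  then have "con u (con v x) \<rho> = (sg u \<rho> * sg v (insert u \<rho>)) * x (insert u (insert v \<rho>))"
    by (auto simp: con_def mult.assoc insert_commute)
  also have "\<dots> = - con v (con u x) \<rho>"
    using False by (subst sg_anti) (auto simp: con_def mult.assoc)
  finally show ?thesis .
qed (auto simp: con_def)

text \<open>Contraction with the linear form \<open>lam\<close>, i.e. a Koszul differential. It
  lives on the full simplex; \<open>ch\<close> cuts out the subcomplex of \<open>L\<close>.\<close>

definition kbd :: "('v::finite \<Rightarrow> 'a::comm_ring_1) \<Rightarrow> ('v set \<Rightarrow> 'a) \<Rightarrow> 'v set \<Rightarrow> 'a" where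
  "kbd lam x \<rho> = (\<Sum>v\<in>UNIV. lam v * con v x \<rho>)"

text \<open>In characteristic 2 antisymmetry says nothing about the diagonal, so the diagonal terms
  are 0 by assumption; the others cancel in pairs ordered by \<open>vnum\<close>.\<close>

lemma antisym_sum:
  fixes F :: "'v::finite \<Rightarrow> 'v \<Rightarrow> 'a::comm_ring_1"
  assumes "\<And>u v. F u v = - F v u" "\<And>u. F u u = 0"
  shows "(\<Sum>u\<in>UNIV. \<Sum>v\<in>UNIV. F u v) = 0"
proof -
  let ?A = "{p :: 'v \<times> 'v. vnum (fst p) < vnum (snd p)}" and ?B = "{p :: 'v \<times> 'v. vnum (snd p) < vnum (fst p)}"
  let ?D = "{p :: 'v \<times> 'v. fst p = snd p}"
  let ?f = "\<lambda>p. F (fst p) (snd p)"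
  have U: "(UNIV :: ('v \<times> 'v) set) = ?A \<union> (?B \<union> ?D)"
    using vnum_eq_iff by (auto simp del: vnum_eq_iff intro: linorder_neqE_nat)
  have "(\<Sum>u\<in>UNIV. \<Sum>v\<in>UNIV. F u v) = sum ?f UNIV"
    by (simp add: sum.cartesian_product case_prod_unfold)
  also have "\<dots> = sum ?f ?A + (sum ?f ?B + sum ?f ?D)"
    unfolding U by (subst sum.union_disjoint; (subst sum.union_disjoint)?) auto
  also have "sum ?f ?D = 0" by (rule sum.neutral) (auto simp: assms(2))
  also have "sum ?f ?B = (\<Sum>p\<in>?A. F (snd p) (fst p))"
    by (rule sum.reindex_bij_witness[of _ prod.swap prod.swap]) auto
  also have "\<dots> = - sum ?f ?A"
    unfolding sum_negf[symmetric] by (rule sum.cong[OF HOL.refl]) (rule assms(1))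
  finally show ?thesis by simp
qed

lemma con_sum: "con v (\<lambda>\<rho>. \<Sum>u\<in>A. f u \<rho>) \<rho> = (\<Sum>u\<in>A. con v (f u) \<rho>)"
  by (simp add: con_def sum_distrib_left)
lemma con_scale: "con v (\<lambda>\<rho>. c * x \<rho>) \<rho> = c * con v x \<rho>"
  by (simp add: con_def mult_ac)

lemma kbd_kbd: "kbd lam (kbd lam x) = (\<lambda>\<rho>. 0)"
proof
  fix \<rho>
  have "kbd lam (kbd lam x) \<rho> = (\<Sum>v\<in>UNIV. lam v * con v (\<lambda>\<rho>. \<Sum>u\<in>UNIV. lam u * con u x \<rho>) \<rho>)"
    unfolding kbd_def ..
  also have "\<dots> = (\<Sum>v\<in>UNIV. \<Sum>u\<in>UNIV. lam v * (lam u * con v (con u x) \<rho>))"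
    by (simp only: con_sum con_scale sum_distrib_left)
  also have "\<dots> = 0"
  proof (rule antisym_sum)
    show "lam v * (lam u * con v (con u x) \<rho>) = - (lam u * (lam v * con u (con v x) \<rho>))" for u v
      by (subst con_anti) (simp add: mult.left_commute)
  qed (simp add: con_same)
  finally show "kbd lam (kbd lam x) \<rho> = 0" .
qed

lemma kbd_add: "kbd lam (\<lambda>\<sigma>. x \<sigma> + y \<sigma>) = (\<lambda>\<sigma>. kbd lam x \<sigma> + kbd lam y \<sigma>)"
  by (simp add: kbd_def con_def distrib_left if_distrib fun_eq_iff flip: sum.distrib) (auto intro!: sum.cong simp: algebra_simps)
lemma kbd_diff: "kbd lam (\<lambda>\<sigma>. x \<sigma> - y \<sigma>) = (\<lambda>\<sigma>. kbd lam x \<sigma> - kbd lam y \<sigma>)"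
  by (simp add: kbd_def con_def fun_eq_iff flip: sum_subtractf) (auto intro!: sum.cong simp: algebra_simps)
lemma kbd_scale: "kbd lam (\<lambda>\<sigma>. c * x \<sigma>) = (\<lambda>\<sigma>. c * kbd lam x \<sigma>)"
  by (simp add: kbd_def con_scale sum_distrib_left mult.left_commute fun_eq_iff)
lemma kbd_0: "kbd lam (\<lambda>\<sigma>. 0) = (\<lambda>\<sigma>. 0)"
  by (rule ext) (auto simp: kbd_def con_def intro!: sum.neutral)

text \<open>Singletons are not demanded, because links and deletions lose vertices while the vertex
  type stays fixed.\<close>

definition down :: "'v set set \<Rightarrow> bool" where
  "down L \<longleftrightarrow> (\<forall>\<sigma>\<in>L. \<forall>\<tau>. \<tau> \<subseteq> \<sigma> \<longrightarrow> \<tau> \<in> L)"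

text \<open>The degree counts vertices, which is the dimension of the corresponding cell of the
  toric complex; the empty simplex sits in degree 0.\<close>

definition ch :: "'v::finite set set \<Rightarrow> int \<Rightarrow> ('v set \<Rightarrow> 'a::comm_ring_1) set" where
  "ch L k = {x. \<forall>\<sigma>. x \<sigma> \<noteq> 0 \<longrightarrow> \<sigma> \<in> L \<and> int (card \<sigma>) = k}"

lemma ch_add: "x \<in> ch L k \<Longrightarrow> y \<in> ch L k \<Longrightarrow> (\<lambda>\<sigma>. x \<sigma> + y \<sigma>) \<in> ch L k"
  unfolding ch_def mem_Collect_eq by (metis add_0 diff_0_right)
lemma ch_diff: "x \<in> ch L k \<Longrightarrow> y \<in> ch L k \<Longrightarrow> (\<lambda>\<sigma>. x \<sigma> - y \<sigma>) \<in> ch L k"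
  unfolding ch_def mem_Collect_eq by (metis add_0 diff_0_right)
lemma ch_scale: "x \<in> ch L k \<Longrightarrow> (\<lambda>\<sigma>. c \<sigma> * x \<sigma>) \<in> ch L k"
  unfolding ch_def mem_Collect_eq by (metis mult_zero_right)
lemma ch_0 [simp]: "(\<lambda>\<sigma>. 0) \<in> ch L k"
  by (simp add: ch_def)
lemma ch_neg: "k < 0 \<Longrightarrow> x \<in> ch L k \<Longrightarrow> x = (\<lambda>\<sigma>. 0)"
  by (fastforce simp: ch_def)

lemma kbd_ch:
  assumes L: "down L" and x: "x \<in> ch L k"
  shows "kbd lam x \<in> ch L (k - 1)"
  unfolding ch_def
proof safe
  fix \<rho> assume "kbd lam x \<rho> \<noteq> 0"
  then obtain v where "con v x \<rho> \<noteq> 0" unfolding kbd_def by (metis (no_types, lifting) mult_zero_right sum.neutral)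
  then have v: "v \<notin> \<rho>" "x (insert v \<rho>) \<noteq> 0" by (auto simp: con_def split: if_splits)
  then have "insert v \<rho> \<in> L" "int (card (insert v \<rho>)) = k" using x by (auto simp: ch_def)
  with v L show "\<rho> \<in> L" "int (card \<rho>) = k - 1" unfolding down_def by auto
qed

section \<open>Cyclic covers of toric complexes with arbitrary weights\<close>

type_synonym 'v pt = "(complex ^ 'v) \<times> real"

definition tcov :: "('v::finite \<Rightarrow> int) \<Rightarrow> 'v set set \<Rightarrow> 'v pt set" where
  "tcov m L = {(x, s). x \<in> toric_complex L \<and> (\<Prod>v\<in>UNIV. x $ v powi m v) = cis (2 * pi * s)}"

lemma downD: "down L \<Longrightarrow> \<sigma> \<in> L \<Longrightarrow> \<tau> \<subseteq> \<sigma> \<Longrightarrow> \<tau> \<in> L"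
  by (simp add: down_def)

lemma toric_complex_iff:
  assumes "down L"
  shows "x \<in> toric_complex L \<longleftrightarrow> (\<forall>v. norm (x $ v) = 1) \<and> {v. x $ v \<noteq> 1} \<in> L"
proof
  assume "x \<in> toric_complex L"
  then obtain \<sigma> where \<sigma>: "\<sigma> \<in> L" "\<And>v. norm (x $ v) = 1" "\<And>v. v \<notin> \<sigma> \<Longrightarrow> x $ v = 1"
    by (auto simp: toric_complex_def)
  then have "{v. x $ v \<noteq> 1} \<subseteq> \<sigma>" by auto
  with \<sigma> assms show "(\<forall>v. norm (x $ v) = 1) \<and> {v. x $ v \<noteq> 1} \<in> L" by (auto simp: down_def)
next
  assume "(\<forall>v. norm (x $ v) = 1) \<and> {v. x $ v \<noteq> 1} \<in> L"
  then show "x \<in> toric_complex L"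
    unfolding toric_complex_def by (intro UN_I[of "{v. x $ v \<noteq> 1}"]) auto
qed

lemma tcov_iff:
  assumes "down L"
  shows "z \<in> tcov m L \<longleftrightarrow> (\<forall>v. norm (fst z $ v) = 1) \<and> {v. fst z $ v \<noteq> 1} \<in> L \<and>
           (\<Prod>v\<in>UNIV. fst z $ v powi m v) = cis (2 * pi * snd z)"
  using toric_complex_iff[OF assms] by (auto simp: tcov_def)

definition link :: "'v \<Rightarrow> 'v set set \<Rightarrow> 'v set set" where
  "link v L = {\<sigma>. v \<notin> \<sigma> \<and> insert v \<sigma> \<in> L}"
definition deletion :: "'v \<Rightarrow> 'v set set \<Rightarrow> 'v set set" where
  "deletion v L = {\<sigma> \<in> L. v \<notin> \<sigma>}"

lemma down_link: "down L \<Longrightarrow> down (link v L)"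
  unfolding down_def link_def by (auto; metis insert_mono)
lemma down_deletion: "down L \<Longrightarrow> down (deletion v L)"
  unfolding down_def deletion_def by blast
lemma link_subset_deletion: "down L \<Longrightarrow> link v L \<subseteq> deletion v L"
  unfolding down_def deletion_def link_def by blast

lemma tcov_mono: "L \<subseteq> L' \<Longrightarrow> tcov m L \<subseteq> tcov m L'"
proof -
  assume "L \<subseteq> L'"
  then have "toric_complex L \<subseteq> toric_complex L'" unfolding toric_complex_def by (rule UN_mono) simp
  then show ?thesis by (auto simp: tcov_def)
qed

text \<open>Rotation of the \<open>v\<close>-th circle through the angle \<open>2 \<pi> a\<close>, lifted to the cyclic cover.\<close>

definition rot :: "('v::finite \<Rightarrow> int) \<Rightarrow> 'v \<Rightarrow> 'v pt \<times> real \<Rightarrow> 'v pt" where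
  "rot m v = (\<lambda>((x, s), a). (\<chi> u. if u = v then x $ u * cis (2 * pi * a) else x $ u, s + a * of_int (m v)))"

lemma rot_0: "rot m v (z, 0) = z"
  by (cases z) (simp add: rot_def vec_eq_iff)

lemma rot_int: "rot m v (z, of_int j) = deck (j * m v) z"
  by (cases z) (simp add: rot_def deck_def vec_eq_iff)

text \<open>A full turn ends at a translate of the starting point. The difference of the two ends is
  the origin of the weight \<open>t^m - 1\<close>.\<close>

lemma rot_1: "rot m v (z, 1) = deck (m v) z"
  using rot_int[of m v z 1] by simp

lemma rot_rot: "rot m v (rot m v (z, a), b) = rot m v (z, a + b)"
  by (cases z) (auto simp: rot_def vec_eq_iff algebra_simps cis_mult)

lemma rot_deck: "rot m v (deck j z, a) = deck j (rot m v (z, a))"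
  by (cases z) (auto simp: rot_def deck_def)

lemma continuous_rot: "continuous_on S (rot m v)"
proof -
  have "continuous_on S (\<lambda>p. if u = v then fst (fst p) $ u * cis (2 * pi * snd p) else fst (fst p) $ u)" for u
    by (cases "u = v") (auto intro!: continuous_intros)
  then show ?thesis
    unfolding rot_def case_prod_unfold
    by (intro continuous_on_Pair continuous_on_vec_lambda continuous_intros) auto
qed

lemma fst_rot: "fst (rot m v (z, a)) $ u = (if u = v then fst z $ v * cis (2 * pi * a) else fst z $ u)"
  by (cases z) (simp add: rot_def)

lemma snd_rot: "snd (rot m v (z, a)) = snd z + a * of_int (m v)"
  by (cases z) (simp add: rot_def)

lemma rot_tcov:
  assumes L: "down L" "down L'" and z: "z \<in> tcov m L"
    and S: "{u. fst (rot m v (z, a)) $ u \<noteq> 1} \<in> L'"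
  shows "rot m v (z, a) \<in> tcov m L'"
proof -
  have n: "norm (fst z $ u) = 1" for u
    using z by (auto simp: tcov_iff[OF L(1)])
  have npr: "(\<Prod>u\<in>UNIV. fst z $ u powi m u) = cis (2 * pi * snd z)"
    using z by (auto simp: tcov_iff[OF L(1)])
  have "fst (rot m v (z, a)) $ u powi m u
      = fst z $ u powi m u * (if u = v then cis (2 * pi * (a * of_int (m v))) else 1)" for u
    by (auto simp: fst_rot power_int_mult_distrib cis_power_int mult_ac)
  then have "(\<Prod>u\<in>UNIV. fst (rot m v (z, a)) $ u powi m u)
      = cis (2 * pi * snd z) * cis (2 * pi * (a * of_int (m v)))"
    by (simp add: prod.distrib npr)
  also have "\<dots> = cis (2 * pi * snd (rot m v (z, a)))"
    by (simp add: cis_mult snd_rot distrib_left)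
  finally show ?thesis
    using S n by (auto simp: tcov_iff[OF L(2)] fst_rot norm_mult)
qed

lemma rot_link:
  assumes L: "down L" and z: "z \<in> tcov m (link v L)"
  shows "rot m v (z, a) \<in> tcov m L"
proof (rule rot_tcov[OF down_link[OF L] L z])
  have S: "{u. fst z $ u \<noteq> 1} \<in> link v L" using z by (simp add: tcov_iff[OF down_link[OF L]])
  have "{u. fst (rot m v (z, a)) $ u \<noteq> 1} \<subseteq> insert v {u. fst z $ u \<noteq> 1}"
    by (auto simp: fst_rot)
  then show "{u. fst (rot m v (z, a)) $ u \<noteq> 1} \<in> L"
    using S L unfolding link_def down_def by blast
qed

lemma link_coord:
  assumes "down L" "z \<in> tcov m (link v L)" shows "fst z $ v = 1"
  using assms(2) unfolding tcov_iff[OF down_link[OF assms(1)]] by (auto simp: link_def)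

lemma tcov_deletion_iff:
  assumes "down L"
  shows "z \<in> tcov m (deletion v L) \<longleftrightarrow> z \<in> tcov m L \<and> fst z $ v = 1"
  unfolding tcov_iff[OF down_deletion[OF assms]] tcov_iff[OF assms] by (auto simp: deletion_def)

section \<open>Angular coordinates and the open cylinder over the link\<close>

lemma cis_eq_1: "cis (2 * pi * a) = 1 \<longleftrightarrow> (\<exists>n::int. a = of_int n)"
proof -
  have "cis (2 * pi * a) = cis 0 \<longleftrightarrow> (\<exists>j::int. 2 * pi * a = 0 + 2 * pi * j)"
    unfolding cis_conv_exp exp_eq by (simp add: complex_eq_iff algebra_simps)
  then show ?thesis by simp
qed

lemma cis_eq_minus_1:
  assumes "0 \<le> a" "a \<le> 1" "cis (2 * pi * a) = - 1" shows "a = 1 / 2"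
proof -
  have "cis (2 * pi * (a - 1/2)) = cis (2 * pi * a) * cis (- pi)"
    by (simp add: cis_mult algebra_simps)
  then have "cis (2 * pi * (a - 1/2)) = 1" using assms(3) by (simp add: cis.code complex_eq_iff)
  then obtain n :: int where "a - 1/2 = of_int n" by (auto simp: cis_eq_1)
  with assms have "n = 0" by linarith
  with \<open>a - 1/2 = of_int n\<close> show ?thesis by simp
qed

text \<open>The fraction of a full turn, in \<open>(0, 1)\<close>, at which a point of the circle minus \<open>1\<close> sits.\<close>

definition turn :: "complex \<Rightarrow> real" where
  "turn w = 1 / 2 + Arg (- w) / (2 * pi)"

lemma cis_turn:
  assumes "norm w = 1" shows "cis (2 * pi * turn w) = w"
proof -
  have "cis (2 * pi * turn w) = cis pi * cis (Arg (- w))"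
    by (simp add: turn_def cis_mult distrib_left del: cis_pi)
  also have "cis (Arg (- w)) = - w"
    using rcis_cmod_Arg[of "- w"] assms by (simp add: rcis_def)
  finally show ?thesis by simp
qed

lemma circle_nonpos:
  fixes w :: complex
  assumes "norm w = 1" "w \<in> \<real>\<^sub>\<le>\<^sub>0" shows "w = - 1"
proof -
  have "Re w \<le> 0" "Im w = 0" using assms(2) by (auto simp: complex_nonpos_Reals_iff)
  moreover from this have "\<bar>Re w\<bar> = 1" using assms(1) by (simp add: cmod_eq_Re)
  ultimately show ?thesis by (simp add: complex_eq_iff)
qed

lemma turn_bounds:
  assumes "norm w = 1" "w \<noteq> 1" shows "0 < turn w" "turn w < 1"
proof -
  have "turn w \<noteq> 0" "turn w \<noteq> 1" using cis_turn[OF assms(1)] assms(2) by auto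
  moreover have "- pi < Arg (- w)" "Arg (- w) \<le> pi" using Arg_bounded by auto
  then have "0 \<le> turn w" "turn w \<le> 1" by (auto simp: turn_def field_simps)
  ultimately show "0 < turn w" "turn w < 1" by auto
qed

text \<open>\<open>Arg\<close> jumps on the negative reals; the negation inside \<open>turn\<close>
  moves the jump to the excluded point 1.\<close>

lemma continuous_turn: "continuous_on {w :: complex. norm w = 1 \<and> w \<noteq> 1} turn"
proof -
  have "continuous_on {w :: complex. norm w = 1 \<and> w \<noteq> 1} (\<lambda>w. Arg (- w))"
  proof (rule continuous_on_compose2[OF continuous_on_Arg])
    show "uminus ` {w :: complex. norm w = 1 \<and> w \<noteq> 1} \<subseteq> - \<real>\<^sub>\<le>\<^sub>0"
    proof
      fix z assume "z \<in> uminus ` {w :: complex. norm w = 1 \<and> w \<noteq> 1}"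
      then have "norm z = 1" "z \<noteq> - 1" by auto
      then show "z \<in> - \<real>\<^sub>\<le>\<^sub>0" using circle_nonpos[of z] by blast
    qed
  qed (intro continuous_intros)
  then show ?thesis unfolding turn_def
    by (intro continuous_on_add continuous_on_divide continuous_on_const) auto
qed

lemma turn_cis:
  assumes "0 < a" "a < 1" shows "turn (cis (2 * pi * a)) = a"
proof -
  have "- cis (2 * pi * a) = cis (2 * pi * (a - 1/2))"
    using cis_mult[of "2 * pi * a" "- pi"] by (simp add: algebra_simps cis.code complex_eq_iff)
  then have "Arg (- cis (2 * pi * a)) = Arg (cis (2 * pi * (a - 1/2)))" by simp
  also have "\<dots> = 2 * pi * (a - 1/2)"
  proof (rule Arg_cis)
    have "pi * a < pi * 1" "pi * 0 < pi * a" using assms by (intro mult_strict_left_mono; simp)+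
    then show "2 * pi * (a - 1/2) \<in> {- pi<..pi}" by (simp add: algebra_simps)
  qed
  finally show ?thesis by (simp add: turn_def field_simps)
qed

text \<open>\<open>U\<close> and \<open>V\<close> exclude the values 1 and -1 of the
  \<open>v\<close>-th coordinate. Rotating points of the cover of the link through fractions of a
  turn in (0, 1) parametrises \<open>U\<close>, with inverse \<open>r\<close> given by rotating back
  by \<open>turn\<close>; the slice 1/2 is the value -1.\<close>

lemma toric_cylinder:
  fixes c :: "('v::finite pt, 'k::field) sing_chain" and m :: "'v \<Rightarrow> int" and v :: 'v
  assumes L: "down L"
  defines "V \<equiv> {z \<in> tcov m L. fst z $ v \<noteq> - 1}"
  assumes c: "c \<in> SC (k - 1) (tcov m (link v L))" "bd (k - 1) c = 0"
    and y: "y \<in> SC (k + 1) (tcov m L)" "bd (k + 1) y - pri (k - 1) (rot m v) c \<in> SC k V"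
  shows "\<exists>g\<in>SC k (tcov m (link v L)). bd k g = c \<and>
           (\<exists>u\<in>SC (k + 2) (tcov m L). y + pri k (rot m v) g - bd (k + 2) u \<in> SC (k + 1) V)"
proof -
  let ?X = "tcov m L" and ?Y = "tcov m (link v L)" and ?q = "rot m v"
  define U where "U = {z \<in> ?X. fst z $ v \<noteq> 1}"
  define r where "r z = (rot m v (z, - turn (fst z $ v)), turn (fst z $ v))" for z :: "'v pt"
  have nX: "norm (fst z $ u) = 1" if "z \<in> ?X" for z u using that by (simp add: tcov_iff[OF L])
  have contv: "continuous_on ?X (\<lambda>z. fst z $ v)" by (intro continuous_intros)
  have "U = ?X \<inter> (\<lambda>z. fst z $ v) -` (- {1})" "V = ?X \<inter> (\<lambda>z. fst z $ v) -` (- {- 1})"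
    by (auto simp: U_def V_def)
  then have op: "openin (top_of_set ?X) U" "openin (top_of_set ?X) V"
    using continuous_openin_preimage_gen[OF contv] by (metis open_Compl closed_singleton)+
  have cov: "?X \<subseteq> U \<union> V" by (auto simp: U_def V_def)
  have qc: "fst (?q (z, a)) $ v = cis (2 * pi * a)" if "z \<in> ?Y" for z a
    using link_coord[OF L that] by (simp add: fst_rot)
  have qX: "?q ` (?Y \<times> {0..1}) \<subseteq> ?X" using rot_link[OF L] by auto
  have qU: "?q ` (?Y \<times> {0<..<1}) \<subseteq> U"
  proof -
    have "cis (2 * pi * a) \<noteq> 1" if "0 < a" "a < 1" for a
      using that by (auto simp: cis_eq_1)
    then show ?thesis using rot_link[OF L] qc by (auto simp: U_def)
  qed
  have qV: "?q ` (?Y \<times> ({0..1} - {1/2})) \<subseteq> V"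
    using rot_link[OF L] qc cis_eq_minus_1 by (auto simp: V_def)
  have rc: "fst (rot m v (z, - turn (fst z $ v))) $ v = 1" if "z \<in> U" for z
  proof -
    have "fst z $ v = cis (2 * pi * turn (fst z $ v))" using cis_turn nX that by (simp add: U_def)
    then have "fst z $ v * cis (2 * pi * - turn (fst z $ v)) = 1"
      by (metis cis_mult add.right_inverse cis_zero mult_minus_right)
    then show ?thesis by (simp add: fst_rot)
  qed
  have rY: "rot m v (z, - turn (fst z $ v)) \<in> ?Y" if "z \<in> U" for z
  proof (rule rot_tcov[OF L down_link[OF L]])
    show "z \<in> ?X" using that by (simp add: U_def)
    then have "{u. fst z $ u \<noteq> 1} \<in> L" by (simp add: tcov_iff[OF L])
    moreover have "insert v {u. fst (rot m v (z, - turn (fst z $ v))) $ u \<noteq> 1} = {u. fst z $ u \<noteq> 1}"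
      using that by (auto simp: fst_rot U_def)
    ultimately show "{u. fst (rot m v (z, - turn (fst z $ v))) $ u \<noteq> 1} \<in> link v L"
      using rc[OF that] by (auto simp: link_def)
  qed
  have t01: "turn (fst z $ v) \<in> {0<..<1}" if "z \<in> U" for z
    using turn_bounds nX that by (auto simp: U_def)
  have rU: "r ` U \<subseteq> ?Y \<times> {0<..<1}" using rY t01 by (auto simp: r_def)
  have rUV: "r ` (U \<inter> V) \<subseteq> ?Y \<times> ({0..1} - {1/2})"
  proof -
    have "turn (fst z $ v) \<noteq> 1/2" if "z \<in> U" "z \<in> V" for z
    proof
      assume h: "turn (fst z $ v) = 1/2"
      have "cis (2 * pi * turn (fst z $ v)) = fst z $ v" using that nX by (intro cis_turn) (simp add: U_def)
      then have "fst z $ v = - 1" unfolding h by simp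
      with that show False by (simp add: V_def)
    qed
    then show ?thesis using rY t01 by (intro image_subsetI) (simp add: r_def less_imp_le)
  qed
  have contt: "continuous_on U (\<lambda>z. turn (fst z $ v))"
    by (rule continuous_on_compose2[OF continuous_turn])
      (use nX in \<open>auto intro!: continuous_intros simp: U_def\<close>)
  have contr: "continuous_on U r"
    unfolding r_def
    by (intro continuous_on_Pair contt continuous_on_compose2[OF continuous_rot[of UNIV]] continuous_on_id continuous_on_minus) auto
  have qr: "?q (r z) = z" if "z \<in> U" for z
    by (simp add: r_def rot_rot rot_0)
  have rq: "r (?q e) = e" if e: "e \<in> ?Y \<times> {0<..<1}" for e
  proof -
    obtain z a where za: "e = (z, a)" "z \<in> ?Y" "0 < a" "a < 1" using e by auto
    then show ?thesis by (simp add: r_def qc turn_cis rot_rot rot_0)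
  qed
  show ?thesis
    by (rule cylinder_cone[OF op cov continuous_rot qX qU qV contr rU rUV qr rq c y])
qed

text \<open>Away from -1 the \<open>v\<close>-th coordinate can be turned back to 1 along the
  shorter arc, and \<open>rot\<close> lifts this to the cover. On the deletion the angle is 0 and
  nothing moves.\<close>

lemma toric_deformation:
  fixes y :: "('v::finite pt, 'k::field) sing_chain" and m :: "'v \<Rightarrow> int" and v :: 'v
  assumes L: "down L"
  defines "V \<equiv> {z \<in> tcov m L. fst z $ v \<noteq> - 1}"
  assumes y: "y \<in> SC k V" "bd k y \<in> SC (k - 1) (tcov m (deletion v L))"
  shows "\<exists>z\<in>SC k (tcov m (deletion v L)). \<exists>u\<in>SC (k + 1) V. y - z = bd (k + 1) u"
proof -
  let ?X = "tcov m L" and ?Z = "tcov m (deletion v L)"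
  let ?A = "\<lambda>z::'v pt. Arg (fst z $ v)"
  define G where "G = (\<lambda>(z, b). rot m v (z, - b * (?A z / (2 * pi))))"
  have nV: "norm (fst z $ u) = 1" if "z \<in> V" for z u using that by (simp add: V_def tcov_iff[OF L])
  have Gc: "fst (G (z, b)) $ v = cis ((1 - b) * ?A z)" if "z \<in> V" for z b
  proof -
    have "fst z $ v = cis (?A z)" using rcis_cmod_Arg[of "fst z $ v"] nV[OF that] by (simp add: rcis_def)
    then have "fst (G (z, b)) $ v = cis (?A z) * cis (- b * ?A z)"
      by (simp add: G_def fst_rot)
    also have "\<dots> = cis ((1 - b) * ?A z)" by (simp add: cis_mult algebra_simps)
    finally show ?thesis .
  qed
  have A1: "?A z = 0" if "fst z $ v = 1" for z using that by simp
  have Apos: "\<bar>?A z\<bar> < pi" if "z \<in> V" for z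
  proof -
    have "?A z \<noteq> pi"
    proof
      assume "?A z = pi"
      then have "fst z $ v = - 1" using rcis_cmod_Arg[of "fst z $ v"] nV[OF that] by (simp add: rcis_def)
      with that show False by (simp add: V_def)
    qed
    then show ?thesis using Arg_bounded[of "fst z $ v"] by auto
  qed
  have GX: "G (z, b) \<in> ?X" if "z \<in> V" for z b
  proof -
    have zX: "z \<in> ?X" using that by (simp add: V_def)
    have "{u. fst (rot m v (z, - b * (?A z / (2 * pi)))) $ u \<noteq> 1} \<subseteq> {u. fst z $ u \<noteq> 1}"
      using A1 by (auto simp: fst_rot split: if_splits)
    moreover have "{u. fst z $ u \<noteq> 1} \<in> L" using zX by (simp add: tcov_iff[OF L])
    ultimately have "{u. fst (rot m v (z, - b * (?A z / (2 * pi)))) $ u \<noteq> 1} \<in> L"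
      by (metis L downD)
    from rot_tcov[OF L L zX this] show ?thesis by (simp add: G_def)
  qed
  have GV: "G (z, b) \<in> V" if "z \<in> V" "b \<in> {0..1}" for z b
  proof -
    have "cis ((1 - b) * ?A z) \<noteq> - 1"
    proof
      assume h: "cis ((1 - b) * ?A z) = - 1"
      have "\<bar>(1 - b) * ?A z\<bar> \<le> \<bar>?A z\<bar>"
        using that(2) by (simp add: abs_mult mult_left_le_one_le)
      with Apos[OF that(1)] have *: "\<bar>(1 - b) * ?A z\<bar> < pi" by linarith
      then have "Arg (cis ((1 - b) * ?A z)) = (1 - b) * ?A z" by (intro Arg_cis) auto
      with h * show False using Arg_of_real[of "- 1"] by simp
    qed
    then show ?thesis using GX[OF that(1)] Gc[OF that(1)] by (simp add: V_def)
  qed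
  have G0: "G (z, 0) = z" for z by (simp add: G_def rot_0)
  have G1: "G (z, 1) \<in> ?Z" if "z \<in> V" for z
    using GX[OF that] Gc[OF that] by (simp add: tcov_deletion_iff[OF L])
  have GZ: "G (z, b) \<in> ?Z" if "z \<in> ?Z" for z b
    using that A1 by (simp add: G_def tcov_deletion_iff[OF L] rot_0)
  have ZV: "?Z \<subseteq> V" by (auto simp: tcov_deletion_iff[OF L] V_def)
  have contA: "continuous_on V ?A"
  proof (rule continuous_on_compose2[OF continuous_on_Arg])
    show "(\<lambda>z. fst z $ v) ` V \<subseteq> - \<real>\<^sub>\<le>\<^sub>0"
    proof (rule image_subsetI)
      fix z assume z: "z \<in> V"
      then have "fst z $ v \<noteq> - 1" by (simp add: V_def)
      then show "fst z $ v \<in> - \<real>\<^sub>\<le>\<^sub>0" using circle_nonpos[OF nV[OF z]] by blast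
    qed
  qed (intro continuous_intros)
  have contG: "continuous_on (V \<times> {0..1}) G"
  proof -
    have "continuous_on (V \<times> {0..1}) (\<lambda>p. ?A (fst p))"
      by (rule continuous_on_compose2[OF contA]) (auto intro!: continuous_intros)
    then have "continuous_on (V \<times> {0..1}) (\<lambda>p. - snd p * (?A (fst p) / (2 * pi)))"
      by (intro continuous_on_mult continuous_on_minus continuous_on_snd continuous_on_id
          continuous_on_divide continuous_on_const) auto
    then have "continuous_on (V \<times> {0..1}) (\<lambda>p. (fst p, - snd p * (?A (fst p) / (2 * pi))))"
      by (intro continuous_on_Pair continuous_on_fst continuous_on_id)
    then show ?thesis
      unfolding G_def case_prod_unfold
      by (intro continuous_on_compose2[OF continuous_rot[of UNIV]]) auto
  qed
  show ?thesis
  proof (rule deformation_cone[OF ZV contG _ G0 G1 GZ y])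
    show "G ` (V \<times> {0..1}) \<subseteq> V" using GV by blast
  qed
qed

section \<open>The cellular chain map\<close>

definition vtx :: "nat \<Rightarrow> 'v::finite" where
  "vtx = inv_into UNIV vnum"

lemma vnum_vtx: "N < CARD('v) \<Longrightarrow> vnum (vtx N :: 'v::finite) = N"
  unfolding vtx_def using bij_vnum by (intro f_inv_into_f) (auto simp: bij_betw_def)

text \<open>The induction removes the highest of the first \<open>N\<close> vertices, at which the
  sign \<open>sg\<close> is 1.\<close>

definition below :: "nat \<Rightarrow> 'v::finite set set \<Rightarrow> bool" where
  "below N L \<longleftrightarrow> (\<forall>\<sigma>\<in>L. \<forall>v\<in>\<sigma>. vnum v < N)"

lemma below_link: "below (Suc N) L \<Longrightarrow> vnum v = N \<Longrightarrow> below N (link v L)"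
  unfolding below_def link_def
  by (auto simp: less_Suc_eq) (metis insertCI less_SucE vnum_eq_iff)

lemma below_deletion: "below (Suc N) L \<Longrightarrow> vnum v = N \<Longrightarrow> below N (deletion v L)"
  unfolding below_def deletion_def by (auto simp: less_Suc_eq) (metis less_SucE vnum_eq_iff)

definition base_pt :: "int \<Rightarrow> 'v::finite pt" where
  "base_pt j = (\<chi> u. 1, of_int j)"

definition const_simp :: "nat \<Rightarrow> int \<Rightarrow> (nat \<Rightarrow> real) \<Rightarrow> 'v::finite pt" where
  "const_simp n j = restrict (\<lambda>_. base_pt j) (standard_simplex n)"

text \<open>The lift of a product cell: the base point is swept around the circles of the vertices
  of \<sigma> in increasing order, one prism for each.\<close>

primrec cell :: "('v::finite \<Rightarrow> int) \<Rightarrow> nat \<Rightarrow> 'v set \<Rightarrow> ('v pt, 'k::field) sing_chain" where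
  "cell m 0 \<sigma> = Poly_Mapping.single (const_simp 0 0) 1"
| "cell m (Suc N) \<sigma> = (if vtx N \<in> \<sigma>
     then pri (int (card \<sigma>) - 1) (rot m (vtx N)) (cell m N (\<sigma> - {vtx N})) else cell m N \<sigma>)"

definition act :: "int \<Rightarrow> (int \<Rightarrow>\<^sub>0 'k::field) \<Rightarrow> ('a \<times> real, 'k) sing_chain \<Rightarrow> ('a \<times> real, 'k) sing_chain" where
  "act k p c = kZ_act (nat k) deck p c"

lemma deck_add: "deck (i + j) = deck i \<circ> deck j"
  by (rule ext) (simp add: deck_def case_prod_unfold)

lemma act_linear:
  "act k p 0 = 0" "act k 0 c = 0" "act k p (c + d) = act k p c + act k p d" "act k (p + q) c = act k p c + act k q c"
  by (auto simp: act_def kZ_act_add kZ_act_plus kZ_act_def[of _ _ 0]) (simp add: kZ_act_def)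

lemma act_diff: "act k p (c - d) = act k p c - act k p d"
  using act_linear(3)[of k p "c - d" d] by simp

lemma act_diff_left: "act k (p - q) c = act k p c - act k q c"
  using act_linear(4)[of k "p - q" q c] by simp

lemma act_neg: "act k p (- c) = - act k p c" "act k (- p) c = - act k p c"
  using act_diff[of k p 0 c] act_diff_left[of k 0 p c] by (simp_all add: act_linear)

lemma act_mult: "act k (p * q) c = act k p (act k q c)"
  unfolding act_def by (rule kZ_act_mult) (rule deck_add)

lemma act_single: "act k (Poly_Mapping.single j a) c = pm_scale a (push k (deck j) c)"
  by (simp add: act_def kZ_act_single)

lemma act_1: "c \<in> SC k A \<Longrightarrow> act k 1 c = c"
  using push_ident[of c k A "deck 0"] unfolding single_one[symmetric] act_single
  by (simp add: deck_def case_prod_unfold)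

lemma deck_tcov: "z \<in> tcov m L \<Longrightarrow> deck j z \<in> tcov m L"
proof -
  assume z: "z \<in> tcov m L"
  have "cis (2 * pi * (s + of_int j)) = cis (2 * pi * s)" for s
  proof -
    have "cis (2 * pi * (s + of_int j)) = cis (2 * pi * s) * cis (2 * pi * of_int j)"
      by (simp only: cis_mult distrib_left)
    moreover have "cis (2 * pi * of_int j) = 1" unfolding cis_eq_1 by blast
    ultimately show ?thesis by (simp only: mult_1_right)
  qed
  with z show ?thesis by (auto simp: tcov_def deck_def)
qed

lemma continuous_deck: "continuous_on A (deck j :: 'a::topological_space \<times> real \<Rightarrow> _)"
  unfolding deck_def case_prod_unfold by (intro continuous_intros)

lemma act_SC: "c \<in> SC k (tcov m L) \<Longrightarrow> act k p c \<in> SC k (tcov m L)"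
  unfolding act_def kZ_act_def
  by (intro pm.subspace_sum[OF SC_subspace] SC_scale push_SC continuous_deck) (auto intro: deck_tcov)

lemma bd_scale: "bd k (pm_scale a c) = pm_scale a (bd k c)"
  by (simp add: bd_def sing_bd_scale)

lemma act_bd:
  assumes "c \<in> SC k A" shows "bd k (act k p c) = act (k - 1) p (bd k c)"
proof (induction rule: pm_induct[of _ p])
  case (3 j a)
  show ?case by (simp add: act_single bd_scale push_bd[OF assms])
qed (simp_all add: act_linear bd_linear)

text \<open>Valid because \<open>H\<close> commutes with deck transformations. The bound on
  \<open>k\<close> matters, since for negative \<open>k\<close> the numbers \<open>nat k\<close> and
  \<open>nat (k + 1)\<close> coincide.\<close>

lemma act_pri:
  assumes "0 \<le> k" and H: "\<And>j z s. H (deck j z, s) = deck j (H (z, s))"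
  shows "act (k + 1) p (pri k H c) = pri k H (act k p c)"
proof (induction rule: pm_induct[of _ p])
  case (3 j a)
  have "sing_push (Suc (nat k)) (deck j) (prism (nat k) H c) = prism (nat k) H (sing_push (nat k) (deck j) c)"
    unfolding prism_push push_prism by (rule arg_cong[of _ _ "\<lambda>h. prism (nat k) h c"]) (auto simp: H)
  then show ?case using assms(1)
    by (simp add: act_single prism_linear Suc_nat_eq_nat_zadd1 add.commute)
qed (simp_all add: act_linear prism_linear)

definition Phi :: "('v::finite \<Rightarrow> int) \<Rightarrow> nat \<Rightarrow> int \<Rightarrow> ('v set \<Rightarrow> int \<Rightarrow>\<^sub>0 'k) \<Rightarrow> ('v pt, 'k::field) sing_chain" where
  "Phi m N k x = (\<Sum>\<sigma>\<in>UNIV. act k (x \<sigma>) (cell m N \<sigma>))"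

definition lamt :: "('v::finite \<Rightarrow> int) \<Rightarrow> 'v \<Rightarrow> int \<Rightarrow>\<^sub>0 'k::field" where
  "lamt m v = Poly_Mapping.single (m v) 1 - 1"

lemma Phi_0: "Phi m N k (\<lambda>\<sigma>. 0) = 0"
  by (simp add: Phi_def act_linear)
lemma Phi_add: "Phi m N k (\<lambda>\<sigma>. x \<sigma> + y \<sigma>) = Phi m N k x + Phi m N k y"
  by (simp add: Phi_def act_linear sum.distrib)
lemma Phi_neg: "Phi m N k (\<lambda>\<sigma>. - x \<sigma>) = - Phi m N k x"
  by (simp add: Phi_def act_neg sum_negf)
lemma act_sum: "act k p (sum f A) = (\<Sum>i\<in>A. act k p (f i))"
  by (induction A rule: infinite_finite_induct) (auto simp: act_linear)
lemma Phi_scale: "Phi m N k (\<lambda>\<sigma>. p * x \<sigma>) = act k p (Phi m N k x)"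
  by (simp add: Phi_def act_mult act_sum)

section \<open>Splitting off the last vertex\<close>

definition part1 :: "'v \<Rightarrow> ('v set \<Rightarrow> 'a::zero) \<Rightarrow> 'v set \<Rightarrow> 'a" where
  "part1 v x \<tau> = (if v \<in> \<tau> then 0 else x (insert v \<tau>))"
definition part0 :: "'v \<Rightarrow> ('v set \<Rightarrow> 'a::zero) \<Rightarrow> 'v set \<Rightarrow> 'a" where
  "part0 v x \<tau> = (if v \<in> \<tau> then 0 else x \<tau>)"

lemma parts_eqI:
  assumes "part1 v x = part1 v y" "part0 v x = part0 v y" shows "x = y"
proof
  fix \<sigma>
  show "x \<sigma> = y \<sigma>"
    using fun_cong[OF assms(1), of "\<sigma> - {v}"] fun_cong[OF assms(2), of \<sigma>]
    by (auto simp: part1_def part0_def insert_absorb split: if_splits)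
qed

lemma part1_ch: "x \<in> ch L k \<Longrightarrow> part1 v x \<in> ch (link v L) (k - 1)"
  by (auto simp: ch_def part1_def link_def split: if_splits)
lemma part0_ch: "x \<in> ch L k \<Longrightarrow> part0 v x \<in> ch (deletion v L) k"
  by (auto simp: ch_def part0_def deletion_def split: if_splits)

text \<open>\<open>v\<close> exceeds all other vertices of \<open>L\<close>, so adding it to a set
  flips the sign of every other contraction. Together with \<open>part0_kbd\<close>, where
  \<open>v\<close> contracts with sign 1, this presents the complex of \<open>L\<close> as the cone
  of \<open>lam v\<close> from the complex of the link to that of the deletion.\<close>

lemma part1_kbd:
  assumes x: "x \<in> ch L k" and L: "below (Suc (vnum v)) L"
  shows "part1 v (kbd lam x) = (\<lambda>\<tau>. - kbd lam (part1 v x) \<tau>)"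
proof
  fix \<tau>
  show "part1 v (kbd lam x) \<tau> = - kbd lam (part1 v x) \<tau>"
  proof (cases "v \<in> \<tau>")
    case True
    then show ?thesis by (auto simp: part1_def kbd_def con_def intro!: sum.neutral)
  next
    case False
    have "con u x (insert v \<tau>) = - con u (part1 v x) \<tau>" for u
    proof (cases "u \<in> insert v \<tau> \<or> x (insert u (insert v \<tau>)) = 0")
      case True
      then show ?thesis by (auto simp: con_def part1_def insert_commute)
    next
      case False': False
      then have "insert u (insert v \<tau>) \<in> L" using x by (auto simp: ch_def)
      then have "vnum u < Suc (vnum v)" using L by (auto simp: below_def)
      moreover have "vnum u \<noteq> vnum v" using False' by auto
      ultimately have "vnum u < vnum v" by linarith
      then show ?thesis using False False' by (auto simp: con_def part1_def insert_commute sg_insert)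
    qed
    then show ?thesis using False by (simp add: part1_def[of v "kbd lam x"] kbd_def sum_negf)
  qed
qed

lemma part0_kbd:
  assumes x: "x \<in> ch L k" and L: "below (Suc (vnum v)) L"
  shows "part0 v (kbd lam x) = (\<lambda>\<tau>. kbd lam (part0 v x) \<tau> + lam v * part1 v x \<tau>)"
proof
  fix \<tau>
  show "part0 v (kbd lam x) \<tau> = kbd lam (part0 v x) \<tau> + lam v * part1 v x \<tau>"
  proof (cases "v \<in> \<tau>")
    case True
    then show ?thesis by (auto simp: part0_def part1_def kbd_def con_def intro!: sum.neutral)
  next
    case False
    have "con u x \<tau> = con u (part0 v x) \<tau> + (if u = v then part1 v x \<tau> else 0)" for u
    proof (cases "u = v")
      case True
      have "sg v \<tau> * x (insert v \<tau>) = x (insert v \<tau>)"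
      proof (cases "x (insert v \<tau>) = 0")
        case False
        then have "insert v \<tau> \<in> L" using x by (auto simp: ch_def)
        then have "vnum u < Suc (vnum v)" if "u \<in> \<tau>" for u
          using L that unfolding below_def by (meson insertCI)
        then have "{u \<in> \<tau>. vnum v < vnum u} = {}" by fastforce
        then show ?thesis by (simp only: sg_def card.empty) simp
      qed simp
      then show ?thesis using True False by (simp add: con_def part0_def part1_def)
    qed (use False in \<open>simp add: con_def part0_def\<close>)
    then have "kbd lam x \<tau> = kbd lam (part0 v x) \<tau> + (\<Sum>u\<in>UNIV. lam u * (if u = v then part1 v x \<tau> else 0))"
      unfolding kbd_def by (simp only: distrib_left sum.distrib)
    also have "(\<Sum>u\<in>UNIV. lam u * (if u = v then part1 v x \<tau> else 0)) = lam v * part1 v x \<tau>"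
      by (simp add: if_distrib cong: if_cong)
    finally show ?thesis using False by (simp add: part0_def[of v "kbd lam x"])
  qed
qed

text \<open>The topological side of this splitting: cells containing the last vertex are prisms over
  cells of the link. Homogeneity of \<open>x\<close> matches the prism degree with the size of the
  simplex.\<close>

lemma Phi_parts:
  fixes x :: "'v::finite set \<Rightarrow> int \<Rightarrow>\<^sub>0 'k::field"
  assumes x: "x \<in> ch L k"
  shows "Phi m (Suc N) k x = pri (k - 1) (rot m (vtx N)) (Phi m N (k - 1) (part1 (vtx N) x)) + Phi m N k (part0 (vtx N) x)"
proof -
  let ?v = "vtx N :: 'v" and ?P = "pri (k - 1) (rot m (vtx N))"
  let ?f = "\<lambda>\<sigma>. act k (x \<sigma>) (cell m (Suc N) \<sigma>)"
  have U: "(UNIV :: 'v set set) = {\<sigma>. ?v \<in> \<sigma>} \<union> {\<sigma>. ?v \<notin> \<sigma>}" by auto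
  have "Phi m (Suc N) k x = sum ?f {\<sigma>. ?v \<in> \<sigma>} + sum ?f {\<sigma>. ?v \<notin> \<sigma>}"
    unfolding Phi_def by (subst U, rule sum.union_disjoint) auto
  also have "sum ?f {\<sigma>. ?v \<notin> \<sigma>} = Phi m N k (part0 ?v x)"
    unfolding Phi_def by (rule sum.mono_neutral_cong_left) (auto simp: part0_def act_linear)
  also have "sum ?f {\<sigma>. ?v \<in> \<sigma>} = (\<Sum>\<tau>\<in>{\<tau>. ?v \<notin> \<tau>}. ?f (insert ?v \<tau>))"
    by (rule sum.reindex_bij_witness[of _ "insert ?v" "\<lambda>\<sigma>. \<sigma> - {?v}"]) (auto simp: insert_absorb)
  also have "\<dots> = (\<Sum>\<tau>\<in>{\<tau>. ?v \<notin> \<tau>}. ?P (act (k - 1) (part1 ?v x \<tau>) (cell m N \<tau>)))"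
  proof (rule sum.cong[OF HOL.refl])
    fix \<tau> assume "\<tau> \<in> {\<tau>. ?v \<notin> \<tau>}"
    then have v: "?v \<notin> \<tau>" by simp
    show "?f (insert ?v \<tau>) = ?P (act (k - 1) (part1 ?v x \<tau>) (cell m N \<tau>))"
    proof (cases "x (insert ?v \<tau>) = 0")
      case False
      then have k: "int (card (insert ?v \<tau>)) = k" using x by (auto simp: ch_def)
      then have k1: "0 \<le> k - 1" "int (card \<tau>) = k - 1" using v by auto
      have "?f (insert ?v \<tau>) = act k (x (insert ?v \<tau>)) (?P (cell m N \<tau>))"
        using v k by simp
      also have "\<dots> = ?P (act (k - 1) (x (insert ?v \<tau>)) (cell m N \<tau>))"
        using act_pri[OF k1(1), of "rot m ?v" "x (insert ?v \<tau>)" "cell m N \<tau>"] by (simp add: rot_deck)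
      finally show ?thesis using v by (simp add: part1_def)
    qed (simp add: part1_def act_linear prism_linear)
  qed
  also have "\<dots> = ?P (\<Sum>\<tau>\<in>{\<tau>. ?v \<notin> \<tau>}. act (k - 1) (part1 ?v x \<tau>) (cell m N \<tau>))"
    by (induction "{\<tau>. ?v \<notin> \<tau>}" rule: infinite_finite_induct) (simp_all add: prism_def kop_sum)
  also have "(\<Sum>\<tau>\<in>{\<tau>. ?v \<notin> \<tau>}. act (k - 1) (part1 ?v x \<tau>) (cell m N \<tau>)) = Phi m N (k - 1) (part1 ?v x)"
    unfolding Phi_def by (rule sum.mono_neutral_left) (auto simp: part1_def act_linear)
  finally show ?thesis .
qed

lemma base_pt_tcov: "{} \<in> L \<Longrightarrow> base_pt j \<in> tcov m L"
  by (auto simp: tcov_def base_pt_def toric_complex_def cis_eq_1[symmetric])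

lemma const_simp: "base_pt j \<in> A \<Longrightarrow> singular_simplex n (top_of_set A) (const_simp n j)"
  unfolding singular_simplex_def const_simp_def by (auto simp: continuous_map_in_subtopology)

lemma cell_SC:
  fixes L :: "'v::finite set set"
  assumes "N \<le> CARD('v)" "down L" "below N L" "\<sigma> \<in> L"
  shows "(cell m N \<sigma> :: ('v pt, 'k::field) sing_chain) \<in> SC (int (card \<sigma>)) (tcov m L)"
  using assms
proof (induction N arbitrary: L \<sigma>)
  case 0
  then have "\<sigma> = {}" by (auto simp: below_def)
  moreover have "singular_simplex 0 (top_of_set (tcov m L)) (const_simp 0 0)"
    using 0 \<open>\<sigma> = {}\<close> by (intro const_simp base_pt_tcov) simp
  ultimately show ?case by (simp add: SC_def sing_chains_def)
next
  case (Suc N)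
  let ?v = "vtx N :: 'v"
  have v: "vnum ?v = N" using Suc.prems by (intro vnum_vtx) simp
  show ?case
  proof (cases "?v \<in> \<sigma>")
    case True
    let ?\<tau> = "\<sigma> - {?v}"
    have "?\<tau> \<in> link ?v L" using True Suc.prems by (simp add: link_def insert_absorb)
    then have "(cell m N ?\<tau> :: ('v pt, 'k) sing_chain) \<in> SC (int (card ?\<tau>)) (tcov m (link ?v L))"
      using Suc.prems v by (intro Suc.IH down_link below_link) auto
    moreover have "rot m ?v ` (tcov m (link ?v L) \<times> {0..1}) \<subseteq> tcov m L"
      using rot_link[OF Suc.prems(2)] by (intro image_subsetI) (metis SigmaE)
    ultimately have "pri (int (card ?\<tau>)) (rot m ?v) (cell m N ?\<tau> :: ('v pt, 'k) sing_chain) \<in> SC (int (card ?\<tau>) + 1) (tcov m L)"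
      by (intro pri_SC continuous_rot)
    moreover have "int (card ?\<tau>) = int (card \<sigma>) - 1"
      using True card_Suc_Diff1[of \<sigma> ?v] by (simp del: card_Diff_insert)
    ultimately show ?thesis using True by simp
  next
    case False
    then have "\<sigma> \<in> deletion ?v L" using Suc.prems by (simp add: deletion_def)
    then have "(cell m N \<sigma> :: ('v pt, 'k) sing_chain) \<in> SC (int (card \<sigma>)) (tcov m (deletion ?v L))"
      using Suc.prems v by (intro Suc.IH down_deletion below_deletion) auto
    then show ?thesis using False tcov_mono[of "deletion ?v L" L m] by (auto simp: deletion_def intro: SC_mono)
  qed
qed

lemma Phi_SC:
  fixes L :: "'v::finite set set"
  assumes "N \<le> CARD('v)" "down L" "below N L" "x \<in> ch L k"
  shows "Phi m N k x \<in> SC k (tcov m L)"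
  unfolding Phi_def
proof (intro pm.subspace_sum[OF SC_subspace])
  fix \<sigma>
  show "act k (x \<sigma>) (cell m N \<sigma>) \<in> SC k (tcov m L)"
  proof (cases "x \<sigma> = 0")
    case False
    then have "\<sigma> \<in> L" "int (card \<sigma>) = k" using assms(4) by (auto simp: ch_def)
    then show ?thesis using cell_SC[OF assms(1-3)] by (auto intro: act_SC)
  qed (simp add: act_linear)
qed

lemma act_lamt:
  assumes "A \<in> SC k (tcov m (L))"
  shows "push k (\<lambda>z. rot m v (z, 1)) A - push k (\<lambda>z. rot m v (z, 0)) A = act k (lamt m v) A"
proof -
  have "push k (\<lambda>z. rot m v (z, 0)) A = A" by (rule push_ident[OF assms]) (rule rot_0)
  moreover have "push k (\<lambda>z. rot m v (z, 1)) A = push k (deck (m v)) A" by (simp only: rot_1)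
  ultimately show ?thesis by (simp add: lamt_def act_diff_left act_single act_1[OF assms])
qed

lemma kbd_base:
  assumes "below 0 L" "x \<in> ch L k" shows "kbd lam x = (\<lambda>\<rho>. 0)"
proof -
  have "x (insert v \<rho>) = 0" for v \<rho>
  proof (rule ccontr)
    assume "x (insert v \<rho>) \<noteq> 0"
    then have "insert v \<rho> \<in> L" using assms(2) by (auto simp: ch_def)
    then show False using assms(1) by (metis below_def insertI1 not_less_zero)
  qed
  then show ?thesis by (intro ext) (auto simp: kbd_def con_def intro!: sum.neutral)
qed

text \<open>In the prism formula the two ends give the action of \<open>lamt m v\<close> on the link
  part, as in \<open>part0_kbd\<close>, and the remaining term gives the minus sign of
  \<open>part1_kbd\<close>.\<close>

lemma Phi_bd:
  fixes L :: "'v::finite set set"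
  assumes "N \<le> CARD('v)" "down L" "below N L" "x \<in> ch L k"
  shows "bd k (Phi m N k x) = Phi m N (k - 1) (kbd (lamt m) x)"
  using assms
proof (induction N arbitrary: L x k)
  case 0
  have "bd k (Phi m 0 k x) = 0"
  proof (cases "k \<le> 0")
    case False
    have "x \<sigma> = 0" for \<sigma> using False 0 by (auto simp: ch_def below_def)
    then have "x = (\<lambda>\<sigma>. 0)" by blast
    then show ?thesis by (simp add: Phi_0 bd_linear)
  qed (simp add: bd_def)
  then show ?case using kbd_base[OF 0(3,4)] by (simp add: Phi_0)
next
  case (Suc N)
  let ?v = "vtx N :: 'v"
  let ?P = "\<lambda>k. pri k (rot m ?v)" and ?a = "part1 ?v x" and ?b = "part0 ?v x"
  have v: "vnum ?v = N" using Suc.prems by (intro vnum_vtx) simp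
  have N: "N \<le> CARD('v)" using Suc.prems by simp
  have lk: "down (link ?v L)" "below N (link ?v L)" and dl: "down (deletion ?v L)" "below N (deletion ?v L)"
    using Suc.prems v by (auto intro: down_link below_link down_deletion below_deletion)
  have a: "?a \<in> ch (link ?v L) (k - 1)" and b: "?b \<in> ch (deletion ?v L) k"
    using Suc.prems by (auto intro: part1_ch part0_ch)
  have L': "below (Suc (vnum ?v)) L" using Suc.prems v by simp
  note A = Phi_SC[OF N lk a, of m]
  have "bd k (Phi m (Suc N) k x) = bd (k - 1 + 1) (?P (k - 1) (Phi m N (k - 1) ?a)) + bd k (Phi m N k ?b)"
    by (simp add: Phi_parts[OF Suc.prems(4)] bd_linear)
  also have "\<dots> = act (k - 1) (lamt m ?v) (Phi m N (k - 1) ?a)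
      - ?P (k - 1 - 1) (bd (k - 1) (Phi m N (k - 1) ?a)) + Phi m N (k - 1) (kbd (lamt m) ?b)"
    unfolding pri_bd[OF A] act_lamt[OF A] Suc.IH[OF N dl b] by simp
  also have "\<dots> = Phi m N (k - 1) (\<lambda>\<sigma>. kbd (lamt m) ?b \<sigma> + lamt m ?v * ?a \<sigma>)
      + ?P (k - 1 - 1) (Phi m N (k - 1 - 1) (\<lambda>\<sigma>. - kbd (lamt m) ?a \<sigma>))"
    by (simp add: Suc.IH[OF N lk a] Phi_add Phi_neg Phi_scale prism_linear)
  also have "\<dots> = Phi m (Suc N) (k - 1) (kbd (lamt m) x)"
    unfolding Phi_parts[OF kbd_ch[OF Suc.prems(2,4)]] part1_kbd[OF Suc.prems(4) L'] part0_kbd[OF Suc.prems(4) L']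
    by simp
  finally show ?case .
qed

section \<open>The cover of a single point\<close>

text \<open>The second coordinate of the image is a connected set of integers, hence a single one,
  and it determines the base point.\<close>

lemma singular_discrete:
  assumes f: "singular_simplex n (top_of_set (range base_pt)) f"
  shows "\<exists>j. f = (const_simp n j :: _ \<Rightarrow> 'v::finite pt)"
proof -
  let ?D = "standard_simplex n"
  have c: "continuous_map (subtopology (powertop_real UNIV) ?D) euclidean f"
    and im': "f \<in> ?D \<rightarrow> range base_pt" and ext: "f \<in> extensional ?D"
    using f by (simp_all add: singular_simplex_def continuous_map_in_subtopology)
  from im' have im: "f ` ?D \<subseteq> range base_pt" by blast
  have "connectedin euclidean (f ` ?D)"
    using connectedin_continuous_map_image[OF c] connectedin_standard_simplex[of n]
    by (simp add: connectedin_subtopology)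
  then have "connected (f ` ?D)" by simp
  then have cn: "connected (snd ` (f ` ?D))"
    by (rule connected_continuous_image[OF continuous_on_snd[OF continuous_on_id]])
  have Z: "snd ` (f ` ?D) \<subseteq> \<int>" using im by (auto simp: base_pt_def)
  have False if "a \<in> snd ` (f ` ?D)" "b \<in> snd ` (f ` ?D)" "a < b" for a b
  proof -
    have ab: "{a..b} \<subseteq> snd ` (f ` ?D)"
      using connected_contains_Icc[OF cn] that by blast
    have "a \<in> \<int>" using that(1) Z by (rule subsetD[rotated])
    then obtain i :: int where i: "a = of_int i" by (rule Ints_cases)
    define e where "e = min b (a + 1/2)"
    have "e \<in> {a..b}" using that(3) by (simp add: e_def min_def)
    then have "e \<in> \<int>" using ab Z by (meson subsetD)
    then obtain i' :: int where "e = of_int i'" by (rule Ints_cases)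
    with i that(3) have "real_of_int i < real_of_int i'" "real_of_int i' < real_of_int i + 1"
      by (auto simp: e_def min_def split: if_splits)
    then have "i < i'" "i' < i + 1" by linarith+
    then show False by simp
  qed
  then have const: "a = b" if "a \<in> snd ` (f ` ?D)" "b \<in> snd ` (f ` ?D)" for a b
    using that by (metis linorder_neqE_linordered_idom)
  obtain x0 where x0: "x0 \<in> ?D" using nonempty_standard_simplex by blast
  obtain j where j: "f x0 = base_pt j" using funcset_mem[OF im' x0] by (rule rangeE)
  have "f x = base_pt j" if x: "x \<in> ?D" for x
  proof -
    obtain j' where j': "f x = base_pt j'" using funcset_mem[OF im' x] by (rule rangeE)
    have "snd (f x) = snd (f x0)" by (intro const imageI x x0)
    then show ?thesis using j j' by (simp add: base_pt_def)
  qed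
  then have "f = const_simp n j" using ext unfolding const_simp_def by (metis extensional_restrict restrict_ext)
  then show ?thesis by blast
qed

lemma single_sum: "Poly_Mapping.single a (sum g A) = (\<Sum>i\<in>A. Poly_Mapping.single a (g i))"
  by (induction A rule: infinite_finite_induct) (simp_all add: single_add)

lemma const_simp_boundary:
  "sing_bd n (Poly_Mapping.single (const_simp n j) 1 :: ('v::finite pt, 'k::field) sing_chain) =
     (if n = 0 \<or> odd n then 0 else Poly_Mapping.single (const_simp (n - 1) j) 1)"
proof (cases "n = 0")
  case False
  have face: "singular_face n i (const_simp n j) = const_simp (n - 1) j" if "i \<le> n" for i
    unfolding singular_face_def const_simp_def One_nat_def using False that
    by (intro restrict_ext) (auto simp: simplical_face_in_standard_simplex)
  have alt: "(\<Sum>i\<le>n. (- 1) ^ i :: 'k) = (if odd n then 0 else 1)" by (induction n) auto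
  have "sing_bd n (Poly_Mapping.single (const_simp n j) 1 :: ('v pt, 'k) sing_chain)
      = (\<Sum>i\<le>n. Poly_Mapping.single (const_simp (n - 1) j) ((- 1) ^ i))"
    using False by (simp add: sing_bd_ext face)
  also have "\<dots> = Poly_Mapping.single (const_simp (n - 1) j) (\<Sum>i\<le>n. (- 1) ^ i)"
    by (rule single_sum[symmetric])
  finally show ?thesis using False by (simp add: alt)
qed (simp add: sing_bd_def)

text \<open>A homotopy operator for constant simplices; the constant is read off at the vertex with
  coordinate 0 equal to 1.\<close>

definition raise :: "nat \<Rightarrow> ('a, 'k::field) sing_chain \<Rightarrow> ('a, 'k) sing_chain" where
  "raise n = pm_ext (\<lambda>f. Poly_Mapping.single (restrict (\<lambda>_. f (\<lambda>j. if j = 0 then 1 else 0)) (standard_simplex (Suc n))) 1)"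

lemma raise_const: "raise n (Poly_Mapping.single (const_simp n j) 1) = Poly_Mapping.single (const_simp (Suc n) j) 1"
  by (simp add: raise_def const_simp_def)

text \<open>The boundary of a constant simplex is 0 in odd degree and a constant simplex in positive
  even degree. So \<open>raise\<close> is a right inverse of the boundary in odd degree, and a left
  inverse in positive even degree, where cycles are therefore 0.\<close>

lemma discrete_cycle:
  fixes c :: "('v::finite pt, 'k::field) sing_chain"
  assumes c: "c \<in> SC k (range base_pt)" "bd k c = 0" and k: "0 < k"
  shows "\<exists>u\<in>SC (k + 1) (range base_pt). c = bd (k + 1) u"
proof -
  let ?n = "nat k"
  have c': "c \<in> sing_chains ?n (top_of_set (range base_pt))" using c k by (simp add: SC_def)
  have lin: "raise n 0 = 0" "raise n (a + b) = raise n a + raise n b" "raise n (pm_scale r a) = pm_scale r (raise n a)"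
    for n r and a b :: "('v pt, 'k) sing_chain" by (auto simp: raise_def pm_ext_add pm_ext_scale)
  show ?thesis
  proof (cases "odd ?n")
    case True
    have "sing_bd (Suc ?n) (raise ?n c) = c"
    proof (rule linear_eq_on_chains[OF c'])
      fix f :: "_ \<Rightarrow> 'v pt" assume "singular_simplex ?n (top_of_set (range base_pt)) f"
      then obtain j where "f = const_simp ?n j" using singular_discrete by blast
      then show "sing_bd (Suc ?n) (raise ?n (Poly_Mapping.single f 1)) = (Poly_Mapping.single f 1 :: ('v pt, 'k) sing_chain)"
        using True by (simp add: raise_const const_simp_boundary)
    qed (simp_all add: lin sing_bd_add sing_bd_scale)
    moreover have "raise ?n c \<in> sing_chains (Suc ?n) (top_of_set (range base_pt))"
      unfolding raise_def pm_ext_def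
    proof (intro pm.subspace_sum pm.subspace_scale sing_chains_subspace)
      fix f assume "f \<in> Poly_Mapping.keys c"
      then obtain j where "f = const_simp ?n j" using singular_discrete sing_chains_single[OF _ c'] by blast
      then show "Poly_Mapping.single (restrict (\<lambda>_. f (\<lambda>j. if j = 0 then 1 else 0)) (standard_simplex (Suc ?n))) 1
         \<in> sing_chains (Suc ?n) (top_of_set (range base_pt))"
        using const_simp[of j "range base_pt" "Suc ?n"] by (simp add: sing_chains_def const_simp_def)
    qed
    ultimately show ?thesis using k
      by (intro bexI[of _ "raise ?n c"]) (auto simp: SC_def bd_def Suc_nat_eq_nat_zadd1 add.commute)
  next
    case False
    have "raise (?n - 1) (sing_bd ?n c) = c"
    proof (rule linear_eq_on_chains[OF c'])
      fix f :: "_ \<Rightarrow> 'v pt" assume "singular_simplex ?n (top_of_set (range base_pt)) f"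
      then obtain j where "f = const_simp ?n j" using singular_discrete by blast
      then show "raise (?n - 1) (sing_bd ?n (Poly_Mapping.single f 1)) = (Poly_Mapping.single f 1 :: ('v pt, 'k) sing_chain)"
        using False k raise_const[of "?n - 1" j] by (simp add: const_simp_boundary)
    qed (simp_all add: lin sing_bd_add sing_bd_scale)
    then have "c = 0" using c(2) k by (simp add: bd_def lin)
    then show ?thesis by (intro bexI[of _ 0]) (auto simp: bd_linear)
  qed
qed

lemma tcov_point: "tcov m {{}} = (range base_pt :: 'v::finite pt set)"
proof -
  have "x \<in> toric_complex {{}} \<longleftrightarrow> x = (\<chi> u. 1)" for x :: "complex ^ 'v"
    by (auto simp: toric_complex_def vec_eq_iff)
  moreover have "cis (2 * pi * s) = 1 \<longleftrightarrow> (\<exists>j::int. s = of_int j)" for s by (rule cis_eq_1)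
  ultimately show ?thesis by (auto simp: tcov_def base_pt_def image_iff) (metis+)?
qed

lemma act_base:
  "act 0 p (Poly_Mapping.single (const_simp 0 0) 1 :: ('v::finite pt, 'k::field) sing_chain) =
     (\<Sum>j\<in>Poly_Mapping.keys p. Poly_Mapping.single (const_simp 0 j) (Poly_Mapping.lookup p j))"
proof -
  have "simplex_map 0 (deck j) (const_simp 0 0) = (const_simp 0 j :: _ \<Rightarrow> 'v pt)" for j
    unfolding simplex_map_def const_simp_def by (rule restrict_ext) (simp add: deck_def base_pt_def)
  then show ?thesis by (simp add: act_def kZ_act_def sing_push_ext pm_scale_single)
qed

lemma const_simp_inj [simp]: "const_simp n i = (const_simp n j :: _ \<Rightarrow> 'v::finite pt) \<longleftrightarrow> i = j"
proof -
  obtain x where "x \<in> standard_simplex n" using nonempty_standard_simplex by blast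
  then have "(const_simp n i x :: 'v pt) = base_pt i" "(const_simp n j x :: 'v pt) = base_pt j"
    by (simp_all add: const_simp_def)
  then show ?thesis by (metis base_pt_def of_int_eq_iff prod.inject)
qed

lemma act_base_inj:
  assumes "act 0 p (Poly_Mapping.single (const_simp 0 0) 1 :: ('v::finite pt, 'k::field) sing_chain) = 0"
  shows "p = 0"
proof (rule poly_mapping_eqI)
  fix i
  have "0 = Poly_Mapping.lookup (\<Sum>j\<in>Poly_Mapping.keys p. Poly_Mapping.single (const_simp 0 j :: _ \<Rightarrow> 'v pt) (Poly_Mapping.lookup p j)) (const_simp 0 i)"
    using assms unfolding act_base by simp
  also have "\<dots> = (\<Sum>j\<in>Poly_Mapping.keys p. if j = i then Poly_Mapping.lookup p i else 0)"
    unfolding lookup_sum by (intro sum.cong) (auto simp: lookup_single when_def)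
  also have "\<dots> = Poly_Mapping.lookup p i" by (simp add: in_keys_iff)
  finally show "Poly_Mapping.lookup p i = Poly_Mapping.lookup 0 i" by simp
qed

lemma act_base_surj:
  fixes y :: "('v::finite pt, 'k::field) sing_chain"
  assumes "y \<in> SC 0 (range base_pt)"
  shows "\<exists>p. y = act 0 p (Poly_Mapping.single (const_simp 0 0) 1)"
proof (rule pm_induct[of _ y])
  show "\<exists>p. 0 = act 0 p (Poly_Mapping.single (const_simp 0 0) 1 :: ('v pt, 'k) sing_chain)"
    by (rule exI[of _ 0]) (simp add: act_linear)
next
  fix a b :: "('v pt, 'k) sing_chain"
  assume "\<exists>p. a = act 0 p (Poly_Mapping.single (const_simp 0 0) 1)" "\<exists>p. b = act 0 p (Poly_Mapping.single (const_simp 0 0) 1)"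
  then obtain p q where "a = act 0 p (Poly_Mapping.single (const_simp 0 0) 1)" "b = act 0 q (Poly_Mapping.single (const_simp 0 0) 1)"
    by blast
  then show "\<exists>p. a + b = act 0 p (Poly_Mapping.single (const_simp 0 0) 1)"
    by (intro exI[of _ "p + q"]) (simp add: act_linear)
next
  fix f a assume "f \<in> Poly_Mapping.keys y"
  then have "singular_simplex 0 (top_of_set (range base_pt)) f"
    using assms sing_chains_single[of f y 0] by (simp add: SC_def)
  then obtain j where "f = const_simp 0 j" using singular_discrete by blast
  then show "\<exists>p. Poly_Mapping.single f a = act 0 p (Poly_Mapping.single (const_simp 0 0) 1)"
    by (intro exI[of _ "Poly_Mapping.single j a"]) (simp add: act_base)
qed

lemma Phi_base:
  fixes x :: "'v::finite set \<Rightarrow> int \<Rightarrow>\<^sub>0 'k::field"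
  assumes "x \<in> ch {{}} k"
  shows "Phi m 0 k x = act k (x {}) (Poly_Mapping.single (const_simp 0 0) 1)"
proof -
  have "Phi m 0 k x = (\<Sum>\<sigma>\<in>(UNIV :: 'v set set). if \<sigma> = {} then act k (x {}) (Poly_Mapping.single (const_simp 0 0) 1) else 0)"
  proof -
    have "x \<sigma> = 0" if "\<sigma> \<noteq> {}" for \<sigma> using assms that by (force simp: ch_def)
    then show ?thesis unfolding Phi_def by (intro sum.cong) (auto simp: act_linear)
  qed
  then show ?thesis by simp
qed

section \<open>The cellular chain map is a quasi-isomorphism\<close>

text \<open>Acyclicity of the mapping cone of \<open>\<Phi>\<close>, as one condition that contains injectivity and
  surjectivity in homology.\<close>

definition cone_acyclic :: "'k::field itself \<Rightarrow> ('v::finite \<Rightarrow> int) \<Rightarrow> nat \<Rightarrow> 'v set set \<Rightarrow> bool" where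
  "cone_acyclic K m N L \<longleftrightarrow> (\<forall>k (x :: 'v set \<Rightarrow> int \<Rightarrow>\<^sub>0 'k) y.
      x \<in> ch L (k - 1) \<longrightarrow> kbd (lamt m) x = (\<lambda>\<rho>. 0) \<longrightarrow> y \<in> SC k (tcov m L) \<longrightarrow> bd k y = Phi m N (k - 1) x \<longrightarrow>
      (\<exists>w\<in>ch L k. kbd (lamt m) w = x \<and> (\<exists>u\<in>SC (k + 1) (tcov m L). y - Phi m N k w = bd (k + 1) u)))"

lemma cone_acyclic_base: "cone_acyclic TYPE('k::field) m 0 ({{}} :: 'v::finite set set)"
  unfolding cone_acyclic_def tcov_point
proof (intro allI impI)
  fix k and x :: "'v set \<Rightarrow> int \<Rightarrow>\<^sub>0 'k" and y :: "('v pt, 'k) sing_chain"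
  assume x: "x \<in> ch {{}} (k - 1)" and y: "y \<in> SC k (range base_pt)" and bdy: "bd k y = Phi m 0 (k - 1) x"
  \<comment> \<open>Only for \<open>k = 1\<close> can \<open>x\<close> be nonzero at all, and then
    its image is the boundary of a 1-chain of a discrete space, hence 0.\<close>
  have x0: "x = (\<lambda>\<rho>. 0)"
  proof (cases "k = 1")
    case True
    have "bd 1 y = 0"
    proof -
      have "sing_bd 1 y = (\<lambda>_. 0) y"
      proof (rule linear_eq_on_chains[of y 1 "top_of_set (range base_pt)"])
        fix f :: "_ \<Rightarrow> 'v pt" assume "singular_simplex 1 (top_of_set (range base_pt)) f"
        then obtain j where "f = const_simp 1 j" using singular_discrete by blast
        then show "sing_bd 1 (Poly_Mapping.single f 1 :: ('v pt, 'k) sing_chain) = 0"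
          by (simp add: const_simp_boundary)
      qed (use y True in \<open>simp_all add: SC_def sing_bd_add sing_bd_scale\<close>)
      then show ?thesis by (simp add: bd_def)
    qed
    then have "x {} = 0"
      using bdy True x Phi_base[of x 0 m] by (auto intro: act_base_inj)
    then have "x \<sigma> = 0" for \<sigma> using x by (cases "\<sigma> = {}") (auto simp: ch_def)
    then show ?thesis by blast
  next
    case False
    have "x \<sigma> = 0" for \<sigma> using x False by (force simp: ch_def)
    then show ?thesis by blast
  qed
  show "\<exists>w\<in>ch {{}} k. kbd (lamt m) w = x \<and> (\<exists>u\<in>SC (k + 1) (range base_pt). y - Phi m 0 k w = bd (k + 1) u)"
  proof (cases "k = 0")
    case True
    obtain p where p: "y = act 0 p (Poly_Mapping.single (const_simp 0 0) 1)"
      using act_base_surj y True by blast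
    define w where "w \<sigma> = (if \<sigma> = {} then p else 0)" for \<sigma> :: "'v set"
    have w: "w \<in> ch {{}} 0" by (simp add: ch_def w_def)
    have "below 0 ({{}} :: 'v set set)" by (simp add: below_def)
    from kbd_base[OF this w] have "kbd (lamt m) w = x" by (simp add: x0)
    moreover have "Phi m 0 0 w = y" using Phi_base[OF w, of m] p by (simp add: w_def)
    ultimately show ?thesis using w True by (intro bexI[of _ w]) (auto intro!: bexI[of _ 0] simp: bd_linear)
  next
    case False
    have "\<exists>u\<in>SC (k + 1) (range base_pt). y = bd (k + 1) u"
    proof (cases "k < 0")
      case True
      then have "y = bd (k + 1) 0" using y by (simp add: SC_def bd_linear)
      then show ?thesis using SC_0 by blast
    next
      case False
      then show ?thesis using \<open>k \<noteq> 0\<close> y bdy by (intro discrete_cycle) (auto simp: x0 Phi_0)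
    qed
    then show ?thesis by (intro bexI[of _ "\<lambda>\<rho>. 0"]) (auto simp: x0 kbd_0 Phi_0)
  qed
qed

text \<open>A five-lemma argument for the cone of \<open>lam v\<close>, carried out on chains: the
  link component is solved first, \<open>y\<close> is then corrected until it lives on the deletion,
  and the rest is solved there.\<close>

lemma cone_acyclic_step:
  fixes L :: "'v::finite set set"
  assumes N: "Suc N \<le> CARD('v)" and L: "down L" "below (Suc N) L"
  defines "v \<equiv> vtx N :: 'v"
  assumes lk: "cone_acyclic TYPE('k::field) m N (link v L)"
    and dl: "cone_acyclic TYPE('k) m N (deletion v L)"
  shows "cone_acyclic TYPE('k) m (Suc N) L"
  unfolding cone_acyclic_def
proof (intro allI impI)
  fix k and x :: "'v set \<Rightarrow> int \<Rightarrow>\<^sub>0 'k" and y :: "('v pt, 'k) sing_chain"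
  assume x: "x \<in> ch L (k - 1)" "kbd (lamt m) x = (\<lambda>\<rho>. 0)"
    and y: "y \<in> SC k (tcov m L)" and bdy: "bd k y = Phi m (Suc N) (k - 1) x"
  let ?X = "tcov m L" and ?Y = "tcov m (link v L)" and ?Z = "tcov m (deletion v L)"
  let ?lam = "lamt m :: 'v \<Rightarrow> int \<Rightarrow>\<^sub>0 'k" and ?P = "\<lambda>k. pri k (rot m v)"
  define V where "V = {z \<in> ?X. fst z $ v \<noteq> - 1}"
  have vN: "vnum v = N" unfolding v_def using N by (intro vnum_vtx) simp
  have N': "N \<le> CARD('v)" using N by simp
  have L': "below (Suc (vnum v)) L" using L vN by simp
  have lkL: "down (link v L)" "below N (link v L)" and dlL: "down (deletion v L)" "below N (deletion v L)"
    using L vN by (auto intro: down_link below_link down_deletion below_deletion)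
  have sub: "?Y \<subseteq> ?Z" "?Z \<subseteq> V" "V \<subseteq> ?X"
    using tcov_mono[OF link_subset_deletion[OF L(1)]] by (auto simp: V_def tcov_deletion_iff[OF L(1)])
  define a b where "a = part1 v x" and "b = part0 v x"
  have a: "a \<in> ch (link v L) (k - 1 - 1)" and b: "b \<in> ch (deletion v L) (k - 1)"
    unfolding a_def b_def by (rule part1_ch[OF x(1)], rule part0_ch[OF x(1)])
  have ka: "kbd ?lam a = (\<lambda>\<rho>. 0)"
  proof -
    have "part1 v (kbd ?lam x) = (\<lambda>\<tau>. - kbd ?lam a \<tau>)" unfolding a_def by (rule part1_kbd[OF x(1) L'])
    then show ?thesis by (auto simp: x(2) part1_def fun_eq_iff)
  qed
  have kb: "kbd ?lam b \<sigma> + ?lam v * a \<sigma> = 0" for \<sigma>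
  proof -
    have "part0 v (kbd ?lam x) = (\<lambda>\<tau>. kbd ?lam b \<tau> + ?lam v * a \<tau>)"
      unfolding a_def b_def by (rule part0_kbd[OF x(1) L'])
    from fun_cong[OF this, of \<sigma>] show ?thesis by (simp add: x(2) part0_def)
  qed
  define c where "c = Phi m N (k - 1 - 1) a"
  have c: "c \<in> SC (k - 1 - 1) ?Y" unfolding c_def by (rule Phi_SC[OF N' lkL a])
  have bc: "bd (k - 1 - 1) c = 0" unfolding c_def Phi_bd[OF N' lkL a] ka by (rule Phi_0)
  have bdy': "bd k y = ?P (k - 1 - 1) c + Phi m N (k - 1) b"
    unfolding bdy Phi_parts[OF x(1)] by (simp add: c_def a_def b_def v_def)
  have Zb: "Phi m N (k - 1) b \<in> SC (k - 1) ?Z" by (rule Phi_SC[OF N' dlL b])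
  \<comment> \<open>Modulo \<open>V\<close> the boundary of \<open>y\<close> is the prism over
    \<open>c\<close>, so \<open>y\<close> must carry a primitive of \<open>c\<close> on the cover of
    the link.\<close>
  have bdV: "bd (k - 1 + 1) y - ?P (k - 1 - 1) c \<in> SC (k - 1) V"
    using SC_mono[OF Zb sub(2)] by (simp add: bdy')
  have y1: "y \<in> SC (k - 1 + 1) ?X" using y by simp
  from toric_cylinder[OF L(1) c bc y1 bdV[unfolded V_def], folded V_def]
  obtain g u where g: "g \<in> SC (k - 1) ?Y" "bd (k - 1) g = c"
    and u: "u \<in> SC (k + 1) ?X" "y + ?P (k - 1) g - bd (k + 1) u \<in> SC k V"
    by (auto simp: add.commute)
  \<comment> \<open>The hypothesis on the link exchanges the singular primitive \<open>g\<close> for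
    a cellular one, up to the boundary of \<open>h\<close>.\<close>
  obtain wa h where wa: "wa \<in> ch (link v L) (k - 1)" "kbd ?lam wa = a"
    and h: "h \<in> SC k ?Y" "g - Phi m N (k - 1) wa = bd k h"
    using lk[unfolded cone_acyclic_def, rule_format, OF a ka g(1)] g(2) by (auto simp: c_def)
  have Fwa: "Phi m N (k - 1) wa \<in> SC (k - 1) ?Y" by (rule Phi_SC[OF N' lkL wa(1)])
  have ph: "?P k h \<in> SC (k + 1) ?X"
    by (rule pri_SC[OF h(1) continuous_rot]) (use rot_link[OF L(1)] in \<open>auto simp del: split_paired_All\<close>)
  have pbh: "?P (k - 1) (bd k h) = act k (?lam v) h - bd (k + 1) (?P k h)"
    unfolding pri_bd[OF h(1)] act_lamt[OF h(1)] by simp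
  \<comment> \<open>Passing from \<open>g\<close> to the image of \<open>wa\<close> costs only the
    action of \<open>?lam v\<close> on \<open>h\<close>, which stays in \<open>V\<close>. The
    boundary of \<open>y'\<close> is now cellular on the deletion, with coefficients
    \<open>b'\<close>.\<close>
  define y' where "y' = y + ?P (k - 1) (Phi m N (k - 1) wa) - bd (k + 1) (u + ?P k h)"
  have "y' = (y + ?P (k - 1) g - bd (k + 1) u) - act k (?lam v) h"
  proof -
    have "?P (k - 1) g = ?P (k - 1) (Phi m N (k - 1) wa) + ?P (k - 1) (bd k h)"
      by (simp add: prism_linear flip: h(2))
    then show ?thesis unfolding y'_def bd_linear pbh by simp
  qed
  moreover have "act k (?lam v) h \<in> SC k V"
    using act_SC[OF h(1)] sub by (blast intro: SC_mono)
  ultimately have y'V: "y' \<in> SC k V" using u(2) by (simp add: SC_diff)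
  define b' where "b' = (\<lambda>\<sigma>. b \<sigma> + ?lam v * wa \<sigma>)"
  have b': "b' \<in> ch (deletion v L) (k - 1)"
  proof -
    have "wa \<in> ch (deletion v L) (k - 1)" using wa(1) link_subset_deletion[OF L(1)] by (auto simp: ch_def)
    then show ?thesis unfolding b'_def by (intro ch_add b ch_scale)
  qed
  have kb': "kbd ?lam b' = (\<lambda>\<rho>. 0)"
    unfolding b'_def kbd_add kbd_scale wa(2) by (simp add: kb)
  have "bd k y' = bd k y + bd (k - 1 + 1) (?P (k - 1) (Phi m N (k - 1) wa))"
    using bd_bd[OF SC_add[OF u(1) ph]] by (simp add: y'_def bd_linear)
  also have "bd (k - 1 + 1) (?P (k - 1) (Phi m N (k - 1) wa))
      = act (k - 1) (?lam v) (Phi m N (k - 1) wa) - ?P (k - 1 - 1) c"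
    unfolding pri_bd[OF Fwa] act_lamt[OF Fwa] Phi_bd[OF N' lkL wa(1)] wa(2) c_def ..
  finally have by': "bd k y' = Phi m N (k - 1) b'"
    by (simp add: bdy' b'_def Phi_add Phi_scale)
  have "bd k y' \<in> SC (k - 1) ?Z" unfolding by' by (rule Phi_SC[OF N' dlL b'])
  from toric_deformation[OF L(1) y'V[unfolded V_def] this, folded V_def]
  obtain z u2 where z: "z \<in> SC k ?Z" and u2: "u2 \<in> SC (k + 1) V" "y' - z = bd (k + 1) u2" by blast
  have "bd k z = Phi m N (k - 1) b'"
    using bd_bd[OF u2(1)] by (simp add: bd_linear by' flip: u2(2))
  from dl[unfolded cone_acyclic_def, rule_format, OF b' kb' z this]
  obtain wb h2 where wb: "wb \<in> ch (deletion v L) k" "kbd ?lam wb = b'"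
    and h2: "h2 \<in> SC (k + 1) ?Z" "z - Phi m N k wb = bd (k + 1) h2" by blast
  \<comment> \<open>The sign on simplices containing \<open>v\<close> cancels the one in
    \<open>part1_kbd\<close>.\<close>
  define w where "w \<sigma> = (if v \<in> \<sigma> then - wa (\<sigma> - {v}) else wb \<sigma>)" for \<sigma>
  have w: "w \<in> ch L k"
    unfolding ch_def
  proof safe
    fix \<sigma> assume nz: "w \<sigma> \<noteq> 0"
    have "\<sigma> \<in> L \<and> int (card \<sigma>) = k"
    proof (cases "v \<in> \<sigma>")
      case True
      then have "wa (\<sigma> - {v}) \<noteq> 0" using nz by (simp add: w_def)
      then have l: "\<sigma> - {v} \<in> link v L" and cd: "int (card (\<sigma> - {v})) = k - 1" using wa(1) by (auto simp: ch_def)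
      have "Suc (card (\<sigma> - {v})) = card \<sigma>" using True by (intro card_Suc_Diff1) auto
      with cd have "int (card \<sigma>) = k" by linarith
      moreover have "\<sigma> \<in> L" using l True by (simp add: link_def insert_absorb)
      ultimately show ?thesis by blast
    next
      case False
      then have "wb \<sigma> \<noteq> 0" using nz by (simp add: w_def)
      then show ?thesis using wb(1) by (auto simp: ch_def deletion_def)
    qed
    then show "\<sigma> \<in> L" "int (card \<sigma>) = k" by auto
  qed
  have wa0: "wa \<tau> = 0" if "v \<in> \<tau>" for \<tau> using wa(1) that by (auto simp: ch_def link_def)
  have wb0: "wb \<tau> = 0" if "v \<in> \<tau>" for \<tau> using wb(1) that by (auto simp: ch_def deletion_def)
  have w1: "part1 v w = (\<lambda>\<tau>. - wa \<tau>)" by (rule ext) (simp add: part1_def w_def wa0)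
  have w0: "part0 v w = wb" by (rule ext) (simp add: part0_def w_def wb0)
  have neg: "kbd ?lam (\<lambda>\<tau>. - wa \<tau>) = (\<lambda>\<tau>. - a \<tau>)"
    using kbd_scale[of ?lam "- 1" wa] by (simp add: wa(2))
  have "kbd ?lam w = x"
  proof (rule parts_eqI[of v])
    show "part1 v (kbd ?lam w) = part1 v x"
      unfolding part1_kbd[OF w L'] w1 neg by (simp add: a_def)
    show "part0 v (kbd ?lam w) = part0 v x"
      unfolding part0_kbd[OF w L'] w1 w0 wb(2) by (simp add: b'_def b_def)
  qed
  moreover have "y - Phi m (Suc N) k w = bd (k + 1) (u2 + h2 + (u + ?P k h))"
  proof -
    have "Phi m (Suc N) k w = - ?P (k - 1) (Phi m N (k - 1) wa) + Phi m N k wb"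
      unfolding Phi_parts[OF w] v_def[symmetric] w1 w0 by (simp add: Phi_neg prism_linear)
    then have "y - Phi m (Suc N) k w = (y' - z) + (z - Phi m N k wb) + bd (k + 1) (u + ?P k h)"
      by (simp add: y'_def)
    then show ?thesis unfolding u2(2) h2(2) bd_linear .
  qed
  moreover have "u2 + h2 + (u + ?P k h) \<in> SC (k + 1) ?X"
    using u2(1) h2(1) u(1) ph sub by (blast intro: SC_add SC_mono)
  ultimately show "\<exists>w\<in>ch L k. kbd ?lam w = x \<and> (\<exists>u\<in>SC (k + 1) ?X. y - Phi m (Suc N) k w = bd (k + 1) u)"
    using w by blast
qed

theorem cone_acyclic:
  fixes L :: "'v::finite set set"
  assumes "N \<le> CARD('v)" "down L" "{} \<in> L" "below N L"
  shows "cone_acyclic TYPE('k::field) m N L"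
  using assms
proof (induction N arbitrary: L)
  case 0
  then have "\<sigma> = {}" if "\<sigma> \<in> L" for \<sigma> using that by (metis below_def equals0I not_less_zero)
  with 0 have "L = {{}}" by auto
  then show ?case by (simp add: cone_acyclic_base)
next
  case (Suc N)
  let ?v = "vtx N :: 'v"
  have v: "vnum ?v = N" using Suc.prems by (intro vnum_vtx) simp
  show ?case
  proof (cases "{?v} \<in> L")
    case True
    then show ?thesis using Suc.prems v
      by (intro cone_acyclic_step Suc.IH down_link down_deletion below_link below_deletion)
        (auto simp: link_def deletion_def)
  next
    \<comment> \<open>Here the link lacks even the empty simplex, so the gluing step cannot be used;
      but the vertex occurs in no simplex, and \<open>L\<close> already lies below
      \<open>N\<close>.\<close>
    case False
    have nv: "?v \<notin> \<sigma>" if "\<sigma> \<in> L" for \<sigma>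
      using False downD[OF Suc.prems(2) that, of "{?v}"] by blast
    have "below N L"
      unfolding below_def
    proof (intro ballI)
      fix \<sigma> u assume "\<sigma> \<in> L" "u \<in> \<sigma>"
      then have "vnum u < Suc N" "u \<noteq> ?v" using Suc.prems(4) nv by (auto simp: below_def)
      then show "vnum u < N" using v by (metis less_SucE vnum_eq_iff)
    qed
    then have IH: "cone_acyclic TYPE('k) m N L" using Suc by auto
    have "Phi m (Suc N) k x = Phi m N k x" if "x \<in> ch L k" for k and x :: "'v set \<Rightarrow> int \<Rightarrow>\<^sub>0 'k"
      unfolding Phi_def
    proof (intro sum.cong HOL.refl)
      fix \<sigma>
      show "act k (x \<sigma>) (cell m (Suc N) \<sigma>) = act k (x \<sigma>) (cell m N \<sigma>)"
      proof (cases "x \<sigma> = 0")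
        case False
        then have "?v \<notin> \<sigma>" using that nv by (auto simp: ch_def)
        then show ?thesis by simp
      qed (simp add: act_linear)
    qed
    then show ?thesis using IH unfolding cone_acyclic_def by metis
  qed
qed

section \<open>The action on homology\<close>

lemma sing_class_eq_iff:
  "sing_class n X a = sing_class n X b \<longleftrightarrow> a - b \<in> sing_boundaries n X"
proof
  note S = sing_boundaries_subspace[of n X]
  assume "sing_class n X a = sing_class n X b"
  moreover have "a \<in> sing_class n X a"
    using pm.subspace_0[OF S] by (auto simp: sing_class_def intro: exI[of _ 0])
  ultimately show "a - b \<in> sing_boundaries n X" by (auto simp: sing_class_def)
next
  note S = sing_boundaries_subspace[of n X]
  assume ab: "a - b \<in> sing_boundaries n X"
  have "a + c = b + ((a - b) + c)" "b + c = a + (c - (a - b))" for c by simp_all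
  then show "sing_class n X a = sing_class n X b"
    unfolding sing_class_def using pm.subspace_add[OF S ab] pm.subspace_diff[OF S _ ab] by blast
qed

lemma trivial_homology_module:
  assumes "Z_space X \<tau>"
  shows "trivial_Z_action (homology_module n X \<tau> :: (int \<Rightarrow>\<^sub>0 'k::field, ('a, 'k) sing_chain set) module) \<longleftrightarrow>
     (\<forall>c \<in> sing_cycles n X. sing_push n (\<tau> 1) c - c \<in> (sing_boundaries n X :: ('a, 'k) sing_chain set))"
proof -
  let ?M = "homology_module n X \<tau> :: (int \<Rightarrow>\<^sub>0 'k, ('a, 'k) sing_chain set) module"
  have car: "carrier ?M = sing_class n X ` sing_cycles n X" by (simp add: homology_module_def)
  have smult: "kZ_t \<odot>\<^bsub>?M\<^esub> sing_class n X c = sing_class n X (sing_push n (\<tau> 1) c)" for c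
    unfolding homology_module_def using Z_space.class_act[OF assms, of n "kZ_t :: int \<Rightarrow>\<^sub>0 'k" c]
    by (simp add: kZ_t_def kZ_act_single)
  show ?thesis unfolding trivial_Z_action_def car by (simp add: smult sing_class_eq_iff)
qed

lemma trivial_direct_sum:
  assumes ne: "\<And>i. i \<in> I \<Longrightarrow> carrier (M i) \<noteq> {}"
  shows "trivial_Z_action (direct_sum_module I M) \<longleftrightarrow> (\<forall>i\<in>I. trivial_Z_action (M i))"
proof
  assume h: "trivial_Z_action (direct_sum_module I M)"
  show "\<forall>i\<in>I. trivial_Z_action (M i)"
    unfolding trivial_Z_action_def
  proof (intro ballI)
    fix i x assume i: "i \<in> I" and x: "x \<in> carrier (M i)"
    \<comment> \<open>The other components are arbitrary elements, which exist by
      \<open>ne\<close>.\<close>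
    define m where "m = (\<lambda>j\<in>I. if j = i then x else (SOME y. y \<in> carrier (M j)))"
    have "m \<in> carrier (direct_sum_module I M)"
      using ne x by (auto simp: m_def direct_sum_module_def some_in_eq)
    then have "kZ_t \<odot>\<^bsub>direct_sum_module I M\<^esub> m = m" using h by (simp add: trivial_Z_action_def)
    from fun_cong[OF this, of i] show "kZ_t \<odot>\<^bsub>M i\<^esub> x = x"
      using i by (simp add: direct_sum_module_def m_def)
  qed
next
  assume h: "\<forall>i\<in>I. trivial_Z_action (M i)"
  show "trivial_Z_action (direct_sum_module I M)"
    unfolding trivial_Z_action_def
  proof
    fix m assume m: "m \<in> carrier (direct_sum_module I M)"
    show "kZ_t \<odot>\<^bsub>direct_sum_module I M\<^esub> m = m"
      using m h by (auto simp: direct_sum_module_def trivial_Z_action_def PiE_iff extensional_def)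
  qed
qed

lemma cyclic_cover_tcov: "cyclic_cover L chi = tcov (weight L chi) L"
  by (simp add: cyclic_cover_def tcov_def char_map_def)

lemma trivial_twisted_homology_le:
  fixes L :: "'v::finite set set"
  shows "trivial_Z_action (twisted_homology_le TYPE('k::field) L chi r) \<longleftrightarrow>
    (\<forall>i. 0 \<le> i \<longrightarrow> i \<le> int r \<longrightarrow> (\<forall>c \<in> SC i (tcov (weight L chi) L). bd i c = 0 \<longrightarrow>
       (\<exists>u\<in>SC (i + 1) (tcov (weight L chi) L). push i (deck 1) c - c = (bd (i + 1) u :: ('v pt, 'k) sing_chain))))"
proof -
  let ?X = "tcov (weight L chi) L"
  have 1: "trivial_Z_action (twisted_homology_le TYPE('k) L chi r) \<longleftrightarrow>
      (\<forall>n\<in>{0..r}. trivial_Z_action (twisted_homology TYPE('k) L chi n))"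
    unfolding twisted_homology_le_def
  proof (rule trivial_direct_sum)
    show "carrier (twisted_homology TYPE('k) L chi n) \<noteq> {}" for n
      using pm.subspace_0[OF sing_cycles_subspace]
      by (auto simp: twisted_homology_def homology_module_def)
  qed
  have 2: "trivial_Z_action (twisted_homology TYPE('k) L chi n) \<longleftrightarrow>
     (\<forall>c \<in> SC (int n) ?X. bd (int n) c = 0 \<longrightarrow>
       (\<exists>u\<in>SC (int n + 1) ?X. push (int n) (deck 1) c - c = (bd (int n + 1) u :: ('v pt, 'k) sing_chain)))" for n
  proof -
    have "bd (int n) c = sing_bd n c" for c :: "('v pt, 'k) sing_chain"
      by (cases "n = 0") (auto simp: bd_def sing_bd_def[of 0])
    moreover have "bd (int n + 1) c = sing_bd (Suc n) c" for c :: "('v pt, 'k) sing_chain"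
      by (simp add: bd_def nat_add_distrib)
    moreover have "SC (int n + 1) ?X = (sing_chains (Suc n) (top_of_set ?X) :: ('v pt, 'k) sing_chain set)"
      by (simp add: SC_def nat_add_distrib)
    moreover have "SC (int n) ?X = (sing_chains n (top_of_set ?X) :: ('v pt, 'k) sing_chain set)"
      by (simp add: SC_def)
    ultimately show ?thesis
      unfolding twisted_homology_def trivial_homology_module[OF Z_space_cyclic_cover]
      unfolding cyclic_cover_tcov
      by (auto simp: sing_cycles_def sing_boundaries_def image_iff)
  qed
  have 3: "(\<forall>n\<in>{0..r}. P (int n)) \<longleftrightarrow> (\<forall>i. 0 \<le> i \<longrightarrow> i \<le> int r \<longrightarrow> P i)" for P
  proof
    assume h: "\<forall>n\<in>{0..r}. P (int n)"
    show "\<forall>i. 0 \<le> i \<longrightarrow> i \<le> int r \<longrightarrow> P i"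
    proof (intro allI impI)
      fix i :: int assume "0 \<le> i" "i \<le> int r"
      then show "P i" using h[rule_format, of "nat i"] by simp
    qed
  qed auto
  show ?thesis unfolding 1 2 by (rule 3)
qed

text \<open>Two uses of the cone. With a chain bounding t - 1 times the image of \<open>x\<close>,
  it returns a cellular primitive; with the cycle \<open>c\<close> and cellular part 0, it returns a
  cellular cycle homologous to \<open>c\<close>, on which the algebraic condition can be
  applied.\<close>

lemma trivial_action_algebraic:
  fixes L :: "'v::finite set set"
  assumes L: "down L" "{} \<in> L"
  shows "(\<forall>c \<in> SC i (tcov m L). bd i c = 0 \<longrightarrow>
       (\<exists>u\<in>SC (i + 1) (tcov m L). push i (deck 1) c - c = (bd (i + 1) u :: ('v pt, 'k::field) sing_chain))) \<longleftrightarrow>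
    (\<forall>x\<in>ch L i. kbd (lamt m) x = (\<lambda>\<rho>. 0) \<longrightarrow>
       (\<exists>w\<in>ch L (i + 1). kbd (lamt m) w = (\<lambda>\<sigma>. (kZ_t - 1 :: int \<Rightarrow>\<^sub>0 'k) * x \<sigma>)))" (is "?l \<longleftrightarrow> ?r")
proof -
  let ?X = "tcov m L" and ?F = "Phi m CARD('v)" and ?lam = "lamt m :: 'v \<Rightarrow> int \<Rightarrow>\<^sub>0 'k"
  let ?s = "kZ_t - 1 :: int \<Rightarrow>\<^sub>0 'k"
  have below: "below CARD('v) L" by (simp add: below_def vnum_less)
  note cone = cone_acyclic[OF order_refl L below, of m, where 'k = 'k, unfolded cone_acyclic_def, rule_format]
  note FSC = Phi_SC[OF order_refl L(1) below] and Fbd = Phi_bd[OF order_refl L(1) below]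
  have s: "act i ?s c = push i (deck 1) c - c" if "c \<in> SC i ?X" for c :: "('v pt, 'k) sing_chain"
    using that by (simp add: kZ_t_def act_diff_left act_single act_1)
  show ?thesis
  proof
    assume l: ?l
    show ?r
    proof (intro ballI impI)
      fix x :: "'v set \<Rightarrow> int \<Rightarrow>\<^sub>0 'k" assume x: "x \<in> ch L i" "kbd ?lam x = (\<lambda>\<rho>. 0)"
      let ?x = "\<lambda>\<sigma>. ?s * x \<sigma>"
      have Fx: "?F i x \<in> SC i ?X" by (rule FSC[OF x(1)])
      have "bd i (?F i x) = 0" unfolding Fbd[OF x(1)] x(2) by (rule Phi_0)
      with l Fx obtain u where u: "u \<in> SC (i + 1) ?X" "push i (deck 1) (?F i x) - ?F i x = bd (i + 1) u" by blast
      have bu: "bd (i + 1) u = ?F (i + 1 - 1) ?x"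
        using u(2) s[OF Fx] by (simp add: Phi_scale)
      have "?x \<in> ch L (i + 1 - 1)" using ch_scale[OF x(1)] by simp
      moreover have "kbd ?lam ?x = (\<lambda>\<rho>. 0)" unfolding kbd_scale x(2) by simp
      ultimately show "\<exists>w\<in>ch L (i + 1). kbd ?lam w = ?x"
        using cone[OF _ _ u(1) bu] by blast
    qed
  next
    assume r: ?r
    show ?l
    proof (intro ballI impI)
      fix c :: "('v pt, 'k) sing_chain" assume c: "c \<in> SC i ?X" "bd i c = 0"
      let ?z = "\<lambda>\<rho>. 0 :: int \<Rightarrow>\<^sub>0 'k"
      have "bd i c = ?F (i - 1) ?z" by (simp add: c(2) Phi_0)
      from cone[OF ch_0 kbd_0 c(1) this] obtain w u where w: "w \<in> ch L i" "kbd ?lam w = ?z"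
        and u: "u \<in> SC (i + 1) ?X" "c - ?F i w = bd (i + 1) u" by blast
      from r w obtain w' where w': "w' \<in> ch L (i + 1)" "kbd ?lam w' = (\<lambda>\<sigma>. ?s * w \<sigma>)" by blast
      have "act i ?s c = act i ?s (bd (i + 1) u) + act i ?s (?F i w)"
        by (simp add: act_diff flip: u(2))
      also have "act i ?s (bd (i + 1) u) = bd (i + 1) (act (i + 1) ?s u)"
        using act_bd[OF u(1), of ?s] by simp
      also have "act i ?s (?F i w) = bd (i + 1) (?F (i + 1) w')"
        using Fbd[OF w'(1), of m] by (simp add: w'(2) Phi_scale)
      finally have "push i (deck 1) c - c = bd (i + 1) (act (i + 1) ?s u + ?F (i + 1) w')"
        by (simp add: s[OF c(1)] bd_linear)
      moreover have "act (i + 1) ?s u + ?F (i + 1) w' \<in> SC (i + 1) ?X"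
        by (intro SC_add act_SC u FSC w')
      ultimately show "\<exists>u\<in>SC (i + 1) ?X. push i (deck 1) c - c = bd (i + 1) u" by blast
    qed
  qed
qed

section \<open>Exactness under change of weights\<close>

definition exact_at :: "'v::finite set set \<Rightarrow> ('v \<Rightarrow> 'a::comm_ring_1) \<Rightarrow> int \<Rightarrow> bool" where
  "exact_at L lam k \<longleftrightarrow> (\<forall>x\<in>ch L k. kbd lam x = (\<lambda>\<rho>. 0) \<longrightarrow> (\<exists>w\<in>ch L (k + 1). kbd lam w = x))"

definition ind :: "'v set \<Rightarrow> 'v \<Rightarrow> 'a::comm_ring_1" where
  "ind W v = (if v \<in> W then 1 else 0)"

lemma exact_at_neg: "k < 0 \<Longrightarrow> exact_at L lam k"
  unfolding exact_at_def using ch_neg[of k _ L] kbd_0[of lam] ch_0[of L "k + 1"] by fast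

text \<open>Multiplication by \<open>s\<close> is injective, so both weights have the same cycles
  and \<open>s\<close> cancels from the equation for a primitive.\<close>

lemma exact_iff_killed:
  fixes lam mu :: "'v::finite \<Rightarrow> 'a::idom"
  assumes s: "s \<noteq> 0" and lam: "\<And>v. lam v = s * mu v"
  shows "(\<forall>x\<in>ch L k. kbd lam x = (\<lambda>\<rho>. 0) \<longrightarrow> (\<exists>w\<in>ch L (k + 1). kbd lam w = (\<lambda>\<sigma>. s * x \<sigma>)))
     \<longleftrightarrow> exact_at L mu k"
proof -
  have "kbd lam x = (\<lambda>\<rho>. s * kbd mu x \<rho>)" for x
    by (simp add: kbd_def lam sum_distrib_left mult.assoc fun_eq_iff)
  moreover have "(\<lambda>\<rho>. s * f \<rho>) = (\<lambda>\<rho>. s * g \<rho>) \<longleftrightarrow> f = g" for f g :: "'v set \<Rightarrow> 'a"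
    using s by (simp add: fun_eq_iff)
  moreover have "(\<lambda>\<rho>. s * f \<rho>) = (\<lambda>\<rho>. 0) \<longleftrightarrow> f = (\<lambda>\<rho>. 0)" for f :: "'v set \<Rightarrow> 'a"
    using s by (simp add: fun_eq_iff)
  ultimately show ?thesis unfolding exact_at_def by simp
qed

lemma ch_hom:
  assumes "x \<in> ch L k" "h 0 = 0" shows "(\<lambda>\<sigma>. h (x \<sigma>)) \<in> ch L k"
  unfolding ch_def
proof (intro CollectI allI impI)
  fix \<sigma> assume "h (x \<sigma>) \<noteq> 0"
  then have "x \<sigma> \<noteq> 0" using assms(2) by auto
  then show "\<sigma> \<in> L \<and> int (card \<sigma>) = k" using assms(1) by (simp add: ch_def)
qed

lemma sg_hom:
  fixes h :: "'a::comm_ring_1 \<Rightarrow> 'b::comm_ring_1"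
  assumes "\<And>a b. h (a + b) = h a + h b"
  shows "h (sg v \<rho> * a) = sg v \<rho> * h a"
proof -
  have h0: "h 0 = 0" using assms[of 0 0] by simp
  have "h (- a) = - h a" for a using assms[of a "- a"] h0 by (simp add: eq_neg_iff_add_eq_0 add.commute)
  then show ?thesis
    unfolding sg_def by (cases "even (card {u \<in> \<rho>. vnum v < vnum u})") auto
qed

text \<open>With weights 0 and 1 additivity of \<open>h\<close> is enough, which admits coefficient
  functionals and linear splittings that are not ring homomorphisms.\<close>

lemma kbd_ind_hom:
  fixes h :: "'a::comm_ring_1 \<Rightarrow> 'b::comm_ring_1"
  assumes h: "\<And>a b. h (a + b) = h a + h b"
  shows "kbd (ind W) (\<lambda>\<sigma>. h (x \<sigma>)) \<rho> = h (kbd (ind W) x \<rho>)"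
proof -
  have h0: "h 0 = 0" using h[of 0 0] by simp
  have hs: "h (sum f A) = (\<Sum>i\<in>A. h (f i))" for f :: "'v \<Rightarrow> 'a" and A
    by (induction A rule: infinite_finite_induct) (auto simp: h h0)
  have "ind W v * con v (\<lambda>\<sigma>. h (x \<sigma>)) \<rho> = h (ind W v * con v x \<rho>)" for v
    by (simp add: ind_def con_def sg_hom[of h, OF h] h0)
  then show ?thesis by (simp add: kbd_def hs)
qed

lemma prod_insert_Int:
  fixes u :: "'v::finite \<Rightarrow> 'a::comm_ring_1"
  assumes "v \<in> W" "v \<notin> \<rho>"
  shows "(\<Prod>w\<in>insert v \<rho> \<inter> W. u w) = u v * (\<Prod>w\<in>\<rho> \<inter> W. u w)"
proof -
  have "insert v \<rho> \<inter> W = insert v (\<rho> \<inter> W)" using assms by auto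
  then show ?thesis using assms by (simp add: finite_subset[OF subset_UNIV])
qed

text \<open>Rescaling the basis vector of \<open>\<sigma>\<close> by the product of the \<open>u v\<close>, \<open>v \<in> \<sigma> \<inter> W\<close>,
  multiplies the weights on \<open>W\<close> by \<open>u\<close>.\<close>

lemma kbd_rescale:
  fixes u :: "'v::finite \<Rightarrow> 'a::comm_ring_1"
  assumes "\<And>v. v \<notin> W \<Longrightarrow> lam v = 0"
  shows "kbd lam (\<lambda>\<sigma>. (\<Prod>w\<in>\<sigma> \<inter> W. u w) * x \<sigma>) \<rho> = (\<Prod>w\<in>\<rho> \<inter> W. u w) * kbd (\<lambda>v. lam v * u v) x \<rho>"
proof -
  have "lam v * con v (\<lambda>\<sigma>. (\<Prod>w\<in>\<sigma> \<inter> W. u w) * x \<sigma>) \<rho> = (\<Prod>w\<in>\<rho> \<inter> W. u w) * (lam v * u v * con v x \<rho>)" for v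
    using assms[of v] prod_insert_Int[of v W \<rho> u]
    by (cases "v \<in> W") (auto simp: con_def mult_ac)
  then show ?thesis by (simp add: kbd_def sum_distrib_left)
qed

lemma dvd_sum_diff: "(\<And>i. i \<in> A \<Longrightarrow> f dvd g i - h i) \<Longrightarrow> (f :: 'a::comm_ring_1) dvd sum g A - sum h A"
  by (simp add: dvd_sum flip: sum_subtractf)

lemma dvd_prod_diff:
  "finite A \<Longrightarrow> (\<And>i. i \<in> A \<Longrightarrow> f dvd g i - h i) \<Longrightarrow> (f :: 'a::comm_ring_1) dvd prod g A - prod h A"
proof (induction A rule: finite_induct)
  case (insert a A)
  have "prod g (insert a A) - prod h (insert a A) = g a * (prod g A - prod h A) + (g a - h a) * prod h A"
    using insert by (simp add: algebra_simps)
  then show ?case using insert by simp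
qed simp

lemma dvd_kbd_diff:
  assumes "\<And>v. f dvd lam v - lam' v" "\<And>\<sigma>. f dvd x \<sigma> - x' \<sigma>"
  shows "f dvd kbd lam x \<rho> - kbd lam' x' \<rho>"
  unfolding kbd_def
proof (rule dvd_sum_diff)
  fix v
  have "f dvd con v x \<rho> - con v x' \<rho>" using assms(2)[of "insert v \<rho>"] by (simp add: con_def flip: right_diff_distrib)
  moreover have "lam v * con v x \<rho> - lam' v * con v x' \<rho>
      = (lam v - lam' v) * con v x \<rho> + lam' v * (con v x \<rho> - con v x' \<rho>)"
    by (simp add: algebra_simps)
  ultimately show "f dvd lam v * con v x \<rho> - lam' v * con v x' \<rho>" using assms(1)[of v] by simp
qed

text \<open>Bockstein argument: a cycle modulo \<open>f\<close> lifts to a chain whose boundary is \<open>f\<close> times a cycle,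
  hence \<open>f\<close> times a boundary.\<close>

lemma exact_specialize:
  fixes mu u :: "'v::finite \<Rightarrow> 'a::idom" and \<phi> :: "'a \<Rightarrow> 'k::field" and \<iota> :: "'k \<Rightarrow> 'a"
  assumes L: "down L" and ex: "exact_at L mu (i - 1)" "exact_at L mu i"
    and f: "f \<noteq> 0" and W: "\<And>v. v \<in> W \<Longrightarrow> f dvd mu v * u v - 1" "\<And>v. v \<notin> W \<Longrightarrow> f dvd mu v"
    and \<phi>: "\<And>a b. \<phi> (a + b) = \<phi> a + \<phi> b" "\<And>a. f dvd a \<Longrightarrow> \<phi> a = 0"
    and \<iota>: "\<And>a b. \<iota> (a + b) = \<iota> a + \<iota> b" "\<And>a. \<phi> (\<iota> a) = a"
  shows "exact_at L (ind W :: 'v \<Rightarrow> 'k) i"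
  unfolding exact_at_def
proof (intro ballI impI)
  fix x :: "'v set \<Rightarrow> 'k" assume x: "x \<in> ch L i" "kbd (ind W) x = (\<lambda>\<rho>. 0)"
  have \<iota>0: "\<iota> 0 = 0" using \<iota>(1)[of 0 0] by (metis add_0 add_cancel_right_right)
  have \<phi>0: "\<phi> 0 = 0" by (rule \<phi>(2)) simp
  have \<phi>d: "\<phi> a = \<phi> b" if "f dvd a - b" for a b
    using \<phi>(1)[of "a - b" b] \<phi>(2)[OF that] by simp
  define mu' where "mu' v = (if v \<in> W then mu v else 0)" for v
  have mu': "f dvd mu v - mu' v" for v using W(2)[of v] by (simp add: mu'_def)
  have mu'': "f dvd mu' v - mu v" for v using W(2)[of v] by (simp add: mu'_def)
  \<comment> \<open>A lift of \<open>x\<close>, rescaled by the inverses \<open>u\<close>: the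
    weights on \<open>W\<close> become 1 modulo \<open>f\<close>, so the boundary of
    \<open>z\<close> is divisible by \<open>f\<close>.\<close>
  define z where "z \<sigma> = (\<Prod>w\<in>\<sigma> \<inter> W. u w) * \<iota> (x \<sigma>)" for \<sigma>
  have z: "z \<in> ch L i"
    unfolding z_def by (rule ch_scale[OF ch_hom[OF x(1)]]) (rule \<iota>0)
  have bz: "f dvd kbd mu z \<rho>" for \<rho>
  proof -
    have "f dvd kbd mu z \<rho> - kbd mu' z \<rho>" by (rule dvd_kbd_diff[OF mu']) simp
    moreover have "kbd mu' z \<rho> = (\<Prod>w\<in>\<rho> \<inter> W. u w) * kbd (\<lambda>v. mu' v * u v) (\<lambda>\<sigma>. \<iota> (x \<sigma>)) \<rho>"
      unfolding z_def by (rule kbd_rescale) (simp add: mu'_def)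
    moreover have "f dvd kbd (\<lambda>v. mu' v * u v) (\<lambda>\<sigma>. \<iota> (x \<sigma>)) \<rho> - kbd (ind W) (\<lambda>\<sigma>. \<iota> (x \<sigma>)) \<rho>"
      by (rule dvd_kbd_diff) (use W(1) in \<open>auto simp: mu'_def ind_def\<close>)
    moreover have "kbd (ind W) (\<lambda>\<sigma>. \<iota> (x \<sigma>)) \<rho> = 0"
      using kbd_ind_hom[of \<iota> W x \<rho>, OF \<iota>(1)] by (simp add: x(2) \<iota>0)
    ultimately show ?thesis by (metis diff_zero dvd_mult diff_add_cancel dvd_add)
  qed
  then have "\<forall>\<rho>. \<exists>y. kbd mu z \<rho> = f * y" by (simp add: dvd_def)
  then obtain y where y: "\<And>\<rho>. kbd mu z \<rho> = f * y \<rho>" by metis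
  have "y \<in> ch L (i - 1)"
    using kbd_ch[OF L z, of mu] y f by (auto simp: ch_def)
  moreover have "kbd mu y = (\<lambda>\<rho>. 0)"
  proof -
    have "(\<lambda>\<rho>. f * kbd mu y \<rho>) = kbd mu (kbd mu z)" unfolding kbd_scale[symmetric] y ..
    then show ?thesis using f by (simp add: kbd_kbd fun_eq_iff)
  qed
  \<comment> \<open>Exactness one degree lower makes the Bockstein image \<open>y\<close> a
    boundary, so \<open>z - f w\<close> is an honest cycle.\<close>
  ultimately obtain w where w: "w \<in> ch L i" "kbd mu w = y"
    using ex(1) unfolding exact_at_def by (metis diff_add_cancel)
  have "(\<lambda>\<sigma>. z \<sigma> - f * w \<sigma>) \<in> ch L i" by (intro ch_diff z ch_scale w)
  moreover have "kbd mu (\<lambda>\<sigma>. z \<sigma> - f * w \<sigma>) = (\<lambda>\<rho>. 0)"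
    unfolding kbd_diff kbd_scale w(2) by (simp add: y)
  ultimately obtain q where q: "q \<in> ch L (i + 1)" "kbd mu q = (\<lambda>\<sigma>. z \<sigma> - f * w \<sigma>)"
    using ex(2) unfolding exact_at_def by metis
  \<comment> \<open>Undoes the rescaling: multiplication by the weights themselves turns a primitive
    for \<open>mu\<close> into one for \<open>ind W\<close> modulo \<open>f\<close>.\<close>
  define q' where "q' \<sigma> = (\<Prod>v\<in>\<sigma> \<inter> W. mu v) * q \<sigma>" for \<sigma>
  have q': "q' \<in> ch L (i + 1)" using ch_scale[OF q(1)] by (simp add: q'_def[abs_def])
  have bq': "f dvd kbd (ind W) q' \<rho> - \<iota> (x \<rho>)" for \<rho>
  proof -
    have "kbd (ind W) q' \<rho> = (\<Prod>v\<in>\<rho> \<inter> W. mu v) * kbd (\<lambda>v. ind W v * mu v) q \<rho>"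
      unfolding q'_def by (rule kbd_rescale) (simp add: ind_def)
    moreover have "(\<lambda>v. ind W v * mu v) = mu'" by (auto simp: ind_def mu'_def)
    moreover have "f dvd kbd mu' q \<rho> - kbd mu q \<rho>"
      by (rule dvd_kbd_diff) (use mu'' in simp_all)
    ultimately have 1: "f dvd kbd (ind W) q' \<rho> - (\<Prod>v\<in>\<rho> \<inter> W. mu v) * kbd mu q \<rho>"
      by (simp flip: right_diff_distrib)
    have "(\<Prod>v\<in>\<rho> \<inter> W. mu v) * kbd mu q \<rho> - \<iota> (x \<rho>)
        = ((\<Prod>v\<in>\<rho> \<inter> W. mu v * u v) - 1) * \<iota> (x \<rho>) - f * ((\<Prod>v\<in>\<rho> \<inter> W. mu v) * w \<rho>)"
      by (simp add: q(2) z_def prod.distrib algebra_simps)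
    moreover have "f dvd (\<Prod>v\<in>\<rho> \<inter> W. mu v * u v) - (\<Prod>v\<in>\<rho> \<inter> W. 1)"
      by (rule dvd_prod_diff) (use W(1) in auto)
    then have "f dvd ((\<Prod>v\<in>\<rho> \<inter> W. mu v * u v) - 1) * \<iota> (x \<rho>)" by simp
    ultimately have 2: "f dvd (\<Prod>v\<in>\<rho> \<inter> W. mu v) * kbd mu q \<rho> - \<iota> (x \<rho>)"
      by (simp only: dvd_diff[OF _ dvd_triv_left])
    show ?thesis using dvd_add[OF 1 2] by simp
  qed
  show "\<exists>w\<in>ch L (i + 1). kbd (ind W) w = x"
  proof (intro bexI[of _ "\<lambda>\<sigma>. \<phi> (q' \<sigma>)"] ext)
    show "kbd (ind W) (\<lambda>\<sigma>. \<phi> (q' \<sigma>)) \<rho> = x \<rho>" for \<rho>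
      using kbd_ind_hom[of \<phi> W q' \<rho>, OF \<phi>(1)] \<phi>d[OF bq'[of \<rho>]] by (simp add: \<iota>(2))
    show "(\<lambda>\<sigma>. \<phi> (q' \<sigma>)) \<in> ch L (i + 1)" using ch_hom[OF q', of \<phi>] \<phi>0 by simp
  qed
qed

text \<open>The group algebra is free over the field on the powers of t, and weights 0 and 1 do not
  mix coefficients; primitives are found one exponent at a time.\<close>

lemma exact_extend:
  assumes "exact_at L (ind W :: 'v::finite \<Rightarrow> 'k::field) i"
  shows "exact_at L (ind W :: 'v \<Rightarrow> (int \<Rightarrow>\<^sub>0 'k)) i"
  unfolding exact_at_def
proof (intro ballI impI)
  fix x :: "'v set \<Rightarrow> int \<Rightarrow>\<^sub>0 'k" assume x: "x \<in> ch L i" "kbd (ind W) x = (\<lambda>\<rho>. 0)"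
  let ?J = "\<Union>\<sigma>\<in>UNIV. Poly_Mapping.keys (x \<sigma>)"
  have J: "finite ?J" by auto
  have "\<exists>w\<in>ch L (i + 1). kbd (ind W) w = (\<lambda>\<sigma>. Poly_Mapping.lookup (x \<sigma>) j)" for j
  proof -
    have "(\<lambda>\<sigma>. Poly_Mapping.lookup (x \<sigma>) j) \<in> ch L i"
      using ch_hom[OF x(1), of "\<lambda>p. Poly_Mapping.lookup p j"] by simp
    moreover have "kbd (ind W) (\<lambda>\<sigma>. Poly_Mapping.lookup (x \<sigma>) j) = (\<lambda>\<rho>. 0)"
      using kbd_ind_hom[of "\<lambda>p. Poly_Mapping.lookup p j" W x] by (simp add: lookup_add x(2) fun_eq_iff)
    ultimately show ?thesis using assms unfolding exact_at_def by blast
  qed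
  then obtain w where w: "\<And>j. w j \<in> ch L (i + 1)" "\<And>j. kbd (ind W) (w j) = (\<lambda>\<sigma>. Poly_Mapping.lookup (x \<sigma>) j)"
    by metis
  define y where "y \<sigma> = (\<Sum>j\<in>?J. Poly_Mapping.single j (w j \<sigma>))" for \<sigma>
  have "y \<in> ch L (i + 1)"
    unfolding ch_def
  proof (intro CollectI allI impI)
    fix \<sigma> assume "y \<sigma> \<noteq> 0"
    then obtain j where "w j \<sigma> \<noteq> 0" unfolding y_def by (metis (no_types, lifting) single_zero sum.neutral)
    then show "\<sigma> \<in> L \<and> int (card \<sigma>) = i + 1" using w(1)[of j] by (simp add: ch_def)
  qed
  moreover have "kbd (ind W) y \<rho> = x \<rho>" for \<rho>
  proof -
    have "kbd (ind W) y \<rho> = (\<Sum>j\<in>?J. kbd (ind W) (\<lambda>\<sigma>. Poly_Mapping.single j (w j \<sigma>)) \<rho>)"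
      unfolding y_def kbd_def con_def by (subst sum.swap) (auto simp: sum_distrib_left intro!: sum.cong)
    also have "\<dots> = (\<Sum>j\<in>?J. Poly_Mapping.single j (Poly_Mapping.lookup (x \<rho>) j))"
      using kbd_ind_hom[of "Poly_Mapping.single j" W "w j" \<rho> for j] by (simp add: single_add w(2))
    also have "\<dots> = (\<Sum>j\<in>Poly_Mapping.keys (x \<rho>). Poly_Mapping.single j (Poly_Mapping.lookup (x \<rho>) j))"
      by (rule sum.mono_neutral_right[OF J]) (auto simp: in_keys_iff)
    also have "\<dots> = x \<rho>" by (rule sum_single_lookup)
    finally show ?thesis .
  qed
  ultimately show "\<exists>w\<in>ch L (i + 1). kbd (ind W) w = x" by blast
qed

text \<open>The part of \<open>lam\<close> supported off \<open>W\<close> is a nilpotent perturbation: it lowers \<open>card (\<sigma> - W)\<close>.\<close>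

lemma kbd_killed:
  fixes lam :: "'v::finite \<Rightarrow> 'a::comm_ring_1"
  assumes L: "down L" and ex: "exact_at L (ind W :: 'v \<Rightarrow> 'a) i"
    and x: "x \<in> ch L i" "kbd lam x = (\<lambda>\<rho>. 0)" "\<And>\<sigma>. x \<sigma> \<noteq> 0 \<Longrightarrow> card (\<sigma> - W) < j"
  shows "\<exists>w\<in>ch L (i + 1). kbd lam w = (\<lambda>\<sigma>. (\<Prod>v\<in>W. lam v) ^ j * x \<sigma>)"
  using x
proof (induction j arbitrary: x)
  case 0
  then have "x \<sigma> = 0" for \<sigma> by blast
  then show ?case by (intro bexI[of _ "\<lambda>\<sigma>. 0"]) (simp_all add: kbd_0)
next
  case (Suc j)
  let ?P = "\<Prod>v\<in>W. lam v"
  define lamW where "lamW v = (if v \<in> W then lam v else 0)" for v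
  define top where "top y \<sigma> = (if card (\<sigma> - W) = j then y \<sigma> else 0)" for y :: "'v set \<Rightarrow> 'a" and \<sigma>
  have top_ch: "top y \<in> ch L k" if "y \<in> ch L k" for y k using that by (auto simp: ch_def top_def)
  have insW: "card (insert v \<rho> - W) = card (\<rho> - W)" if "v \<in> W" for v \<rho>
    using that by (simp add: insert_Diff_if)
  have insN: "card (insert v \<rho> - W) = Suc (card (\<rho> - W))" if "v \<notin> W" "v \<notin> \<rho>" for v \<rho>
    using that by (simp add: insert_Diff_if)
  have kbd_top: "kbd nu (top y) = top (kbd nu y)" if "\<And>v. v \<notin> W \<Longrightarrow> nu v = 0" for nu :: "'v \<Rightarrow> 'a" and y
  proof
    fix \<rho>
    have "nu v * con v (top y) \<rho> = (if card (\<rho> - W) = j then nu v * con v y \<rho> else 0)" for v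
      using that[of v] insW[of v \<rho>] by (cases "v \<in> W") (simp_all add: con_def top_def)
    then show "kbd nu (top y) \<rho> = top (kbd nu y) \<rho>" by (simp add: kbd_def top_def)
  qed
  have lamW_top: "kbd lamW (top x) = (\<lambda>\<rho>. 0)"
  proof
    fix \<rho>
    have "kbd lamW x \<rho> = kbd lam x \<rho>" if "card (\<rho> - W) = j"
      unfolding kbd_def
    proof (intro sum.cong HOL.refl)
      fix v
      have "x (insert v \<rho>) = 0" if "v \<notin> W" "v \<notin> \<rho>"
        using Suc.prems(3)[of "insert v \<rho>"] insN[OF that] \<open>card (\<rho> - W) = j\<close> by auto
      then show "lamW v * con v x \<rho> = lam v * con v x \<rho>" by (auto simp: lamW_def con_def)
    qed
    then show "kbd lamW (top x) \<rho> = 0"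
      using kbd_top[of lamW x] Suc.prems(2) by (simp add: lamW_def top_def)
  qed
  \<comment> \<open>Only simplices with exactly \<open>j\<close> vertices outside \<open>W\<close>,
    the largest possible number, are treated. This part of \<open>x\<close> is a cycle for
    \<open>lamW\<close>, and the rescaling turns those weights into 1.\<close>
  define z where "z \<sigma> = (\<Prod>w\<in>\<sigma> \<inter> W. lam w) * top x \<sigma>" for \<sigma>
  have z: "z \<in> ch L i" unfolding z_def by (intro ch_scale top_ch Suc.prems(1))
  have "kbd (ind W) z = (\<lambda>\<rho>. 0)"
  proof
    fix \<rho>
    have "(\<lambda>v. ind W v * lam v) = lamW" by (auto simp: ind_def lamW_def)
    then show "kbd (ind W) z \<rho> = 0"
      unfolding z_def by (subst kbd_rescale) (simp_all add: ind_def lamW_top)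
  qed
  with ex z obtain y where y: "y \<in> ch L (i + 1)" "kbd (ind W) y = z" unfolding exact_at_def by blast
  \<comment> \<open>The product over the complement \<open>W - \<sigma>\<close> completes the one in
    \<open>z\<close> to the same factor \<open>?P\<close> on every simplex.\<close>
  define w where "w \<sigma> = (\<Prod>v\<in>W - \<sigma>. lam v) * top y \<sigma>" for \<sigma>
  have w: "w \<in> ch L (i + 1)" unfolding w_def by (intro ch_scale top_ch y)
  have kw: "kbd lamW w \<rho> = ?P * top x \<rho>" for \<rho>
  proof -
    have "lamW v * con v w \<rho> = (\<Prod>v\<in>W - \<rho>. lam v) * (ind W v * con v (top y) \<rho>)" for v
    proof (cases "v \<in> W \<and> v \<notin> \<rho>")
      case True
      then have "W - \<rho> = insert v (W - insert v \<rho>)" by auto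
      then have "(\<Prod>v\<in>W - \<rho>. lam v) = lam v * (\<Prod>v\<in>W - insert v \<rho>. lam v)"
        by (metis (no_types, lifting) DiffD2 finite insertCI prod.insert)
      then show ?thesis using True by (simp add: con_def w_def lamW_def ind_def mult_ac)
    qed (auto simp: con_def lamW_def ind_def)
    then have "kbd lamW w \<rho> = (\<Prod>v\<in>W - \<rho>. lam v) * kbd (ind W) (top y) \<rho>"
      by (simp add: kbd_def sum_distrib_left)
    also have "kbd (ind W) (top y) \<rho> = top z \<rho>"
      using kbd_top[of "ind W" y] by (simp add: ind_def y(2))
    also have "top z \<rho> = (\<Prod>w\<in>\<rho> \<inter> W. lam w) * top x \<rho>" by (simp add: top_def z_def)
    also have "(\<Prod>v\<in>W - \<rho>. lam v) * ((\<Prod>w\<in>\<rho> \<inter> W. lam w) * top x \<rho>) = ?P * top x \<rho>"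
    proof -
      have "W = (W - \<rho>) \<union> (\<rho> \<inter> W)" by auto
      then have "?P = (\<Prod>v\<in>W - \<rho>. lam v) * (\<Prod>w\<in>\<rho> \<inter> W. lam w)"
        by (metis (no_types, lifting) Diff_disjoint Int_assoc finite inf_commute inf_bot_left prod.union_disjoint)
      then show ?thesis by (simp add: mult.assoc)
    qed
    finally show ?thesis .
  qed
  \<comment> \<open>After subtracting this boundary every remaining simplex has fewer than
    \<open>j\<close> vertices outside \<open>W\<close>.\<close>
  define x' where "x' \<sigma> = ?P * x \<sigma> - kbd lam w \<sigma>" for \<sigma>
  have x': "x' \<in> ch L i"
    using ch_diff[OF ch_scale[OF Suc.prems(1)] , of "kbd lam w" "\<lambda>_. ?P"] kbd_ch[OF L w, of lam]
    by (simp add: x'_def[abs_def])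
  have kx': "kbd lam x' = (\<lambda>\<rho>. 0)"
    unfolding x'_def kbd_diff kbd_scale Suc.prems(2) kbd_kbd by simp
  have small: "card (\<sigma> - W) < j" if "x' \<sigma> \<noteq> 0" for \<sigma>
  proof (rule ccontr)
    assume ge: "\<not> card (\<sigma> - W) < j"
    have "kbd lam w \<sigma> = kbd lamW w \<sigma>"
      unfolding kbd_def
    proof (intro sum.cong HOL.refl)
      fix v
      have "w (insert v \<sigma>) = 0" if "v \<notin> W" "v \<notin> \<sigma>"
        using insN[OF that] ge by (simp add: w_def top_def)
      then show "lam v * con v w \<sigma> = lamW v * con v w \<sigma>" by (auto simp: lamW_def con_def)
    qed
    then have "x' \<sigma> = ?P * (x \<sigma> - top x \<sigma>)" by (simp add: x'_def kw right_diff_distrib)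
    moreover have "x \<sigma> = top x \<sigma>" using ge Suc.prems(3)[of \<sigma>] by (cases "x \<sigma> = 0") (auto simp: top_def)
    ultimately show False using that by simp
  qed
  from Suc.IH[OF x' kx' small] obtain w' where w': "w' \<in> ch L (i + 1)" "kbd lam w' = (\<lambda>\<sigma>. ?P ^ j * x' \<sigma>)" by blast
  show ?case
  proof (intro bexI[of _ "\<lambda>\<sigma>. w' \<sigma> + ?P ^ j * w \<sigma>"])
    show "kbd lam (\<lambda>\<sigma>. w' \<sigma> + ?P ^ j * w \<sigma>) = (\<lambda>\<sigma>. ?P ^ Suc j * x \<sigma>)"
      unfolding kbd_add kbd_scale w'(2) by (simp add: x'_def fun_eq_iff algebra_simps)
    show "(\<lambda>\<sigma>. w' \<sigma> + ?P ^ j * w \<sigma>) \<in> ch L (i + 1)" by (intro ch_add ch_scale w' w)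
  qed
qed

section \<open>Prime ideals\<close>

definition is_ideal :: "'a::comm_ring_1 set \<Rightarrow> bool" where
  "is_ideal I \<longleftrightarrow> 0 \<in> I \<and> (\<forall>a\<in>I. \<forall>b\<in>I. a + b \<in> I) \<and> (\<forall>a\<in>I. \<forall>r. r * a \<in> I)"

text \<open>Zorn's lemma gives an ideal maximal among the proper ones above \<open>J\<close>. If it
  misses \<open>a\<close>, adjoining \<open>a\<close> produces 1, and multiplying that relation by
  \<open>b\<close> gives primality.\<close>

lemma exists_prime_ideal:
  assumes J: "is_ideal J" "1 \<notin> J"
  shows "\<exists>M. is_ideal M \<and> J \<subseteq> M \<and> 1 \<notin> M \<and> (\<forall>a b. a * b \<in> M \<longrightarrow> a \<in> M \<or> b \<in> M)"
proof -
  let ?S = "{I. is_ideal I \<and> J \<subseteq> I \<and> 1 \<notin> I}"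
  have "\<exists>M\<in>?S. \<forall>I\<in>?S. M \<subseteq> I \<longrightarrow> I = M"
  proof (rule subset_Zorn_nonempty)
    show "?S \<noteq> {}" using J by auto
    fix C assume C: "C \<noteq> {}" "subset.chain ?S C"
    then have CS: "\<And>I. I \<in> C \<Longrightarrow> is_ideal I \<and> J \<subseteq> I \<and> 1 \<notin> I" by (auto simp: subset.chain_def)
    have "a + b \<in> \<Union>C" if ab: "a \<in> \<Union>C" "b \<in> \<Union>C" for a b
    proof -
      obtain A B where AB: "A \<in> C" "a \<in> A" "B \<in> C" "b \<in> B" using ab by blast
      then have "A \<subseteq> B \<or> B \<subseteq> A" using C(2) by (auto simp: subset.chain_def)
      then obtain D where "D \<in> C" "a \<in> D" "b \<in> D" using AB by blast
      then show ?thesis using CS[of D] by (auto simp: is_ideal_def)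
    qed
    moreover have "r * a \<in> \<Union>C" if a: "a \<in> \<Union>C" for a r
    proof -
      obtain A where A: "A \<in> C" "a \<in> A" using a by blast
      then have "r * a \<in> A" using CS[of A] by (simp add: is_ideal_def)
      then show ?thesis using A(1) by (rule UnionI[rotated])
    qed
    moreover have "0 \<in> \<Union>C" using C(1) CS by (auto simp: is_ideal_def)
    ultimately have "is_ideal (\<Union>C)" by (simp only: is_ideal_def) blast
    then show "\<Union>C \<in> ?S" using C(1) CS by auto
  qed
  then obtain M where M: "is_ideal M" "J \<subseteq> M" "1 \<notin> M"
    and max: "\<And>I. is_ideal I \<Longrightarrow> J \<subseteq> I \<Longrightarrow> 1 \<notin> I \<Longrightarrow> M \<subseteq> I \<Longrightarrow> I = M" by auto
  have "b \<in> M" if ab: "a * b \<in> M" and a: "a \<notin> M" for a b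
  proof -
    let ?I = "{m + r * a | m r. m \<in> M}"
    have "is_ideal ?I"
      unfolding is_ideal_def
    proof (intro conjI ballI allI)
      show "0 \<in> ?I" using M(1) by (auto simp: is_ideal_def intro!: exI[of _ 0])
      fix x assume "x \<in> ?I"
      then obtain m r where x: "x = m + r * a" "m \<in> M" by auto
      show "s * x \<in> ?I" for s
      proof -
        have "s * x = s * m + (s * r) * a" "s * m \<in> M"
          using x M(1) by (simp_all add: is_ideal_def algebra_simps)
        then show ?thesis by blast
      qed
      fix y assume "y \<in> ?I"
      then obtain m' r' where y: "y = m' + r' * a" "m' \<in> M" by auto
      have "x + y = (m + m') + (r + r') * a" "m + m' \<in> M"
        using x y M(1) by (simp_all add: is_ideal_def algebra_simps)
      then show "x + y \<in> ?I" by blast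
    qed
    moreover have "M \<subseteq> ?I"
    proof
      show "x \<in> ?I" if "x \<in> M" for x
        using that by (intro CollectI exI[of _ x] exI[of _ 0]) simp
    qed
    moreover have "a \<in> ?I"
      using M(1) by (intro CollectI exI[of _ 0] exI[of _ 1]) (simp add: is_ideal_def)
    ultimately have "1 \<in> ?I" using max[of ?I] M(2) a by blast
    then obtain m r where "1 = m + r * a" "m \<in> M" by auto
    then have "b = b * m + r * (a * b)" by (metis (no_types) distrib_left mult.assoc mult.commute mult.right_neutral)
    then show ?thesis using M(1) ab \<open>m \<in> M\<close> by (metis is_ideal_def)
  qed
  then show ?thesis using M by blast
qed

section \<open>The quantum integers in the group algebra\<close>

abbreviation tp :: "int \<Rightarrow> int \<Rightarrow>\<^sub>0 'k::field" where
  "tp j \<equiv> Poly_Mapping.single j 1"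

abbreviation cst :: "'k::field \<Rightarrow> int \<Rightarrow>\<^sub>0 'k" where
  "cst a \<equiv> Poly_Mapping.single 0 a"

lemma tp_mult: "tp i * tp j = tp (i + j)"
  by (simp add: mult_single)

lemma cst_inverse:
  assumes "a \<noteq> 0" shows "cst a * cst (1 / a) = (1 :: int \<Rightarrow>\<^sub>0 'k::field)"
proof -
  have "cst a * cst (1 / a) = cst (a * (1 / a))" by (simp only: mult_single add_0)
  then show ?thesis using assms by simp
qed

lemma geometric: "(tp a - 1) * (\<Sum>j<n. tp (a * int j)) = (tp (a * int n) - 1 :: int \<Rightarrow>\<^sub>0 'k::field)"
proof (induction n)
  case (Suc n)
  have "(tp a - 1) * (\<Sum>j<Suc n. tp (a * int j)) = tp (a * int n) - 1 + (tp a - 1) * (tp (a * int n) :: int \<Rightarrow>\<^sub>0 'k)"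
    by (simp add: distrib_left Suc)
  also have "\<dots> = tp (a + a * int n) - 1"
    by (simp add: left_diff_distrib tp_mult)
  finally show ?case by (simp add: algebra_simps)
qed simp

lemma tp_dvd: "(tp a - 1 :: int \<Rightarrow>\<^sub>0 'k::field) dvd tp (a * b) - 1"
proof (cases "b \<ge> 0")
  case True
  then obtain n where "b = int n" using nonneg_int_cases by blast
  then show ?thesis using geometric[of a n, where 'k = 'k] by (metis dvd_triv_left)
next
  case False
  then obtain n where n: "b = - int n" by (metis nonneg_int_cases linear neg_0_le_iff_le add.inverse_inverse)
  have "tp (a * b) * (tp (a * int n) - 1 :: int \<Rightarrow>\<^sub>0 'k) = 1 - tp (a * b)"
    by (simp add: right_diff_distrib tp_mult n)
  then have "tp (a * b) - 1 = - (tp (a * b) * (tp (a * int n) - 1 :: int \<Rightarrow>\<^sub>0 'k))" by simp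
  then show ?thesis using geometric[of a n, where 'k = 'k] by (metis dvd_minus_iff dvd_mult dvd_triv_left)
qed

text \<open>The quantum integer [m], for negative \<open>m\<close> too; the quotient is unique
  because t - 1 is not a zero divisor, see \<open>gz_eqI\<close>.\<close>

definition gz :: "int \<Rightarrow> int \<Rightarrow>\<^sub>0 'k::field" where
  "gz m = (SOME g. tp m - 1 = (tp 1 - 1) * g)"

lemma gz: "tp m - 1 = (tp 1 - 1) * (gz m :: int \<Rightarrow>\<^sub>0 'k::field)"
proof -
  have "\<exists>g :: int \<Rightarrow>\<^sub>0 'k. tp m - 1 = (tp 1 - 1) * g" using tp_dvd[of 1 m, where 'k = 'k] by (simp add: dvd_def)
  then show ?thesis unfolding gz_def by (rule someI_ex)
qed

lemma s_nonzero: "(tp 1 - 1 :: int \<Rightarrow>\<^sub>0 'k::field) \<noteq> 0"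
proof
  assume "(tp 1 - 1 :: int \<Rightarrow>\<^sub>0 'k) = 0"
  then have "Poly_Mapping.lookup (tp 1 - 1 :: int \<Rightarrow>\<^sub>0 'k) 1 = 0" by simp
  then show False by (simp add: lookup_minus lookup_one)
qed

lemma gz_eqI: "tp m - 1 = (tp 1 - 1) * g \<Longrightarrow> gz m = (g :: int \<Rightarrow>\<^sub>0 'k::field)"
  using gz[of m, where 'k = 'k] s_nonzero[where 'k = 'k] by simp

lemma gz_Suc: "gz (m + 1) = gz m + (tp m :: int \<Rightarrow>\<^sub>0 'k::field)"
proof (rule gz_eqI)
  have "(tp 1 - 1) * (gz m + tp m) = (tp m - 1) + (tp 1 - 1) * (tp m :: int \<Rightarrow>\<^sub>0 'k)"
    by (simp add: distrib_left flip: gz)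
  then show "tp (m + 1) - 1 = (tp 1 - 1) * (gz m + tp m :: int \<Rightarrow>\<^sub>0 'k)"
    by (simp add: left_diff_distrib tp_mult add.commute)
qed

text \<open>At t = 1 a quantum integer becomes the ordinary one; the induction runs in both
  directions because \<open>m\<close> may be negative.\<close>

lemma gz_cong: "(tp 1 - 1) dvd (gz m - cst (of_int m) :: int \<Rightarrow>\<^sub>0 'k::field)"
proof (induction m rule: int_induct[where k = 0])
  case base
  have "gz 0 = (0 :: int \<Rightarrow>\<^sub>0 'k)" by (rule gz_eqI) simp
  then show ?case by simp
next
  case (step1 m)
  have "gz (m + 1) - cst (of_int (m + 1)) = (gz m - cst (of_int m)) + (tp m - 1 :: int \<Rightarrow>\<^sub>0 'k)"
    by (simp add: gz_Suc single_add)
  then show ?case using step1 gz[of m, where 'k = 'k] by (metis dvd_add dvd_triv_left)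
next
  case (step2 m)
  have "gz (m - 1) - cst (of_int (m - 1)) = (gz m - cst (of_int m)) - (tp (m - 1) - 1 :: int \<Rightarrow>\<^sub>0 'k)"
    using gz_Suc[of "m - 1", where 'k = 'k] by (simp add: single_diff)
  then show ?case using step2 gz[of "m - 1", where 'k = 'k] by (metis dvd_diff dvd_triv_left)
qed

text \<open>The functionals \<open>t\<^sup>j \<mapsto> c j\<close>; a suitable one splits the inclusion of the field into a quotient
  of the group algebra.\<close>

definition fnl :: "(int \<Rightarrow> 'k) \<Rightarrow> (int \<Rightarrow>\<^sub>0 'k::field) \<Rightarrow> 'k" where
  "fnl c a = (\<Sum>j\<in>Poly_Mapping.keys a. Poly_Mapping.lookup a j * c j)"

lemma fnl_superset:
  "finite A \<Longrightarrow> Poly_Mapping.keys a \<subseteq> A \<Longrightarrow> fnl c a = (\<Sum>j\<in>A. Poly_Mapping.lookup a j * c j)"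
  unfolding fnl_def by (intro sum.mono_neutral_left) (auto simp: in_keys_iff)

lemma fnl_add: "fnl c (a + b) = fnl c a + fnl c b"
proof -
  let ?A = "Poly_Mapping.keys a \<union> Poly_Mapping.keys b"
  have "Poly_Mapping.keys (a + b) \<subseteq> ?A" by (rule Poly_Mapping.keys_add)
  then show ?thesis by (simp add: fnl_superset[of ?A] lookup_add distrib_right sum.distrib)
qed

lemma fnl_0 [simp]: "fnl c 0 = 0" by (simp add: fnl_def)

lemma fnl_sum: "fnl c (sum g A) = (\<Sum>i\<in>A. fnl c (g i))"
  by (induction A rule: infinite_finite_induct) (auto simp: fnl_add)

lemma fnl_diff: "fnl c (a - b) = fnl c a - fnl c b"
  using fnl_add[of c "a - b" b] by simp

lemma fnl_single [simp]: "fnl c (Poly_Mapping.single j b) = b * c j"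
  by (simp add: fnl_superset[of "{j}"])

lemma fnl_kills:
  assumes "\<And>j b. fnl c (f * Poly_Mapping.single j b) = 0" "f dvd a" shows "fnl c a = 0"
proof -
  obtain d where d: "a = f * d" using assms(2) by (auto simp: dvd_def)
  have "fnl c (f * d) = 0"
    by (rule pm_induct[of "\<lambda>d. fnl c (f * d) = 0"]) (simp_all add: distrib_left fnl_add assms(1))
  then show ?thesis using d by simp
qed

section \<open>Reduction modulo t - 1 and modulo [q]\<close>

definition VV :: "('v \<Rightarrow> int) \<Rightarrow> nat \<Rightarrow> 'v set" where
  "VV m q = {v. \<not> int q dvd m v}"

text \<open>Modulo t - 1 the weight \<open>gz (m v)\<close> is the scalar \<open>m v\<close>, a unit
  exactly when the characteristic does not divide it. The splitting functional is the sum of the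
  coefficients.\<close>

lemma exact_char:
  fixes m :: "'v::finite \<Rightarrow> int"
  assumes L: "down L" and p: "CHAR('k::field) = p"
    and ex: "exact_at L (\<lambda>v. gz (m v) :: int \<Rightarrow>\<^sub>0 'k) (i - 1)" "exact_at L (\<lambda>v. gz (m v) :: int \<Rightarrow>\<^sub>0 'k) i"
  shows "exact_at L (ind (VV m p) :: 'v \<Rightarrow> 'k) i"
proof (rule exact_specialize[OF L ex, where f = "tp 1 - 1" and \<phi> = "fnl (\<lambda>_. 1)" and \<iota> = cst
      and u = "\<lambda>v. cst (1 / of_int (m v))"])
  have V: "v \<in> VV m p \<longleftrightarrow> of_int (m v) \<noteq> (0 :: 'k)" for v
    by (simp add: VV_def of_int_eq_0_iff_char_dvd p)
  show "(tp 1 - 1 :: int \<Rightarrow>\<^sub>0 'k) \<noteq> 0" by (rule s_nonzero)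
  fix v
  show "(tp 1 - 1 :: int \<Rightarrow>\<^sub>0 'k) dvd gz (m v) * cst (1 / of_int (m v)) - 1" if "v \<in> VV m p"
  proof -
    have "cst (of_int (m v)) * cst (1 / of_int (m v)) = (1 :: int \<Rightarrow>\<^sub>0 'k)"
      using that by (intro cst_inverse) (simp add: V)
    then have "gz (m v) * cst (1 / of_int (m v)) - 1
        = (gz (m v) - cst (of_int (m v))) * cst (1 / of_int (m v) :: 'k)"
      by (simp add: left_diff_distrib)
    then show ?thesis using gz_cong[of "m v", where 'k = 'k] by simp
  qed
  show "(tp 1 - 1 :: int \<Rightarrow>\<^sub>0 'k) dvd gz (m v)" if "v \<notin> VV m p"
  proof -
    have "of_int (m v) = (0 :: 'k)" using that V by blast
    then show ?thesis using gz_cong[of "m v", where 'k = 'k] by (metis diff_zero single_zero)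
  qed
next
  have "fnl (\<lambda>_. 1) ((tp 1 - 1) * Poly_Mapping.single j b) = 0" for j and b :: 'k
    by (simp add: left_diff_distrib mult_single fnl_diff)
  then show "fnl (\<lambda>_. 1) a = 0" if "(tp 1 - 1) dvd a" for a :: "int \<Rightarrow>\<^sub>0 'k"
    by (rule fnl_kills[OF _ that])
qed (simp_all add: fnl_add single_add)

text \<open>\<open>f\<close> is [q]. Modulo \<open>f\<close> the q-th power of t is 1, so [m]
  becomes 0 if \<open>q\<close> divides \<open>m\<close> and a unit otherwise. The quotient may have
  no ring homomorphism to the field, so a linear functional takes its place.\<close>

lemma exact_prime:
  fixes m :: "'v::finite \<Rightarrow> int"
  assumes L: "down L" and q: "prime q"
    and ex: "exact_at L (\<lambda>v. gz (m v) :: int \<Rightarrow>\<^sub>0 'k::field) (i - 1)" "exact_at L (\<lambda>v. gz (m v) :: int \<Rightarrow>\<^sub>0 'k) i"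
  shows "exact_at L (ind (VV m q) :: 'v \<Rightarrow> 'k) i"
proof -
  let ?s = "tp 1 - 1 :: int \<Rightarrow>\<^sub>0 'k"
  define f where "f = (\<Sum>j<q. tp (int j) :: int \<Rightarrow>\<^sub>0 'k)"
  \<comment> \<open>The functional kills all multiples of \<open>f\<close> if its values have period
    \<open>q\<close> and sum 0 over a period, and it splits the scalars if its value at exponent 0
    is 1. The values 1 and -1 at the residues 0 and 1 do both, these residues being distinct as
    \<open>q \<ge> 2\<close>.\<close>
  define c where "c j = (if int q dvd j then 1 else if int q dvd j - 1 then - 1 else 0 :: 'k)" for j
  have q2: "q \<ge> 2" using q by (rule prime_ge_2_nat)
  have sf: "?s * f = tp (int q) - 1" using geometric[of 1 q, where 'k = 'k] by (simp add: f_def)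
  have f0: "f \<noteq> 0"
  proof
    assume "f = 0"
    then have "Poly_Mapping.lookup (tp (int q) - 1 :: int \<Rightarrow>\<^sub>0 'k) 0 = 0" using sf by simp
    then show False using q2 by (simp add: lookup_minus lookup_one lookup_single)
  qed
  have u: "\<exists>u. f dvd gz (m v) * u - 1" if "v \<in> VV m q" for v
  proof -
    have "coprime (m v) (int q)"
      using q that prime_imp_coprime[of "int q" "m v"] by (simp add: VV_def coprime_commute)
    then obtain n l where "m v * n + int q * l = 1"
      by (metis bezout_int coprime_iff_gcd_eq_1 mult.commute)
    \<comment> \<open>\<open>n\<close> inverts \<open>m v\<close> modulo \<open>q\<close>. Modulo
      \<open>f\<close> this gives \<open>t^(m n) = t\<close>, so the quotient of
      \<open>t^(m n) - 1\<close> by \<open>t^m - 1\<close> is an inverse of [m].\<close>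
    then have mn: "m v * n = 1 + int q * (- l)" by simp
    obtain u where u: "tp (m v * n) - 1 = (tp (m v) - 1) * (u :: int \<Rightarrow>\<^sub>0 'k)" using tp_dvd by (auto simp: dvd_def)
    from tp_dvd[of "int q" "- l"] obtain g where
      g: "tp (int q * (- l)) - 1 = (tp (int q) - 1) * (g :: int \<Rightarrow>\<^sub>0 'k)" by (rule dvdE)
    have "?s * (gz (m v) * u) = tp (m v * n) - 1" by (simp only: u mult.assoc[symmetric] gz[symmetric])
    also have "\<dots> = tp 1 * (tp (int q * (- l)) - 1) + ?s" unfolding mn by (simp add: right_diff_distrib tp_mult)
    also have "\<dots> = tp 1 * (?s * f * g) + ?s" by (simp only: g sf)
    also have "\<dots> = ?s * (tp 1 * f * g + 1)"
    proof -
      have "a * (s * f * g) + s = s * (a * f * g + 1)" for a s f g :: "int \<Rightarrow>\<^sub>0 'k"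
        by (simp add: algebra_simps)
      then show ?thesis .
    qed
    finally have "gz (m v) * u = tp 1 * f * g + 1" using s_nonzero[where 'k = 'k] by (metis mult_cancel_left)
    then have "gz (m v) * u - 1 = f * (tp 1 * g)" by (simp add: mult_ac)
    then show ?thesis by (intro exI[of _ u]) simp
  qed
  then obtain u where u: "\<And>v. v \<in> VV m q \<Longrightarrow> f dvd gz (m v) * u v - 1" by metis
  have v: "f dvd gz (m v)" if "v \<notin> VV m q" for v
  proof -
    have "int q dvd m v" using that by (simp add: VV_def)
    then obtain b where b: "m v = int q * b" by (rule dvdE)
    obtain g where g: "tp (int q * b) - 1 = (tp (int q) - 1) * (g :: int \<Rightarrow>\<^sub>0 'k)" using tp_dvd by (auto simp: dvd_def)
    have "gz (m v) = f * g"
      by (rule gz_eqI) (simp only: b g mult.assoc[symmetric] sf)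
    then show ?thesis by simp
  qed
  have per: "c (j + int q) = c j" for j
  proof -
    have "j + int q - 1 = (j - 1) + int q" by simp
    then have "int q dvd j + int q - 1 \<longleftrightarrow> int q dvd j - 1" by (simp only: dvd_add_triv_right_iff)
    then show ?thesis by (simp add: c_def)
  qed
  \<comment> \<open>A window of length \<open>q\<close> may start anywhere: shifting it by one
    exchanges two equal values of the periodic \<open>c\<close>.\<close>
  have csum: "(\<Sum>i<q. c (int i + j)) = 0" for j
  proof (induction j rule: int_induct[where k = 0])
    case base
    have "c (int i) = (if i = 0 then 1 else 0) - (if i = 1 then 1 else 0)" if "i < q" for i
    proof -
      have "int q dvd int i \<longleftrightarrow> i = 0" using that by (auto dest: nat_dvd_not_less)
      moreover have "int q dvd int i - 1 \<longleftrightarrow> i = 1" if "i \<noteq> 0"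
      proof -
        have "int i - 1 = int (i - 1)" using that by simp
        then have "int q dvd int i - 1 \<longleftrightarrow> q dvd i - 1" by (simp only: int_dvd_int_iff)
        then show ?thesis using \<open>i < q\<close> that by (auto dest: dvd_imp_le)
      qed
      ultimately show ?thesis by (auto simp: c_def)
    qed
    then have "(\<Sum>i<q. c (int i + 0)) = (\<Sum>i<q. (if i = 0 then 1 else 0) - (if i = 1 then 1 else 0))"
      by (intro sum.cong) auto
    also have "\<dots> = 0" using q2 by (simp add: sum_subtractf)
    finally show ?case .
  next
    case (step1 j)
    have "(\<Sum>i<q. c (int i + (j + 1))) = (\<Sum>i<q. c (int (Suc i) + j))" by (simp add: add_ac)
    also have "\<dots> = (\<Sum>i<q. c (int i + j)) + (c (int q + j) - c j)"
      using sum.lessThan_Suc_shift[of "\<lambda>i. c (int i + j)" q] sum.lessThan_Suc[of "\<lambda>i. c (int i + j)" q] by (simp add: algebra_simps)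
    finally show ?case using step1 per[of j] by (simp add: add.commute)
  next
    case (step2 j)
    have "(\<Sum>i<q. c (int i + j)) = (\<Sum>i<q. c (int (Suc i) + (j - 1)))" by (simp add: add_ac)
    also have "\<dots> = (\<Sum>i<q. c (int i + (j - 1))) + (c (int q + (j - 1)) - c (j - 1))"
      using sum.lessThan_Suc_shift[of "\<lambda>i. c (int i + (j - 1))" q] sum.lessThan_Suc[of "\<lambda>i. c (int i + (j - 1))" q] by (simp add: algebra_simps)
    finally show ?case using step2 per[of "j - 1"] by (simp add: add.commute)
  qed
  have kills: "fnl c a = 0" if "f dvd a" for a
  proof (rule fnl_kills[OF _ that])
    fix j b
    have "fnl c (f * Poly_Mapping.single j b) = b * (\<Sum>i<q. c (int i + j))"
      by (simp add: f_def sum_distrib_right mult_single fnl_sum sum_distrib_left)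
    then show "fnl c (f * Poly_Mapping.single j b) = 0" by (simp add: csum)
  qed
  show ?thesis
    by (rule exact_specialize[OF L ex f0 u v, where \<phi> = "fnl c" and \<iota> = cst])
      (simp_all add: fnl_add kills single_add c_def)
qed

section \<open>The order of t in a residue field\<close>

lemma char_laurent: "CHAR(int \<Rightarrow>\<^sub>0 'k::field) = CHAR('k)"
proof (rule CHAR_eqI)
  have on: "(of_nat n :: int \<Rightarrow>\<^sub>0 'k) = cst (of_nat n)" for n
    by (induction n) (simp_all add: single_add)
  show "(of_nat CHAR('k) :: int \<Rightarrow>\<^sub>0 'k) = 0" by (simp only: on of_nat_CHAR single_zero)
  show "CHAR('k) dvd n" if "(of_nat n :: int \<Rightarrow>\<^sub>0 'k) = 0" for n
  proof -
    have "cst (of_nat n) = (0 :: int \<Rightarrow>\<^sub>0 'k)" using that by (simp only: on)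
    then have "(of_nat n :: 'k) = 0" by (metis lookup_single_eq lookup_zero)
    then show ?thesis by (simp add: of_nat_eq_0_iff_char_dvd)
  qed
qed

lemma prime_ideal_prod:
  assumes "\<And>a b. a * b \<in> M \<Longrightarrow> a \<in> M \<or> b \<in> M" "1 \<notin> M" "finite A" "prod g A \<in> (M :: 'a::comm_ring_1 set)"
  shows "\<exists>a\<in>A. g a \<in> M"
  using assms(3,4) by (induction A rule: finite_induct) (use assms(1,2) in auto)

lemma prime_ideal_power:
  assumes "\<And>a b. a * b \<in> M \<Longrightarrow> a \<in> M \<or> b \<in> M" "1 \<notin> M" "a ^ n \<in> (M :: 'a::comm_ring_1 set)"
  shows "a \<in> M"
  using assms(3) by (induction n) (use assms(1,2) in auto)

text \<open>In a prime ideal containing all products \<open>\<Prod>\<^sub>v [m\<^sub>v]\<close>, \<open>v \<in> V\<^sub>q\<close>, some \<open>t\<^sup>d - 1\<close> lies; the least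
  such \<open>d > 0\<close> is the order of \<open>t\<close> in the residue field, and its prime factors give a contradiction.\<close>

lemma no_prime_ideal:
  fixes m :: "'v::finite \<Rightarrow> int" and M :: "(int \<Rightarrow>\<^sub>0 'k::field) set"
  assumes p: "CHAR('k) = p"
    and M: "is_ideal M" "1 \<notin> M" "\<And>a b. a * b \<in> M \<Longrightarrow> a \<in> M \<or> b \<in> M"
    and Vp: "\<exists>v\<in>VV m p. gz (m v) \<in> M"
    and Vq: "\<And>q. prime q \<Longrightarrow> VV m q \<subset> VV m 0 \<Longrightarrow> q \<noteq> p \<Longrightarrow> \<exists>v\<in>VV m q. gz (m v) \<in> M"
  shows False
proof -
  have add: "a + b \<in> M" if "a \<in> M" "b \<in> M" for a b using M(1) that by (simp add: is_ideal_def)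
  have mult: "r * a \<in> M" if "a \<in> M" for a r using M(1) that by (simp add: is_ideal_def)
  have neg: "- a \<in> M" if "a \<in> M" for a using mult[OF that, of "- 1"] by simp
  have dvd: "b \<in> M" if "a \<in> M" "a dvd b" for a b using that mult by (metis dvd_def mult.commute)
  \<comment> \<open>The exponents whose power of t is 1 modulo \<open>M\<close>; below they turn out
    to be the multiples of the order \<open>d\<close>.\<close>
  define S where "S = {n. tp n - 1 \<in> M}"
  have Sadd: "a + b \<in> S" if "a \<in> S" "b \<in> S" for a b
  proof -
    have "tp (a + b) - 1 = tp a * (tp b - 1) + (tp a - 1 :: int \<Rightarrow>\<^sub>0 'k)"
      by (simp add: right_diff_distrib tp_mult)
    moreover have "tp a * (tp b - 1) + (tp a - 1) \<in> M"
      using that by (intro add mult) (simp_all add: S_def)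
    ultimately have "tp (a + b) - 1 \<in> M" by (simp only:)
    then show ?thesis by (simp add: S_def)
  qed
  have Smult: "a * b \<in> S" if "a \<in> S" for a b using that dvd tp_dvd by (auto simp: S_def)
  have gzS: "n \<in> S" if "gz n \<in> M" for n
  proof -
    have "tp n - 1 \<in> M" unfolding gz[of n] by (rule mult[OF that])
    then show ?thesis by (simp add: S_def)
  qed
  obtain v where v: "v \<in> VV m p" "gz (m v) \<in> M" using Vp by blast
  have mv0: "of_int (m v) \<noteq> (0 :: 'k)" using v(1) by (simp add: VV_def of_int_eq_0_iff_char_dvd p)
  \<comment> \<open>If t were 1 modulo \<open>M\<close>, then [m] would be the scalar
    \<open>m v\<close>, which is nonzero in the field by the choice of \<open>v\<close>.\<close>
  have "1 \<notin> S"
  proof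
    assume "1 \<in> S"
    then have "gz (m v) - cst (of_int (m v)) \<in> M" using dvd gz_cong by (auto simp: S_def)
    from add[OF neg[OF this] v(2)] have "cst (of_int (m v)) \<in> M" by simp
    from mult[OF this, of "cst (1 / of_int (m v))"] have "1 \<in> M"
      using cst_inverse[OF mv0] by (simp only: mult.commute)
    then show False using M(2) by simp
  qed
  have "\<exists>d>0. int d \<in> S"
  proof -
    have "int (nat \<bar>m v\<bar>) = m v * sgn (m v)" by (simp flip: abs_sgn)
    then have "int (nat \<bar>m v\<bar>) \<in> S" by (simp only: Smult[OF gzS[OF v(2)]])
    moreover have "nat \<bar>m v\<bar> > 0" using mv0 by auto
    ultimately show ?thesis by blast
  qed
  define d where "d = (LEAST d. d > 0 \<and> int d \<in> S)"
  have d: "d > 0" "int d \<in> S" using LeastI_ex[OF \<open>\<exists>d>0. int d \<in> S\<close>] by (auto simp: d_def)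
  have least: "d \<le> e" if "e > 0" "int e \<in> S" for e using that by (auto simp: d_def intro: Least_le)
  have Sdvd: "int d dvd n" if "n \<in> S" for n
  proof -
    have "n mod int d = n + int d * (- (n div int d))" by (simp add: minus_div_mult_eq_mod[symmetric] mult.commute)
    then have r: "n mod int d \<in> S" using Sadd[OF that Smult[OF d(2), of "- (n div int d)"]] by simp
    have "n mod int d = 0"
    proof (rule ccontr)
      assume nz: "n mod int d \<noteq> 0"
      have "0 \<le> n mod int d" "n mod int d < int d" using d(1) by simp_all
      moreover from this nz have "d \<le> nat (n mod int d)" using r by (intro least) auto
      ultimately show False by linarith
    qed
    then show ?thesis by auto
  qed
  have "d \<noteq> 1" using d(2) \<open>1 \<notin> S\<close> by auto
  then obtain q where q: "prime q" "q dvd d" using prime_factor_nat by blast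
  \<comment> \<open>The order is prime to the characteristic: for \<open>d = p e\<close> the p-th
    power of \<open>t^e - 1\<close> is \<open>t^d - 1\<close>, so \<open>M\<close> would already
    contain \<open>t^e - 1\<close>, against minimality of \<open>d\<close>.\<close>
  have "q \<noteq> p"
  proof
    assume "q = p"
    then obtain e where e: "d = p * e" using q by (auto simp: dvd_def)
    have pr: "prime CHAR(int \<Rightarrow>\<^sub>0 'k)" using q \<open>q = p\<close> p by (simp add: char_laurent)
    have "(tp (int e) + (- 1)) ^ p = tp (int e) ^ p + (- 1 :: int \<Rightarrow>\<^sub>0 'k) ^ p"
      using freshmans_dream[OF pr, of p "tp (int e)" "- 1"] by (simp only: char_laurent p)
    moreover have "(tp (int e) :: int \<Rightarrow>\<^sub>0 'k) ^ n = tp (int (n * e))" for n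
      by (induction n) (simp_all add: tp_mult algebra_simps)
    moreover have "(- 1 :: int \<Rightarrow>\<^sub>0 'k) ^ p = - 1"
    proof (cases "even p")
      case True
      then have "p = 2" using q \<open>q = p\<close> primes_dvd_imp_eq two_is_prime_nat by blast
      then have "(of_nat 2 :: int \<Rightarrow>\<^sub>0 'k) = 0" using of_nat_CHAR[where 'a = "int \<Rightarrow>\<^sub>0 'k"] by (simp add: char_laurent p)
      then have "(1 :: int \<Rightarrow>\<^sub>0 'k) + 1 = 0" by simp
      then have "(- 1 :: int \<Rightarrow>\<^sub>0 'k) = 1" by (simp add: neg_eq_iff_add_eq_0)
      then show ?thesis using True by simp
    qed simp
    ultimately have "(tp (int e) - 1) ^ p = tp (int d) - (1 :: int \<Rightarrow>\<^sub>0 'k)" by (simp add: e)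
    also have "\<dots> \<in> M" using d(2) by (simp add: S_def)
    finally have "tp (int e) - 1 \<in> M" using prime_ideal_power M by blast
    then have "d \<le> e" using e d(1) by (intro least) (auto simp: S_def)
    moreover have "e > 0" "p \<ge> 2" using e d(1) q \<open>q = p\<close> by (auto intro: prime_ge_2_nat)
    ultimately show False using e by simp
  qed
  have inV0: "VV m q \<subseteq> VV m 0" by (auto simp: VV_def)
  \<comment> \<open>If [m] lies in \<open>M\<close>, the order \<open>d\<close> divides
    \<open>m u\<close>, and so does its prime factor \<open>q\<close>.\<close>
  have nd: "u \<notin> VV m q" if "gz (m u) \<in> M" for u
    using Sdvd[OF gzS[OF that]] q(2) by (auto simp: VV_def intro: dvd_trans)
  show False
  proof (cases "VV m q = VV m 0")
    \<comment> \<open>\<open>q\<close> is not among the primes of \<open>Vq\<close>, but the vertex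
      \<open>v\<close> obtained from the characteristic already contradicts
      \<open>nd\<close>.\<close>
    case True
    have "v \<in> VV m 0" using mv0 by (auto simp: VV_def)
    then show False using nd[OF v(2)] True by simp
  next
    case False
    then show False using Vq[OF q(1) _ \<open>q \<noteq> p\<close>] inV0 nd by blast
  qed
qed

theorem exact_quantum_iff:
  fixes m :: "'v::finite \<Rightarrow> int"
  assumes L: "down L" and p: "CHAR('k::field) = p"
  shows "(\<forall>i. 0 \<le> i \<longrightarrow> i \<le> r \<longrightarrow> exact_at L (\<lambda>v. gz (m v) :: int \<Rightarrow>\<^sub>0 'k) i) \<longleftrightarrow>
    (\<forall>i. 0 \<le> i \<longrightarrow> i \<le> r \<longrightarrow> exact_at L (ind (VV m p) :: 'v \<Rightarrow> 'k) i) \<and>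
    (\<forall>q. prime q \<longrightarrow> VV m q \<subset> VV m 0 \<longrightarrow> q \<noteq> p \<longrightarrow>
        (\<forall>i. 0 \<le> i \<longrightarrow> i \<le> r \<longrightarrow> exact_at L (ind (VV m q) :: 'v \<Rightarrow> 'k) i))" (is "?l \<longleftrightarrow> ?r")
proof
  assume l: ?l
  \<comment> \<open>Negative degrees are included so that the degree \<open>i - 1\<close> of the
    reduction lemmas is available at \<open>i = 0\<close>.\<close>
  have ex: "exact_at L (\<lambda>v. gz (m v) :: int \<Rightarrow>\<^sub>0 'k) i" if "i \<le> r" for i
    using l that exact_at_neg by (cases "i < 0") auto
  show ?r
    by (intro conjI allI impI exact_char[OF L p] exact_prime[OF L] ex) auto
next
  assume r: ?r
  let ?mu = "\<lambda>v. gz (m v) :: int \<Rightarrow>\<^sub>0 'k"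
  \<comment> \<open>The common annihilator of the homology in degrees 0 to \<open>r\<close>;
    exactness means that it contains 1.\<close>
  define J where "J = {a. \<forall>i. 0 \<le> i \<longrightarrow> i \<le> r \<longrightarrow> (\<forall>x\<in>ch L i. kbd ?mu x = (\<lambda>\<rho>. 0) \<longrightarrow>
      (\<exists>w\<in>ch L (i + 1). kbd ?mu w = (\<lambda>\<sigma>. a * x \<sigma>)))}"
  have J: "is_ideal J"
    unfolding is_ideal_def
  proof (intro conjI ballI allI)
    show "0 \<in> J" unfolding J_def by (auto intro!: bexI[of _ "\<lambda>\<sigma>. 0"] simp: kbd_0)
    fix a assume a: "a \<in> J"
    show "s * a \<in> J" for s
      unfolding J_def
    proof (intro CollectI allI impI ballI)
      fix i and x :: "'v set \<Rightarrow> int \<Rightarrow>\<^sub>0 'k" assume "0 \<le> i" "i \<le> r" "x \<in> ch L i" "kbd ?mu x = (\<lambda>\<rho>. 0)"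
      then obtain w where w: "w \<in> ch L (i + 1)" "kbd ?mu w = (\<lambda>\<sigma>. a * x \<sigma>)" using a unfolding J_def by blast
      show "\<exists>w\<in>ch L (i + 1). kbd ?mu w = (\<lambda>\<sigma>. s * a * x \<sigma>)"
        by (intro bexI[of _ "\<lambda>\<sigma>. s * w \<sigma>"] ch_scale w) (simp only: kbd_scale w mult.assoc)
    qed
    fix b assume b: "b \<in> J"
    show "a + b \<in> J"
      unfolding J_def
    proof (intro CollectI allI impI ballI)
      fix i and x :: "'v set \<Rightarrow> int \<Rightarrow>\<^sub>0 'k" assume *: "0 \<le> i" "i \<le> r" "x \<in> ch L i" "kbd ?mu x = (\<lambda>\<rho>. 0)"
      obtain w where w: "w \<in> ch L (i + 1)" "kbd ?mu w = (\<lambda>\<sigma>. a * x \<sigma>)" using a * unfolding J_def by blast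
      obtain w' where w': "w' \<in> ch L (i + 1)" "kbd ?mu w' = (\<lambda>\<sigma>. b * x \<sigma>)" using b * unfolding J_def by blast
      show "\<exists>w\<in>ch L (i + 1). kbd ?mu w = (\<lambda>\<sigma>. (a + b) * x \<sigma>)"
        by (intro bexI[of _ "\<lambda>\<sigma>. w \<sigma> + w' \<sigma>"] ch_add w w') (simp only: kbd_add w w' distrib_right)
    qed
  qed
  have inJ: "(\<Prod>v\<in>W. gz (m v)) ^ Suc CARD('v) \<in> J"
    if "\<forall>i. 0 \<le> i \<longrightarrow> i \<le> r \<longrightarrow> exact_at L (ind W :: 'v \<Rightarrow> 'k) i" for W
    unfolding J_def
  proof (intro CollectI allI impI ballI)
    fix i and x :: "'v set \<Rightarrow> int \<Rightarrow>\<^sub>0 'k" assume *: "0 \<le> i" "i \<le> r" "x \<in> ch L i" "kbd ?mu x = (\<lambda>\<rho>. 0)"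
    have "card (\<sigma> - W) < Suc CARD('v)" for \<sigma> by (simp add: less_Suc_eq_le card_mono)
    then show "\<exists>w\<in>ch L (i + 1). kbd ?mu w = (\<lambda>\<sigma>. (\<Prod>v\<in>W. gz (m v)) ^ Suc CARD('v) * x \<sigma>)"
      using kbd_killed[OF L exact_extend *(3,4), of W "Suc CARD('v)"] that * by blast
  qed
  have "1 \<in> J"
  proof (rule ccontr)
    assume "1 \<notin> J"
    then obtain M where M: "is_ideal M" "J \<subseteq> M" "1 \<notin> M" "\<And>a b. a * b \<in> M \<Longrightarrow> a \<in> M \<or> b \<in> M"
      using exists_prime_ideal[OF J] by blast
    have h: "\<exists>v\<in>W. gz (m v) \<in> M" if "\<forall>i. 0 \<le> i \<longrightarrow> i \<le> r \<longrightarrow> exact_at L (ind W :: 'v \<Rightarrow> 'k) i" for W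
    proof (rule prime_ideal_prod[OF M(4,3)])
      show "(\<Prod>v\<in>W. gz (m v)) \<in> M"
        by (rule prime_ideal_power[OF M(4,3), of _ "Suc CARD('v)"]) (use inJ[OF that] M(2) in auto)
      show "finite W" by (rule finite)
    qed
    show False
    proof (rule no_prime_ideal[OF p M(1,3)])
      show "a \<in> M \<or> b \<in> M" if "a * b \<in> M" for a b by (rule M(4)[OF that])
      show "\<exists>v\<in>VV m p. gz (m v) \<in> M" by (rule h) (rule conjunct1[OF r])
      show "\<exists>v\<in>VV m q. gz (m v) \<in> M" if "prime q" "VV m q \<subset> VV m 0" "q \<noteq> p" for q
        by (rule h) (use conjunct2[OF r] that in blast)
    qed
  qed
  then show ?l unfolding J_def exact_at_def by simp
qed

section \<open>Words acting on the exterior algebra\<close>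

text \<open>Right multiplication by a dual basis vector in the basis of increasing monomials: moving
  the new letter to the left past the larger ones costs the sign \<open>sg\<close>. With this sign
  rule it is the transpose of \<open>con\<close>.\<close>

definition rmul :: "'v::finite \<Rightarrow> ('v set \<Rightarrow> 'k::comm_ring_1) \<Rightarrow> 'v set \<Rightarrow> 'k" where
  "rmul v x \<sigma> = (if v \<in> \<sigma> then sg v (\<sigma> - {v}) * x (\<sigma> - {v}) else 0)"

lemma rmul_same: "rmul v (rmul v x) \<sigma> = 0"
  by (simp add: rmul_def)

lemma rmul_anti: "rmul u (rmul v x) \<sigma> = - rmul v (rmul u x) \<sigma>"
proof (cases "u \<in> \<sigma> \<and> v \<in> \<sigma> \<and> u \<noteq> v")
  case True
  define \<rho> where "\<rho> = \<sigma> - {u} - {v}"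
  have \<rho>: "\<sigma> = insert u (insert v \<rho>)" "u \<notin> \<rho>" "v \<notin> \<rho>"
    using True by (auto simp: \<rho>_def)
  have d: "\<sigma> - {u} = insert v \<rho>" "\<sigma> - {v} = insert u \<rho>" "insert v \<rho> - {v} = \<rho>" "insert u \<rho> - {u} = \<rho>"
    using \<rho> True by auto
  have "rmul u (rmul v x) \<sigma> = (sg v \<rho> * sg u (insert v \<rho>)) * x \<rho>"
    using True by (simp add: rmul_def d mult_ac)
  also have "sg v \<rho> * sg u (insert v \<rho>) = - (sg u \<rho> * sg v (insert u \<rho>))"
    using True \<rho> by (intro sg_anti) auto
  also have "- (sg u \<rho> * sg v (insert u \<rho>)) * x \<rho> = - rmul v (rmul u x) \<sigma>"
    using True by (simp add: rmul_def d mult_ac)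
  finally show ?thesis .
qed (auto simp: rmul_def)

lemma rmul_add: "rmul v (\<lambda>\<sigma>. x \<sigma> + y \<sigma>) \<sigma> = rmul v x \<sigma> + rmul v y \<sigma>"
  by (simp add: rmul_def distrib_left)
lemma rmul_scale: "rmul v (\<lambda>\<sigma>. c * x \<sigma>) \<sigma> = c * rmul v x \<sigma>"
  by (simp add: rmul_def mult_ac)
lemma rmul_0: "rmul v (\<lambda>\<sigma>. 0) = (\<lambda>\<sigma>. 0)"
  by (simp add: rmul_def fun_eq_iff)
lemma rmul_sum: "rmul v (\<lambda>\<sigma>. \<Sum>i\<in>A. f i \<sigma>) \<sigma> = (\<Sum>i\<in>A. rmul v (f i) \<sigma>)"
  by (simp add: rmul_def sum_distrib_left)

definition wmul :: "'v::finite list \<Rightarrow> ('v set \<Rightarrow> 'k::comm_ring_1) \<Rightarrow> 'v set \<Rightarrow> 'k" where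
  "wmul vs x = foldl (\<lambda>x v. rmul v x) x vs"

lemma wmul_simps [simp]: "wmul [] x = x" "wmul (v # vs) x = wmul vs (rmul v x)"
  by (simp_all add: wmul_def)
lemma wmul_append: "wmul (us @ vs) x = wmul vs (wmul us x)"
  by (simp add: wmul_def)
lemma wmul_add: "wmul vs (\<lambda>\<sigma>. x \<sigma> + y \<sigma>) = (\<lambda>\<sigma>. wmul vs x \<sigma> + wmul vs y \<sigma>)"
  by (induction vs arbitrary: x y) (simp_all add: rmul_add[abs_def])
lemma wmul_scale: "wmul vs (\<lambda>\<sigma>. c * x \<sigma>) = (\<lambda>\<sigma>. c * wmul vs x \<sigma>)"
  by (induction vs arbitrary: x) (simp_all add: rmul_scale[abs_def])
lemma wmul_0: "wmul vs (\<lambda>\<sigma>. 0) = (\<lambda>\<sigma>. 0)"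
  by (induction vs) (simp_all add: rmul_0)

text \<open>The tensor algebra acts on the exterior algebra from the right, whence the order of the
  factors in \<open>opr_mult\<close>.\<close>

definition opr :: "('v::finite dword \<Rightarrow>\<^sub>0 'k::field) \<Rightarrow> ('v set \<Rightarrow> 'k) \<Rightarrow> 'v set \<Rightarrow> 'k" where
  "opr p x \<sigma> = (\<Sum>w\<in>Poly_Mapping.keys p. Poly_Mapping.lookup p w * wmul (letters w) x \<sigma>)"

lemma opr_superset:
  "finite A \<Longrightarrow> Poly_Mapping.keys p \<subseteq> A \<Longrightarrow> opr p x \<sigma> = (\<Sum>w\<in>A. Poly_Mapping.lookup p w * wmul (letters w) x \<sigma>)"
  unfolding opr_def by (intro sum.mono_neutral_left) (auto simp: in_keys_iff)

lemma opr_add: "opr (p + q) x \<sigma> = opr p x \<sigma> + opr q x \<sigma>"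
proof -
  let ?A = "Poly_Mapping.keys p \<union> Poly_Mapping.keys q"
  have "Poly_Mapping.keys (p + q) \<subseteq> ?A" by (rule Poly_Mapping.keys_add)
  then show ?thesis by (simp add: opr_superset[of ?A] lookup_add distrib_right sum.distrib)
qed
lemma opr_0 [simp]: "opr 0 x \<sigma> = 0" by (simp add: opr_def)
lemma opr_single [simp]: "opr (Poly_Mapping.single w a) x \<sigma> = a * wmul (letters w) x \<sigma>"
  by (simp add: opr_superset[of "{w}"])
lemma opr_diff: "opr (p - q) x \<sigma> = opr p x \<sigma> - opr q x \<sigma>"
  using opr_add[of "p - q" q x \<sigma>] by simp
lemma opr_scale: "opr (pm_scale a p) x \<sigma> = a * opr p x \<sigma>"
proof -
  have "Poly_Mapping.keys (pm_scale a p) \<subseteq> Poly_Mapping.keys p"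
    by (auto simp: in_keys_iff lookup_pm_scale)
  then show ?thesis
    by (simp add: opr_superset[of "Poly_Mapping.keys p"] lookup_pm_scale sum_distrib_left mult.assoc)
qed
lemma opr_sum: "opr (sum p A) x \<sigma> = (\<Sum>i\<in>A. opr (p i) x \<sigma>)"
  by (induction A rule: infinite_finite_induct) (auto simp: opr_add)

lemma opr_arg_add: "opr p (\<lambda>\<sigma>. x \<sigma> + y \<sigma>) \<sigma> = opr p x \<sigma> + opr p y \<sigma>"
  by (simp add: opr_def wmul_add distrib_left sum.distrib)
lemma opr_arg_0: "opr p (\<lambda>\<sigma>. 0) \<sigma> = 0"
  by (simp add: opr_def wmul_0)

lemma opr_mult: "opr (p * q) x = opr q (opr p x)"
proof (induction rule: pm_induct[of _ p])
  case (3 u a)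
  show ?case
  proof (induction rule: pm_induct[of _ q])
    case (3 v b)
    show ?case
      by (simp add: mult_single plus_dword_def wmul_append wmul_scale fun_eq_iff opr_single[abs_def])
  qed (simp_all add: distrib_left opr_add[abs_def] opr_0[abs_def])
qed (simp_all add: distrib_right opr_add[abs_def] opr_0[abs_def] opr_arg_add[abs_def] opr_arg_0[abs_def])

text \<open>In coordinates on the exterior algebra these are the elements of the ideal of non-faces;
  closure of \<open>L\<close> under subsets makes them stable under multiplication.\<close>

definition vanishes :: "'v set set \<Rightarrow> ('v set \<Rightarrow> 'k::zero) \<Rightarrow> bool" where
  "vanishes L x \<longleftrightarrow> (\<forall>\<sigma>\<in>L. x \<sigma> = 0)"

lemma vanishes_rmul: "down L \<Longrightarrow> vanishes L x \<Longrightarrow> vanishes L (rmul v x)"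
  unfolding vanishes_def rmul_def by (auto simp: down_def)

lemma vanishes_wmul: "down L \<Longrightarrow> vanishes L x \<Longrightarrow> vanishes L (wmul vs x)"
  by (induction vs arbitrary: x) (auto intro: vanishes_rmul)

lemma vanishes_opr: "down L \<Longrightarrow> vanishes L x \<Longrightarrow> vanishes L (opr p x)"
  using vanishes_wmul[of L x] by (auto simp: vanishes_def opr_def)

lemma wmul_support: "wmul vs x \<sigma> \<noteq> 0 \<Longrightarrow> set vs \<subseteq> \<sigma>"
proof (induction vs arbitrary: \<sigma> rule: rev_induct)
  case (snoc v vs)
  then have v: "v \<in> \<sigma>" and nz: "wmul vs x (\<sigma> - {v}) \<noteq> 0" by (auto simp: wmul_append rmul_def split: if_splits)
  from snoc.IH[OF nz] v show ?case by auto
qed simp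

definition unit_fun :: "'v set \<Rightarrow> 'v set \<Rightarrow> 'k::zero_neq_one" where
  "unit_fun \<tau> \<sigma> = (if \<sigma> = \<tau> then 1 else 0)"

lemma wmul_unit_support: "wmul vs (unit_fun {}) \<sigma> \<noteq> (0 :: 'k::field) \<Longrightarrow> distinct vs \<and> set vs = \<sigma>"
proof (induction vs arbitrary: \<sigma> rule: rev_induct)
  case Nil
  then show ?case by (auto simp: unit_fun_def split: if_splits)
next
  case (snoc v vs)
  then have v: "v \<in> \<sigma>" and nz: "wmul vs (unit_fun {}) (\<sigma> - {v}) \<noteq> (0 :: 'k)"
    by (auto simp: wmul_append rmul_def split: if_splits)
  from snoc.IH[OF nz] v show ?case by auto
qed

lemma sg_nonzero: "sg v \<rho> \<noteq> (0 :: 'k::field)"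
  by (simp add: sg_def)

lemma wmul_unit_nonzero: "distinct vs \<Longrightarrow> wmul vs (unit_fun {}) (set vs) \<noteq> (0 :: 'k::field)"
proof (induction vs rule: rev_induct)
  case (snoc v vs)
  then have "insert v (set vs) - {v} = set vs" by auto
  then show ?case using snoc by (simp add: wmul_append rmul_def sg_nonzero)
qed (simp add: unit_fun_def)

text \<open>The value on the unit of the exterior algebra, i.e. the image of \<open>p\<close> in \<open>\<And>V\<^sup>*\<close>.\<close>

definition ev :: "('v::finite dword \<Rightarrow>\<^sub>0 'k::field) \<Rightarrow> 'v set \<Rightarrow> 'k" where
  "ev p = opr p (unit_fun {})"

lemma ev_mult: "ev (p * q) = opr q (ev p)"
  by (simp add: ev_def opr_mult)

lemma opr_grade1:
  assumes "x \<in> tensor_grade 1"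
  shows "opr x f \<sigma> = (\<Sum>v\<in>UNIV. Poly_Mapping.lookup x (DWord [v]) * rmul v f \<sigma>)"
proof -
  have "Poly_Mapping.keys x \<subseteq> range (\<lambda>v. DWord [v])"
  proof
    fix w assume "w \<in> Poly_Mapping.keys x"
    then have "length (letters w) = 1" using assms by (simp add: tensor_grade_def)
    then obtain v where "letters w = [v]" by (auto simp: length_Suc_conv)
    then have "w = DWord [v]" by (cases w) simp
    then show "w \<in> range (\<lambda>v. DWord [v])" by simp
  qed
  then have "opr x f \<sigma> = (\<Sum>w\<in>range (\<lambda>v. DWord [v]). Poly_Mapping.lookup x w * wmul (letters w) f \<sigma>)"
    by (intro opr_superset) auto
  also have "\<dots> = (\<Sum>v\<in>UNIV. Poly_Mapping.lookup x (DWord [v]) * rmul v f \<sigma>)"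
    by (subst sum.reindex) (auto simp: inj_on_def)
  finally show ?thesis .
qed

lemma opr_square:
  assumes x: "x \<in> tensor_grade 1" shows "opr (x * x) f \<sigma> = 0"
proof -
  let ?c = "\<lambda>v. Poly_Mapping.lookup x (DWord [v])"
  have "opr (x * x) f \<sigma> = (\<Sum>u\<in>UNIV. ?c u * rmul u (\<lambda>\<sigma>. \<Sum>v\<in>UNIV. ?c v * rmul v f \<sigma>) \<sigma>)"
    unfolding opr_mult opr_grade1[OF x] opr_grade1[OF x, abs_def] ..
  also have "\<dots> = (\<Sum>u\<in>UNIV. \<Sum>v\<in>UNIV. ?c u * (?c v * rmul u (rmul v f) \<sigma>))"
    by (simp only: rmul_sum rmul_scale sum_distrib_left)
  also have "\<dots> = 0"
  proof (rule antisym_sum)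
    show "?c u * (?c v * rmul u (rmul v f) \<sigma>) = - (?c v * (?c u * rmul v (rmul u f) \<sigma>))" for u v
      by (subst rmul_anti) (simp add: mult.left_commute)
  qed (simp add: rmul_same)
  finally show ?thesis .
qed

text \<open>Squares of linear forms act as 0, and multiplication by a word only reaches sets that
  contain its letters, none of which is a face if the letters do not form one.\<close>

lemma ev_face_ideal:
  assumes L: "down L" and p: "p \<in> face_ideal L" shows "vanishes L (ev p)"
proof -
  let ?G = "{a * g * b | a g b. g \<in> face_ideal_gens L} :: ('a dword \<Rightarrow>\<^sub>0 'b) set"
  have gen: "vanishes L (ev (a * g * b))" if g: "g \<in> face_ideal_gens L" for a g b :: "'a dword \<Rightarrow>\<^sub>0 'b"
  proof -
    have "vanishes L (opr g (ev a))"
    proof (cases "\<exists>x\<in>tensor_grade 1. g = x * x")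
      case True
      then show ?thesis by (auto simp: vanishes_def opr_square)
    next
      case False
      then obtain w where w: "g = Poly_Mapping.single w 1" "set (letters w) \<notin> L"
        using g by (auto simp: face_ideal_gens_def)
      have "wmul (letters w) (ev a) \<sigma> = 0" if "\<sigma> \<in> L" for \<sigma>
        using wmul_support[of "letters w" "ev a" \<sigma>] w(2) L that by (auto simp: down_def)
      then show ?thesis using w(1) by (simp add: vanishes_def)
    qed
    then show ?thesis by (simp add: ev_mult vanishes_opr[OF L])
  qed
  show ?thesis
    using p unfolding face_ideal_def
  proof (induction rule: pm.span_induct_alt)
    case base
    then show ?case by (simp add: vanishes_def ev_def)
  next
    case (step c x y)
    then obtain a g b where "x = a * g * b" "g \<in> face_ideal_gens L" by blast
    with gen step(2) show ?case by (simp add: vanishes_def ev_def opr_add opr_scale)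
  qed
qed

section \<open>The face ideal is the kernel of the action\<close>

abbreviation word :: "'v list \<Rightarrow> 'v dword \<Rightarrow>\<^sub>0 'k::field" where
  "word vs \<equiv> Poly_Mapping.single (DWord vs) 1"

lemma face_ideal_add: "a \<in> face_ideal L \<Longrightarrow> b \<in> face_ideal L \<Longrightarrow> a + b \<in> face_ideal L"
  unfolding face_ideal_def by (rule pm.span_add)
lemma face_ideal_scale: "a \<in> face_ideal L \<Longrightarrow> pm_scale c a \<in> face_ideal L"
  unfolding face_ideal_def by (rule pm.span_scale)
lemma face_ideal_diff: "a \<in> face_ideal L \<Longrightarrow> b \<in> face_ideal L \<Longrightarrow> a - b \<in> face_ideal L"
  unfolding face_ideal_def by (rule pm.span_diff)
lemma face_ideal_0: "0 \<in> face_ideal L"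
  unfolding face_ideal_def by (rule pm.span_zero)
lemma face_ideal_gen: "g \<in> face_ideal_gens L \<Longrightarrow> g \<in> face_ideal L"
proof -
  assume "g \<in> face_ideal_gens L"
  then have "1 * g * 1 \<in> {a * g * b | a g b. g \<in> face_ideal_gens L}" by blast
  then have "1 * g * 1 \<in> pm.span {a * g * b | a g b. g \<in> face_ideal_gens L}" by (rule pm.span_base)
  then show ?thesis by (simp add: face_ideal_def)
qed

lemma dual_vec_grade: "dual_vec v \<in> tensor_grade 1"
  by (simp add: tensor_grade_def dual_vec_def)

lemma square_in_ideal: "x \<in> tensor_grade 1 \<Longrightarrow> x * x \<in> face_ideal L"
  by (rule face_ideal_gen) (auto simp: face_ideal_gens_def)

lemma word_nonface: "set vs \<notin> L \<Longrightarrow> word vs \<in> face_ideal L"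
  by (rule face_ideal_gen) (auto simp: face_ideal_gens_def intro!: exI[of _ "DWord vs"])

lemma word_repeat: "word (a @ v # v # b) \<in> face_ideal L"
proof -
  have eq: "word (a @ v # v # b) = word a * (dual_vec v * dual_vec v) * word b"
    by (simp add: mult_single plus_dword_def dual_vec_def)
  show ?thesis unfolding eq by (rule face_ideal_closed[OF square_in_ideal[OF dual_vec_grade]])
qed

text \<open>Polarisation of the square of \<open>?u + ?v\<close>, which is valid in every
  characteristic.\<close>

lemma word_swap: "word (a @ u # v # b) - pm_scale (- 1) (word (a @ v # u # b)) \<in> face_ideal L"
proof -
  let ?u = "dual_vec u" and ?v = "dual_vec v"
  have "?u + ?v \<in> tensor_grade 1"
    by (intro pm.subspace_add[OF tensor_grade_subspace] dual_vec_grade)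
  then have "(?u + ?v) * (?u + ?v) - ?u * ?u - ?v * ?v \<in> face_ideal L"
    by (intro face_ideal_diff square_in_ideal dual_vec_grade)
  then have "?u * ?v + ?v * ?u \<in> face_ideal L" by (simp add: algebra_simps)
  from face_ideal_closed[OF this, of "word a" "word b"]
  have "word a * ?u * ?v * word b + word a * ?v * ?u * word b \<in> face_ideal L"
    by (simp add: algebra_simps mult.assoc)
  then show ?thesis
    by (simp add: mult_single plus_dword_def dual_vec_def pm_scale_single single_uminus)
qed

text \<open>The scalar is left existential, so the sign of a permutation is never computed.\<close>

definition prop_mod :: "'v::finite set set \<Rightarrow> 'k::field itself \<Rightarrow> 'v list \<Rightarrow> 'v list \<Rightarrow> bool" where
  "prop_mod L K us vs \<longleftrightarrow> (\<exists>c :: 'k. word us - pm_scale c (word vs) \<in> face_ideal L)"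

lemma prop_mod_refl: "prop_mod L K us us"
  unfolding prop_mod_def by (rule exI[of _ 1]) (simp add: face_ideal_0)

lemma prop_mod_trans:
  assumes "prop_mod L TYPE('k::field) us vs" "prop_mod L TYPE('k) vs ws" shows "prop_mod L TYPE('k) us ws"
proof -
  obtain c d :: 'k where c: "word us - pm_scale c (word vs) \<in> face_ideal L" and d: "word vs - pm_scale d (word ws) \<in> face_ideal L"
    using assms by (auto simp: prop_mod_def)
  have eq: "word us - pm_scale (c * d) (word ws)
      = (word us - pm_scale c (word vs)) + pm_scale c (word vs - pm_scale d (word ws))"
    by (simp add: pm.scale_right_diff_distrib)
  have "word us - pm_scale (c * d) (word ws) \<in> face_ideal L"
    unfolding eq by (rule face_ideal_add[OF c face_ideal_scale[OF d]])
  then show ?thesis unfolding prop_mod_def by blast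
qed

lemma prop_mod_move: "prop_mod L TYPE('k::field) (a @ v # ys @ b) (a @ ys @ v # b)"
proof (induction ys arbitrary: a)
  case (Cons y ys)
  have "prop_mod L TYPE('k) (a @ v # y # (ys @ b)) (a @ y # v # (ys @ b))"
    unfolding prop_mod_def by (rule exI[of _ "- 1"]) (rule word_swap)
  moreover have "prop_mod L TYPE('k) ((a @ [y]) @ v # ys @ b) ((a @ [y]) @ ys @ v # b)" by (rule Cons.IH)
  ultimately show ?case by (auto intro: prop_mod_trans)
qed (simp add: prop_mod_refl)

lemma prop_mod_perm: "mset xs = mset ys \<Longrightarrow> prop_mod L TYPE('k::field) (a @ xs) (a @ ys)"
proof (induction xs arbitrary: a ys)
  case (Cons x xs)
  then have "x \<in> set ys" by (metis list.set_intros(1) mset_eq_setD)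
  then obtain l1 l2 where ys: "ys = l1 @ x # l2" by (meson split_list)
  then have "mset xs = mset (l1 @ l2)" using Cons.prems by simp
  from Cons.IH[OF this, of "a @ [x]"] have "prop_mod L TYPE('k) (a @ x # xs) (a @ x # l1 @ l2)" by simp
  then show ?case using prop_mod_move[of L a x l1 l2] ys by (auto intro: prop_mod_trans)
qed (simp add: prop_mod_refl)

lemma word_not_distinct:
  assumes "\<not> distinct vs" shows "(word vs :: 'v::finite dword \<Rightarrow>\<^sub>0 'k::field) \<in> face_ideal L"
proof -
  obtain a b c y where vs: "vs = a @ [y] @ b @ [y] @ c" using assms not_distinct_decomp by blast
  have "prop_mod L TYPE('k) vs (a @ b @ y # y # c)"
    using prop_mod_move[of L a y b "y # c"] by (simp add: vs)
  then obtain k :: 'k where k: "word vs - pm_scale k (word (a @ b @ y # y # c)) \<in> face_ideal L"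
    by (auto simp: prop_mod_def)
  have "word ((a @ b) @ y # y # c) \<in> (face_ideal L :: ('v dword \<Rightarrow>\<^sub>0 'k) set)" by (rule word_repeat)
  then have "pm_scale k (word (a @ b @ y # y # c)) \<in> face_ideal L" by (intro face_ideal_scale) simp
  from face_ideal_add[OF k this] show ?thesis by simp
qed

definition std :: "'v::finite set \<Rightarrow> 'v list" where
  "std \<sigma> = (SOME vs. distinct vs \<and> set vs = \<sigma>)"

lemma std: "distinct (std \<sigma>)" "set (std \<sigma>) = \<sigma>"
  using someI_ex[OF finite_distinct_list[OF finite, of \<sigma>]] unfolding std_def by (auto simp: conj_commute)

lemma word_std:
  "\<exists>c. (word vs :: 'v::finite dword \<Rightarrow>\<^sub>0 'k::field) - pm_scale c (word (std (set vs))) \<in> face_ideal L"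
proof (cases "distinct vs")
  case True
  then have "mset vs = mset (std (set vs))" using set_eq_iff_mset_eq_distinct[OF True std(1)] std(2) by blast
  from prop_mod_perm[OF this, of L "[]", where 'k = 'k] show ?thesis by (simp add: prop_mod_def)
next
  case False
  then show ?thesis using word_not_distinct by (intro exI[of _ 0]) auto
qed

lemma ev_word_std: "ev (word (std \<sigma>)) \<tau> \<noteq> (0 :: 'k::field) \<longleftrightarrow> \<tau> = \<sigma>"
  using wmul_unit_support[of "std \<sigma>" \<tau>, where 'k = 'k] wmul_unit_nonzero[OF std(1), of \<sigma>, where 'k = 'k]
  by (auto simp: ev_def std)

lemma ideal_normal_form:
  fixes p :: "'v::finite dword \<Rightarrow>\<^sub>0 'k::field"
  shows "\<exists>d. p - (\<Sum>\<sigma>\<in>L. pm_scale (d \<sigma>) (word (std \<sigma>))) \<in> face_ideal L"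
proof (rule pm_induct[of "\<lambda>p. \<exists>d. p - (\<Sum>\<sigma>\<in>L. pm_scale (d \<sigma>) (word (std \<sigma>))) \<in> face_ideal L"])
  show "\<exists>d. 0 - (\<Sum>\<sigma>\<in>L. pm_scale (d \<sigma>) (word (std \<sigma>))) \<in> (face_ideal L :: ('v dword \<Rightarrow>\<^sub>0 'k) set)"
    by (rule exI[of _ "\<lambda>_. 0"]) (simp add: face_ideal_0)
next
  fix a b :: "'v dword \<Rightarrow>\<^sub>0 'k"
  assume "\<exists>d. a - (\<Sum>\<sigma>\<in>L. pm_scale (d \<sigma>) (word (std \<sigma>))) \<in> face_ideal L"
    "\<exists>d. b - (\<Sum>\<sigma>\<in>L. pm_scale (d \<sigma>) (word (std \<sigma>))) \<in> face_ideal L"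
  then obtain d e where "a - (\<Sum>\<sigma>\<in>L. pm_scale (d \<sigma>) (word (std \<sigma>))) \<in> face_ideal L"
    "b - (\<Sum>\<sigma>\<in>L. pm_scale (e \<sigma>) (word (std \<sigma>))) \<in> face_ideal L" by blast
  from face_ideal_add[OF this]
  show "\<exists>d. a + b - (\<Sum>\<sigma>\<in>L. pm_scale (d \<sigma>) (word (std \<sigma>))) \<in> face_ideal L"
    by (intro exI[of _ "\<lambda>\<sigma>. d \<sigma> + e \<sigma>"]) (simp add: pm.scale_left_distrib sum.distrib algebra_simps)
next
  fix w :: "'v dword" and a :: 'k
  obtain vs where w: "w = DWord vs" by (cases w)
  have s: "Poly_Mapping.single w a = pm_scale a (word vs)" by (simp add: w pm_scale_single)
  show "\<exists>d. Poly_Mapping.single w a - (\<Sum>\<sigma>\<in>L. pm_scale (d \<sigma>) (word (std \<sigma>))) \<in> face_ideal L"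
  proof (cases "set vs \<in> L")
    case True
    obtain c where c: "(word vs :: 'v dword \<Rightarrow>\<^sub>0 'k) - pm_scale c (word (std (set vs))) \<in> face_ideal L" using word_std by blast
    have "(\<Sum>\<sigma>\<in>L. pm_scale (if \<sigma> = set vs then a * c else 0) (word (std \<sigma>)))
        = (\<Sum>\<sigma>\<in>L. if \<sigma> = set vs then pm_scale (a * c) (word (std (set vs))) else (0 :: 'v dword \<Rightarrow>\<^sub>0 'k))"
      by (intro sum.cong) auto
    also have "\<dots> = pm_scale (a * c) (word (std (set vs)))" using True by simp
    finally have eq: "Poly_Mapping.single w a - (\<Sum>\<sigma>\<in>L. pm_scale (if \<sigma> = set vs then a * c else 0) (word (std \<sigma>)))
        = pm_scale a (word vs - pm_scale c (word (std (set vs))))"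
      by (simp add: s pm.scale_right_diff_distrib)
    show ?thesis
      by (rule exI[of _ "\<lambda>\<sigma>. if \<sigma> = set vs then a * c else 0"]) (simp only: eq face_ideal_scale[OF c])
  next
    case False
    then have "Poly_Mapping.single w a \<in> face_ideal L" unfolding s by (intro face_ideal_scale word_nonface)
    then show ?thesis by (intro exI[of _ "\<lambda>_. 0"]) simp
  qed
qed

text \<open>Modulo the ideal every tensor is a combination of one word per face. These words
  evaluate to nonzero multiples of distinct coordinate functions, so vanishing on \<open>L\<close>
  forces all coefficients to be 0.\<close>

lemma face_ideal_iff:
  fixes p :: "'a::finite dword \<Rightarrow>\<^sub>0 'b::field"
  assumes L: "down L" shows "p \<in> face_ideal L \<longleftrightarrow> vanishes L (ev p)"
proof
  assume v: "vanishes L (ev p)"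
  obtain d where d: "p - (\<Sum>\<sigma>\<in>L. pm_scale (d \<sigma>) (word (std \<sigma>))) \<in> face_ideal L" using ideal_normal_form by blast
  have "d \<tau> = 0" if \<tau>: "\<tau> \<in> L" for \<tau>
  proof -
    have "ev (p - (\<Sum>\<sigma>\<in>L. pm_scale (d \<sigma>) (word (std \<sigma>)))) \<tau> = 0"
      using ev_face_ideal[OF L d] \<tau> by (simp add: vanishes_def)
    then have "(\<Sum>\<sigma>\<in>L. d \<sigma> * ev (word (std \<sigma>)) \<tau>) = 0"
      using v \<tau> by (simp add: ev_def opr_diff opr_sum opr_scale vanishes_def del: opr_single)
    moreover have "(\<Sum>\<sigma>\<in>L. d \<sigma> * ev (word (std \<sigma>)) \<tau>) = (\<Sum>\<sigma>\<in>L. if \<sigma> = \<tau> then d \<tau> * ev (word (std \<tau>)) \<tau> else 0)"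
      using ev_word_std[where 'k = 'b] by (intro sum.cong) auto
    ultimately show ?thesis using \<tau> ev_word_std[of \<tau> \<tau>, where 'k = 'b] by simp
  qed
  then show "p \<in> face_ideal L" using d by simp
qed (rule ev_face_ideal[OF L])

section \<open>Cohomology and homology of the Koszul complex\<close>

definition cob :: "'v::finite set \<Rightarrow> ('v set \<Rightarrow> 'k::comm_ring_1) \<Rightarrow> 'v set \<Rightarrow> 'k" where
  "cob W f \<sigma> = (\<Sum>v\<in>UNIV. ind W v * rmul v f \<sigma>)"

text \<open>Equations are imposed on \<open>L\<close> only: values of \<open>cob\<close> off
  \<open>L\<close> are zero in the face ring.\<close>

definition coexact_at :: "'v::finite set set \<Rightarrow> 'v set \<Rightarrow> 'k::field itself \<Rightarrow> int \<Rightarrow> bool" where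
  "coexact_at L W K i \<longleftrightarrow> (\<forall>f :: 'v set \<Rightarrow> 'k. f \<in> ch L i \<longrightarrow> vanishes L (cob W f) \<longrightarrow>
     (\<exists>g\<in>ch L (i - 1). \<forall>\<sigma>\<in>L. cob W g \<sigma> = f \<sigma>))"

lemma cob_cong: "down L \<Longrightarrow> (\<And>\<sigma>. \<sigma> \<in> L \<Longrightarrow> f \<sigma> = g \<sigma>) \<Longrightarrow> \<sigma> \<in> L \<Longrightarrow> cob W f \<sigma> = cob W g \<sigma>"
  unfolding cob_def rmul_def by (intro sum.cong) (auto simp: down_def)

lemma cob_degree: "f \<in> ch L i \<Longrightarrow> cob W f \<sigma> \<noteq> 0 \<Longrightarrow> int (card \<sigma>) = i + 1"
proof -
  assume f: "f \<in> ch L i" and "cob W f \<sigma> \<noteq> 0"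
  then obtain v where "rmul v f \<sigma> \<noteq> 0" unfolding cob_def by (metis (no_types, lifting) mult_zero_right sum.neutral)
  then have v: "v \<in> \<sigma>" "f (\<sigma> - {v}) \<noteq> 0" by (auto simp: rmul_def split: if_splits)
  have "\<And>\<rho>. f \<rho> \<noteq> 0 \<Longrightarrow> int (card \<rho>) = i" using f unfolding ch_def by blast
  from this[OF v(2)] have "int (card (\<sigma> - {v})) = i" .
  moreover have "Suc (card (\<sigma> - {v})) = card \<sigma>" using v(1) by (intro card_Suc_Diff1) auto
  ultimately show ?thesis by linarith
qed

lemma kbd_cob_adjoint:
  "(\<Sum>\<rho>\<in>UNIV. kbd (ind W) x \<rho> * f \<rho>) = (\<Sum>\<sigma>\<in>UNIV. x \<sigma> * cob W f \<sigma>)"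
proof -
  have 1: "(\<Sum>\<rho>\<in>UNIV. con v x \<rho> * f \<rho>) = (\<Sum>\<sigma>\<in>UNIV. x \<sigma> * rmul v f \<sigma>)" for v
  proof -
    have "(\<Sum>\<rho>\<in>UNIV. con v x \<rho> * f \<rho>) = (\<Sum>\<rho>\<in>{\<rho>. v \<notin> \<rho>}. sg v \<rho> * x (insert v \<rho>) * f \<rho>)"
      by (rule sum.mono_neutral_cong_right) (auto simp: con_def)
    also have "\<dots> = (\<Sum>\<sigma>\<in>{\<sigma>. v \<in> \<sigma>}. x \<sigma> * (sg v (\<sigma> - {v}) * f (\<sigma> - {v})))"
      by (rule sum.reindex_bij_witness[of _ "\<lambda>\<sigma>. \<sigma> - {v}" "insert v"]) (auto simp: insert_absorb mult_ac)
    also have "\<dots> = (\<Sum>\<sigma>\<in>UNIV. x \<sigma> * rmul v f \<sigma>)"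
      by (rule sum.mono_neutral_cong_left) (auto simp: rmul_def)
    finally show ?thesis .
  qed
  have "(\<Sum>\<rho>\<in>UNIV. kbd (ind W) x \<rho> * f \<rho>) = (\<Sum>v\<in>UNIV. ind W v * (\<Sum>\<rho>\<in>UNIV. con v x \<rho> * f \<rho>))"
    unfolding kbd_def sum_distrib_right sum_distrib_left by (subst sum.swap) (simp only: mult.assoc)
  also have "\<dots> = (\<Sum>v\<in>UNIV. ind W v * (\<Sum>\<sigma>\<in>UNIV. x \<sigma> * rmul v f \<sigma>))" by (simp only: 1)
  also have "\<dots> = (\<Sum>\<sigma>\<in>UNIV. x \<sigma> * cob W f \<sigma>)"
    unfolding cob_def sum_distrib_left by (subst sum.swap) (simp only: mult.left_commute)
  finally show ?thesis .
qed

section \<open>Transposed matrices and duality over a field\<close>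

lemma sum_unit_fun:
  "(\<Sum>\<rho>\<in>UNIV. x \<rho> * unit_fun \<tau> \<rho>) = x (\<tau> :: 'v::finite set)" "(\<Sum>\<rho>\<in>UNIV. unit_fun \<tau> \<rho> * x \<rho>) = (x \<tau> :: 'k::comm_ring_1)"
proof -
  have "(\<Sum>\<rho>\<in>UNIV. x \<rho> * unit_fun \<tau> \<rho>) = (\<Sum>\<rho>\<in>UNIV. if \<rho> = \<tau> then x \<tau> else 0)"
    by (intro sum.cong) (auto simp: unit_fun_def)
  then show "(\<Sum>\<rho>\<in>UNIV. x \<rho> * unit_fun \<tau> \<rho>) = x \<tau>" by simp
  then show "(\<Sum>\<rho>\<in>UNIV. unit_fun \<tau> \<rho> * x \<rho>) = x \<tau>" by (simp only: mult.commute)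
qed

lemma kbd_matrix: "kbd (ind W) x \<rho> = (\<Sum>\<sigma>\<in>UNIV. x \<sigma> * cob W (unit_fun \<rho>) \<sigma>)"
  using kbd_cob_adjoint[of W x "unit_fun \<rho>"] by (simp add: sum_unit_fun)

lemma cob_matrix: "cob W f \<sigma> = (\<Sum>\<rho>\<in>UNIV. cob W (unit_fun \<rho>) \<sigma> * f \<rho>)"
  using kbd_cob_adjoint[of W "unit_fun \<sigma>" f] by (simp add: sum_unit_fun kbd_matrix)

text \<open>The Fredholm alternative, by induction on columns: a multiple of the new column is
  subtracted from \<open>b\<close> so that the rest is orthogonal to the left kernel of the
  remaining columns.\<close>

lemma fredholm:
  fixes A :: "'i \<Rightarrow> 'j \<Rightarrow> 'k::field"
  assumes "finite I" "finite J"
    and "\<And>y. (\<forall>j\<in>J. (\<Sum>i\<in>I. y i * A i j) = 0) \<Longrightarrow> (\<Sum>i\<in>I. y i * b i) = 0"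
  shows "\<exists>x. \<forall>i\<in>I. (\<Sum>j\<in>J. A i j * x j) = b i"
  using assms(2,3)
proof (induction J arbitrary: b rule: finite_induct)
  case empty
  have "b i = 0" if i: "i \<in> I" for i
  proof -
    have "(\<Sum>k\<in>I. (if k = i then 1 else 0) * b k) = b i" using i assms(1) by (simp add: if_distrib[of "\<lambda>c. c * _"] cong: if_cong)
    then show ?thesis using empty[of "\<lambda>k. if k = i then 1 else 0"] by simp
  qed
  then show ?case by simp
next
  case (insert j0 J)
  let ?orth = "\<lambda>y. \<forall>j\<in>J. (\<Sum>i\<in>I. y i * A i j) = 0"
  have ex: "\<exists>s. \<forall>y. ?orth y \<longrightarrow> (\<Sum>i\<in>I. y i * (b i - s * A i j0)) = 0"
  proof (cases "\<forall>y. ?orth y \<longrightarrow> (\<Sum>i\<in>I. y i * A i j0) = 0")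
    case True
    then show ?thesis using insert.prems by (intro exI[of _ 0]) auto
  next
    case False
    then obtain y0 where y0: "?orth y0" "(\<Sum>i\<in>I. y0 i * A i j0) \<noteq> 0" by blast
    define a where "a = (\<Sum>i\<in>I. y0 i * A i j0)"
    \<comment> \<open>The test vector \<open>y0\<close>, not orthogonal to the new column, dictates
      the coefficient. Any other test vector differs by a multiple of \<open>y0\<close> from one
      orthogonal to all columns, to which the premise applies.\<close>
    define s where "s = (\<Sum>i\<in>I. y0 i * b i) / a"
    have a: "a \<noteq> 0" using y0(2) by (simp add: a_def)
    have "(\<Sum>i\<in>I. y i * (b i - s * A i j0)) = 0" if y: "?orth y" for y
    proof -
      define c where "c = (\<Sum>i\<in>I. y i * A i j0)"
      define y' where "y' i = y i - (c / a) * y0 i" for i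
      have comb: "(\<Sum>i\<in>I. y' i * z i) = (\<Sum>i\<in>I. y i * z i) - (c / a) * (\<Sum>i\<in>I. y0 i * z i)" for z
        by (simp add: y'_def left_diff_distrib sum_subtractf sum_distrib_left mult.assoc)
      have "\<forall>j\<in>insert j0 J. (\<Sum>i\<in>I. y' i * A i j) = 0"
        using y y0(1) a by (auto simp: comb simp flip: a_def c_def)
      then have "(\<Sum>i\<in>I. y' i * b i) = 0" by (rule insert.prems)
      then have "(\<Sum>i\<in>I. y i * b i) = (c / a) * (\<Sum>i\<in>I. y0 i * b i)" unfolding comb by simp
      then have "(\<Sum>i\<in>I. y i * b i) = s * c" unfolding s_def by (simp only: times_divide_eq_left times_divide_eq_right mult.commute)
      moreover have "(\<Sum>i\<in>I. y i * (b i - s * A i j0)) = (\<Sum>i\<in>I. y i * b i) - s * c"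
        by (simp add: c_def right_diff_distrib sum_subtractf sum_distrib_left mult.left_commute)
      ultimately show ?thesis by simp
    qed
    then show ?thesis by blast
  qed
  then obtain s where s: "\<And>y. ?orth y \<Longrightarrow> (\<Sum>i\<in>I. y i * (b i - s * A i j0)) = 0" by blast
  then obtain x where x: "\<forall>i\<in>I. (\<Sum>j\<in>J. A i j * x j) = b i - s * A i j0"
    using insert.IH[of "\<lambda>i. b i - s * A i j0"] by blast
  have "(\<Sum>j\<in>insert j0 J. A i j * (x(j0 := s)) j) = b i" if i: "i \<in> I" for i
  proof -
    have "(\<Sum>j\<in>J. A i j * (x(j0 := s)) j) = (\<Sum>j\<in>J. A i j * x j)"
      using insert.hyps by (intro sum.cong) auto
    then show ?thesis using insert.hyps x i by simp
  qed
  then show ?case by blast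
qed

text \<open>The two complexes have transposed matrices. A test vector in the alternative is a cycle
  of the complex assumed exact, hence a boundary there, and adjointness shows that it passes the
  test.\<close>

lemma coexact_iff_exact:
  assumes L: "down L"
  shows "coexact_at L W TYPE('k::field) i \<longleftrightarrow> exact_at L (ind W :: 'v::finite \<Rightarrow> 'k) i"
proof
  let ?B = "\<lambda>\<sigma> \<rho>. cob W (unit_fun \<rho>) \<sigma> :: 'k"
  let ?F = "\<lambda>k. {\<sigma>\<in>L. int (card \<sigma>) = k}"
  have restr: "(\<Sum>\<sigma>\<in>UNIV. y \<sigma> * z \<sigma>) = (\<Sum>\<sigma>\<in>?F k. y \<sigma> * z \<sigma>)" if "y \<in> ch L k" for y z :: "'v set \<Rightarrow> 'k" and k
    by (rule sum.mono_neutral_right) (use that in \<open>auto simp: ch_def\<close>)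
  have cutoff: "(\<lambda>\<sigma>. if \<sigma> \<in> ?F k then y \<sigma> else 0) \<in> ch L k" for y :: "'v set \<Rightarrow> 'k" and k
    by (simp add: ch_def)
  {
    assume ex: "exact_at L (ind W :: 'v \<Rightarrow> 'k) i"
    show "coexact_at L W TYPE('k) i"
      unfolding coexact_at_def
    proof (intro allI impI)
      fix f :: "'v set \<Rightarrow> 'k" assume f: "f \<in> ch L i" "vanishes L (cob W f)"
      have "\<exists>g. \<forall>\<sigma>\<in>?F i. (\<Sum>\<rho>\<in>?F (i - 1). ?B \<sigma> \<rho> * g \<rho>) = f \<sigma>"
      proof (rule fredholm)
        fix y0 assume h: "\<forall>\<rho>\<in>?F (i - 1). (\<Sum>\<sigma>\<in>?F i. y0 \<sigma> * ?B \<sigma> \<rho>) = 0"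
        define y where "y \<sigma> = (if \<sigma> \<in> ?F i then y0 \<sigma> else 0)" for \<sigma>
        have y: "y \<in> ch L i" unfolding y_def by (rule cutoff)
        have "kbd (ind W) y \<rho> = 0" for \<rho>
        proof (cases "\<rho> \<in> ?F (i - 1)")
          case True
          have "kbd (ind W) y \<rho> = (\<Sum>\<sigma>\<in>?F i. y \<sigma> * ?B \<sigma> \<rho>)"
            unfolding kbd_matrix by (rule restr[OF y])
          also have "\<dots> = (\<Sum>\<sigma>\<in>?F i. y0 \<sigma> * ?B \<sigma> \<rho>)" by (intro sum.cong) (auto simp: y_def)
          finally show ?thesis using h True by simp
        next
          case False
          then show ?thesis using kbd_ch[OF L y, of "ind W"] by (auto simp: ch_def)
        qed
        then have "kbd (ind W) y = (\<lambda>\<rho>. 0)" by blast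
        then obtain w where w: "w \<in> ch L (i + 1)" "kbd (ind W) w = y" using ex y unfolding exact_at_def by blast
        have "(\<Sum>\<sigma>\<in>?F i. y0 \<sigma> * f \<sigma>) = (\<Sum>\<sigma>\<in>?F i. y \<sigma> * f \<sigma>)" by (intro sum.cong) (auto simp: y_def)
        also have "\<dots> = (\<Sum>\<sigma>\<in>UNIV. kbd (ind W) w \<sigma> * f \<sigma>)" unfolding w(2) by (rule restr[OF y, symmetric])
        also have "\<dots> = (\<Sum>\<sigma>\<in>UNIV. w \<sigma> * cob W f \<sigma>)" by (rule kbd_cob_adjoint)
        also have "\<dots> = 0"
          by (rule sum.neutral) (use w(1) f(2) in \<open>auto simp: ch_def vanishes_def\<close>)
        finally show "(\<Sum>\<sigma>\<in>?F i. y0 \<sigma> * f \<sigma>) = 0" .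
      qed auto
      then obtain g0 where g0: "\<And>\<sigma>. \<sigma> \<in> ?F i \<Longrightarrow> (\<Sum>\<rho>\<in>?F (i - 1). ?B \<sigma> \<rho> * g0 \<rho>) = f \<sigma>" by blast
      define g where "g \<rho> = (if \<rho> \<in> ?F (i - 1) then g0 \<rho> else 0)" for \<rho>
      have g: "g \<in> ch L (i - 1)" unfolding g_def by (rule cutoff)
      have "cob W g \<sigma> = f \<sigma>" if \<sigma>: "\<sigma> \<in> L" for \<sigma>
      proof (cases "int (card \<sigma>) = i")
        case True
        have "cob W g \<sigma> = (\<Sum>\<rho>\<in>UNIV. g \<rho> * ?B \<sigma> \<rho>)" unfolding cob_matrix[of W g] by (simp only: mult.commute)
        also have "\<dots> = (\<Sum>\<rho>\<in>?F (i - 1). g \<rho> * ?B \<sigma> \<rho>)" by (rule restr[OF g])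
        also have "\<dots> = (\<Sum>\<rho>\<in>?F (i - 1). ?B \<sigma> \<rho> * g0 \<rho>)" by (intro sum.cong) (auto simp: g_def mult.commute)
        also have "\<dots> = f \<sigma>" using g0 \<sigma> True by simp
        finally show ?thesis .
      next
        case False
        then have "cob W g \<sigma> = 0" using cob_degree[OF g, of W \<sigma>] by auto
        moreover have "f \<sigma> = 0" using f(1) False by (auto simp: ch_def)
        ultimately show ?thesis by simp
      qed
      then show "\<exists>g\<in>ch L (i - 1). \<forall>\<sigma>\<in>L. cob W g \<sigma> = f \<sigma>" using g by blast
    qed
  }
  assume co: "coexact_at L W TYPE('k) i"
  show "exact_at L (ind W :: 'v \<Rightarrow> 'k) i"
    unfolding exact_at_def
  proof (intro ballI impI)
    fix z :: "'v set \<Rightarrow> 'k" assume z: "z \<in> ch L i" "kbd (ind W) z = (\<lambda>\<rho>. 0)"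
    have "\<exists>w. \<forall>\<rho>\<in>?F i. (\<Sum>\<sigma>\<in>?F (i + 1). ?B \<sigma> \<rho> * w \<sigma>) = z \<rho>"
    proof (rule fredholm)
      fix y0 assume h: "\<forall>\<sigma>\<in>?F (i + 1). (\<Sum>\<rho>\<in>?F i. y0 \<rho> * ?B \<sigma> \<rho>) = 0"
      define y where "y \<rho> = (if \<rho> \<in> ?F i then y0 \<rho> else 0)" for \<rho>
      have y: "y \<in> ch L i" unfolding y_def by (rule cutoff)
      have "cob W y \<sigma> = 0" if \<sigma>: "\<sigma> \<in> L" for \<sigma>
      proof (cases "int (card \<sigma>) = i + 1")
        case True
        have "cob W y \<sigma> = (\<Sum>\<rho>\<in>UNIV. y \<rho> * ?B \<sigma> \<rho>)" unfolding cob_matrix[of W y] by (simp only: mult.commute)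
        also have "\<dots> = (\<Sum>\<rho>\<in>?F i. y \<rho> * ?B \<sigma> \<rho>)" by (rule restr[OF y])
        also have "\<dots> = (\<Sum>\<rho>\<in>?F i. y0 \<rho> * ?B \<sigma> \<rho>)" by (intro sum.cong) (auto simp: y_def)
        finally show ?thesis using h \<sigma> True by simp
      next
        case False
        then show ?thesis using cob_degree[OF y, of W \<sigma>] by auto
      qed
      then have "vanishes L (cob W y)" by (simp add: vanishes_def)
      then obtain g where g: "g \<in> ch L (i - 1)" "\<And>\<sigma>. \<sigma> \<in> L \<Longrightarrow> cob W g \<sigma> = y \<sigma>"
        using co y unfolding coexact_at_def by blast
      have "(\<Sum>\<rho>\<in>?F i. y0 \<rho> * z \<rho>) = (\<Sum>\<rho>\<in>?F i. z \<rho> * cob W g \<rho>)"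
        using g(2) by (intro sum.cong) (auto simp: y_def)
      also have "\<dots> = (\<Sum>\<rho>\<in>UNIV. z \<rho> * cob W g \<rho>)" by (rule restr[OF z(1), symmetric])
      also have "\<dots> = (\<Sum>\<rho>\<in>UNIV. kbd (ind W) z \<rho> * g \<rho>)" by (rule kbd_cob_adjoint[symmetric])
      also have "\<dots> = 0" by (simp add: z(2))
      finally show "(\<Sum>\<rho>\<in>?F i. y0 \<rho> * z \<rho>) = 0" .
    qed auto
    then obtain w0 where w0: "\<And>\<rho>. \<rho> \<in> ?F i \<Longrightarrow> (\<Sum>\<sigma>\<in>?F (i + 1). ?B \<sigma> \<rho> * w0 \<sigma>) = z \<rho>" by blast
    define w where "w \<sigma> = (if \<sigma> \<in> ?F (i + 1) then w0 \<sigma> else 0)" for \<sigma>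
    have w: "w \<in> ch L (i + 1)" unfolding w_def by (rule cutoff)
    have "kbd (ind W) w \<rho> = z \<rho>" for \<rho>
    proof (cases "\<rho> \<in> ?F i")
      case True
      have "kbd (ind W) w \<rho> = (\<Sum>\<sigma>\<in>?F (i + 1). w \<sigma> * ?B \<sigma> \<rho>)" unfolding kbd_matrix by (rule restr[OF w])
      also have "\<dots> = (\<Sum>\<sigma>\<in>?F (i + 1). ?B \<sigma> \<rho> * w0 \<sigma>)" by (intro sum.cong) (auto simp: w_def mult.commute)
      finally show ?thesis using w0[OF True] by simp
    next
      case False
      have "kbd (ind W) w \<rho> = 0"
        using kbd_ch[OF L w, of "ind W"] False by (auto simp: ch_def)
      moreover have "z \<rho> = 0" using z(1) False by (auto simp: ch_def)
      ultimately show ?thesis by simp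
    qed
    then show "\<exists>w\<in>ch L (i + 1). kbd (ind W) w = z" using w by blast
  qed
qed

section \<open>Betti numbers\<close>

text \<open>A basis of \<open>V\<close> extends to a finite basis of \<open>U\<close>, so truncated
  subtraction of dimensions loses nothing and the value 0 makes the two bases equal.\<close>

lemma dim_diff_eq_0_iff:
  fixes U V B :: "('b \<Rightarrow>\<^sub>0 'k::field) set"
  assumes V: "pm.subspace V" "V \<subseteq> U" and B: "finite B" "U \<subseteq> pm.span B"
  shows "pm.dim U - pm.dim V = 0 \<longleftrightarrow> U \<subseteq> V"
proof
  assume le: "pm.dim U - pm.dim V = 0"
  obtain BV where BV: "BV \<subseteq> V" "pm.independent BV" "V \<subseteq> pm.span BV" "card BV = pm.dim V"
    by (rule pm.basis_exists)
  obtain BU where BU: "BV \<subseteq> BU" "BU \<subseteq> U" "pm.independent BU" "U \<subseteq> pm.span BU"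
    using pm.maximal_independent_subset_extend[of BV U] BV V by (metis subset_trans)
  have fin: "finite BU" using pm.independent_span_bound[OF B(1) BU(3)] BU(2) B(2) by blast
  have "card BU = pm.dim U" using BU by (intro pm.basis_card_eq_dim) auto
  then have "BV = BU" using le BV(4) BU(1) fin by (intro card_seteq) auto
  then show "U \<subseteq> V" using BU(4) pm.span_minimal[OF BV(1) V(1)] by blast
next
  assume "U \<subseteq> V"
  with V have "U = V" by blast
  then show "pm.dim U - pm.dim V = 0" by simp
qed

lemma tensor_grade_span:
  "(tensor_grade i :: ('v::finite dword \<Rightarrow>\<^sub>0 'k::field) set) \<subseteq> pm.span ((\<lambda>vs. word vs) ` {vs. length vs = i})"
proof
  fix x :: "'v dword \<Rightarrow>\<^sub>0 'k" assume x: "x \<in> tensor_grade i"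
  have "(\<Sum>w\<in>Poly_Mapping.keys x. Poly_Mapping.single w (Poly_Mapping.lookup x w)) \<in> pm.span ((\<lambda>vs. word vs) ` {vs. length vs = i})"
  proof (rule pm.span_sum)
    fix w assume "w \<in> Poly_Mapping.keys x"
    then have "length (letters w) = i" using x by (simp add: tensor_grade_def)
    then have "(word (letters w) :: 'v dword \<Rightarrow>\<^sub>0 'k) \<in> (\<lambda>vs. word vs) ` {vs. length vs = i}"
      by (intro image_eqI[of _ _ "letters w"]) simp_all
    then have "word (letters w) \<in> pm.span ((\<lambda>vs. word vs :: 'v dword \<Rightarrow>\<^sub>0 'k) ` {vs. length vs = i})"
      by (rule pm.span_base)
    from pm.span_scale[OF this, of "Poly_Mapping.lookup x w"]
    show "Poly_Mapping.single w (Poly_Mapping.lookup x w) \<in> pm.span ((\<lambda>vs. word vs) ` {vs. length vs = i})"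
      by (simp add: pm_scale_single)
  qed
  then show "x \<in> pm.span ((\<lambda>vs. word vs) ` {vs. length vs = i})" by (simp add: sum_single_lookup)
qed

lemma finite_words: "finite {vs :: 'v::finite list. length vs = i}"
  using finite_lists_length_eq[of "UNIV :: 'v set" i] by simp

lemma face_coboundaries_subspace: "pm.subspace (face_coboundaries L W i :: ('v::finite dword \<Rightarrow>\<^sub>0 'k::field) set)"
proof -
  let ?Y = "{y :: 'v dword \<Rightarrow>\<^sub>0 'k. case i of 0 \<Rightarrow> y = 0 | Suc j \<Rightarrow> y \<in> tensor_grade j}"
  let ?U = "face_ideal L \<inter> tensor_grade i :: ('v dword \<Rightarrow>\<^sub>0 'k) set"
  have Y: "pm.subspace ?Y"
  proof (cases i)
    case 0
    then show ?thesis by (simp add: pm.subspace_def)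
  next
    case (Suc j)
    then show ?thesis using tensor_grade_subspace[of j, where 'v = 'v and 'k = 'k] by simp
  qed
  have U: "pm.subspace ?U"
    unfolding face_ideal_def by (intro pm.subspace_inter pm.subspace_span tensor_grade_subspace)
  have eq: "face_coboundaries L W i = {y * z_elt W + u | y u. y \<in> ?Y \<and> u \<in> ?U}"
    by (simp add: face_coboundaries_def)
  show ?thesis
    unfolding eq
  proof (rule pm.subspaceI)
    have "0 = 0 * z_elt W + (0 :: 'v dword \<Rightarrow>\<^sub>0 'k)" by simp
    then show "0 \<in> {y * z_elt W + u | y u. y \<in> ?Y \<and> u \<in> ?U}" using pm.subspace_0[OF Y] pm.subspace_0[OF U] by blast
  next
    fix a b assume "a \<in> {y * z_elt W + u | y u. y \<in> ?Y \<and> u \<in> ?U}" "b \<in> {y * z_elt W + u | y u. y \<in> ?Y \<and> u \<in> ?U}"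
    then obtain y u y' u' where "a = y * z_elt W + u" "y \<in> ?Y" "u \<in> ?U" "b = y' * z_elt W + u'" "y' \<in> ?Y" "u' \<in> ?U"
      by blast
    moreover from this have "a + b = (y + y') * z_elt W + (u + u')" by (simp add: algebra_simps)
    ultimately show "a + b \<in> {y * z_elt W + u | y u. y \<in> ?Y \<and> u \<in> ?U}"
      using pm.subspace_add[OF Y, of y y'] pm.subspace_add[OF U, of u u'] by blast
  next
    fix c a assume "a \<in> {y * z_elt W + u | y u. y \<in> ?Y \<and> u \<in> ?U}"
    then obtain y u where a: "a = y * z_elt W + u" "y \<in> ?Y" "u \<in> ?U" by blast
    have "pm_scale c a = pm_scale c y * z_elt W + pm_scale c u"
      by (simp add: a(1) pm_scale_mult distrib_left mult.assoc)
    then show "pm_scale c a \<in> {y * z_elt W + u | y u. y \<in> ?Y \<and> u \<in> ?U}"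
      using pm.subspace_scale[OF Y a(2), of c] pm.subspace_scale[OF U a(3), of c] by blast
  qed
qed

lemma ev_z: "ev (x * z_elt W) \<sigma> = cob W (ev x) \<sigma>"
proof -
  have "ev (x * z_elt W) \<sigma> = (\<Sum>v\<in>W. rmul v (ev x) \<sigma>)"
    by (simp add: ev_mult z_elt_def opr_sum dual_vec_def)
  also have "\<dots> = (\<Sum>v\<in>UNIV. if v \<in> W then rmul v (ev x) \<sigma> else 0)"
    by (simp add: sum.If_cases)
  also have "\<dots> = cob W (ev x) \<sigma>"
    unfolding cob_def by (intro sum.cong) (auto simp: ind_def)
  finally show ?thesis .
qed

lemma ev_grade:
  assumes "x \<in> tensor_grade i" "ev x \<sigma> \<noteq> 0" shows "card \<sigma> = i"
proof -
  obtain w where w: "w \<in> Poly_Mapping.keys x" "wmul (letters w) (unit_fun {}) \<sigma> \<noteq> (0 :: 'b)"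
    using assms(2) unfolding ev_def opr_def by (metis (no_types, lifting) mult_zero_right sum.neutral)
  from wmul_unit_support[OF w(2)] have "card \<sigma> = length (letters w)" using distinct_card by force
  then show ?thesis using w(1) assms(1) by (simp add: tensor_grade_def)
qed

text \<open>The word of each set evaluates to a nonzero multiple of its coordinate function;
  dividing by that multiple reaches \<open>f\<close>.\<close>

lemma ev_surj:
  assumes f: "f \<in> ch L (int i)"
  shows "\<exists>x\<in>tensor_grade i. \<forall>\<sigma>. ev x \<sigma> = (f \<sigma> :: 'k::field)"
proof -
  define x where "x = (\<Sum>\<tau>\<in>UNIV. pm_scale (f \<tau> / ev (word (std \<tau>)) \<tau>) (word (std \<tau>)))"
  have "x \<in> tensor_grade i"
    unfolding x_def
  proof (rule pm.subspace_sum[OF tensor_grade_subspace])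
    fix \<tau>
    show "pm_scale (f \<tau> / ev (word (std \<tau>)) \<tau>) (word (std \<tau>)) \<in> tensor_grade i"
    proof (cases "f \<tau> = 0")
      case False
      then have "card \<tau> = i" using f by (auto simp: ch_def)
      then have "length (std \<tau>) = i" using distinct_card[OF std(1), of \<tau>] by (simp add: std(2))
      then show ?thesis by (intro pm.subspace_scale[OF tensor_grade_subspace]) (simp add: tensor_grade_def)
    qed (simp add: pm.subspace_0[OF tensor_grade_subspace])
  qed
  moreover have "ev x \<sigma> = f \<sigma>" for \<sigma>
  proof -
    have "ev x \<sigma> = (\<Sum>\<tau>\<in>UNIV. f \<tau> / ev (word (std \<tau>)) \<tau> * ev (word (std \<tau>)) \<sigma>)"
      by (simp add: x_def ev_def opr_sum opr_scale del: opr_single)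
    also have "\<dots> = (\<Sum>\<tau>\<in>UNIV. if \<tau> = \<sigma> then f \<sigma> else 0)"
    proof (intro sum.cong HOL.refl)
      fix \<tau>
      show "f \<tau> / ev (word (std \<tau>)) \<tau> * ev (word (std \<tau>)) \<sigma> = (if \<tau> = \<sigma> then f \<sigma> else 0)"
        using ev_word_std[of \<tau> \<sigma>, where 'k = 'k] by auto
    qed
    finally show ?thesis by simp
  qed
  ultimately show ?thesis by blast
qed

lemma betti_eq_0_iff:
  fixes L :: "'v::finite set set"
  assumes L: "down L"
  shows "betti TYPE('k::field) L W i = 0 \<longleftrightarrow> exact_at L (ind W :: 'v \<Rightarrow> 'k) (int i)"
proof -
  let ?Z = "face_cocycles L W i :: ('v dword \<Rightarrow>\<^sub>0 'k) set" and ?B = "face_coboundaries L W i :: ('v dword \<Rightarrow>\<^sub>0 'k) set"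
  have "betti TYPE('k) L W i = 0 \<longleftrightarrow> ?Z \<subseteq> ?B"
    unfolding betti_def
  proof (rule dim_diff_eq_0_iff[OF face_coboundaries_subspace face_coboundaries_subset])
    show "?Z \<subseteq> pm.span ((\<lambda>vs. word vs) ` {vs. length vs = i})"
      using tensor_grade_span[of i, where 'v = 'v and 'k = 'k] by (auto simp: face_cocycles_def)
  qed (rule finite_imageI[OF finite_words])
  also have "\<dots> \<longleftrightarrow> coexact_at L W TYPE('k) (int i)"
  proof
    assume sub: "?Z \<subseteq> ?B"
    show "coexact_at L W TYPE('k) (int i)"
      unfolding coexact_at_def
    proof (intro allI impI)
      fix f :: "'v set \<Rightarrow> 'k" assume f: "f \<in> ch L (int i)" "vanishes L (cob W f)"
      obtain x where x: "x \<in> tensor_grade i" "ev x = f" using ev_surj[OF f(1)] by blast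
      have "x * z_elt W \<in> face_ideal L"
        unfolding face_ideal_iff[OF L] using f(2) by (simp add: vanishes_def ev_z x(2))
      then have "x \<in> ?Z" using x(1) by (simp add: face_cocycles_def)
      then obtain y u where yu: "x = y * z_elt W + u" "u \<in> face_ideal L"
        and y: "case i of 0 \<Rightarrow> y = 0 | Suc j \<Rightarrow> y \<in> tensor_grade j"
        using sub by (auto simp: face_coboundaries_def)
      \<comment> \<open>Values off \<open>L\<close> are cut away to land in \<open>ch\<close>; on
        faces \<open>cob\<close> only looks at faces.\<close>
      define g where "g \<sigma> = (if \<sigma> \<in> L then ev y \<sigma> else 0)" for \<sigma>
      have "g \<in> ch L (int i - 1)"
        unfolding ch_def
      proof (intro CollectI allI impI)
        fix \<sigma> assume nz: "g \<sigma> \<noteq> 0"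
        then have "\<sigma> \<in> L" "ev y \<sigma> \<noteq> 0" by (auto simp: g_def split: if_splits)
        then show "\<sigma> \<in> L \<and> int (card \<sigma>) = int i - 1"
          using y ev_grade[of y _ \<sigma>] by (cases i) (auto simp: ev_def)
      qed
      moreover have "cob W g \<sigma> = f \<sigma>" if \<sigma>: "\<sigma> \<in> L" for \<sigma>
      proof -
        have "cob W g \<sigma> = cob W (ev y) \<sigma>" by (rule cob_cong[OF L _ \<sigma>]) (simp add: g_def)
        also have "\<dots> = ev x \<sigma> - ev u \<sigma>" by (simp add: yu(1) ev_def opr_add) (simp add: ev_z flip: ev_def)
        also have "ev u \<sigma> = 0" using yu(2) \<sigma> unfolding face_ideal_iff[OF L] by (simp add: vanishes_def)
        finally show ?thesis by (simp add: x(2))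
      qed
      ultimately show "\<exists>g\<in>ch L (int i - 1). \<forall>\<sigma>\<in>L. cob W g \<sigma> = f \<sigma>" by blast
    qed
  next
    assume co: "coexact_at L W TYPE('k) (int i)"
    show "?Z \<subseteq> ?B"
    proof
      fix x assume "x \<in> ?Z"
      then have x: "x \<in> tensor_grade i" "x * z_elt W \<in> face_ideal L" by (auto simp: face_cocycles_def)
      define f where "f \<sigma> = (if \<sigma> \<in> L then ev x \<sigma> else 0)" for \<sigma>
      have "f \<in> ch L (int i)" using ev_grade[OF x(1)] by (auto simp: ch_def f_def)
      moreover have "cob W f \<sigma> = 0" if \<sigma>: "\<sigma> \<in> L" for \<sigma>
      proof -
        have "cob W f \<sigma> = cob W (ev x) \<sigma>" by (rule cob_cong[OF L _ \<sigma>]) (simp add: f_def)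
        also have "\<dots> = 0" using x(2) \<sigma> unfolding face_ideal_iff[OF L] by (simp add: vanishes_def ev_z)
        finally show ?thesis .
      qed
      ultimately obtain g where g: "g \<in> ch L (int i - 1)" "\<And>\<sigma>. \<sigma> \<in> L \<Longrightarrow> cob W g \<sigma> = f \<sigma>"
        using co unfolding coexact_at_def vanishes_def by blast
      \<comment> \<open>In degree 0 there is no lower tensor power: \<open>g\<close> has degree -1,
        hence is 0, which matches the default \<open>y = 0\<close>.\<close>
      have "\<exists>y. (case i of 0 \<Rightarrow> y = 0 | Suc j \<Rightarrow> y \<in> tensor_grade j) \<and> (\<forall>\<sigma>. ev y \<sigma> = g \<sigma>)"
      proof (cases i)
        case 0
        then have "g = (\<lambda>\<sigma>. 0)" using ch_neg[OF _ g(1)] by simp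
        then show ?thesis using 0 by (intro exI[of _ 0]) (simp add: ev_def)
      next
        case (Suc j)
        then show ?thesis using ev_surj[of g L j] g(1) by auto
      qed
      then obtain y where y: "case i of 0 \<Rightarrow> y = 0 | Suc j \<Rightarrow> y \<in> tensor_grade j" "ev y = g" by blast
      define u where "u = x - y * z_elt W"
      have yz: "y * z_elt W \<in> tensor_grade i"
        using y(1) tensor_grade_mult[OF _ z_elt_grade, of y "i - 1" W]
        by (cases i) (auto simp: pm.subspace_0[OF tensor_grade_subspace])
      have "u \<in> tensor_grade i" unfolding u_def by (intro pm.subspace_diff[OF tensor_grade_subspace] x yz)
      moreover have "u \<in> face_ideal L"
        unfolding face_ideal_iff[OF L]
      proof (unfold vanishes_def, intro ballI)
        fix \<sigma> assume \<sigma>: "\<sigma> \<in> L"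
        have "ev u \<sigma> = ev x \<sigma> - cob W g \<sigma>"
          by (simp add: u_def ev_def opr_diff) (simp add: ev_z y(2) flip: ev_def)
        then show "ev u \<sigma> = 0" using g(2)[OF \<sigma>] \<sigma> by (simp add: f_def)
      qed
      moreover have "x = y * z_elt W + u" by (simp add: u_def)
      ultimately show "x \<in> ?B" using y(1) unfolding face_coboundaries_def by blast
    qed
  qed
  also have "\<dots> \<longleftrightarrow> exact_at L (ind W :: 'v \<Rightarrow> 'k) (int i)" by (rule coexact_iff_exact[OF L])
  finally show ?thesis .
qed

section \<open>Trivial action and vanishing Betti numbers\<close>

lemma Vq_VV: "Vq L chi q = VV (weight L chi) q"
  by (simp add: Vq_def VV_def cong_0_iff)

theorem theorem6p2:
  fixes L :: "'v::finite set set"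
    and chi :: "'v gword set \<Rightarrow> int"
    and p r :: nat
  assumes "CHAR('k::field) = p"
    and "abstract_simplicial_complex L"
    and "chi \<in> epi (raag L) integer_group"
    and "r \<ge> 1"
  shows "trivial_Z_action (twisted_homology_le TYPE('k) L chi r) \<longleftrightarrow>
      (\<forall>i\<le>r. betti TYPE('k) L (Vq L chi p) i = 0) \<and>
      (\<forall>q\<in>bad_primes L chi. q \<noteq> p \<longrightarrow> (\<forall>i\<le>r. betti TYPE('k) L (Vq L chi q) i = 0))"
proof -
  have L: "down L" "{} \<in> L"
    using assms(2) by (auto simp: abstract_simplicial_complex_def down_def)
  let ?m = "weight L chi" and ?s = "kZ_t - 1 :: int \<Rightarrow>\<^sub>0 'k"
  have s: "?s = tp 1 - 1" by (simp add: kZ_t_def)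
  have "(\<forall>x\<in>ch L i. kbd (lamt ?m) x = (\<lambda>\<rho>. 0) \<longrightarrow> (\<exists>w\<in>ch L (i + 1). kbd (lamt ?m) w = (\<lambda>\<sigma>. ?s * x \<sigma>)))
      \<longleftrightarrow> exact_at L (\<lambda>v. gz (?m v) :: int \<Rightarrow>\<^sub>0 'k) i" for i
    using s_nonzero gz by (intro exact_iff_killed) (simp_all add: s lamt_def)
  then have "trivial_Z_action (twisted_homology_le TYPE('k) L chi r) \<longleftrightarrow>
      (\<forall>i. 0 \<le> i \<longrightarrow> i \<le> int r \<longrightarrow> exact_at L (\<lambda>v. gz (?m v) :: int \<Rightarrow>\<^sub>0 'k) i)"
    by (simp only: trivial_twisted_homology_le trivial_action_algebraic[OF L])
  also note exact_quantum_iff[OF L(1) assms(1)]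
  finally have "trivial_Z_action (twisted_homology_le TYPE('k) L chi r) \<longleftrightarrow>
      (\<forall>i. 0 \<le> i \<longrightarrow> i \<le> int r \<longrightarrow> exact_at L (ind (VV ?m p) :: 'v \<Rightarrow> 'k) i) \<and>
      (\<forall>q. prime q \<longrightarrow> VV ?m q \<subset> VV ?m 0 \<longrightarrow> q \<noteq> p \<longrightarrow>
        (\<forall>i. 0 \<le> i \<longrightarrow> i \<le> int r \<longrightarrow> exact_at L (ind (VV ?m q) :: 'v \<Rightarrow> 'k) i))" .
  moreover have "(\<forall>i. 0 \<le> i \<longrightarrow> i \<le> int r \<longrightarrow> exact_at L (ind W :: 'v \<Rightarrow> 'k) i) \<longleftrightarrow> (\<forall>i\<le>r. betti TYPE('k) L W i = 0)" for W
  proof -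
    have "(\<forall>i. 0 \<le> i \<longrightarrow> i \<le> int r \<longrightarrow> P i) \<longleftrightarrow> (\<forall>i\<le>r. P (int i))" for P
      by (metis nonneg_int_cases of_nat_0_le_iff of_nat_le_iff)
    then show ?thesis by (simp only: betti_eq_0_iff[OF L(1)])
  qed
  ultimately show ?thesis unfolding Vq_VV bad_primes_def by (simp add: imp_conjL)
qed

end
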